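(* Let the shear flow $(\mathbf U^s,\mathbf B^s)$, the point $z_0>0$, the rational number $a$, the admissible small parameters $\varepsilon$, the approximate tangential profile $\mathbf Z_\varepsilon=(U_\varepsilon,V_\varepsilon,B_\varepsilon,G_\varepsilon)(t,z)$ and the residual $\mathbf R_\varepsilon=(R_{1\varepsilon},R_{2\varepsilon},R_{3\varepsilon},R_{4\varepsilon})(t,z)$ be as defined in the context, and let $L_\varepsilon:=1+|\log\varepsilon|$. Then for every fixed $K_0>0$ there exist $N\ge 1$, $\varepsilon_0>0$ and positive constants $c_0,C_0,\sigma_0$, independent of $\varepsilon$, such that for all admissible $\varepsilon$ with $0<\varepsilon<\varepsilon_0$ and all $0\le t\le K_0\sqrt\varepsilon\,L_\varepsilon$, $$c_0e^{\sigma_0t/\sqrt\varepsilon}\le\|\mathbf Z_\varepsilon(t)\|_{L^2_\alpha}\le C_0L_\varepsilon^Ne^{\sigma_0t/\sqrt\varepsilon},$$ $$\|\mathbf R_\varepsilon(t)\|_{L^2_\alpha}\le C_0\,\varepsilon^{-3/8}L_\varepsilon^Ne^{\sigma_0t/\sqrt\varepsilon}.$$ In particular, $\|\mathbf Z_\varepsilon(0)\|_{L^2_\alpha}\le C_0L_\varepsilon^N$.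
   Context: Spaces. For $\alpha\ge 0$: $L^2_\alpha(\mathbb R^+)=\{f:e^{\alpha z}f\in L^2(\mathbb R^+)\}$, $H^s_\alpha=\{f:e^{\alpha z}f\in H^s\}$, $W^{s,\infty}_\alpha=\{f:e^{\alpha z}f\in W^{s,\infty}\}$, with the norms $\|e^{\alpha z}f\|$; vectors are measured componentwise. Shear flow and assumptions. $\mathbf U^E,\mathbf B^E\in\mathbb R^2$ are constants; $\mathbf U^s=(u^s,v^s)(t,z)$ and $\mathbf B^s=(b^s,g^s)(t,z)$ solve, for $t\ge0,z\ge0$, $(\partial_t-\partial_z^2)\mathbf U^s=0$, $\mathbf U^s|_{z=0}=\mathbf 0$, $\mathbf U^s\to\mathbf U^E$ as $z\to+\infty$, $\mathbf U^s|_{t=0}=(U_s,V_s)$; and $(\partial_t-\partial_z^2)\mathbf B^s=0$, $\partial_z\mathbf B^s|_{z=0}=\mathbf 0$, $\mathbf B^s\to\mathbf B^E$ as $z\to+\infty$, $\mathbf B^s|_{t=0}=\mathbf B_s=(B_s,G_s)$. Assume $\mathbf U^s-\mathbf U^E\in\bigcap_{i=0}^1C^i(\mathbb R_+;W^{4-2i,\infty}_\alpha\cap H^{4-2i}_\alpha)$ and $\mathbf B^s-\mathbf B^E\in\bigcap_{i=0}^2C^i(\mathbb R_+;W^{6-2i,\infty}_\alpha\cap H^{6-2i}_\alpha)$, and that for some $z_0>0$: $V_s'(z_0)U_s''(z_0)\ne U_s'(z_0)V_s''(z_0)$, $\mathbf B_s(z_0)=\partial_z\mathbf B_s(z_0)=\mathbf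 0$, $U_s'(z_0)\ne0$, and $a:=V_s'(z_0)/U_s'(z_0)\in\mathbb Q$. Write $a=p/q$ with integers $p,q$, $q>0$; the admissible parameters are $\varepsilon=\varepsilon_n=(qn)^{-1}$, $n\in\mathbb N$, $n\ge1$ (so that $e^{i\varepsilon^{-1}(y-ax)}$ is periodic on $\mathbb T^2$). Set $w_a^s:=v^s-au^s$ and $c^s:=g^s-ab^s$. Then $z_0$ is a non-degenerate critical point of $w_a^s(0,\cdot)$; the sign is normalized so that $\partial_z^2w_a^s(0,z_0)<0$. On a small time interval $[0,t_0)$ let $f(t)$ be the critical point of $w_a^s(t,\cdot)$ given by $$\partial_t\partial_zw_a^s(t,f(t))+\partial_z^2w_a^s(t,f(t))\,f'(t)=0,\qquad f(0)=z_0.$$ Put $\kappa(t):=\big|\tfrac12\partial_z^2w_a^s(t,f(t))\big|$. Critical-layer profile (Gérard-Varet–Dormy). $\tilde\tau\in\mathbb C$ with $\Im\tilde\tau<0$ and a smooth $\tilde W:\mathbb R\to\mathbb C$ are fixed, solving $$(\tilde\tau-Z^2)^2\tilde W'(Z)+i\frac{d^3}{dZ^3}\big((\tilde\tau-Z^2)\tilde W(Z)\big)=0,\qquad \lim_{Z\to-\infty}\tilde W=0,\quad\lim_{Z\to+\infty}\tilde W=1$$ (such a pair is known to exist), and $W_{sl}(Z):=(\tilde\tau-Z^2)\tilde W(Z)-\mathbf 1_{\mathbb R^+}(Z)(\tilde\tau-Z^2)$, which decays exponentially, with its derivatives, as $|Z|\to\infty$. $\varphi$ is a fixed smooth cutoff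 equal to $1$ near $0$ and supported in a sufficiently small neighbourhood of $0$; in particular $\varphi(z-f(t))$ vanishes near $z=0$. Approximate solution. Let $H$ be the Heaviside function and $$\lambda_\varepsilon(t)=-w_a^s(t,f(t))+\sqrt\varepsilon\,\kappa(t)^{1/2}\tilde\tau,\qquad E_\varepsilon(t)=\exp\Big(i\varepsilon^{-1}\int_0^t\lambda_\varepsilon(s)\,ds\Big),\qquad A_\varepsilon(t,z)=\lambda_\varepsilon(t)+w_a^s(t,z),$$ $$W_\varepsilon^{\rm reg}=H(z-f(t))\big[w_a^s(t,z)-w_a^s(t,f(t))+\sqrt\varepsilon\,\kappa(t)^{1/2}\tilde\tau\big],\qquad W_\varepsilon^{\rm sl}=\sqrt\varepsilon\,\varphi(z-f(t))\,\kappa(t)^{1/2}\,W_{sl}\Big(\kappa(t)^{1/4}\frac{z-f(t)}{\varepsilon^{1/4}}\Big),$$ $$Q_\varepsilon=W_\varepsilon^{\rm reg}+W_\varepsilon^{\rm sl},\qquad \rho_\varepsilon=Q_\varepsilon/A_\varepsilon,$$ $$\boldsymbol{\mathcal U}_\varepsilon=H(z-f(t))\,\partial_z\mathbf U^s(t,z)+\frac{\partial_z^2W_\varepsilon^{\rm sl}}{\partial_z^2w_a^s(t,f(t))}\,\partial_z\mathbf U^s(t,f(t))+\frac{\partial_zW_\varepsilon^{\rm sl}}{\partial_z^2w_a^s(t,f(t))}\,\partial_z^2\mathbf U^s(t,f(t)),$$ where the $z$-derivatives of $W_\varepsilon^{\rm sl}$ are taken piecewise, on each side of $z=f(t)$,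 and $$\boldsymbol{\mathcal B}_\varepsilon=\rho_\varepsilon\,\partial_z\mathbf B^s+\frac{c^s}{A_\varepsilon}\big(\boldsymbol{\mathcal U}_\varepsilon-\rho_\varepsilon\,\partial_z\mathbf U^s\big).$$ The amplitudes are $$(U_\varepsilon,V_\varepsilon)=iE_\varepsilon\boldsymbol{\mathcal U}_\varepsilon,\quad W_\varepsilon=\varepsilon^{-1}E_\varepsilon Q_\varepsilon,\quad (B_\varepsilon,G_\varepsilon)=iE_\varepsilon\boldsymbol{\mathcal B}_\varepsilon,\quad H_\varepsilon=\varepsilon^{-1}E_\varepsilon c^s\rho_\varepsilon,$$ and $\mathbf Z_\varepsilon=(U_\varepsilon,V_\varepsilon,B_\varepsilon,G_\varepsilon)$. Residual. $\mathbf R_\varepsilon$ is the amplitude of the error obtained by inserting $e^{i\varepsilon^{-1}(y-ax)}(U_\varepsilon,V_\varepsilon,W_\varepsilon,B_\varepsilon,G_\varepsilon,H_\varepsilon)$ into the linearized MHD boundary layer equations around $(\mathbf U^s,0,\mathbf B^s,0)$, i.e. (derivatives in the sense of distributions) $$(R_{1\varepsilon},R_{2\varepsilon})=(\partial_t+i\varepsilon^{-1}w_a^s-\partial_z^2)(U_\varepsilon,V_\varepsilon)-i\varepsilon^{-1}c^s(B_\varepsilon,G_\varepsilon)+W_\varepsilon\,\partial_z\mathbf U^s-H_\varepsilon\,\partial_z\mathbf B^s,$$ $$(R_{3\varepsilon},R_{4\varepsilon})=(\partial_t+i\varepsilon^{-1}w_a^s-\partial_z^2)(B_\varepsilon,G_\varepsilon)-i\varepsilon^{-1}c^s(U_\varepsilon,V_\varepsilon)+W_\varepsilon\,\partial_z\mathbf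 B^s-H_\varepsilon\,\partial_z\mathbf U^s.$$ *)

theory Defs
  imports "HOL-Analysis.Analysis"
begin

section \<open>Derivatives and test functions\<close>

definition vderiv :: "(real \<Rightarrow> 'a::real_normed_vector) \<Rightarrow> real \<Rightarrow> 'a" where
  "vderiv g x = vector_derivative g (at x)"

definition smooth :: "(real \<Rightarrow> 'a::real_normed_vector) \<Rightarrow> bool" where
  "smooth g \<longleftrightarrow> (\<forall>k. (vderiv ^^ k) g differentiable_on UNIV)"

text \<open>
  Functions of time and height are written \<open>g t z\<close> and matter only for \<open>t \<ge> 0\<close>, \<open>z \<ge> 0\<close>;
  on the boundary of this quarter plane the partial derivatives are one-sided.
\<close>

definition dz :: "(real \<Rightarrow> real \<Rightarrow> real) \<Rightarrow> real \<Rightarrow> real \<Rightarrow> real" where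
  "dz g t z = vector_derivative (g t) (at z within {0..})"

definition dt :: "(real \<Rightarrow> real \<Rightarrow> real) \<Rightarrow> real \<Rightarrow> real \<Rightarrow> real" where
  "dt g t z = vector_derivative (\<lambda>s. g s z) (at t within {0..})"

definition test_fun :: "(real \<Rightarrow> real) \<Rightarrow> bool" where
  "test_fun \<psi> \<longleftrightarrow> smooth \<psi> \<and> (\<exists>r>0. \<exists>R. \<forall>z. z \<notin> {r..R} \<longrightarrow> \<psi> z = 0)"

definition loc_integrable :: "(real \<Rightarrow> 'a::{banach, second_countable_topology}) \<Rightarrow> bool" where
  "loc_integrable g \<longleftrightarrow> (\<forall>r>0. \<forall>R. set_integrable lborel {r..R} g)"


section \<open>Weighted spaces on the half-line\<close>

definition L2_space :: "real \<Rightarrow> (real \<Rightarrow> 'a::real_normed_vector) set" where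
  "L2_space \<alpha> = {g. set_borel_measurable lborel {0..} g \<and>
     set_integrable lborel {0..} (\<lambda>z. (norm (exp (\<alpha> * z) *\<^sub>R g z))\<^sup>2)}"

definition L2_norm :: "real \<Rightarrow> (real \<Rightarrow> 'a::real_normed_vector) \<Rightarrow> real" where
  "L2_norm \<alpha> g = sqrt (LINT z:{0..}|lborel. (norm (exp (\<alpha> * z) *\<^sub>R g z))\<^sup>2)"

definition Linf_space :: "(real \<Rightarrow> real) set" where
  "Linf_space = {g. set_borel_measurable lborel {0..} g \<and>
     (\<exists>c. AE z in lborel. 0 \<le> z \<longrightarrow> \<bar>g z\<bar> \<le> c)}"

definition Linf_norm :: "(real \<Rightarrow> real) \<Rightarrow> real" where
  "Linf_norm g = Inf {c. 0 \<le> c \<and> (AE z in lborel. 0 \<le> z \<longrightarrow> \<bar>g z\<bar> \<le> c)}"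

definition weak_deriv :: "nat \<Rightarrow> (real \<Rightarrow> real) \<Rightarrow> (real \<Rightarrow> real) \<Rightarrow> bool" where
  "weak_deriv k g h \<longleftrightarrow> loc_integrable g \<and> loc_integrable h \<and>
     (\<forall>\<psi>. test_fun \<psi> \<longrightarrow>
        (\<integral>z. g z * (vderiv ^^ k) \<psi> z \<partial>lborel) = (-1) ^ k * (\<integral>z. h z * \<psi> z \<partial>lborel))"

text \<open>A weak derivative on \<open>(0,\<infinity>)\<close> is unique up to null sets, so the norms below do not depend on the choice.\<close>

definition wderiv :: "nat \<Rightarrow> (real \<Rightarrow> real) \<Rightarrow> real \<Rightarrow> real" where
  "wderiv k g = (SOME h. weak_deriv k g h)"

definition H_space :: "nat \<Rightarrow> (real \<Rightarrow> real) set" where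
  "H_space k = {g. \<forall>j\<le>k. \<exists>h. weak_deriv j g h \<and> h \<in> L2_space 0}"

definition H_norm :: "nat \<Rightarrow> (real \<Rightarrow> real) \<Rightarrow> real" where
  "H_norm k g = sqrt (\<Sum>j\<le>k. (L2_norm 0 (wderiv j g))\<^sup>2)"

definition Winf_space :: "nat \<Rightarrow> (real \<Rightarrow> real) set" where
  "Winf_space k = {g. \<forall>j\<le>k. \<exists>h. weak_deriv j g h \<and> h \<in> Linf_space}"

definition Winf_norm :: "nat \<Rightarrow> (real \<Rightarrow> real) \<Rightarrow> real" where
  "Winf_norm k g = (\<Sum>j\<le>k. Linf_norm (wderiv j g))"

text \<open>\<open>X_space \<alpha> k\<close> is the intersection of the weighted spaces \<open>W\<^sup>k\<^sup>,\<^sup>\<infinity>\<close> and \<open>H\<^sup>k\<close>.\<close>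

definition X_space :: "real \<Rightarrow> nat \<Rightarrow> (real \<Rightarrow> real) set" where
  "X_space \<alpha> k = {g. (\<lambda>z. exp (\<alpha> * z) * g z) \<in> Winf_space k \<inter> H_space k}"

definition X_norm :: "real \<Rightarrow> nat \<Rightarrow> (real \<Rightarrow> real) \<Rightarrow> real" where
  "X_norm \<alpha> k g =
     Winf_norm k (\<lambda>z. exp (\<alpha> * z) * g z) + H_norm k (\<lambda>z. exp (\<alpha> * z) * g z)"

text \<open>
  \<open>C_time i \<alpha> k F\<close>: the curve \<open>t \<mapsto> F t\<close> is of class \<open>C\<^sup>i\<close> from \<open>[0,\<infinity>)\<close> into
  \<open>X_space \<alpha> k\<close>; \<open>D j\<close> is its \<open>j\<close>-th derivative in the norm of that space.
\<close>

definition C_time :: "nat \<Rightarrow> real \<Rightarrow> nat \<Rightarrow> (real \<Rightarrow> real \<Rightarrow> real) \<Rightarrow> bool" where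
  "C_time i \<alpha> k F \<longleftrightarrow> (\<exists>D :: nat \<Rightarrow> real \<Rightarrow> real \<Rightarrow> real. D 0 = F \<and>
     (\<forall>j\<le>i. \<forall>t\<ge>0. D j t \<in> X_space \<alpha> k \<and>
        ((\<lambda>s. X_norm \<alpha> k (\<lambda>z. D j s z - D j t z)) \<longlongrightarrow> 0) (at t within {0..})) \<and>
     (\<forall>j<i. \<forall>t\<ge>0.
        ((\<lambda>s. X_norm \<alpha> k (\<lambda>z. (D j s z - D j t z) / (s - t) - D (Suc j) t z)) \<longlongrightarrow> 0)
          (at t within {0..})))"


section \<open>Shear flows\<close>

definition heat_solution :: "(real \<Rightarrow> real \<Rightarrow> real) \<Rightarrow> bool" where
  "heat_solution u \<longleftrightarrow> (\<forall>t\<ge>0. \<forall>z\<ge>0.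
     (\<lambda>s. u s z) differentiable (at t within {0..}) \<and>
     u t differentiable (at z within {0..}) \<and>
     dz u t differentiable (at z within {0..}) \<and>
     dt u t z - dz (dz u) t z = 0)"

definition velocity_shear ::
    "real \<Rightarrow> (real \<Rightarrow> real \<Rightarrow> real) \<Rightarrow> real \<Rightarrow> (real \<Rightarrow> real) \<Rightarrow> bool" where
  "velocity_shear \<alpha> u uE u0 \<longleftrightarrow> heat_solution u \<and>
     (\<forall>t\<ge>0. u t 0 = 0) \<and> (\<forall>t\<ge>0. (u t \<longlongrightarrow> uE) at_top) \<and> (\<forall>z\<ge>0. u 0 z = u0 z) \<and>
     (\<forall>i\<le>1. C_time i \<alpha> (4 - 2 * i) (\<lambda>t z. u t z - uE))"

definition magnetic_shear ::
    "real \<Rightarrow> (real \<Rightarrow> real \<Rightarrow> real) \<Rightarrow> real \<Rightarrow> (real \<Rightarrow> real) \<Rightarrow> bool" where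
  "magnetic_shear \<alpha> b bE b0 \<longleftrightarrow> heat_solution b \<and>
     (\<forall>t\<ge>0. dz b t 0 = 0) \<and> (\<forall>t\<ge>0. (b t \<longlongrightarrow> bE) at_top) \<and> (\<forall>z\<ge>0. b 0 z = b0 z) \<and>
     (\<forall>i\<le>2. C_time i \<alpha> (6 - 2 * i) (\<lambda>t z. b t z - bE))"


section \<open>Critical-layer profile and cutoff\<close>

text \<open>The value of the Heaviside function at \<open>0\<close> only affects the objects below on null sets.\<close>

definition heaviside :: "real \<Rightarrow> real" where
  "heaviside x = (if x \<ge> 0 then 1 else 0)"

definition W_sl :: "complex \<Rightarrow> (real \<Rightarrow> complex) \<Rightarrow> real \<Rightarrow> complex" where
  "W_sl \<tau> W Z = (\<tau> - of_real (Z\<^sup>2)) * W Z - of_real (heaviside Z) * (\<tau> - of_real (Z\<^sup>2))"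

text \<open>
  In the decay condition \<open>Z = 0\<close>, where \<open>W_sl\<close> jumps, is excluded; elsewhere its derivatives exist.
\<close>

definition critical_layer_profile :: "complex \<Rightarrow> (real \<Rightarrow> complex) \<Rightarrow> bool" where
  "critical_layer_profile \<tau> W \<longleftrightarrow> Im \<tau> < 0 \<and> smooth W \<and>
     (\<forall>Z. (\<tau> - of_real (Z\<^sup>2))\<^sup>2 * vderiv W Z
          + \<i> * (vderiv ^^ 3) (\<lambda>Y. (\<tau> - of_real (Y\<^sup>2)) * W Y) Z = 0) \<and>
     (W \<longlongrightarrow> 0) at_bot \<and> (W \<longlongrightarrow> 1) at_top \<and>
     (\<forall>k. \<exists>C. \<exists>\<eta>>0. \<forall>Z. Z \<noteq> 0 \<longrightarrow>
        norm ((vderiv ^^ k) (W_sl \<tau> W) Z) \<le> C * exp (- \<eta> * \<bar>Z\<bar>))"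

definition cutoff :: "real \<Rightarrow> (real \<Rightarrow> real) \<Rightarrow> bool" where
  "cutoff \<delta> \<phi> \<longleftrightarrow> smooth \<phi> \<and> (\<exists>r>0. \<forall>x. \<bar>x\<bar> < r \<longrightarrow> \<phi> x = 1) \<and>
     (\<exists>r<\<delta>. \<forall>x. \<bar>x\<bar> > r \<longrightarrow> \<phi> x = 0)"


section \<open>Approximate solution\<close>

text \<open>
  The shear flow \<open>U\<^sup>s = (us, vs)\<close>, \<open>B\<^sup>s = (bs, gs)\<close>, the number \<open>a\<close> (\<open>slope\<close>), the
  critical point \<open>f\<close> (\<open>crit\<close>) and the critical-layer pair (\<open>tau\<close>, \<open>prof\<close>).
\<close>

record layer =
  us :: "real \<Rightarrow> real \<Rightarrow> real"
  vs :: "real \<Rightarrow> real \<Rightarrow> real"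
  bs :: "real \<Rightarrow> real \<Rightarrow> real"
  gs :: "real \<Rightarrow> real \<Rightarrow> real"
  slope :: real
  crit :: "real \<Rightarrow> real"
  tau :: complex
  prof :: "real \<Rightarrow> complex"

definition wa :: "layer \<Rightarrow> real \<Rightarrow> real \<Rightarrow> real" where
  "wa L t z = vs L t z - slope L * us L t z"

definition cs :: "layer \<Rightarrow> real \<Rightarrow> real \<Rightarrow> real" where
  "cs L t z = gs L t z - slope L * bs L t z"

definition kap :: "layer \<Rightarrow> real \<Rightarrow> real" where
  "kap L t = \<bar>1 / 2 * dz (dz (wa L)) t (crit L t)\<bar>"

definition lam :: "layer \<Rightarrow> real \<Rightarrow> real \<Rightarrow> complex" where
  "lam L \<epsilon> t = of_real (- wa L t (crit L t)) + of_real (sqrt \<epsilon> * sqrt (kap L t)) * tau L"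

definition E_amp :: "layer \<Rightarrow> real \<Rightarrow> real \<Rightarrow> complex" where
  "E_amp L \<epsilon> t = exp (\<i> / of_real \<epsilon> * integral {0..t} (lam L \<epsilon>))"

definition A_eps :: "layer \<Rightarrow> real \<Rightarrow> real \<Rightarrow> real \<Rightarrow> complex" where
  "A_eps L \<epsilon> t z = lam L \<epsilon> t + of_real (wa L t z)"

definition W_reg_eps :: "layer \<Rightarrow> real \<Rightarrow> real \<Rightarrow> real \<Rightarrow> complex" where
  "W_reg_eps L \<epsilon> t z = of_real (heaviside (z - crit L t)) *
     (of_real (wa L t z - wa L t (crit L t)) + of_real (sqrt \<epsilon> * sqrt (kap L t)) * tau L)"

definition W_sl_eps :: "layer \<Rightarrow> (real \<Rightarrow> real) \<Rightarrow> real \<Rightarrow> real \<Rightarrow> real \<Rightarrow> complex" where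
  "W_sl_eps L \<phi> \<epsilon> t z = of_real (sqrt \<epsilon> * \<phi> (z - crit L t) * sqrt (kap L t)) *
     W_sl (tau L) (prof L) (kap L t powr (1 / 4) * ((z - crit L t) / \<epsilon> powr (1 / 4)))"

definition Q_eps :: "layer \<Rightarrow> (real \<Rightarrow> real) \<Rightarrow> real \<Rightarrow> real \<Rightarrow> real \<Rightarrow> complex" where
  "Q_eps L \<phi> \<epsilon> t z = W_reg_eps L \<epsilon> t z + W_sl_eps L \<phi> \<epsilon> t z"

definition rho_eps :: "layer \<Rightarrow> (real \<Rightarrow> real) \<Rightarrow> real \<Rightarrow> real \<Rightarrow> real \<Rightarrow> complex" where
  "rho_eps L \<phi> \<epsilon> t z = Q_eps L \<phi> \<epsilon> t z / A_eps L \<epsilon> t z"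

text \<open>
  The vector profiles are given by component: \<open>u\<close> is \<open>us L\<close> or \<open>vs L\<close>, and \<open>b\<close> is
  correspondingly \<open>bs L\<close> or \<open>gs L\<close>. For \<open>z \<noteq> crit L t\<close> the derivatives of \<open>W_sl_eps\<close> are the
  piecewise ones; at \<open>z = crit L t\<close> they have no meaning, which concerns a null set only.
\<close>

definition U_prof ::
    "layer \<Rightarrow> (real \<Rightarrow> real) \<Rightarrow> real \<Rightarrow> (real \<Rightarrow> real \<Rightarrow> real) \<Rightarrow> real \<Rightarrow> real \<Rightarrow> complex" where
  "U_prof L \<phi> \<epsilon> u t z = of_real (heaviside (z - crit L t) * dz u t z)
     + (vderiv ^^ 2) (W_sl_eps L \<phi> \<epsilon> t) z / of_real (dz (dz (wa L)) t (crit L t))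
         * of_real (dz u t (crit L t))
     + vderiv (W_sl_eps L \<phi> \<epsilon> t) z / of_real (dz (dz (wa L)) t (crit L t))
         * of_real (dz (dz u) t (crit L t))"

definition B_prof ::
    "layer \<Rightarrow> (real \<Rightarrow> real) \<Rightarrow> real \<Rightarrow> (real \<Rightarrow> real \<Rightarrow> real) \<Rightarrow> (real \<Rightarrow> real \<Rightarrow> real) \<Rightarrow>
     real \<Rightarrow> real \<Rightarrow> complex" where
  "B_prof L \<phi> \<epsilon> u b t z = rho_eps L \<phi> \<epsilon> t z * of_real (dz b t z)
     + of_real (cs L t z) / A_eps L \<epsilon> t z
         * (U_prof L \<phi> \<epsilon> u t z - rho_eps L \<phi> \<epsilon> t z * of_real (dz u t z))"

definition U_amp ::
    "layer \<Rightarrow> (real \<Rightarrow> real) \<Rightarrow> real \<Rightarrow> (real \<Rightarrow> real \<Rightarrow> real) \<Rightarrow> real \<Rightarrow> real \<Rightarrow> complex" where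
  "U_amp L \<phi> \<epsilon> u t z = \<i> * E_amp L \<epsilon> t * U_prof L \<phi> \<epsilon> u t z"

definition B_amp ::
    "layer \<Rightarrow> (real \<Rightarrow> real) \<Rightarrow> real \<Rightarrow> (real \<Rightarrow> real \<Rightarrow> real) \<Rightarrow> (real \<Rightarrow> real \<Rightarrow> real) \<Rightarrow>
     real \<Rightarrow> real \<Rightarrow> complex" where
  "B_amp L \<phi> \<epsilon> u b t z = \<i> * E_amp L \<epsilon> t * B_prof L \<phi> \<epsilon> u b t z"

definition W_amp :: "layer \<Rightarrow> (real \<Rightarrow> real) \<Rightarrow> real \<Rightarrow> real \<Rightarrow> real \<Rightarrow> complex" where
  "W_amp L \<phi> \<epsilon> t z = of_real (1 / \<epsilon>) * E_amp L \<epsilon> t * Q_eps L \<phi> \<epsilon> t z"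

definition H_amp :: "layer \<Rightarrow> (real \<Rightarrow> real) \<Rightarrow> real \<Rightarrow> real \<Rightarrow> real \<Rightarrow> complex" where
  "H_amp L \<phi> \<epsilon> t z = of_real (1 / \<epsilon>) * E_amp L \<epsilon> t * of_real (cs L t z) * rho_eps L \<phi> \<epsilon> t z"

text \<open>The product norm on the target is Euclidean, so \<open>L2_norm\<close> of a quadruple is the usual one.\<close>

definition Z_amp ::
    "layer \<Rightarrow> (real \<Rightarrow> real) \<Rightarrow> real \<Rightarrow> real \<Rightarrow> real \<Rightarrow> complex \<times> complex \<times> complex \<times> complex" where
  "Z_amp L \<phi> \<epsilon> t z =
     (U_amp L \<phi> \<epsilon> (us L) t z, U_amp L \<phi> \<epsilon> (vs L) t z,
      B_amp L \<phi> \<epsilon> (us L) (bs L) t z, B_amp L \<phi> \<epsilon> (vs L) (gs L) t z)"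


section \<open>Residual\<close>

text \<open>
  \<open>heat_residual T X F t R\<close>: at time \<open>t\<close>, \<open>(\<partial>\<^sub>t - \<partial>\<^sub>z\<^sup>2) X + F = R\<close> in the distributions on
  \<open>(0,\<infinity>)\<close>. The \<open>z\<close>-derivatives are moved to the test function, and \<open>\<partial>\<^sub>t X\<close> at time \<open>t\<close> is the
  derivative in \<open>s\<close> of the distribution-valued curve \<open>s \<mapsto> X s\<close> (one-sided at \<open>t = 0\<close>). This fixes
  \<open>R\<close> at every single time up to null sets in \<open>z\<close>; when it holds on an interval with \<open>R\<close> and \<open>F\<close>
  locally bounded in \<open>t\<close>, testing with products \<open>\<chi> t * \<psi> z\<close> and integrating by parts in \<open>t\<close>
  gives the identity in the distributions on space-time.
\<close>

definition heat_residual ::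
    "real \<Rightarrow> (real \<Rightarrow> real \<Rightarrow> complex) \<Rightarrow> (real \<Rightarrow> complex) \<Rightarrow> real \<Rightarrow> (real \<Rightarrow> complex) \<Rightarrow> bool" where
  "heat_residual T X F t R \<longleftrightarrow>
     loc_integrable (X t) \<and> loc_integrable F \<and> loc_integrable R \<and>
     (\<forall>\<psi>. test_fun \<psi> \<longrightarrow>
        ((\<lambda>s. \<integral>z. \<psi> z *\<^sub>R X s z \<partial>lborel) has_vector_derivative
           ((\<integral>z. (vderiv ^^ 2) \<psi> z *\<^sub>R X t z \<partial>lborel) - (\<integral>z. \<psi> z *\<^sub>R F z \<partial>lborel)
             + (\<integral>z. \<psi> z *\<^sub>R R z \<partial>lborel))) (at t within {0..<T}))"

definition velocity_residual ::
    "layer \<Rightarrow> (real \<Rightarrow> real) \<Rightarrow> real \<Rightarrow> real \<Rightarrow> (real \<Rightarrow> real \<Rightarrow> real) \<Rightarrow> (real \<Rightarrow> real \<Rightarrow> real) \<Rightarrow>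
     real \<Rightarrow> (real \<Rightarrow> complex) \<Rightarrow> bool" where
  "velocity_residual L \<phi> \<epsilon> T u b t R \<longleftrightarrow>
     heat_residual T (U_amp L \<phi> \<epsilon> u)
       (\<lambda>z. \<i> / of_real \<epsilon> * of_real (wa L t z) * U_amp L \<phi> \<epsilon> u t z - \<i> / of_real \<epsilon> * of_real (cs L t z) * B_amp L \<phi> \<epsilon> u b t z
          + W_amp L \<phi> \<epsilon> t z * of_real (dz u t z) - H_amp L \<phi> \<epsilon> t z * of_real (dz b t z)) t R"

definition magnetic_residual ::
    "layer \<Rightarrow> (real \<Rightarrow> real) \<Rightarrow> real \<Rightarrow> real \<Rightarrow> (real \<Rightarrow> real \<Rightarrow> real) \<Rightarrow> (real \<Rightarrow> real \<Rightarrow> real) \<Rightarrow>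
     real \<Rightarrow> (real \<Rightarrow> complex) \<Rightarrow> bool" where
  "magnetic_residual L \<phi> \<epsilon> T u b t R \<longleftrightarrow>
     heat_residual T (B_amp L \<phi> \<epsilon> u b)
       (\<lambda>z. \<i> / of_real \<epsilon> * of_real (wa L t z) * B_amp L \<phi> \<epsilon> u b t z - \<i> / of_real \<epsilon> * of_real (cs L t z) * U_amp L \<phi> \<epsilon> u t z
          + W_amp L \<phi> \<epsilon> t z * of_real (dz b t z) - H_amp L \<phi> \<epsilon> t z * of_real (dz u t z)) t R"

definition residual ::
    "layer \<Rightarrow> (real \<Rightarrow> real) \<Rightarrow> real \<Rightarrow> real \<Rightarrow> real \<Rightarrow>
     (real \<Rightarrow> complex \<times> complex \<times> complex \<times> complex) \<Rightarrow> bool" where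
  "residual L \<phi> \<epsilon> T t R \<longleftrightarrow>
     velocity_residual L \<phi> \<epsilon> T (us L) (bs L) t (\<lambda>z. fst (R z)) \<and>
     velocity_residual L \<phi> \<epsilon> T (vs L) (gs L) t (\<lambda>z. fst (snd (R z))) \<and>
     magnetic_residual L \<phi> \<epsilon> T (us L) (bs L) t (\<lambda>z. fst (snd (snd (R z)))) \<and>
     magnetic_residual L \<phi> \<epsilon> T (vs L) (gs L) t (\<lambda>z. snd (snd (snd (R z))))"

definition admissible :: "int \<Rightarrow> real set" where
  "admissible q = {1 / (real_of_int q * real n) | n. n \<ge> 1}"

definition L_log :: "real \<Rightarrow> real" where
  "L_log \<epsilon> = 1 + \<bar>ln \<epsilon>\<bar>"

end

theory Submission
  imports Defs "HOL-Real_Asymp.Real_Asymp"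
begin

text \<open>
  Everything happens in the layer variable \<open>Z = (z - f(t)) / \<epsilon>\<^bsup>1/4\<^esup>\<close>. For \<open>t \<le> K\<^sub>0 \<surd>\<epsilon> L\<^sub>\<epsilon>\<close> and near the
  critical point, \<open>A = \<lambda> + w\<close> is of size \<open>\<surd>\<epsilon> (1 + Z\<^sup>2)\<close> and, as \<open>Im \<tau> < 0\<close>, at least of size
  \<open>\<surd>\<epsilon>\<close>; since the magnetic field vanishes to second order at \<open>(0, z\<^sub>0)\<close>, \<open>c = O(t + (z - f)\<^sup>2)\<close> is
  \<open>O(L\<^sub>\<epsilon> \<surd>\<epsilon> (1 + Z\<^sup>2))\<close>. A \<open>z\<close>-derivative costs \<open>\<epsilon>\<^bsup>-1/4\<^esup>\<close> and a \<open>t\<close>-derivative at most \<open>\<epsilon>\<^bsup>-1/2\<^esup>\<close>.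

  The profiles have one smooth branch on each side of \<open>z = f(t)\<close>. From below to above, \<open>W\<^sub>s\<^sub>l\<close> and its first three
  derivatives jump by \<open>-\<tau>, 0, 2, 0\<close>, which makes the branches of each amplitude agree to first
  order, so that the distributional residual has no singular part. Because \<open>\<lambda> + w = A\<close> and
  \<open>Q = A \<rho>\<close>, its transport part reduces to \<open>\<epsilon>\<^sup>-\<^sup>1 (A - c\<^sup>2 / A) (U - \<rho> \<partial>\<^sub>z U\<^sup>s)\<close>; the shear
  flow solves the heat equation, so only the layer remains. Hence the residual is \<open>\<epsilon>\<^bsup>-1/2\<^esup>\<close> times
  a decaying function of \<open>Z\<close>, of norm \<open>\<epsilon>\<^bsup>-1/2 + 1/8\<^esup>\<close>. This is cruder than what the equation of
  the profile would give: only its decay and its jumps enter.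

  Finally \<open>\<sigma>\<^sub>0 = - \<kappa>(0)\<^bsup>1/2\<^esup> Im \<tau>\<close>: the exponent of \<open>\<bar>E\<bar>\<close> differs from \<open>\<sigma>\<^sub>0 t / \<surd>\<epsilon>\<close> by
  \<open>O(t\<^sup>2 / \<surd>\<epsilon>) = O(1)\<close>. The lower bound comes from an interval above the support of the
  cutoff, where the velocity profile is \<open>\<partial>\<^sub>z U\<^sup>s \<noteq> 0\<close>.
\<close>

section \<open>Smooth functions and the fundamental lemma\<close>

text \<open>The shear flow is given as a curve in spaces of weak derivatives, with time derivatives
  taken in norm, while the estimates evaluate classical derivatives up to
  \<open>dz (dz (dz u))\<close> and \<open>dt (dz (dz u))\<close> at points. The heat equation
  bridges the gap: the time derivative of the curve has to be \<open>dz (dz u)\<close>, which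
  thereby inherits two more z-derivatives from the space.

  The residual is a distribution and the interface z = f(t) moves, so a fixed z may change sides.
  Each branch is therefore a function for all z > 0, and the two are compared only at the interface,
  where value and slope agree. A jump in value would leave a Dirac mass in the time derivative and
  the derivative of one in the second z-derivative.

  Size and support are kept apart: orders in \<epsilon> are claimed only for |z - f| \<le> \<delta>
  and only for the branch valid on that side, because a branch continued beyond the interface grows;
  farther away the layer parts are exactly zero by the cutoff. The radius \<delta> is fixed by the
  flow and the path f before the cutoff and \<open>K0\<close> are chosen.\<close>

primrec cdiff :: "nat \<Rightarrow> (real \<Rightarrow> 'a::real_normed_vector) \<Rightarrow> bool" where
  "cdiff 0 g \<longleftrightarrow> True"
| "cdiff (Suc n) g \<longleftrightarrow> (\<exists>g'. (\<forall>x. (g has_vector_derivative g' x) (at x)) \<and> cdiff n g')"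

lemma vderiv_eqI:
  assumes "\<And>x. (g has_vector_derivative g' x) (at x)"
  shows "vderiv g = g'"
  using assms by (auto simp: vderiv_def fun_eq_iff intro: vector_derivative_at)

lemma cdiff_SucD:
  assumes "cdiff (Suc n) g"
  shows "(g has_vector_derivative vderiv g x) (at x)" "cdiff n (vderiv g)"
proof -
  obtain g' where g': "\<And>x. (g has_vector_derivative g' x) (at x)" "cdiff n g'"
    using assms by auto
  then show "(g has_vector_derivative vderiv g x) (at x)" "cdiff n (vderiv g)"
    by (simp_all add: vderiv_eqI[OF g'(1)])
qed

text \<open>\<open>vderiv\<close> is a total operator, so an iterate means something only once the
  previous one is known to be differentiable. The existential in \<open>cdiff\<close> carries that
  knowledge along, and closure under sums, products and affine changes of variable becomes a plain
  induction on the order.\<close>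

lemma smooth_iff_cdiff: "smooth g \<longleftrightarrow> (\<forall>n. cdiff n g)"
proof
  assume g: "smooth g"
  have "smooth g \<Longrightarrow> cdiff n g" for n and g :: "real \<Rightarrow> 'a"
  proof (induction n arbitrary: g)
    case (Suc n)
    have "g differentiable at x" for x
      using Suc.prems by (auto simp: smooth_def differentiable_on_def dest: spec[of _ 0])
    then have "(g has_vector_derivative vderiv g x) (at x)" for x
      by (simp add: vderiv_def vector_derivative_works)
    moreover have "smooth (vderiv g)"
      using Suc.prems by (auto simp: smooth_def simp flip: funpow_Suc_right funpow_swap1 dest: spec[of _ "Suc _"])
    ultimately show ?case using Suc.IH by auto
  qed simp
  with g show "\<forall>n. cdiff n g" by blast
next
  assume g: "\<forall>n. cdiff n g"
  have "(vderiv ^^ k) g differentiable at x" if "cdiff (Suc k) g" for k x and g :: "real \<Rightarrow> 'a"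
    using that
  proof (induction k arbitrary: g)
    case 0
    then show ?case
      by (metis cdiff_SucD(1) differentiableI_vector funpow_0)
  next
    case (Suc k)
    from Suc.IH[OF cdiff_SucD(2)[OF Suc.prems]] show ?case
      by (simp add: funpow_swap1)
  qed
  with g show "smooth g"
    unfolding smooth_def differentiable_on_def by blast
qed

lemma smooth_vderiv: "smooth g \<Longrightarrow> smooth (vderiv g)"
  by (meson cdiff_SucD(2) smooth_iff_cdiff)

lemma smooth_funpow_vderiv: "smooth g \<Longrightarrow> smooth ((vderiv ^^ n) g)"
  by (induction n) (auto intro: smooth_vderiv)

lemma smooth_has_vderiv: "smooth g \<Longrightarrow> (g has_vector_derivative vderiv g x) (at x)"
  by (meson cdiff_SucD(1) smooth_iff_cdiff)

lemma smooth_has_vderiv_funpow: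
  "smooth g \<Longrightarrow> ((vderiv ^^ n) g has_vector_derivative (vderiv ^^ Suc n) g x) (at x)"
  using smooth_has_vderiv[OF smooth_funpow_vderiv[of g n]] by simp

lemma smooth_continuous_on: "smooth g \<Longrightarrow> continuous_on S g"
  by (meson continuous_at_imp_continuous_on has_vector_derivative_continuous smooth_has_vderiv)

lemma smooth_funpow_continuous_on: "smooth g \<Longrightarrow> continuous_on S ((vderiv ^^ n) g)"
  by (intro smooth_continuous_on smooth_funpow_vderiv)

lemma cdiff_mono: "cdiff (Suc n) g \<Longrightarrow> cdiff n g"
  by (induction n arbitrary: g) (simp, force)

lemma cdiff_add: "cdiff n g \<Longrightarrow> cdiff n h \<Longrightarrow> cdiff n (\<lambda>x. g x + h x)"
proof (induction n arbitrary: g h)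
  case (Suc n)
  then obtain g' h' where *: "\<And>x. (g has_vector_derivative g' x) (at x)" "cdiff n g'"
    "\<And>x. (h has_vector_derivative h' x) (at x)" "cdiff n h'" by auto
  then show ?case using Suc.IH[of g' h']
    by (auto intro!: exI[of _ "\<lambda>x. g' x + h' x"] has_vector_derivative_add)
qed simp

lemma cdiff_mult:
  fixes g h :: "real \<Rightarrow> 'a::real_normed_algebra"
  shows "cdiff n g \<Longrightarrow> cdiff n h \<Longrightarrow> cdiff n (\<lambda>x. g x * h x)"
proof (induction n arbitrary: g h)
  case (Suc n)
  then obtain g' h' where *: "\<And>x. (g has_vector_derivative g' x) (at x)" "cdiff n g'"
    "\<And>x. (h has_vector_derivative h' x) (at x)" "cdiff n h'" by auto
  \<comment> \<open>The derivative falls on one factor at a time; the undifferentiated factor is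
    then used at the lower order n, which \<open>cdiff_mono\<close> provides.\<close>
  have "cdiff n (\<lambda>x. g x * h' x + g' x * h x)"
    using * Suc.prems by (intro cdiff_add Suc.IH cdiff_mono[of n g] cdiff_mono[of n h]) auto
  then show ?case using *
    by (auto intro!: exI[of _ "\<lambda>x. g x * h' x + g' x * h x"] has_vector_derivative_mult)
qed simp

lemma smooth_add: "smooth g \<Longrightarrow> smooth h \<Longrightarrow> smooth (\<lambda>x. g x + h x)"
  by (auto simp: smooth_iff_cdiff cdiff_add)

lemma smooth_mult:
  fixes g h :: "real \<Rightarrow> 'a::real_normed_algebra"
  shows "smooth g \<Longrightarrow> smooth h \<Longrightarrow> smooth (\<lambda>x. g x * h x)"
  by (auto simp: smooth_iff_cdiff cdiff_mult)

lemma cdiff_affine: "cdiff n g \<Longrightarrow> cdiff n (\<lambda>x. g (a * x + b))"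
proof (induction n arbitrary: g)
  case (Suc n)
  then obtain g' where *: "\<And>x. (g has_vector_derivative g' x) (at x)" "cdiff n g'" by auto
  have c: "cdiff m (\<lambda>x. a *\<^sub>R g x)" if "cdiff m g" for m and g :: "real \<Rightarrow> 'a"
    using that
  proof (induction m arbitrary: g)
    case (Suc m)
    then obtain g' where *: "\<And>x. (g has_vector_derivative g' x) (at x)" "cdiff m g'" by auto
    then show ?case using Suc.IH[of g']
      by (auto intro!: exI[of _ "\<lambda>x. a *\<^sub>R g' x"] derivative_eq_intros)
  qed simp
  have "((\<lambda>x. g (a * x + b)) has_vector_derivative a *\<^sub>R g' (a * x + b)) (at x)" for x
  proof -
    have "((\<lambda>x. a * x + b) has_vector_derivative a) (at x)"
      by (auto intro!: derivative_eq_intros simp flip: has_real_derivative_iff_has_vector_derivative)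
    from vector_diff_chain_at[OF this *(1)] show ?thesis by (simp add: o_def)
  qed
  with c[OF Suc.IH[OF *(2)]] show ?case
    unfolding cdiff.simps(2) by (intro exI[of _ "\<lambda>x. a *\<^sub>R g' (a * x + b)"] conjI allI)
qed simp

lemma smooth_affine: "smooth g \<Longrightarrow> smooth (\<lambda>x. g (a * x + b))"
  by (auto simp: smooth_iff_cdiff cdiff_affine)

lemma smooth_of_all: "(\<And>x. (g has_vector_derivative g' x) (at x)) \<Longrightarrow> smooth g' \<Longrightarrow> smooth g"
  unfolding smooth_iff_cdiff by (metis cdiff.simps not0_implies_Suc)

lemma smooth_const: "smooth (\<lambda>x. c)"
  unfolding smooth_iff_cdiff
proof
  fix n show "cdiff n (\<lambda>x. c)"
    by (induction n arbitrary: c) (auto intro!: exI[of _ "\<lambda>x. 0"])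
qed

section \<open>Bump functions approximating indicators of intervals\<close>

definition flat :: "real poly \<Rightarrow> real \<Rightarrow> real" where
  "flat p x = (if x > 0 then poly p (1 / x) * exp (- (1 / x)) else 0)"

lemma poly_exp_tendsto: "((\<lambda>v. poly p v * exp (- v)) \<longlongrightarrow> (0::real)) at_top"
proof -
  have "((\<lambda>v. \<Sum>i\<le>degree p. coeff p i * (v ^ i / exp v)) \<longlongrightarrow> (\<Sum>i\<le>degree p. coeff p i * 0)) at_top"
    by (intro tendsto_sum tendsto_mult tendsto_const tendsto_power_div_exp_0)
  then show ?thesis
    by (simp add: poly_altdef exp_minus sum_distrib_right divide_inverse mult.assoc)
qed

text \<open>With v = 1/x the derivative of p(v) exp(-v) is (p(v) - p'(v)) v^2 exp(-v). The
  polynomial factor closes the family under differentiation, so smoothness follows by induction on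
  the order with p arbitrary.\<close>

lemma flat_deriv:
  "(flat p has_real_derivative flat ((p - pderiv p) * [:0, 0, 1:]) x) (at x)"
proof -
  consider "x > 0" | "x < 0" | "x = 0" by linarith
  then show ?thesis
  proof cases
    case 1
    have "((\<lambda>x. poly p (1 / x) * exp (- (1 / x))) has_real_derivative
        flat ((p - pderiv p) * [:0, 0, 1:]) x) (at x)"
      using 1 unfolding flat_def
      by (auto intro!: derivative_eq_intros simp: power2_eq_square field_simps)
    then show ?thesis
      by (rule has_field_derivative_transform_within_open[where S="{0<..}"])
         (use 1 in \<open>auto simp: flat_def\<close>)
  next
    case 2
    have "((\<lambda>x. 0) has_real_derivative flat ((p - pderiv p) * [:0, 0, 1:]) x) (at x)"
      using 2 by (auto simp: flat_def)
    then show ?thesis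
      by (rule has_field_derivative_transform_within_open[where S="{..<0}"])
         (use 2 in \<open>auto simp: flat_def\<close>)
  next
    case 3
    \<comment> \<open>The difference quotient at 0 vanishes on the left; on the right it is
      \<open>poly (p * [:0,1:]) v * exp (- v)\<close> at v = 1/y, which tends to 0 as v
      grows.\<close>
    have "((\<lambda>y. flat p y / y) \<longlongrightarrow> 0) (at 0)"
    proof (rule filterlim_split_at_real)
      have "\<forall>\<^sub>F x in at_left 0. 0 = flat p x / x"
        unfolding eventually_at_left_field by (auto simp: flat_def intro!: exI[of _ "-1"])
      then show "((\<lambda>y. flat p y / y) \<longlongrightarrow> 0) (at_left 0)"
        by (rule Lim_transform_eventually[OF tendsto_const])
      have "((\<lambda>y. poly (p * [:0,1:]) (inverse y) * exp (- (inverse y))) \<longlongrightarrow> 0) (at_right 0)"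
        by (rule filterlim_compose[OF poly_exp_tendsto filterlim_inverse_at_top_right])
      moreover have "\<forall>\<^sub>F y in at_right 0. poly (p * [:0,1:]) (inverse y) * exp (- (inverse y)) = flat p y / y"
        unfolding eventually_at_right_field
        by (auto simp: flat_def field_simps intro!: exI[of _ "1"])
      ultimately show "((\<lambda>y. flat p y / y) \<longlongrightarrow> 0) (at_right 0)"
        by (rule Lim_transform_eventually)
    qed
    then show ?thesis
      using 3 by (simp add: has_field_derivative_iff flat_def)
  qed
qed

lemma smooth_flat: "smooth (flat p)"
  unfolding smooth_iff_cdiff
proof
  fix n show "cdiff n (flat p)"
    by (induction n arbitrary: p) (auto intro!: exI flat_deriv[THEN has_real_derivative_iff_has_vector_derivative[THEN iffD1]])
qed

text \<open>The two arguments are n(x - a) and n(b - x). Raising n leaves the support inside [a, b]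
  and sends both factors to 1 in the interior, so indicators of open intervals are reached by
  bounded pointwise convergence, in place of mollification.\<close>

definition bump :: "real \<Rightarrow> real \<Rightarrow> nat \<Rightarrow> real \<Rightarrow> real" where
  "bump a b n x = flat 1 (real n * x + - (real n * a)) * flat 1 (- real n * x + real n * b)"

lemma test_fun_bump: "0 < a \<Longrightarrow> test_fun (bump a b n)"
proof -
  assume a: "0 < a"
  have s: "smooth (bump a b n)"
    unfolding bump_def by (intro smooth_mult smooth_affine smooth_flat)
  have "bump a b n z = 0" if "z \<notin> {a..b}" for z
  proof -
    from that have "z < a \<or> z > b" by auto
    then have "real n * (z - a) \<le> 0 \<or> real n * (b - z) \<le> 0"
      by (auto simp: mult_nonneg_nonpos)
    then show ?thesis by (auto simp: bump_def flat_def algebra_simps)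
  qed
  with a s show "test_fun (bump a b n)" unfolding test_fun_def by blast
qed

lemma bump_bound: "\<bar>bump a b n x\<bar> \<le> 1"
  by (auto simp: bump_def flat_def abs_mult intro!: mult_le_one)

lemma bump_tendsto: "(\<lambda>n. bump a b n x) \<longlonglongrightarrow> indicator {a<..<b} x"
proof (cases "x \<in> {a<..<b}")
  case True
  have "(\<lambda>n. exp (- (1 / (x - a) * inverse (real n))) * exp (- (1 / (b - x) * inverse (real n))))
      \<longlonglongrightarrow> exp (- (1 / (x - a) * 0)) * exp (- (1 / (b - x) * 0))"
    by (intro tendsto_intros lim_inverse_n)
  moreover have "\<forall>\<^sub>F n in sequentially. exp (- (1 / (x - a) * inverse (real n))) * exp (- (1 / (b - x) * inverse (real n)))
     = bump a b n x"
    using eventually_gt_at_top[of 0]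
  proof eventually_elim
    case (elim n)
    have "0 < real n * (x - a)" "0 < real n * (b - x)" using elim True by auto
    moreover have "real n * x + - (real n * a) = real n * (x - a)" "- real n * x + real n * b = real n * (b - x)"
      by (auto simp: algebra_simps)
    ultimately show ?case
      unfolding bump_def flat_def by (simp add: field_simps)
  qed
  ultimately show ?thesis using True by (auto intro: Lim_transform_eventually)
next
  case False
  have "bump a b n x = 0" for n
  proof -
    have "real n * (x - a) \<le> 0 \<or> real n * (b - x) \<le> 0"
      using False by (auto simp: mult_nonneg_nonpos not_less)
    then show ?thesis by (auto simp: bump_def flat_def algebra_simps)
  qed
  then show ?thesis using False by simp
qed

text \<open>The positive and the negative part of f are densities of two finite measures with the
  same mass on every half-line. Such measures coincide, and equal measures have densities that agree
  almost everywhere.\<close>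

lemma AE_zero_intervals:
  fixes f :: "real \<Rightarrow> real"
  assumes f: "integrable lborel f" and 0: "\<And>x. (\<integral>y. indicator {x<..} y * f y \<partial>lborel) = 0"
  shows "AE x in lborel. f x = 0"
proof -
  have [measurable]: "f \<in> borel_measurable borel" using f by simp
  define P where "P x = ennreal (max 0 (f x))" for x
  define N where "N x = ennreal (max 0 (- f x))" for x
  have [measurable]: "P \<in> borel_measurable borel" "N \<in> borel_measurable borel"
    unfolding P_def N_def by measurable
  have i: "integrable lborel (\<lambda>y. indicator {x<..} y * max 0 (f y))"
    "integrable lborel (\<lambda>y. indicator {x<..} y * max 0 (- f y))" for x
    by (rule Bochner_Integration.integrable_bound[OF f]; auto simp: indicator_def)+
  have e: "emeasure (density lborel P) {x<..} = ennreal (\<integral>y. indicator {x<..} y * max 0 (f y) \<partial>lborel)"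
    "emeasure (density lborel N) {x<..} = ennreal (\<integral>y. indicator {x<..} y * max 0 (- f y) \<partial>lborel)" for x
    using i[of x]
    by (auto simp: emeasure_density P_def N_def nn_integral_eq_integral[symmetric] indicator_def
        intro!: nn_integral_cong)
  have eq: "(\<integral>y. indicator {x<..} y * max 0 (f y) \<partial>lborel) = (\<integral>y. indicator {x<..} y * max 0 (- f y) \<partial>lborel)" for x
  proof -
    have "(\<integral>y. indicator {x<..} y * max 0 (f y) \<partial>lborel) - (\<integral>y. indicator {x<..} y * max 0 (- f y) \<partial>lborel)
       = (\<integral>y. indicator {x<..} y * f y \<partial>lborel)"
      unfolding Bochner_Integration.integral_diff[OF i, symmetric]
      by (intro Bochner_Integration.integral_cong) (auto simp: indicator_def max_def)
    then show ?thesis using 0 by simp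
  qed
  have "density lborel P = density lborel N"
    by (rule measure_eqI_lessThan) (auto simp: e eq)
  then have "AE x in lborel. P x = N x"
    by (intro sigma_finite_measure.density_unique[OF sigma_finite_lborel]) auto
  then show ?thesis
    by eventually_elim (auto simp: P_def N_def max_def ennreal_eq_0_iff split: if_splits)
qed

lemma test_fun_continuous_on: "test_fun \<psi> \<Longrightarrow> continuous_on S \<psi>"
  by (auto simp: test_fun_def intro: smooth_continuous_on)

text \<open>Bumps converge boundedly to the indicator of (a, b), so h has integral zero over every
  such interval with a > 0. \<open>AE_zero_intervals\<close> then applies to h cut to (1/(n+1), n),
  where it is integrable, and the countably many exceptional null sets are united.\<close>

lemma fundamental_lemma:
  assumes h: "loc_integrable h" and 0: "\<And>\<psi>. test_fun \<psi> \<Longrightarrow> (\<integral>z. h z * \<psi> z \<partial>lborel) = 0"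
  shows "AE z in lborel. 0 < z \<longrightarrow> h z = (0::real)"
proof -
  have int0: "(\<integral>z. indicator {a<..<b} z * h z \<partial>lborel) = 0" if "0 < a" for a b
  proof -
    have hi: "integrable lborel (\<lambda>z. indicator {a..b} z * h z)"
      using h that by (auto simp: loc_integrable_def set_integrable_def)
    have mb[measurable]: "bump a b n \<in> borel_measurable borel" for n
      by (intro borel_measurable_continuous_onI test_fun_continuous_on test_fun_bump that)
    have localized: "bump a b n z = indicator {a..b} z * bump a b n z" for n z
    proof -
      have "real n * (z - a) \<le> 0 \<or> real n * (b - z) \<le> 0" if "z \<notin> {a..b}"
        using that by (auto simp: mult_nonneg_nonpos not_le)
      then have "bump a b n z = 0" if "z \<notin> {a..b}"
        using that by (auto simp: bump_def flat_def algebra_simps)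
      then show ?thesis by (cases "z \<in> {a..b}") auto
    qed
    have "(\<lambda>n. \<integral>z. (indicator {a..b} z * h z) * bump a b n z \<partial>lborel)
        \<longlonglongrightarrow> (\<integral>z. (indicator {a..b} z * h z) * indicator {a<..<b} z \<partial>lborel)"
    proof (rule integral_dominated_convergence)
      show "(\<lambda>z. (indicator {a..b} z * h z) * indicator {a<..<b} z) \<in> borel_measurable lborel"
        using hi by measurable
      show "(\<lambda>z. (indicator {a..b} z * h z) * bump a b n z) \<in> borel_measurable lborel" for n
        using hi by measurable
      show "integrable lborel (\<lambda>z. \<bar>indicator {a..b} z * h z\<bar>)" using hi by (rule integrable_abs)
      show "AE x in lborel. (\<lambda>i. indicator {a..b} x * h x * bump a b i x) \<longlonglongrightarrow> indicator {a..b} x * h x * indicator {a<..<b} x"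
        by (intro AE_I2 tendsto_intros bump_tendsto)
      show "AE x in lborel. norm (indicator {a..b} x * h x * bump a b n x) \<le> \<bar>indicator {a..b} x * h x\<bar>" for n
        using bump_bound by (auto simp: abs_mult intro!: AE_I2 mult_left_le)
    qed
    moreover have "(\<integral>z. (indicator {a..b} z * h z) * bump a b n z \<partial>lborel) = 0" for n
    proof -
      have "(\<lambda>z. (indicator {a..b} z * h z) * bump a b n z) = (\<lambda>z. h z * bump a b n z)"
        by (subst (2) localized) (auto simp: fun_eq_iff)
      then show ?thesis using 0[OF test_fun_bump[OF that]] by simp
    qed
    moreover have "(\<lambda>z. (indicator {a..b} z * h z) * indicator {a<..<b} z) = (\<lambda>z. indicator {a<..<b} z * h z)"
      by (auto simp: indicator_def)
    ultimately show ?thesis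
      by (simp add: LIMSEQ_const_iff)
  qed
  have loc: "AE z in lborel. z \<in> {1 / real (Suc n)<..<real n} \<longrightarrow> h z = 0" for n
  proof -
    let ?f = "\<lambda>z. indicator {1 / real (Suc n)<..<real n} z * h z"
    have "integrable lborel (\<lambda>z. indicator {1 / real (Suc n)..real n} z * h z)"
      using h by (auto simp: loc_integrable_def set_integrable_def)
    then have "integrable lborel (\<lambda>z. indicator {1 / real (Suc n)<..<real n} z * (indicator {1 / real (Suc n)..real n} z * h z))"
      using integrable_mult_indicator[of "{1 / real (Suc n)<..<real n}" lborel
          "\<lambda>z. indicator {1 / real (Suc n)..real n} z * h z"] by simp
    also have "(\<lambda>z. indicator {1 / real (Suc n)<..<real n} z * (indicator {1 / real (Suc n)..real n} z * h z)) = ?f"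
      by (auto simp: indicator_def)
    finally have fi: "integrable lborel ?f" .
    have "(\<integral>y. indicator {x<..} y * ?f y \<partial>lborel) = 0" for x
    proof -
      have "(\<integral>y. indicator {x<..} y * ?f y \<partial>lborel)
         = (\<integral>y. indicator {max x (1 / real (Suc n))<..<real n} y * h y \<partial>lborel)"
        by (intro Bochner_Integration.integral_cong) (auto simp: indicator_def)
      also have "\<dots> = 0" by (rule int0) (rule max.strict_coboundedI2, simp)
      finally show ?thesis .
    qed
    from AE_zero_intervals[OF fi this] show ?thesis
      by eventually_elim auto
  qed
  have "AE z in lborel. \<forall>n. z \<in> {1 / real (Suc n)<..<real n} \<longrightarrow> h z = 0"
    unfolding AE_all_countable using loc by blast
  then show ?thesis
  proof eventually_elim
    case (elim z)
    show ?case
    proof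
      assume z: "0 < z"
      obtain n1 where n1: "z < real n1" using reals_Archimedean2 by blast
      obtain n2 where n2: "1 / real (Suc n2) < z" using nat_approx_posE[OF z] by blast
      have "1 / real (Suc (max n1 n2)) \<le> 1 / real (Suc n2)" by (auto intro!: divide_left_mono)
      then show "h z = 0" using elim[rule_format, of "max n1 n2"] n1 n2 by auto
    qed
  qed
qed

section \<open>Weak derivatives and weighted norms\<close>

lemma at_within_half_line: "0 < z \<Longrightarrow> at z within {0::real..} = at z"
  by (rule at_within_interior) simp

lemma test_fun_smooth: "test_fun \<psi> \<Longrightarrow> smooth \<psi>"
  by (simp add: test_fun_def)

lemma test_fun_vderiv: "test_fun \<psi> \<Longrightarrow> test_fun (vderiv \<psi>)"
proof -
  assume t: "test_fun \<psi>"
  then obtain r R where r: "0 < r" and z: "\<And>z. z \<notin> {r..R} \<Longrightarrow> \<psi> z = 0"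
    unfolding test_fun_def by blast
  have "vderiv \<psi> z = 0" if "z \<notin> {r..R}" for z
  proof -
    have "(\<psi> has_vector_derivative 0) (at z)"
      by (rule has_vector_derivative_transform_within_open[of "\<lambda>_. 0" _ _ "- {r..R}"])
         (use that z in \<open>auto intro: open_Compl\<close>)
    then show ?thesis by (simp add: vderiv_def vector_derivative_at)
  qed
  then show ?thesis using smooth_vderiv[OF test_fun_smooth[OF t]] r unfolding test_fun_def by blast
qed

lemma test_fun_funpow_vderiv: "test_fun \<psi> \<Longrightarrow> test_fun ((vderiv ^^ n) \<psi>)"
  by (induction n) (auto intro: test_fun_vderiv)

lemma test_fun_bounded: "test_fun \<psi> \<Longrightarrow> \<exists>C. \<forall>z. \<bar>\<psi> z\<bar> \<le> C"
proof -
  assume t: "test_fun \<psi>"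
  then obtain r R where z: "\<And>z. z \<notin> {r..R} \<Longrightarrow> \<psi> z = 0"
    unfolding test_fun_def by blast
  have "compact (\<psi> ` {r..R})"
    by (intro compact_continuous_image test_fun_continuous_on t) simp
  then have "bounded (\<psi> ` {r..R})" by (rule compact_imp_bounded)
  then obtain C where "\<And>y. y \<in> \<psi> ` {r..R} \<Longrightarrow> norm y \<le> C"
    unfolding bounded_iff by blast
  then have C: "\<bar>\<psi> z\<bar> \<le> C" if "z \<in> {r..R}" for z
    using that by (metis image_eqI real_norm_def)
  have "\<bar>\<psi> z\<bar> \<le> max C 0" for z
  proof (cases "z \<in> {r..R}")
    case True
    from C[OF True] show ?thesis by simp
  next
    case False
    from z[OF False] show ?thesis by simp
  qed
  then show ?thesis by blast
qed

lemma test_fun_measurable: "test_fun \<psi> \<Longrightarrow> \<psi> \<in> borel_measurable borel"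
  by (intro borel_measurable_continuous_onI test_fun_continuous_on)

lemma integrable_test_scaleR:
  assumes t: "test_fun \<psi>" and g: "loc_integrable g"
  shows "integrable lborel (\<lambda>z. \<psi> z *\<^sub>R g z)"
proof -
  obtain r R where r: "0 < r" and z: "\<And>z. z \<notin> {r..R} \<Longrightarrow> \<psi> z = 0"
    using t unfolding test_fun_def by blast
  obtain C where C: "\<And>z. \<bar>\<psi> z\<bar> \<le> C" using test_fun_bounded[OF t] by blast
  have gi: "integrable lborel (\<lambda>z. indicator {r..R} z *\<^sub>R g z)"
    using g r by (auto simp: loc_integrable_def set_integrable_def)
  have [measurable]: "\<psi> \<in> borel_measurable borel" by (rule test_fun_measurable[OF t])
  have "integrable lborel (\<lambda>z. \<psi> z *\<^sub>R (indicator {r..R} z *\<^sub>R g z))"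
  proof (rule Bochner_Integration.integrable_bound)
    show "integrable lborel (\<lambda>z. C *\<^sub>R (indicator {r..R} z *\<^sub>R g z))"
      by (rule integrable_scaleR_right) (rule gi)
    show "(\<lambda>z. \<psi> z *\<^sub>R (indicator {r..R} z *\<^sub>R g z)) \<in> borel_measurable lborel"
      using gi by measurable
    show "AE x in lborel. norm (\<psi> x *\<^sub>R indicator {r..R} x *\<^sub>R g x) \<le> norm (C *\<^sub>R indicator {r..R} x *\<^sub>R g x)"
    proof (rule AE_I2)
      fix x
      have "\<bar>\<psi> x\<bar> * norm (indicator {r..R} x *\<^sub>R g x) \<le> \<bar>C\<bar> * norm (indicator {r..R} x *\<^sub>R g x)"
        by (intro mult_right_mono order.trans[OF C abs_ge_self]) simp
      then show "norm (\<psi> x *\<^sub>R indicator {r..R} x *\<^sub>R g x) \<le> norm (C *\<^sub>R indicator {r..R} x *\<^sub>R g x)"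
        by (simp only: norm_scaleR)
    qed
  qed
  moreover have "(\<lambda>z. \<psi> z *\<^sub>R (indicator {r..R} z *\<^sub>R g z)) = (\<lambda>z. \<psi> z *\<^sub>R g z)"
    using z by (auto simp: fun_eq_iff indicator_def)
  ultimately show ?thesis by simp
qed

lemma integrable_test_mult:
  "test_fun \<psi> \<Longrightarrow> loc_integrable g \<Longrightarrow> integrable lborel (\<lambda>z. g z * \<psi> z :: real)"
  using integrable_test_scaleR[of \<psi> g] by (simp add: mult.commute)

lemma loc_integrable_continuous:
  "continuous_on {0<..} g \<Longrightarrow> loc_integrable g"
  unfolding loc_integrable_def
  by (auto intro!: borel_integrable_atLeastAtMost' elim: continuous_on_subset)

lemma loc_integrable_lincomb:
  fixes g h :: "real \<Rightarrow> real"
  shows "loc_integrable g \<Longrightarrow> loc_integrable h \<Longrightarrow> loc_integrable (\<lambda>z. a * g z + b * h z)"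
  unfolding loc_integrable_def by auto

lemma weak_deriv_lincomb:
  assumes "weak_deriv k g h" "weak_deriv k g' h'"
  shows "weak_deriv k (\<lambda>z. a * g z + b * g' z) (\<lambda>z. a * h z + b * h' z)"
  unfolding weak_deriv_def
proof (intro conjI allI impI)
  show "loc_integrable (\<lambda>z. a * g z + b * g' z)" "loc_integrable (\<lambda>z. a * h z + b * h' z)"
    using assms by (auto simp: weak_deriv_def intro: loc_integrable_lincomb)
  fix \<psi> assume t: "test_fun \<psi>"
  note tk = test_fun_funpow_vderiv[OF t, of k]
  have li: "loc_integrable g" "loc_integrable g'" "loc_integrable h" "loc_integrable h'"
    using assms by (auto simp: weak_deriv_def)
  have "(\<integral>z. (a * g z + b * g' z) * (vderiv ^^ k) \<psi> z \<partial>lborel)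
    = (\<integral>z. a * (g z * (vderiv ^^ k) \<psi> z) + b * (g' z * (vderiv ^^ k) \<psi> z) \<partial>lborel)"
    by (simp add: algebra_simps)
  also have "\<dots> = a * (\<integral>z. g z * (vderiv ^^ k) \<psi> z \<partial>lborel) + b * (\<integral>z. g' z * (vderiv ^^ k) \<psi> z \<partial>lborel)"
    using integrable_test_mult[OF tk] li by simp
  also have "\<dots> = a * ((-1)^k * (\<integral>z. h z * \<psi> z \<partial>lborel)) + b * ((-1)^k * (\<integral>z. h' z * \<psi> z \<partial>lborel))"
    using assms t by (simp add: weak_deriv_def)
  also have "\<dots> = (-1)^k * (a * (\<integral>z. h z * \<psi> z \<partial>lborel) + b * (\<integral>z. h' z * \<psi> z \<partial>lborel))"
    by (simp add: algebra_simps)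
  also have "a * (\<integral>z. h z * \<psi> z \<partial>lborel) + b * (\<integral>z. h' z * \<psi> z \<partial>lborel)
      = (\<integral>z. a * (h z * \<psi> z) + b * (h' z * \<psi> z) \<partial>lborel)"
    using integrable_test_mult[OF t] li by simp
  also have "(\<integral>z. a * (h z * \<psi> z) + b * (h' z * \<psi> z) \<partial>lborel) = (\<integral>z. (a * h z + b * h' z) * \<psi> z \<partial>lborel)"
    by (simp add: algebra_simps)
  finally show "(\<integral>z. (a * g z + b * g' z) * (vderiv ^^ k) \<psi> z \<partial>lborel) =
     (-1)^k * (\<integral>z. (a * h z + b * h' z) * \<psi> z \<partial>lborel)" .
qed

lemma weak_deriv_unique:
  assumes "weak_deriv k g h" "weak_deriv k g h'"
  shows "AE z in lborel. 0 < z \<longrightarrow> h z = h' z"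
proof -
  have li: "loc_integrable h" "loc_integrable h'" using assms by (auto simp: weak_deriv_def)
  have "AE z in lborel. 0 < z \<longrightarrow> 1 * h z + (-1) * h' z = 0"
  proof (rule fundamental_lemma[OF loc_integrable_lincomb[OF li]])
    fix \<psi> assume t: "test_fun \<psi>"
    have "(-1) ^ k * (\<integral>z. h z * \<psi> z \<partial>lborel) = (-1) ^ k * (\<integral>z. h' z * \<psi> z \<partial>lborel)"
      using assms t by (simp add: weak_deriv_def)
    moreover have "(\<integral>z. (1 * h z + (-1) * h' z) * \<psi> z \<partial>lborel) = (\<integral>z. h z * \<psi> z - h' z * \<psi> z \<partial>lborel)"
      by (simp add: algebra_simps)
    ultimately show "(\<integral>z. (1 * h z + (-1) * h' z) * \<psi> z \<partial>lborel) = 0"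
      using integrable_test_mult[OF t] li by simp
  qed
  then show ?thesis by eventually_elim auto
qed

lemma weak_deriv_wderiv: "weak_deriv k g h \<Longrightarrow> weak_deriv k g (wderiv k g)"
  unfolding wderiv_def by (rule someI[of "weak_deriv k g"])

lemma weak_deriv_0: "continuous_on {0<..} g \<Longrightarrow> weak_deriv 0 g g"
  by (simp add: weak_deriv_def loc_integrable_continuous)

text \<open>Integration by parts for g times \<eta>, where \<eta> is the k-th derivative of the test
  function. This moves one derivative from \<eta> to g; the assumption on g' moves the other
  k.\<close>

lemma weak_deriv_Suc:
  assumes d: "\<And>z. 0 < z \<Longrightarrow> (g has_real_derivative g' z) (at z)" and c: "continuous_on {0<..} g'"
    and w: "weak_deriv k g' h"
  shows "weak_deriv (Suc k) g h"
  unfolding weak_deriv_def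
proof (intro conjI allI impI)
  have "continuous_on {0<..} g"
    by (rule DERIV_continuous_on) (auto intro: has_field_derivative_at_within d)
  then show gl: "loc_integrable g" by (rule loc_integrable_continuous)
  show "loc_integrable h" using w by (simp add: weak_deriv_def)
  fix \<psi> assume t: "test_fun \<psi>"
  define \<eta> where "\<eta> = (vderiv ^^ k) \<psi>"
  have t\<eta>: "test_fun \<eta>" unfolding \<eta>_def by (rule test_fun_funpow_vderiv[OF t])
  have g'l: "loc_integrable g'" by (rule loc_integrable_continuous[OF c])
  obtain r R where r: "0 < r" and z: "\<And>z. z \<notin> {r..R} \<Longrightarrow> \<eta> z = 0"
    using t\<eta> unfolding test_fun_def by blast
  \<comment> \<open>[a, b] exceeds [r, R] strictly on both sides, so \<eta> vanishes at the ends and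
    no boundary term remains. The maximum with r keeps the interval nondegenerate when R <
    r.\<close>
  define a where "a = r / 2"
  define b where "b = max R r + 1"
  have ab: "0 < a" "a < b" "a < r" "R < b" using r by (auto simp: a_def b_def)
  define P where "P = (\<lambda>z. g z * vderiv \<eta> z + g' z * \<eta> z)"
  have \<eta>d: "(\<eta> has_real_derivative vderiv \<eta> x) (at x)" for x
    using smooth_has_vderiv[OF test_fun_smooth[OF t\<eta>]] by (simp add: has_real_derivative_iff_has_vector_derivative)
  have "(P has_integral (g b * \<eta> b - g a * \<eta> a)) {a..b}"
  proof (rule fundamental_theorem_of_calculus)
    fix x assume x: "x \<in> {a..b}"
    have "((\<lambda>z. g z * \<eta> z) has_real_derivative P x) (at x)"
      unfolding P_def using ab x by (auto intro!: derivative_eq_intros d \<eta>d)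
    then show "((\<lambda>z. g z * \<eta> z) has_vector_derivative P x) (at x within {a..b})"
      by (simp add: has_real_derivative_iff_has_vector_derivative has_vector_derivative_at_within)
  qed (use ab in simp)
  then have P0: "integral {a..b} P = 0"
    using z[of a] z[of b] ab by (simp add: integral_unique)
  have i1: "integrable lborel (\<lambda>z. g z * vderiv \<eta> z)" and i2: "integrable lborel (\<lambda>z. g' z * \<eta> z)"
    by (auto intro!: integrable_test_mult t\<eta> test_fun_vderiv gl g'l)
  have Pi: "integrable lborel P"
    unfolding P_def using i1 i2 by simp
  have Ps: "P x = indicator {a..b} x * P x" for x
  proof (cases "x \<in> {a..b}")
    case False
    have "vderiv \<eta> x = 0"
    proof -
      have "(\<eta> has_vector_derivative 0) (at x)"
        by (rule has_vector_derivative_transform_within_open[of "\<lambda>_. 0" _ _ "- {r..R}"])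
           (use False ab z in \<open>auto intro: open_Compl\<close>)
      then show ?thesis by (simp add: vderiv_def vector_derivative_at)
    qed
    then show ?thesis using False z[of x] ab by (auto simp: P_def)
  qed simp
  have Psi: "set_integrable lborel {a..b} P"
    using Pi by (simp add: set_integrable_def flip: Ps)
  have "(\<integral>z. P z \<partial>lborel) = (LINT z:{a..b}|lborel. P z)"
    unfolding set_lebesgue_integral_def by (simp flip: Ps)
  also have "\<dots> = 0" using set_borel_integral_eq_integral(2)[OF Psi] P0 by simp
  finally have "(\<integral>z. P z \<partial>lborel) = 0" .
  then have "(\<integral>z. g z * vderiv \<eta> z \<partial>lborel) = - (\<integral>z. g' z * \<eta> z \<partial>lborel)"
    unfolding P_def using i1 i2 by simp
  also have "\<dots> = (-1) ^ Suc k * (\<integral>z. h z * \<psi> z \<partial>lborel)"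
    using w t by (simp add: weak_deriv_def \<eta>_def)
  finally show "(\<integral>z. g z * (vderiv ^^ Suc k) \<psi> z \<partial>lborel) = (-1) ^ Suc k * (\<integral>z. h z * \<psi> z \<partial>lborel)"
    by (simp add: \<eta>_def)
qed

section \<open>Bounds that the weighted norms give for weak derivatives\<close>

lemma AE_pos: "(AE z in lborel. 0 \<le> z \<longrightarrow> P z) \<longleftrightarrow> (AE z in lborel. 0 < z \<longrightarrow> P (z::real))"
proof
  assume "AE z in lborel. 0 < z \<longrightarrow> P z"
  moreover have "AE z in lborel. z \<noteq> (0::real)" by (rule AE_lborel_singleton)
  ultimately show "AE z in lborel. 0 \<le> z \<longrightarrow> P z" by eventually_elim auto
qed (auto elim: eventually_mono)

text \<open>The infimum is itself an essential bound: every number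
  \<open>Linf_norm g + 1 / Suc n\<close> is one outside a null set, and countably many null sets
  make a null set.\<close>

lemma Linf_norm_bound:
  assumes "AE z in lborel. 0 < z \<longrightarrow> \<bar>g z\<bar> \<le> c"
  shows "0 \<le> Linf_norm g" "AE z in lborel. 0 < z \<longrightarrow> \<bar>g z\<bar> \<le> Linf_norm g"
proof -
  let ?S = "{c. 0 \<le> c \<and> (AE z in lborel. 0 \<le> z \<longrightarrow> \<bar>g z\<bar> \<le> c)}"
  have "max c 0 \<in> ?S"
    using assms by (auto simp: AE_pos elim: eventually_mono)
  then have ne: "?S \<noteq> {}" by blast
  show "0 \<le> Linf_norm g" unfolding Linf_norm_def by (rule cInf_greatest[OF ne]) auto
  have "AE z in lborel. 0 < z \<longrightarrow> \<bar>g z\<bar> \<le> Linf_norm g + 1 / real (Suc n)" for n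
  proof -
    have "Linf_norm g < Linf_norm g + 1 / real (Suc n)" by simp
    then obtain c where "c \<in> ?S" "c < Linf_norm g + 1 / real (Suc n)"
      using cInf_lessD[OF ne] unfolding Linf_norm_def by blast
    then show ?thesis by (auto simp: AE_pos elim!: eventually_mono)
  qed
  then have "AE z in lborel. \<forall>n. 0 < z \<longrightarrow> \<bar>g z\<bar> \<le> Linf_norm g + 1 / real (Suc n)"
    unfolding AE_all_countable by blast
  then show "AE z in lborel. 0 < z \<longrightarrow> \<bar>g z\<bar> \<le> Linf_norm g"
  proof eventually_elim
    case (elim z)
    show ?case
    proof (rule impI, rule field_le_epsilon)
      fix e :: real assume "0 < z" "0 < e"
      moreover obtain n where "1 / real (Suc n) < e" using nat_approx_posE[OF \<open>0 < e\<close>] by blast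
      ultimately show "\<bar>g z\<bar> \<le> Linf_norm g + e"
        using elim[rule_format, of n] by linarith
    qed
  qed
qed

lemma Linf_spaceD: "g \<in> Linf_space \<Longrightarrow> \<exists>c. AE z in lborel. 0 < z \<longrightarrow> \<bar>g z\<bar> \<le> c"
  by (auto simp: Linf_space_def AE_pos)

text \<open>The norm is computed from the arbitrary representatives \<open>wderiv\<close>.
  Uniqueness up to null sets transfers the bound to whichever weak derivative is at hand, in
  practice a classical one.\<close>

lemma Winf_norm_bound:
  assumes g: "g \<in> Winf_space k" and j: "j \<le> k" and w: "weak_deriv j g h"
  shows "0 \<le> Winf_norm k g" "AE z in lborel. 0 < z \<longrightarrow> \<bar>h z\<bar> \<le> Winf_norm k g"
proof -
  have b: "\<exists>c. AE z in lborel. 0 < z \<longrightarrow> \<bar>wderiv i g z\<bar> \<le> c" if i: "i \<le> k" for i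
  proof -
    obtain h where h: "weak_deriv i g h" and "h \<in> Linf_space"
      using g i unfolding Winf_space_def by blast
    then obtain c where "AE z in lborel. 0 < z \<longrightarrow> \<bar>h z\<bar> \<le> c"
      using Linf_spaceD by blast
    from this weak_deriv_unique[OF weak_deriv_wderiv[OF h] h]
    have "AE z in lborel. 0 < z \<longrightarrow> \<bar>wderiv i g z\<bar> \<le> c" by eventually_elim auto
    then show ?thesis by blast
  qed
  have nn: "0 \<le> Linf_norm (wderiv i g)" if "i \<le> k" for i
    using b[OF that] Linf_norm_bound(1) by blast
  then show "0 \<le> Winf_norm k g" unfolding Winf_norm_def by (auto intro: sum_nonneg)
  have le: "Linf_norm (wderiv j g) \<le> Winf_norm k g"
    unfolding Winf_norm_def using nn j by (intro member_le_sum) auto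
  obtain c where "AE z in lborel. 0 < z \<longrightarrow> \<bar>wderiv j g z\<bar> \<le> c" using b[OF j] by blast
  from Linf_norm_bound(2)[OF this] weak_deriv_unique[OF weak_deriv_wderiv[OF w] w]
  show "AE z in lborel. 0 < z \<longrightarrow> \<bar>h z\<bar> \<le> Winf_norm k g"
    by eventually_elim (use le in auto)
qed

lemma H_norm_nonneg: "0 \<le> H_norm k g"
  by (auto simp: H_norm_def intro!: real_sqrt_ge_zero sum_nonneg)

lemma loc_integrable_measurable:
  assumes "loc_integrable g"
  shows "set_borel_measurable lborel {0..} g"
proof -
  \<comment> \<open>Local integrability speaks of intervals [r, R] with r > 0. The sets used here
    increase to the open half-line, and the value at 0 is added as a separate term.\<close>
  have m: "(\<lambda>z. indicator {1 / real (Suc n)..real n} z *\<^sub>R g z + indicator {0} z *\<^sub>R g 0) \<in> borel_measurable lborel" for n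
  proof (rule borel_measurable_add)
    have "0 < 1 / real (Suc n)" by simp
    then have "set_integrable lborel {1 / real (Suc n)..real n} g"
      using assms unfolding loc_integrable_def by blast
    then show "(\<lambda>z. indicator {1 / real (Suc n)..real n} z *\<^sub>R g z) \<in> borel_measurable lborel"
      unfolding set_integrable_def by (rule borel_measurable_integrable)
  qed simp
  have "(\<lambda>z. indicator {0..} z *\<^sub>R g z) \<in> borel_measurable lborel"
  proof (rule borel_measurable_LIMSEQ_metric[OF m])
    fix z :: real
    show "(\<lambda>n. indicator {1 / real (Suc n)..real n} z *\<^sub>R g z + indicator {0} z *\<^sub>R g 0)
      \<longlonglongrightarrow> indicator {0..} z *\<^sub>R g z"
    proof (cases "z > 0")
      case True
      have "\<forall>\<^sub>F n in sequentially. inverse (real (Suc n)) < z"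
        using order_tendstoD(2)[OF LIMSEQ_inverse_real_of_nat True] .
      moreover have "\<forall>\<^sub>F n in sequentially. z \<le> real n"
        using filterlim_real_sequentially by (auto simp: filterlim_at_top)
      ultimately have "\<forall>\<^sub>F n in sequentially. indicator {0..} z *\<^sub>R g z =
        indicator {1 / real (Suc n)..real n} z *\<^sub>R g z + indicator {0} z *\<^sub>R g 0"
        by eventually_elim (use True in \<open>auto simp: indicator_def inverse_eq_divide\<close>)
      then show ?thesis by (rule Lim_transform_eventually[OF tendsto_const])
    next
      case False
      then have "indicator {1 / real (Suc n)..real n} z *\<^sub>R g z + indicator {0} z *\<^sub>R g 0 = indicator {0..} z *\<^sub>R g z" for n
        using less_le_trans[of 0 "1 / real (Suc n)" z] by (auto simp: indicator_def)
      then show ?thesis by simp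
    qed
  qed
  then show ?thesis by (simp add: set_borel_measurable_def)
qed

lemma H_norm_bound:
  assumes g: "g \<in> H_space k" and j: "j \<le> k" and w: "weak_deriv j g h"
  shows "h \<in> L2_space 0" "L2_norm 0 h \<le> H_norm k g"
proof -
  obtain h0 where h0: "weak_deriv j g h0" "h0 \<in> L2_space 0"
    using g j by (auto simp: H_space_def)
  have m: "set_borel_measurable lborel {0..} h'" if "weak_deriv j g h'" for h'
    using that by (auto simp: weak_deriv_def intro: loc_integrable_measurable)
  have meas: "(\<lambda>z. indicator {0..} z *\<^sub>R (norm (exp (0 * z) *\<^sub>R h' z))\<^sup>2) \<in> borel_measurable lborel"
    if "weak_deriv j g h'" for h'
  proof -
    have "(\<lambda>z. (indicator {0..} z *\<^sub>R h' z)\<^sup>2) \<in> borel_measurable lborel"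
      using m[OF that] unfolding set_borel_measurable_def by measurable
    also have "(\<lambda>z. (indicator {0..} z *\<^sub>R h' z)\<^sup>2) = (\<lambda>z. indicator {0..} z *\<^sub>R (norm (exp (0 * z) *\<^sub>R h' z))\<^sup>2)"
      by (auto simp: indicator_def)
    finally show ?thesis .
  qed
  have ae: "AE z in lborel. indicator {0..} z *\<^sub>R (norm (exp (0 * z) *\<^sub>R h1 z))\<^sup>2
      = indicator {0..} z *\<^sub>R (norm (exp (0 * z) *\<^sub>R h2 z))\<^sup>2" if "weak_deriv j g h1" "weak_deriv j g h2" for h1 h2
    using weak_deriv_unique[OF that, folded AE_pos] by eventually_elim (auto simp: indicator_def)
  show "h \<in> L2_space 0"
    using h0(2) m[OF w] integrable_cong_AE[OF meas[OF w] meas[OF h0(1)] ae[OF w h0(1)]]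
    by (auto simp: L2_space_def set_integrable_def)
  have "L2_norm 0 h = L2_norm 0 (wderiv j g)"
    unfolding L2_norm_def set_lebesgue_integral_def
    using integral_cong_AE[OF meas[OF w] meas[OF weak_deriv_wderiv[OF w]] ae[OF w weak_deriv_wderiv[OF w]]] by simp
  also have "\<dots> = sqrt ((L2_norm 0 (wderiv j g))\<^sup>2)"
    by (simp add: L2_norm_def set_lebesgue_integral_def)
  also have "\<dots> \<le> H_norm k g"
    unfolding H_norm_def using j
    by (intro real_sqrt_le_mono member_le_sum[of j _ "\<lambda>j. (L2_norm 0 (wderiv j g))\<^sup>2"]) auto
  finally show "L2_norm 0 h \<le> H_norm k g" .
qed

lemma Linf_space_lincomb:
  assumes "g \<in> Linf_space" "h \<in> Linf_space"
  shows "(\<lambda>z. a * g z + b * h z) \<in> Linf_space"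
proof -
  obtain c d where "AE z in lborel. 0 \<le> z \<longrightarrow> \<bar>g z\<bar> \<le> c" "AE z in lborel. 0 \<le> z \<longrightarrow> \<bar>h z\<bar> \<le> d"
    using assms by (auto simp: Linf_space_def)
  then have "AE z in lborel. 0 \<le> z \<longrightarrow> \<bar>a * g z + b * h z\<bar> \<le> \<bar>a\<bar> * c + \<bar>b\<bar> * d"
  proof eventually_elim
    case (elim z)
    show ?case
    proof
      assume "0 \<le> z"
      have "\<bar>a * g z + b * h z\<bar> \<le> \<bar>a\<bar> * \<bar>g z\<bar> + \<bar>b\<bar> * \<bar>h z\<bar>"
        by (rule order.trans[OF abs_triangle_ineq]) (simp add: abs_mult)
      also have "\<dots> \<le> \<bar>a\<bar> * c + \<bar>b\<bar> * d" using elim \<open>0 \<le> z\<close> by (intro add_mono mult_left_mono) auto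
      finally show "\<bar>a * g z + b * h z\<bar> \<le> \<bar>a\<bar> * c + \<bar>b\<bar> * d" .
    qed
  qed
  moreover have "set_borel_measurable lborel {0..} (\<lambda>z. a * g z + b * h z)"
  proof -
    have "(\<lambda>z. a * (indicator {0..} z *\<^sub>R g z) + b * (indicator {0..} z *\<^sub>R h z)) \<in> borel_measurable lborel"
      using assms unfolding Linf_space_def set_borel_measurable_def by (auto intro!: borel_measurable_add borel_measurable_times)
    then show ?thesis unfolding set_borel_measurable_def by (simp add: algebra_simps)
  qed
  ultimately show ?thesis unfolding Linf_space_def by blast
qed

lemma L2_space_lincomb:
  fixes g h :: "real \<Rightarrow> real"
  assumes "g \<in> L2_space \<alpha>" "h \<in> L2_space \<alpha>"
  shows "(\<lambda>z. a * g z + b * h z) \<in> L2_space \<alpha>"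
proof -
  have m: "set_borel_measurable lborel {0..} (\<lambda>z. a * g z + b * h z)"
  proof -
    have "(\<lambda>z. a * (indicator {0..} z *\<^sub>R g z) + b * (indicator {0..} z *\<^sub>R h z)) \<in> borel_measurable lborel"
      using assms unfolding L2_space_def set_borel_measurable_def by (auto intro!: borel_measurable_add borel_measurable_times)
    then show ?thesis unfolding set_borel_measurable_def by (simp add: algebra_simps)
  qed
  have "set_integrable lborel {0..} (\<lambda>z. (norm (exp (\<alpha> * z) *\<^sub>R (a * g z + b * h z)))\<^sup>2)"
    unfolding set_integrable_def
  proof (rule Bochner_Integration.integrable_bound)
    show "integrable lborel (\<lambda>z. 2 * a\<^sup>2 * (indicator {0..} z *\<^sub>R (norm (exp (\<alpha> * z) *\<^sub>R g z))\<^sup>2)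
       + 2 * b\<^sup>2 * (indicator {0..} z *\<^sub>R (norm (exp (\<alpha> * z) *\<^sub>R h z))\<^sup>2))"
      using assms by (auto simp: L2_space_def set_integrable_def)
    have "(\<lambda>z. (exp (\<alpha> * z) * (indicator {0..} z *\<^sub>R (a * g z + b * h z)))\<^sup>2) \<in> borel_measurable lborel"
      using m unfolding set_borel_measurable_def by (auto intro!: borel_measurable_power borel_measurable_times)
    also have "(\<lambda>z. (exp (\<alpha> * z) * (indicator {0..} z *\<^sub>R (a * g z + b * h z)))\<^sup>2)
       = (\<lambda>z. indicator {0..} z *\<^sub>R (norm (exp (\<alpha> * z) *\<^sub>R (a * g z + b * h z)))\<^sup>2)"
      by (auto simp: indicator_def power_mult_distrib)
    finally show "(\<lambda>z. indicator {0..} z *\<^sub>R (norm (exp (\<alpha> * z) *\<^sub>R (a * g z + b * h z)))\<^sup>2) \<in> borel_measurable lborel" .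
    have "(exp (\<alpha> * z) * (a * g z + b * h z))\<^sup>2 \<le> 2 * a\<^sup>2 * (exp (\<alpha> * z) * g z)\<^sup>2 + 2 * b\<^sup>2 * (exp (\<alpha> * z) * h z)\<^sup>2" for z
      using zero_le_power2[of "exp (\<alpha> * z) * (a * g z - b * h z)"]
      by (simp add: power2_eq_square algebra_simps)
    then show "AE z in lborel. norm (indicator {0..} z *\<^sub>R (norm (exp (\<alpha> * z) *\<^sub>R (a * g z + b * h z)))\<^sup>2)
     \<le> norm (2 * a\<^sup>2 * (indicator {0..} z *\<^sub>R (norm (exp (\<alpha> * z) *\<^sub>R g z))\<^sup>2)
       + 2 * b\<^sup>2 * (indicator {0..} z *\<^sub>R (norm (exp (\<alpha> * z) *\<^sub>R h z))\<^sup>2))"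
      by (auto simp: indicator_def intro!: AE_I2 order.trans[OF _ abs_ge_self])
  qed
  with m show ?thesis by (simp add: L2_space_def)
qed

lemma X_space_lincomb:
  assumes g: "g \<in> X_space \<alpha> k" and h: "h \<in> X_space \<alpha> k"
  shows "(\<lambda>z. a * g z + b * h z) \<in> X_space \<alpha> k"
proof -
  have eq: "(\<lambda>z. exp (\<alpha> * z) * (a * g z + b * h z)) = (\<lambda>z. a * (exp (\<alpha> * z) * g z) + b * (exp (\<alpha> * z) * h z))"
    by (simp add: algebra_simps)
  show ?thesis unfolding X_space_def mem_Collect_eq eq
  proof
    show "(\<lambda>z. a * (exp (\<alpha> * z) * g z) + b * (exp (\<alpha> * z) * h z)) \<in> Winf_space k"
      unfolding Winf_space_def mem_Collect_eq
    proof (intro allI impI)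
      fix j assume "j \<le> k"
      then obtain g' h' where "weak_deriv j (\<lambda>z. exp (\<alpha> * z) * g z) g'" "g' \<in> Linf_space"
        "weak_deriv j (\<lambda>z. exp (\<alpha> * z) * h z) h'" "h' \<in> Linf_space"
        using g h unfolding X_space_def Winf_space_def by blast
      then show "\<exists>h'. weak_deriv j (\<lambda>z. a * (exp (\<alpha> * z) * g z) + b * (exp (\<alpha> * z) * h z)) h' \<and> h' \<in> Linf_space"
        using weak_deriv_lincomb Linf_space_lincomb by blast
    qed
    show "(\<lambda>z. a * (exp (\<alpha> * z) * g z) + b * (exp (\<alpha> * z) * h z)) \<in> H_space k"
      unfolding H_space_def mem_Collect_eq
    proof (intro allI impI)
      fix j assume "j \<le> k"
      then obtain g' h' where "weak_deriv j (\<lambda>z. exp (\<alpha> * z) * g z) g'" "g' \<in> L2_space 0"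
        "weak_deriv j (\<lambda>z. exp (\<alpha> * z) * h z) h'" "h' \<in> L2_space 0"
        using g h unfolding X_space_def H_space_def by blast
      then show "\<exists>h'. weak_deriv j (\<lambda>z. a * (exp (\<alpha> * z) * g z) + b * (exp (\<alpha> * z) * h z)) h' \<and> h' \<in> L2_space 0"
        using weak_deriv_lincomb L2_space_lincomb by blast
    qed
  qed
qed

lemma X_norm_bound:
  assumes g: "g \<in> X_space \<alpha> k" and j: "j \<le> k" and w: "weak_deriv j (\<lambda>z. exp (\<alpha> * z) * g z) h"
  shows "0 \<le> X_norm \<alpha> k g" "AE z in lborel. 0 < z \<longrightarrow> \<bar>h z\<bar> \<le> X_norm \<alpha> k g"
    "h \<in> L2_space 0" "L2_norm 0 h \<le> X_norm \<alpha> k g"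
proof -
  let ?g = "\<lambda>z. exp (\<alpha> * z) * g z"
  have gs: "?g \<in> Winf_space k" "?g \<in> H_space k" using g by (auto simp: X_space_def)
  note W = Winf_norm_bound[OF gs(1) j w] and H = H_norm_bound[OF gs(2) j w]
  show "0 \<le> X_norm \<alpha> k g" "h \<in> L2_space 0" "L2_norm 0 h \<le> X_norm \<alpha> k g"
    using W(1) H H_norm_nonneg[of k ?g] by (auto simp: X_norm_def)
  show "AE z in lborel. 0 < z \<longrightarrow> \<bar>h z\<bar> \<le> X_norm \<alpha> k g"
    using W(2) by eventually_elim (use H_norm_nonneg[of k ?g] in \<open>auto simp: X_norm_def\<close>)
qed

text \<open>A violation at one point persists on an open interval by continuity, and such an
  interval is not a null set.\<close>

lemma continuous_AE_le:
  fixes f :: "real \<Rightarrow> real"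
  assumes c: "continuous_on {0<..} f" and ae: "AE z in lborel. 0 < z \<longrightarrow> f z \<le> b" and z: "0 < z"
  shows "f z \<le> b"
proof (rule ccontr)
  assume "\<not> f z \<le> b"
  then have "isCont f z" "b < f z" using c z by (auto simp: continuous_on_eq_continuous_at)
  then have "\<forall>\<^sub>F y in at z. b < f y" by (auto simp: isCont_def order_tendsto_iff)
  then obtain d where d: "0 < d" "\<And>y. y \<noteq> z \<Longrightarrow> dist y z < d \<Longrightarrow> b < f y"
    by (auto simp: eventually_at)
  have "AE y in lborel. y \<notin> {z<..<z + d}"
    using ae by eventually_elim (use d z in \<open>force simp: dist_real_def\<close>)
  then have "{z<..<z + d} \<in> null_sets lborel"
    by (subst AE_iff_null_sets) auto
  then show False using d by (simp add: null_sets_def)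
qed

text \<open>The limit d is known only up to null sets. Almost everywhere bounds between the
  continuous functions \<open>g s\<close> hold everywhere, so these functions are uniformly Cauchy.
  Their limit e is continuous, represents d, and keeps the modulus N at every point.\<close>

lemma essential_uniform_limit:
  fixes g :: "real \<Rightarrow> real \<Rightarrow> real"
  assumes t: "0 \<le> t"
    and c: "\<And>s. 0 \<le> s \<Longrightarrow> s \<noteq> t \<Longrightarrow> continuous_on {0<..} (g s)"
    and ae: "\<And>s. 0 \<le> s \<Longrightarrow> s \<noteq> t \<Longrightarrow> AE z in lborel. 0 < z \<longrightarrow> \<bar>g s z - d z\<bar> \<le> N s"
    and N: "(N \<longlongrightarrow> 0) (at t within {0..})"
  shows "\<exists>e. continuous_on {0<..} e \<and> (AE z in lborel. 0 < z \<longrightarrow> e z = d z) \<and>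
    (\<forall>s\<ge>0. s \<noteq> t \<longrightarrow> (\<forall>z>0. \<bar>g s z - e z\<bar> \<le> N s))"
proof -
  \<comment> \<open>Approaching t from the right keeps the sequence in the domain also when t =
    0.\<close>
  define s where "s n = t + 1 / real (Suc n)" for n
  have s: "0 \<le> s n" "s n \<noteq> t" for n using t by (auto simp: s_def)
  have "s \<longlonglongrightarrow> t + 0" unfolding s_def
    by (intro tendsto_add tendsto_const LIMSEQ_Suc[OF lim_1_over_n])
  then have st: "filterlim s (at t within {0..}) sequentially"
    using s by (auto simp: filterlim_at)
  have Ns: "(\<lambda>n. N (s n)) \<longlonglongrightarrow> 0" by (rule filterlim_compose[OF N st])
  have pw: "\<bar>g a z - g b z\<bar> \<le> N a + N b" if ab: "0 \<le> a" "a \<noteq> t" "0 \<le> b" "b \<noteq> t" and z: "0 < z" for a b z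
  proof (rule continuous_AE_le[of "\<lambda>z. \<bar>g a z - g b z\<bar>", OF _ _ z])
    show "continuous_on {0<..} (\<lambda>z. \<bar>g a z - g b z\<bar>)" using c ab by (intro continuous_intros) auto
    show "AE z in lborel. 0 < z \<longrightarrow> \<bar>g a z - g b z\<bar> \<le> N a + N b"
      using ae[OF ab(1,2)] ae[OF ab(3,4)] by eventually_elim auto
  qed
  have "convergent (\<lambda>n. g (s n) z)" if z: "0 < z" for z
  proof (rule Cauchy_convergent, rule metric_CauchyI)
    fix r :: real assume r: "0 < r"
    then obtain M where M: "\<And>n. n \<ge> M \<Longrightarrow> \<bar>N (s n)\<bar> < r / 2"
      using LIMSEQ_D[OF Ns, of "r / 2"] by auto
    show "\<exists>M. \<forall>m\<ge>M. \<forall>n\<ge>M. dist (g (s m) z) (g (s n) z) < r"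
    proof (intro exI allI impI)
      fix m n assume "M \<le> m" "M \<le> n"
      from M[OF this(1)] M[OF this(2)] pw[OF s(1) s(2) s(1) s(2) z, of m n]
      show "dist (g (s m) z) (g (s n) z) < r" unfolding dist_real_def by linarith
    qed
  qed
  then obtain e where e: "\<And>z. 0 < z \<Longrightarrow> (\<lambda>n. g (s n) z) \<longlonglongrightarrow> e z"
    unfolding convergent_def by metis
  have le: "\<bar>g a z - e z\<bar> \<le> N a" if a: "0 \<le> a" "a \<noteq> t" and z: "0 < z" for a z
  proof (rule tendsto_le[OF trivial_limit_sequentially])
    show "(\<lambda>n. \<bar>g a z - g (s n) z\<bar>) \<longlonglongrightarrow> \<bar>g a z - e z\<bar>" using e[OF z] by (intro tendsto_intros)
    show "(\<lambda>n. N a + N (s n)) \<longlonglongrightarrow> N a" using tendsto_add[OF tendsto_const Ns] by simp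
    show "\<forall>\<^sub>F n in sequentially. \<bar>g a z - g (s n) z\<bar> \<le> N a + N (s n)"
      using pw[OF a s z] by simp
  qed
  have "continuous_on {0<..} e"
  proof (rule uniform_limit_theorem[where F=sequentially])
    show "\<forall>\<^sub>F n in sequentially. continuous_on {0<..} (g (s n))" using c s by simp
    show "uniform_limit {0<..} (\<lambda>n. g (s n)) e sequentially"
    proof (rule uniform_limitI)
      fix r :: real assume "0 < r"
      from order_tendstoD(2)[OF Ns this]
      show "\<forall>\<^sub>F n in sequentially. \<forall>z\<in>{0<..}. dist (g (s n) z) (e z) < r"
        by eventually_elim (auto simp: dist_real_def intro: le_less_trans[OF le[OF s]])
    qed
  qed simp
  moreover have "AE z in lborel. \<forall>n. 0 < z \<longrightarrow> \<bar>g (s n) z - d z\<bar> \<le> N (s n)"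
    unfolding AE_all_countable using ae[OF s] by blast
  then have "AE z in lborel. 0 < z \<longrightarrow> e z = d z"
  proof eventually_elim
    case (elim z)
    show ?case
    proof
      assume z: "0 < z"
      have "(\<lambda>n. g (s n) z - d z) \<longlonglongrightarrow> 0"
        by (rule Lim_null_comparison[OF _ Ns]) (use elim z in simp)
      then have "(\<lambda>n. g (s n) z) \<longlonglongrightarrow> d z" by (simp add: LIM_zero_iff)
      with e[OF z] show "e z = d z" by (rule LIMSEQ_unique)
    qed
  qed
  ultimately show ?thesis using le by blast
qed

section \<open>Regularity of the shear flow\<close>

abbreviation jointly_continuous :: "(real \<Rightarrow> real \<Rightarrow> real) \<Rightarrow> bool" where
  "jointly_continuous g \<equiv> continuous_on ({0..} \<times> {0<..}) (\<lambda>x. g (fst x) (snd x))"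

text \<open>The heat equation is built in: the time derivatives of u and of \<open>dz u\<close> are
  stated as two further z-derivatives, and only \<open>dz (dz u)\<close> has a time derivative of
  its own. Continuity is joint in both variables because the chain rule along a moving point z =
  f(t) requires it.\<close>

definition regular :: "(real \<Rightarrow> real \<Rightarrow> real) \<Rightarrow> bool" where
  "regular u \<longleftrightarrow>
    (\<forall>t\<ge>0. \<forall>z>0. (u t has_real_derivative dz u t z) (at z) \<and>
      (dz u t has_real_derivative dz (dz u) t z) (at z) \<and>
      (dz (dz u) t has_real_derivative dz (dz (dz u)) t z) (at z) \<and>
      ((\<lambda>s. u s z) has_real_derivative dz (dz u) t z) (at t within {0..}) \<and>
      ((\<lambda>s. dz u s z) has_real_derivative dz (dz (dz u)) t z) (at t within {0..}) \<and>
      ((\<lambda>s. dz (dz u) s z) has_real_derivative dt (dz (dz u)) t z) (at t within {0..})) \<and>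
    jointly_continuous u \<and> jointly_continuous (dz u) \<and> jointly_continuous (dz (dz u)) \<and>
    jointly_continuous (dz (dz (dz u))) \<and> jointly_continuous (dt (dz (dz u)))"

lemma dz_eqI: "(g t has_real_derivative d) (at z) \<Longrightarrow> 0 < z \<Longrightarrow> dz g t z = d"
  by (auto simp: dz_def at_within_half_line has_real_derivative_iff_has_vector_derivative
      intro: vector_derivative_at)

lemma at_within_half_line_neq_bot: "0 \<le> t \<Longrightarrow> at t within {0::real..} \<noteq> bot"
proof -
  assume "0 \<le> t"
  then have "t \<in> closure {t<..}" "{t<..} \<subseteq> {0..}" by auto
  then have "at t within {t<..} \<noteq> bot" "at t within {t<..} \<le> at t within {0..}"
    by (auto intro: at_le)
  then show ?thesis by (metis bot.extremum_uniqueI)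
qed

lemma dt_eqI: "((\<lambda>s. g s z) has_real_derivative d) (at t within {0..}) \<Longrightarrow> 0 \<le> t \<Longrightarrow> dt g t z = d"
  unfolding dt_def has_real_derivative_iff_has_vector_derivative
  by (rule vector_derivative_within[OF at_within_half_line_neq_bot])

lemma jointly_continuous_eq:
  assumes "jointly_continuous g" "\<And>t z. 0 \<le> t \<Longrightarrow> 0 < z \<Longrightarrow> h t z = g t z"
  shows "jointly_continuous h"
  using assms(1) by (rule continuous_on_eq) (use assms(2) in auto)

lemma jointly_continuousI:
  assumes z: "\<And>t. 0 \<le> t \<Longrightarrow> continuous_on {0<..} (g t)"
    and t: "\<And>t. 0 \<le> t \<Longrightarrow> \<exists>N. (N \<longlongrightarrow> 0) (at t within {0..}) \<and> (\<forall>s\<ge>0. \<forall>z>0. \<bar>g s z - g t z\<bar> \<le> N s)"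
  shows "jointly_continuous g"
  unfolding continuous_on_def
proof (rule ballI, rule tendstoI)
  fix x :: "real \<times> real" and e :: real
  assume x: "x \<in> {0..} \<times> {0<..}" and e: "0 < e"
  obtain t0 z0 where x0: "x = (t0, z0)" by (cases x)
  have tz: "0 \<le> t0" "0 < z0" using x x0 by auto
  obtain N where N: "(N \<longlongrightarrow> 0) (at t0 within {0..})" "\<And>s z. 0 \<le> s \<Longrightarrow> 0 < z \<Longrightarrow> \<bar>g s z - g t0 z\<bar> \<le> N s"
    using t[OF tz(1)] by blast
  have "\<forall>\<^sub>F s in at t0 within {0..}. N s < e / 2"
    using order_tendstoD(2)[OF N(1), of "e / 2"] e by simp
  then obtain d1 where d1: "0 < d1" "\<And>s. 0 \<le> s \<Longrightarrow> s \<noteq> t0 \<Longrightarrow> dist s t0 < d1 \<Longrightarrow> N s < e / 2"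
    unfolding eventually_at by auto
  have "(g t0 \<longlongrightarrow> g t0 z0) (at z0 within {0<..})"
    using z[OF tz(1)] tz(2) by (auto simp: continuous_on_def)
  then have "\<forall>\<^sub>F z in at z0 within {0<..}. dist (g t0 z) (g t0 z0) < e / 2"
    using e by (intro tendstoD) auto
  then obtain d2 where d2: "0 < d2" "\<And>z. 0 < z \<Longrightarrow> z \<noteq> z0 \<Longrightarrow> dist z z0 < d2 \<Longrightarrow> dist (g t0 z) (g t0 z0) < e / 2"
    unfolding eventually_at by auto
  show "\<forall>\<^sub>F y in at x within {0..} \<times> {0<..}. dist (g (fst y) (snd y)) (g (fst x) (snd x)) < e"
    unfolding eventually_at
  proof (intro exI[of _ "min d1 d2"] conjI ballI impI)
    show "0 < min d1 d2" using d1 d2 by simp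
    fix y assume y: "y \<in> {0..} \<times> {0<..}" and "y \<noteq> x \<and> dist y x < min d1 d2"
    then have "dist (fst y) t0 < d1" "dist (snd y) z0 < d2"
      using dist_fst_le[of y x] dist_snd_le[of y x] x0 by auto
    moreover have y0: "0 \<le> fst y" "0 < snd y" using y by auto
    ultimately have a: "\<bar>g (fst y) (snd y) - g t0 (snd y)\<bar> < e / 2" and b: "\<bar>g t0 (snd y) - g t0 z0\<bar> < e / 2"
      using d1(2)[of "fst y"] N(2)[of "fst y" "snd y"] d2(2)[of "snd y"] e
      by (cases "fst y = t0"; fastforce simp: dist_real_def)
         (cases "snd y = z0"; use \<open>dist (snd y) z0 < d2\<close> y0 d2(2)[of "snd y"] e in \<open>auto simp: dist_real_def\<close>)
    then show "dist (g (fst y) (snd y)) (g (fst x) (snd x)) < e"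
      unfolding x0 dist_real_def fst_conv snd_conv by linarith
  qed
qed

section \<open>Classical derivatives gained from the heat equation\<close>

locale parabolic_curve =
  fixes \<alpha> :: real and u :: "real \<Rightarrow> real \<Rightarrow> real" and uE :: real and D :: "nat \<Rightarrow> real \<Rightarrow> real \<Rightarrow> real"
  assumes heat: "heat_solution u"
    and D0: "D 0 = (\<lambda>t z. u t z - uE)"
    and D_X: "\<And>j t. j \<le> 1 \<Longrightarrow> 0 \<le> t \<Longrightarrow> D j t \<in> X_space \<alpha> 2"
    and D_cont: "\<And>j t. j \<le> 1 \<Longrightarrow> 0 \<le> t \<Longrightarrow>
        ((\<lambda>s. X_norm \<alpha> 2 (\<lambda>z. D j s z - D j t z)) \<longlongrightarrow> 0) (at t within {0..})"
    and D_deriv: "\<And>t. 0 \<le> t \<Longrightarrow>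
        ((\<lambda>s. X_norm \<alpha> 2 (\<lambda>z. (D 0 s z - D 0 t z) / (s - t) - D 1 t z)) \<longlongrightarrow> 0) (at t within {0..})"
begin

definition "u1 = dz u"
definition "u2 = dz (dz u)"

lemma heatD:
  assumes "0 \<le> t" "0 < z"
  shows "(\<lambda>s. u s z) differentiable (at t within {0..})" "u t differentiable (at z)"
    "dz u t differentiable (at z)" "dt u t z = dz (dz u) t z"
proof -
  have "(\<lambda>s. u s z) differentiable (at t within {0..}) \<and> u t differentiable (at z within {0..}) \<and>
     dz u t differentiable (at z within {0..}) \<and> dt u t z - dz (dz u) t z = 0"
    using heat assms unfolding heat_solution_def by (meson less_imp_le)
  then show "(\<lambda>s. u s z) differentiable (at t within {0..})" "u t differentiable (at z)"
    "dz u t differentiable (at z)" "dt u t z = dz (dz u) t z"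
    using assms by (simp_all add: at_within_half_line)
qed

lemma u_dz: "0 \<le> t \<Longrightarrow> 0 < z \<Longrightarrow> (u t has_real_derivative u1 t z) (at z)"
  using heatD(2)[of t z] unfolding u1_def dz_def
  by (simp add: at_within_half_line vector_derivative_works has_real_derivative_iff_has_vector_derivative)

lemma u1_dz: "0 \<le> t \<Longrightarrow> 0 < z \<Longrightarrow> (u1 t has_real_derivative u2 t z) (at z)"
proof -
  assume "0 \<le> t" "0 < z"
  from heatD(3)[OF this] show ?thesis unfolding u1_def u2_def dz_def[of "dz u"]
    using \<open>0 < z\<close> by (simp add: at_within_half_line vector_derivative_works has_real_derivative_iff_has_vector_derivative)
qed

lemma u_dt: "0 \<le> t \<Longrightarrow> 0 < z \<Longrightarrow> ((\<lambda>s. u s z) has_real_derivative u2 t z) (at t within {0..})"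
proof -
  assume "0 \<le> t" "0 < z"
  then have "(\<lambda>s. u s z) differentiable (at t within {0..})" "dt u t z = u2 t z"
    unfolding u2_def by (rule heatD)+
  then show ?thesis unfolding dt_def
    by (metis vector_derivative_works has_real_derivative_iff_has_vector_derivative)
qed

lemma continuous_u: "0 \<le> t \<Longrightarrow> continuous_on {0<..} (u t)"
  by (rule DERIV_continuous_on) (auto intro: has_field_derivative_at_within u_dz)

lemma continuous_u1: "0 \<le> t \<Longrightarrow> continuous_on {0<..} (u1 t)"
  by (rule DERIV_continuous_on) (auto intro: has_field_derivative_at_within u1_dz)

text \<open>The weighted deviation from the limit at infinity, followed by its first two
  z-derivatives in classical form. \<open>G t\<close> is also exp(\<alpha> z) times
  \<open>D 0 t\<close>, so the norms of the curve control these functions.\<close>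

definition "G t z = exp (\<alpha> * z) * (u t z - uE)"
definition "G1 t z = exp (\<alpha> * z) * (\<alpha> * (u t z - uE) + u1 t z)"
definition "G2 t z = exp (\<alpha> * z) * (\<alpha>\<^sup>2 * (u t z - uE) + 2 * \<alpha> * u1 t z + u2 t z)"

lemma G_dz: "0 \<le> t \<Longrightarrow> 0 < z \<Longrightarrow> (G t has_real_derivative G1 t z) (at z)"
  unfolding G_def[abs_def] G1_def
  by (auto intro!: derivative_eq_intros u_dz simp: algebra_simps)

lemma G1_dz: "0 \<le> t \<Longrightarrow> 0 < z \<Longrightarrow> (G1 t has_real_derivative G2 t z) (at z)"
  unfolding G1_def[abs_def] G2_def
  by (auto intro!: derivative_eq_intros u_dz u1_dz simp: algebra_simps power2_eq_square)

lemma continuous_G: "0 \<le> t \<Longrightarrow> continuous_on {0<..} (G t)"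
  unfolding G_def[abs_def] by (intro continuous_intros continuous_u)

lemma continuous_G1: "0 \<le> t \<Longrightarrow> continuous_on {0<..} (G1 t)"
  unfolding G1_def[abs_def] by (intro continuous_intros continuous_u continuous_u1)

lemma weak_G0: "0 \<le> t \<Longrightarrow> weak_deriv 0 (G t) (G t)"
  by (intro weak_deriv_0 continuous_G)

lemma weak_G1: "0 \<le> t \<Longrightarrow> weak_deriv (Suc 0) (G t) (G1 t)"
  by (intro weak_deriv_Suc[where g'="G1 t"] weak_deriv_0 continuous_G1 G_dz)

text \<open>It is fixed only up to null sets; \<open>e0\<close>, \<open>e1\<close> and
  \<open>e2\<close> will be continuous representatives for j = 0, 1, 2.\<close>

definition "dq t j = (SOME h. weak_deriv j (\<lambda>z. exp (\<alpha> * z) * D 1 t z) h)"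

lemma weak_D1: "0 \<le> t \<Longrightarrow> j \<le> 2 \<Longrightarrow> weak_deriv j (\<lambda>z. exp (\<alpha> * z) * D 1 t z) (dq t j)"
proof -
  assume "0 \<le> t" "j \<le> 2"
  then have "\<exists>h. weak_deriv j (\<lambda>z. exp (\<alpha> * z) * D 1 t z) h"
    using D_X[of 1 t] unfolding X_space_def H_space_def by blast
  then show ?thesis unfolding dq_def by (rule someI_ex)
qed

text \<open>The norms of the difference quotients of the curve control the difference quotients of
  the weighted derivatives.\<close>

definition "Nq t s = X_norm \<alpha> 2 (\<lambda>z. (D 0 s z - D 0 t z) / (s - t) - D 1 t z)"

text \<open>The difference quotient minus \<open>D 1 t\<close> is a linear combination of elements
  of the space, and its j-th weak derivative is the same combination of \<open>g s\<close>,
  \<open>g t\<close> and \<open>dq t j\<close>. Convergence of the curve in norm is thus uniform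
  convergence of these quotients up to null sets, the situation of
  \<open>essential_uniform_limit\<close>.\<close>

lemma quotient_limit:
  assumes t: "0 \<le> t" and j: "j \<le> 2"
    and w: "\<And>s. 0 \<le> s \<Longrightarrow> weak_deriv j (G s) (g s)"
    and c: "\<And>s. 0 \<le> s \<Longrightarrow> continuous_on {0<..} (g s)"
  obtains e where "continuous_on {0<..} e" "AE z in lborel. 0 < z \<longrightarrow> e z = dq t j z"
    "\<And>s z. 0 \<le> s \<Longrightarrow> s \<noteq> t \<Longrightarrow> 0 < z \<Longrightarrow> \<bar>(g s z - g t z) / (s - t) - e z\<bar> \<le> Nq t s"
proof -
  have "\<exists>e. continuous_on {0<..} e \<and> (AE z in lborel. 0 < z \<longrightarrow> e z = dq t j z) \<and>
    (\<forall>s\<ge>0. s \<noteq> t \<longrightarrow> (\<forall>z>0. \<bar>(g s z - g t z) / (s - t) - e z\<bar> \<le> Nq t s))"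
  proof (rule essential_uniform_limit[OF t])
    show "(Nq t \<longlongrightarrow> 0) (at t within {0..})" unfolding Nq_def[abs_def] by (rule D_deriv[OF t])
    fix s assume s: "0 \<le> s" "s \<noteq> t"
    show "continuous_on {0<..} (\<lambda>z. (g s z - g t z) / (s - t))"
      using s t by (intro continuous_intros c) auto
    let ?i = "1 / (s - t)"
    have X: "(\<lambda>z. 1 * (?i * D 0 s z + (- ?i) * D 0 t z) + (-1) * D 1 t z) \<in> X_space \<alpha> 2"
      using s t by (intro X_space_lincomb D_X) auto
    have "weak_deriv j (\<lambda>z. 1 * (?i * G s z + (- ?i) * G t z) + (-1) * (exp (\<alpha> * z) * D 1 t z))
       (\<lambda>z. 1 * (?i * g s z + (- ?i) * g t z) + (-1) * dq t j z)"
      using s t j by (intro weak_deriv_lincomb w weak_D1) auto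
    moreover have "(\<lambda>z. 1 * (?i * G s z + (- ?i) * G t z) + (-1) * (exp (\<alpha> * z) * D 1 t z))
      = (\<lambda>z. exp (\<alpha> * z) * (1 * (?i * D 0 s z + (- ?i) * D 0 t z) + (-1) * D 1 t z))"
      unfolding G_def D0 by (rule ext) (simp add: right_diff_distrib left_diff_distrib mult.left_commute)
    ultimately have "weak_deriv j (\<lambda>z. exp (\<alpha> * z) * (1 * (?i * D 0 s z + (- ?i) * D 0 t z) + (-1) * D 1 t z))
       (\<lambda>z. 1 * (?i * g s z + (- ?i) * g t z) + (-1) * dq t j z)"
      by (simp only:)
    from X_norm_bound(2)[OF X j this]
    show "AE z in lborel. 0 < z \<longrightarrow> \<bar>(g s z - g t z) / (s - t) - dq t j z\<bar> \<le> Nq t s"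
      unfolding Nq_def by (simp add: diff_divide_distrib)
  qed
  then show ?thesis using that by blast
qed

lemma quotient_limit_pointwise:
  assumes t: "0 \<le> t" and le: "\<And>s. 0 \<le> s \<Longrightarrow> s \<noteq> t \<Longrightarrow> \<bar>(g s - g t) / (s - t) - e\<bar> \<le> Nq t s"
  shows "(g has_real_derivative e) (at t within {0..})"
proof -
  have "((\<lambda>s. (g s - g t) / (s - t) - e) \<longlongrightarrow> 0) (at t within {0..})"
  proof (rule Lim_null_comparison)
    show "(Nq t \<longlongrightarrow> 0) (at t within {0..})" unfolding Nq_def[abs_def] by (rule D_deriv[OF t])
    show "\<forall>\<^sub>F s in at t within {0..}. norm ((g s - g t) / (s - t) - e) \<le> Nq t s"
      using le by (auto simp: eventually_at intro!: exI[of _ 1])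
  qed
  then show ?thesis by (simp add: has_field_derivative_iff LIM_zero_iff)
qed

lemma derivative_in_time_unique:
  "0 \<le> t \<Longrightarrow> (g has_real_derivative a) (at t within {0..}) \<Longrightarrow> (g has_real_derivative b) (at t within {0..}) \<Longrightarrow> a = b"
  unfolding has_field_derivative_iff by (rule tendsto_unique[OF at_within_half_line_neq_bot])

definition "e0 t z = exp (\<alpha> * z) * u2 t z"

text \<open>Here the heat equation enters. The time quotients of \<open>G\<close> converge uniformly
  to a continuous function, and at each point to exp(\<alpha> z) u_zz. Hence u_zz is continuous in
  z, which the bare existence of derivatives in \<open>heat_solution\<close> does not
  provide.\<close>

lemma e0:
  assumes t: "0 \<le> t"
  shows "continuous_on {0<..} (e0 t)" "AE z in lborel. 0 < z \<longrightarrow> e0 t z = dq t 0 z"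
    "\<And>s z. 0 \<le> s \<Longrightarrow> s \<noteq> t \<Longrightarrow> 0 < z \<Longrightarrow> \<bar>(G s z - G t z) / (s - t) - e0 t z\<bar> \<le> Nq t s"
proof -
  obtain e where e: "continuous_on {0<..} e" "AE z in lborel. 0 < z \<longrightarrow> e z = dq t 0 z"
    "\<And>s z. 0 \<le> s \<Longrightarrow> s \<noteq> t \<Longrightarrow> 0 < z \<Longrightarrow> \<bar>(G s z - G t z) / (s - t) - e z\<bar> \<le> Nq t s"
    by (rule quotient_limit[OF t, of 0 G]) (auto intro: weak_G0 continuous_G)
  have eq: "e z = e0 t z" if z: "0 < z" for z
  proof (rule derivative_in_time_unique[OF t])
    show "((\<lambda>s. G s z) has_real_derivative e z) (at t within {0..})"
      by (rule quotient_limit_pointwise[OF t]) (rule e(3)[OF _ _ z])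
    show "((\<lambda>s. G s z) has_real_derivative e0 t z) (at t within {0..})"
      unfolding G_def e0_def using t z by (auto intro!: derivative_eq_intros u_dt)
  qed
  show "continuous_on {0<..} (e0 t)" by (rule continuous_on_eq[OF e(1)]) (simp add: eq)
  show "AE z in lborel. 0 < z \<longrightarrow> e0 t z = dq t 0 z" using e(2) by eventually_elim (auto simp: eq)
  fix s z :: real assume "0 \<le> s" "s \<noteq> t" "0 < z"
  then show "\<bar>(G s z - G t z) / (s - t) - e0 t z\<bar> \<le> Nq t s" using e(3) eq by auto
qed

lemma continuous_u2: "0 \<le> t \<Longrightarrow> continuous_on {0<..} (u2 t)"
proof -
  assume t: "0 \<le> t"
  have "continuous_on {0<..} (\<lambda>z. exp (- (\<alpha> * z)) * e0 t z)"
    by (intro continuous_intros e0 t)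
  also have "(\<lambda>z. exp (- (\<alpha> * z)) * e0 t z) = u2 t"
    by (auto simp: e0_def fun_eq_iff exp_minus)
  finally show ?thesis .
qed

lemma continuous_G2: "0 \<le> t \<Longrightarrow> continuous_on {0<..} (G2 t)"
  unfolding G2_def[abs_def] by (intro continuous_intros continuous_u continuous_u1 continuous_u2)

lemma weak_G2: "0 \<le> t \<Longrightarrow> weak_deriv 2 (G t) (G2 t)"
  unfolding numeral_2_eq_2
  by (intro weak_deriv_Suc[where g'="G1 t"] weak_deriv_Suc[where g'="G2 t"] weak_deriv_0
      continuous_G1 continuous_G2 G_dz G1_dz)

definition "e1 t = (SOME e. continuous_on {0<..} e \<and> (AE z in lborel. 0 < z \<longrightarrow> e z = dq t 1 z) \<and>
    (\<forall>s z. 0 \<le> s \<longrightarrow> s \<noteq> t \<longrightarrow> 0 < z \<longrightarrow> \<bar>(G1 s z - G1 t z) / (s - t) - e z\<bar> \<le> Nq t s))"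

definition "e2 t = (SOME e. continuous_on {0<..} e \<and> (AE z in lborel. 0 < z \<longrightarrow> e z = dq t 2 z) \<and>
    (\<forall>s z. 0 \<le> s \<longrightarrow> s \<noteq> t \<longrightarrow> 0 < z \<longrightarrow> \<bar>(G2 s z - G2 t z) / (s - t) - e z\<bar> \<le> Nq t s))"

lemma e1:
  assumes t: "0 \<le> t"
  shows "continuous_on {0<..} (e1 t) \<and> (AE z in lborel. 0 < z \<longrightarrow> e1 t z = dq t 1 z) \<and>
    (\<forall>s z. 0 \<le> s \<longrightarrow> s \<noteq> t \<longrightarrow> 0 < z \<longrightarrow> \<bar>(G1 s z - G1 t z) / (s - t) - e1 t z\<bar> \<le> Nq t s)"
proof -
  obtain e where e: "continuous_on {0<..} e" "AE z in lborel. 0 < z \<longrightarrow> e z = dq t 1 z"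
    "\<And>s z. 0 \<le> s \<Longrightarrow> s \<noteq> t \<Longrightarrow> 0 < z \<Longrightarrow> \<bar>(G1 s z - G1 t z) / (s - t) - e z\<bar> \<le> Nq t s"
    by (rule quotient_limit[OF t, of 1 G1]) (auto intro: weak_G1 continuous_G1)
  show ?thesis unfolding e1_def by (rule someI[of _ e]) (use e in blast)
qed

lemma e2:
  assumes t: "0 \<le> t"
  shows "continuous_on {0<..} (e2 t) \<and> (AE z in lborel. 0 < z \<longrightarrow> e2 t z = dq t 2 z) \<and>
    (\<forall>s z. 0 \<le> s \<longrightarrow> s \<noteq> t \<longrightarrow> 0 < z \<longrightarrow> \<bar>(G2 s z - G2 t z) / (s - t) - e2 t z\<bar> \<le> Nq t s)"
proof -
  obtain e where e: "continuous_on {0<..} e" "AE z in lborel. 0 < z \<longrightarrow> e z = dq t 2 z"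
    "\<And>s z. 0 \<le> s \<Longrightarrow> s \<noteq> t \<Longrightarrow> 0 < z \<Longrightarrow> \<bar>(G2 s z - G2 t z) / (s - t) - e z\<bar> \<le> Nq t s"
    by (rule quotient_limit[OF t, of 2 G2]) (auto intro: weak_G2 continuous_G2)
  show ?thesis unfolding e2_def by (rule someI[of _ e]) (use e in blast)
qed

text \<open>The quotients of \<open>G\<close> converge to \<open>e0\<close>, and their
  z-derivatives, the quotients of \<open>G1\<close>, converge uniformly to \<open>e1\<close>.
  Differentiating the limit of this sequence produces the third z-derivative of u.\<close>

lemma e0_dz:
  assumes t: "0 \<le> t" and z: "0 < z"
  shows "(e0 t has_real_derivative e1 t z) (at z)"
proof -
  define s where "s n = t + 1 / real (Suc n)" for n
  have s: "0 \<le> s n" "s n \<noteq> t" for n using t by (auto simp: s_def)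
  have "s \<longlonglongrightarrow> t + 0" unfolding s_def
    by (intro tendsto_add tendsto_const LIMSEQ_Suc[OF lim_1_over_n])
  then have st: "filterlim s (at t within {0..}) sequentially"
    using s by (auto simp: filterlim_at)
  have Ns: "(\<lambda>n. Nq t (s n)) \<longlonglongrightarrow> 0"
    unfolding Nq_def by (rule filterlim_compose[OF D_deriv[OF t] st])
  define f where "f n z = (G (s n) z - G t z) / (s n - t)" for n z
  define f' where "f' n z = (G1 (s n) z - G1 t z) / (s n - t)" for n z
  have lim: "(\<lambda>n. f n y) \<longlonglongrightarrow> e0 t y" if y: "0 < y" for y
  proof -
    have "(\<lambda>n. f n y - e0 t y) \<longlonglongrightarrow> 0"
      by (rule Lim_null_comparison[OF _ Ns]) (use e0(3)[OF t s y] in \<open>simp add: f_def\<close>)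
    then show ?thesis by (simp add: LIM_zero_iff)
  qed
  have "\<exists>g. \<forall>x\<in>{0<..}. (\<lambda>n. f n x) \<longlonglongrightarrow> g x \<and> (g has_derivative (*) (e1 t x)) (at x within {0<..})"
  proof (rule has_derivative_sequence[where f'="\<lambda>n x. (*) (f' n x)"])
    show "(f n has_derivative (*) (f' n x)) (at x within {0<..})" if "x \<in> {0<..}" for n x
    proof -
      have "(f n has_real_derivative f' n x) (at x)"
        unfolding f_def[abs_def] f'_def using that t s by (auto intro!: derivative_eq_intros G_dz)
      then show ?thesis by (simp add: has_field_derivative_def has_derivative_at_withinI)
    qed
    show "\<forall>\<^sub>F n in sequentially. \<forall>x\<in>{0<..}. \<forall>h. norm (f' n x * h - e1 t x * h) \<le> r * norm h" if r: "r > 0" for r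
      using order_tendstoD(2)[OF Ns r]
    proof eventually_elim
      case (elim n)
      show ?case
      proof (intro ballI allI)
        fix x h :: real assume "x \<in> {0<..}"
        then have "\<bar>f' n x - e1 t x\<bar> \<le> r" using e1[OF t] s[of n] elim unfolding f'_def by fastforce
        then show "norm (f' n x * h - e1 t x * h) \<le> r * norm h"
          by (simp add: abs_mult mult_right_mono flip: left_diff_distrib)
      qed
    qed
    show "(\<lambda>n. f n z) \<longlonglongrightarrow> e0 t z" by (rule lim[OF z])
  qed (use z in auto)
  then obtain g where g: "\<And>x. 0 < x \<Longrightarrow> (\<lambda>n. f n x) \<longlonglongrightarrow> g x" "\<And>x. 0 < x \<Longrightarrow> (g has_real_derivative e1 t x) (at x within {0<..})"
    by (auto simp: has_field_derivative_def)
  have "(g has_real_derivative e1 t z) (at z)"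
    using g(2)[OF z] z by (simp add: at_within_open[of z "{0<..}"])
  then show ?thesis
    by (rule has_field_derivative_transform_within_open[of _ _ _ "{0<..}"])
       (use z LIMSEQ_unique[OF g(1) lim] in auto)
qed

text \<open>The derivatives of u after removal of the weight: \<open>e1\<close> is the z-derivative
  of exp(\<alpha> z) u_zz, and \<open>e2\<close> is the time derivative of \<open>G2\<close>. So
  \<open>u3\<close> is u_zzz, and \<open>u4\<close> is the time derivative of u_zz.\<close>

definition "u3 t z = exp (- (\<alpha> * z)) * e1 t z - \<alpha> * u2 t z"
definition "u4 t z = exp (- (\<alpha> * z)) * e2 t z - \<alpha>\<^sup>2 * u2 t z - 2 * \<alpha> * u3 t z"

lemma u2_dz:
  assumes t: "0 \<le> t" and z: "0 < z"
  shows "(u2 t has_real_derivative u3 t z) (at z)"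
proof -
  have "((\<lambda>z. exp (- (\<alpha> * z)) * e0 t z) has_real_derivative
      exp (- (\<alpha> * z)) * e1 t z - \<alpha> * (exp (- (\<alpha> * z)) * e0 t z)) (at z)"
    using t z by (auto intro!: derivative_eq_intros e0_dz)
  also have "exp (- (\<alpha> * z)) * e1 t z - \<alpha> * (exp (- (\<alpha> * z)) * e0 t z) = u3 t z"
    by (simp add: u3_def e0_def exp_minus)
  also have "(\<lambda>z. exp (- (\<alpha> * z)) * e0 t z) = u2 t"
    by (auto simp: e0_def fun_eq_iff exp_minus)
  finally show ?thesis .
qed

lemma u1_dt:
  assumes t: "0 \<le> t" and z: "0 < z"
  shows "((\<lambda>s. u1 s z) has_real_derivative u3 t z) (at t within {0..})"
proof -
  have G1: "((\<lambda>s. G1 s z) has_real_derivative e1 t z) (at t within {0..})"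
    by (rule quotient_limit_pointwise[OF t]) (use e1[OF t] z in blast)
  have "((\<lambda>s. exp (- (\<alpha> * z)) * G1 s z - \<alpha> * (u s z - uE)) has_real_derivative u3 t z) (at t within {0..})"
    unfolding u3_def using t z by (auto intro!: derivative_eq_intros G1 u_dt)
  also have "(\<lambda>s. exp (- (\<alpha> * z)) * G1 s z - \<alpha> * (u s z - uE)) = (\<lambda>s. u1 s z)"
    by (auto simp: G1_def fun_eq_iff exp_minus field_simps)
  finally show ?thesis .
qed

lemma u2_dt:
  assumes t: "0 \<le> t" and z: "0 < z"
  shows "((\<lambda>s. u2 s z) has_real_derivative u4 t z) (at t within {0..})"
proof -
  have G2: "((\<lambda>s. G2 s z) has_real_derivative e2 t z) (at t within {0..})"
    by (rule quotient_limit_pointwise[OF t]) (use e2[OF t] z in blast)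
  have "((\<lambda>s. exp (- (\<alpha> * z)) * G2 s z - \<alpha>\<^sup>2 * (u s z - uE) - 2 * \<alpha> * u1 s z) has_real_derivative u4 t z) (at t within {0..})"
    unfolding u4_def using t z by (auto intro!: derivative_eq_intros G2 u_dt u1_dt)
  also have "(\<lambda>s. exp (- (\<alpha> * z)) * G2 s z - \<alpha>\<^sup>2 * (u s z - uE) - 2 * \<alpha> * u1 s z) = (\<lambda>s. u2 s z)"
    by (auto simp: G2_def fun_eq_iff exp_minus field_simps)
  finally show ?thesis .
qed

text \<open>The norm bounds differences of weak derivatives almost everywhere, hence differences of
  their continuous representatives everywhere. The bound does not depend on z, and this uniformity
  gives joint continuity.\<close>

lemma time_modulus:
  assumes i: "i \<le> 1" and j: "j \<le> 2" and s: "0 \<le> s" and t: "0 \<le> t" and z: "0 < z"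
    and w: "\<And>s. 0 \<le> s \<Longrightarrow> weak_deriv j (\<lambda>z. exp (\<alpha> * z) * D i s z) (h s)"
    and ae: "\<And>s. 0 \<le> s \<Longrightarrow> AE z in lborel. 0 < z \<longrightarrow> g s z = h s z"
    and c: "\<And>s. 0 \<le> s \<Longrightarrow> continuous_on {0<..} (g s)"
  shows "\<bar>g s z - g t z\<bar> \<le> X_norm \<alpha> 2 (\<lambda>z. D i s z - D i t z)"
proof (rule continuous_AE_le[OF _ _ z, of "\<lambda>z. \<bar>g s z - g t z\<bar>"])
  show "continuous_on {0<..} (\<lambda>z. \<bar>g s z - g t z\<bar>)" using s t by (intro continuous_intros c)
  have X: "(\<lambda>z. 1 * D i s z + (-1) * D i t z) \<in> X_space \<alpha> 2"
    using s t i by (intro X_space_lincomb D_X)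
  have "weak_deriv j (\<lambda>z. 1 * (exp (\<alpha> * z) * D i s z) + (-1) * (exp (\<alpha> * z) * D i t z)) (\<lambda>z. 1 * h s z + (-1) * h t z)"
    using s t by (intro weak_deriv_lincomb w)
  then have "weak_deriv j (\<lambda>z. exp (\<alpha> * z) * (1 * D i s z + (-1) * D i t z)) (\<lambda>z. 1 * h s z + (-1) * h t z)"
    by (simp add: algebra_simps)
  from X_norm_bound(2)[OF X j this] ae[OF s] ae[OF t]
  show "AE z in lborel. 0 < z \<longrightarrow> \<bar>g s z - g t z\<bar> \<le> X_norm \<alpha> 2 (\<lambda>z. D i s z - D i t z)"
    by eventually_elim simp
qed

lemma jointly_continuous_weighted:
  assumes i: "i \<le> 1" and j: "j \<le> 2"
    and w: "\<And>s. 0 \<le> s \<Longrightarrow> weak_deriv j (\<lambda>z. exp (\<alpha> * z) * D i s z) (h s)"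
    and ae: "\<And>s. 0 \<le> s \<Longrightarrow> AE z in lborel. 0 < z \<longrightarrow> g s z = h s z"
    and c: "\<And>s. 0 \<le> s \<Longrightarrow> continuous_on {0<..} (g s)"
  shows "jointly_continuous g"
  by (rule jointly_continuousI[OF c])
     (use D_cont[OF i] time_modulus[OF i j _ _ _ w ae c] in blast)+

lemma G_eq_D0: "G t = (\<lambda>z. exp (\<alpha> * z) * D 0 t z)"
  by (simp add: G_def D0 fun_eq_iff)

lemmas jc_rules = continuous_on_add continuous_on_diff continuous_on_mult continuous_on_exp
  continuous_on_minus continuous_on_const continuous_on_snd continuous_on_id

lemma jointly_continuous_all:
  "jointly_continuous u" "jointly_continuous u1" "jointly_continuous u2" "jointly_continuous u3" "jointly_continuous u4"
proof -
  have G: "jointly_continuous G"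
    by (rule jointly_continuous_weighted[of 0 0 G]) (use weak_G0 continuous_G in \<open>auto simp flip: G_eq_D0\<close>)
  have G1: "jointly_continuous G1"
    by (rule jointly_continuous_weighted[of 0 1 G1]) (use weak_G1 continuous_G1 in \<open>auto simp flip: G_eq_D0\<close>)
  have E0: "jointly_continuous e0"
    by (rule jointly_continuous_weighted[of 1 0 "\<lambda>t. dq t 0"]) (use weak_D1 e0 in auto)
  have E1: "jointly_continuous e1"
    by (rule jointly_continuous_weighted[of 1 1 "\<lambda>t. dq t 1"]) (use weak_D1 e1 in auto)
  have E2: "jointly_continuous e2"
    by (rule jointly_continuous_weighted[of 1 2 "\<lambda>t. dq t 2"]) (use weak_D1 e2 in auto)
  have "jointly_continuous (\<lambda>t z. exp (- (\<alpha> * z)) * G t z + uE)" by (intro jc_rules G)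
  then show 0: "jointly_continuous u"
    by (rule jointly_continuous_eq) (simp add: G_def exp_minus flip: mult.assoc)
  have "jointly_continuous (\<lambda>t z. exp (- (\<alpha> * z)) * G1 t z - \<alpha> * (u t z - uE))" by (intro jc_rules G1 0)
  then show "jointly_continuous u1"
    by (rule jointly_continuous_eq) (simp add: G1_def exp_minus field_simps)
  have "jointly_continuous (\<lambda>t z. exp (- (\<alpha> * z)) * e0 t z)" by (intro jc_rules E0)
  then show 2: "jointly_continuous u2"
    by (rule jointly_continuous_eq) (simp add: e0_def exp_minus)
  have "jointly_continuous (\<lambda>t z. exp (- (\<alpha> * z)) * e1 t z - \<alpha> * u2 t z)" by (intro jc_rules E1 2)
  then show 3: "jointly_continuous u3"
    by (rule jointly_continuous_eq) (simp add: u3_def)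
  have "jointly_continuous (\<lambda>t z. exp (- (\<alpha> * z)) * e2 t z - \<alpha>\<^sup>2 * u2 t z - 2 * \<alpha> * u3 t z)"
    by (intro jc_rules E2 2 3)
  then show "jointly_continuous u4"
    by (rule jointly_continuous_eq) (simp add: u4_def)
qed

lemma dz_u2: "0 \<le> t \<Longrightarrow> 0 < z \<Longrightarrow> dz u2 t z = u3 t z"
  by (intro dz_eqI u2_dz)

lemma dt_u2: "0 \<le> t \<Longrightarrow> 0 < z \<Longrightarrow> dt u2 t z = u4 t z"
  by (intro dt_eqI u2_dt)

lemma regular: "regular u"
  unfolding regular_def u1_def[symmetric] u2_def[symmetric]
proof (intro conjI allI impI)
  fix t z :: real assume tz: "0 \<le> t" "0 < z"
  show "(u t has_real_derivative u1 t z) (at z)" by (rule u_dz[OF tz])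
  show "(u1 t has_real_derivative dz u1 t z) (at z)" using u1_dz[OF tz] by (simp add: u1_def u2_def)
  show "(dz u1 t has_real_derivative dz (dz u1) t z) (at z)"
    using u2_dz[OF tz] dz_u2[OF tz] by (simp add: u1_def u2_def)
  show "((\<lambda>s. u s z) has_real_derivative dz u1 t z) (at t within {0..})"
    using u_dt[OF tz] by (simp add: u1_def u2_def)
  show "((\<lambda>s. u1 s z) has_real_derivative dz (dz u1) t z) (at t within {0..})"
    using u1_dt[OF tz] dz_u2[OF tz] by (simp add: u1_def u2_def)
  show "((\<lambda>s. dz u1 s z) has_real_derivative dt (dz u1) t z) (at t within {0..})"
    using u2_dt[OF tz] dt_u2[OF tz] by (simp add: u1_def u2_def)
next
  have e: "dz u1 = u2" by (simp add: u1_def u2_def)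
  show "jointly_continuous u" "jointly_continuous u1" "jointly_continuous (dz u1)"
    using jointly_continuous_all by (simp_all add: e)
  show "jointly_continuous (dz (dz u1))" unfolding e
    by (rule jointly_continuous_eq[OF jointly_continuous_all(4) dz_u2])
  show "jointly_continuous (dt (dz u1))" unfolding e
    by (rule jointly_continuous_eq[OF jointly_continuous_all(5) dt_u2])
qed

section \<open>Weighted square integrals near the initial time\<close>

lemma L2_diff_bound:
  fixes g h :: "real \<Rightarrow> real"
  assumes "g \<in> L2_space 0" "h \<in> L2_space 0" "L2_norm 0 (\<lambda>z. g z - h z) \<le> 1" "(\<lambda>z. g z - h z) \<in> L2_space 0"
  shows "(LINT z:{0..}|lborel. (g z)\<^sup>2) \<le> 2 + 2 * (LINT z:{0..}|lborel. (h z)\<^sup>2)"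
proof -
  have i: "set_integrable lborel {0..} (\<lambda>z. (g z)\<^sup>2)" "set_integrable lborel {0..} (\<lambda>z. (h z)\<^sup>2)"
    "set_integrable lborel {0..} (\<lambda>z. (g z - h z)\<^sup>2)"
    using assms by (auto simp: L2_space_def)
  have "(LINT z:{0..}|lborel. (g z)\<^sup>2) \<le> (LINT z:{0..}|lborel. 2 * (g z - h z)\<^sup>2 + 2 * (h z)\<^sup>2)"
  proof (rule set_integral_mono)
    show "set_integrable lborel {0..} (\<lambda>z. 2 * (g z - h z)\<^sup>2 + 2 * (h z)\<^sup>2)"
      using i by (intro set_integral_add) auto
    show "(g z)\<^sup>2 \<le> 2 * (g z - h z)\<^sup>2 + 2 * (h z)\<^sup>2" for z
      using zero_le_power2[of "g z - 2 * h z"] by (simp add: power2_eq_square algebra_simps)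
  qed (rule i)
  also have "\<dots> = 2 * (LINT z:{0..}|lborel. (g z - h z)\<^sup>2) + 2 * (LINT z:{0..}|lborel. (h z)\<^sup>2)"
    using i by (subst set_integral_add(2)) auto
  also have "(LINT z:{0..}|lborel. (g z - h z)\<^sup>2) \<le> 1"
    using assms(3) by (simp add: L2_norm_def)
  finally show ?thesis by simp
qed

lemma L2_u1:
  assumes t: "0 \<le> t"
  shows "u1 t \<in> L2_space \<alpha>"
proof -
  have X: "D 0 t \<in> X_space \<alpha> 2" by (rule D_X) (use t in auto)
  have "G t \<in> L2_space 0" "G1 t \<in> L2_space 0"
    using X_norm_bound(3)[OF X, of 0 "G t"] X_norm_bound(3)[OF X, of 1 "G1 t"] weak_G0[OF t] weak_G1[OF t]
    by (simp_all add: G_eq_D0)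
  from L2_space_lincomb[OF this(2,1), of 1 "- \<alpha>"] 
  have "(\<lambda>z. exp (\<alpha> * z) * u1 t z) \<in> L2_space 0"
    by (simp add: G_def G1_def algebra_simps)
  then have i: "set_integrable lborel {0..} (\<lambda>z. (exp (\<alpha> * z) * u1 t z)\<^sup>2)"
    and m: "(\<lambda>z. exp (- (\<alpha> * z)) * (indicator {0..} z *\<^sub>R (exp (\<alpha> * z) * u1 t z))) \<in> borel_measurable lborel"
    by (auto simp: L2_space_def set_borel_measurable_def intro!: borel_measurable_times)
  have "(\<lambda>z. exp (- (\<alpha> * z)) * (indicator {0..} z *\<^sub>R (exp (\<alpha> * z) * u1 t z))) = (\<lambda>z. indicator {0..} z *\<^sub>R u1 t z)"
    by (auto simp: exp_minus fun_eq_iff)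
  with i m show ?thesis by (simp add: L2_space_def set_borel_measurable_def power_mult_distrib)
qed

text \<open>Continuity of the curve at time 0 keeps \<open>G\<close> and \<open>G1\<close> within
  distance 1 of their initial values in mean square for short times, and exp(\<alpha> z) u_z is
  \<open>G1\<close> minus \<alpha> times \<open>G\<close>.\<close>

lemma L2_u1_bounded:
  "\<exists>t2>0. \<exists>M. \<forall>t. 0 \<le> t \<and> t \<le> t2 \<longrightarrow> (LINT z:{0..}|lborel. (exp (\<alpha> * z) * u1 t z)\<^sup>2) \<le> M"
proof -
  have "\<forall>\<^sub>F s in at 0 within {0..}. X_norm \<alpha> 2 (\<lambda>z. D 0 s z - D 0 0 z) < 1"
    using order_tendstoD(2)[OF D_cont[of 0 0]] by simp
  then obtain d where d: "0 < d" "\<And>s. 0 < s \<Longrightarrow> s < d \<Longrightarrow> X_norm \<alpha> 2 (\<lambda>z. D 0 s z - D 0 0 z) < 1"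
    unfolding eventually_at by (auto simp: dist_real_def)
  define J where "J g = (LINT z:{0..}|lborel. (g z)\<^sup>2)" for g :: "real \<Rightarrow> real"
  have nn: "0 \<le> J g" for g unfolding J_def set_lebesgue_integral_def by (auto intro!: integral_nonneg_AE)
  have mem: "G t \<in> L2_space 0" "G1 t \<in> L2_space 0" if "0 \<le> t" for t
    using X_norm_bound(3)[of "D 0 t" \<alpha> 2 0 "G t"] X_norm_bound(3)[of "D 0 t" \<alpha> 2 1 "G1 t"] D_X[of 0 t]
      weak_G0[OF that] weak_G1[OF that] that by (simp_all add: G_eq_D0)
  have dif: "J (G t) \<le> 2 + 2 * J (G 0) \<and> J (G1 t) \<le> 2 + 2 * J (G1 0)" if t: "0 \<le> t" "t < d" for t
  proof (cases "t = 0")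
    case True
    then show ?thesis using nn[of "G 0"] nn[of "G1 0"] by auto
  next
    case False
    have X: "(\<lambda>z. 1 * D 0 t z + (-1) * D 0 0 z) \<in> X_space \<alpha> 2"
      using t by (intro X_space_lincomb D_X) auto
    have le: "X_norm \<alpha> 2 (\<lambda>z. 1 * D 0 t z + (-1) * D 0 0 z) < 1" using d(2)[of t] t False by simp
    have e: "(\<lambda>z. exp (\<alpha> * z) * (1 * D 0 t z + (-1) * D 0 0 z)) = (\<lambda>z. 1 * G t z + (-1) * G 0 z)"
      by (simp add: G_eq_D0 algebra_simps)
    have w: "weak_deriv 0 (\<lambda>z. exp (\<alpha> * z) * (1 * D 0 t z + (-1) * D 0 0 z)) (\<lambda>z. 1 * G t z + (-1) * G 0 z)"
      "weak_deriv 1 (\<lambda>z. exp (\<alpha> * z) * (1 * D 0 t z + (-1) * D 0 0 z)) (\<lambda>z. 1 * G1 t z + (-1) * G1 0 z)"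
      unfolding e using t weak_G0 weak_G1 by (auto intro!: weak_deriv_lincomb[of _ _ _ _ _ 1 "-1", simplified])
    show ?thesis unfolding J_def
      using X_norm_bound(3,4)[OF X _ w(1)] X_norm_bound(3,4)[OF X _ w(2)] le mem[of t] mem[of 0] t
      by (auto intro!: L2_diff_bound)
  qed
  have "(LINT z:{0..}|lborel. (exp (\<alpha> * z) * u1 t z)\<^sup>2) \<le> 2 * (2 + 2 * J (G1 0)) + 2 * \<alpha>\<^sup>2 * (2 + 2 * J (G 0))"
    if t: "0 \<le> t" "t \<le> d / 2" for t
  proof -
    have i: "set_integrable lborel {0..} (\<lambda>z. (G t z)\<^sup>2)" "set_integrable lborel {0..} (\<lambda>z. (G1 t z)\<^sup>2)"
      using mem[OF t(1)] by (auto simp: L2_space_def)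
    have "(LINT z:{0..}|lborel. (exp (\<alpha> * z) * u1 t z)\<^sup>2) \<le> (LINT z:{0..}|lborel. 2 * (G1 t z)\<^sup>2 + 2 * \<alpha>\<^sup>2 * (G t z)\<^sup>2)"
    proof (rule set_integral_mono)
      show "set_integrable lborel {0..} (\<lambda>z. 2 * (G1 t z)\<^sup>2 + 2 * \<alpha>\<^sup>2 * (G t z)\<^sup>2)"
        using i by (intro set_integral_add) auto
      show "set_integrable lborel {0..} (\<lambda>z. (exp (\<alpha> * z) * u1 t z)\<^sup>2)"
        using L2_u1[OF t(1)] by (simp add: L2_space_def power_mult_distrib)
      have "exp (\<alpha> * z) * u1 t z = G1 t z - \<alpha> * G t z" for z by (simp add: G_def G1_def algebra_simps)
      moreover have "(G1 t z - \<alpha> * G t z)\<^sup>2 \<le> 2 * (G1 t z)\<^sup>2 + 2 * \<alpha>\<^sup>2 * (G t z)\<^sup>2" for z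
        using zero_le_power2[of "G1 t z + \<alpha> * G t z"] by (simp add: power2_eq_square algebra_simps)
      ultimately show "(exp (\<alpha> * z) * u1 t z)\<^sup>2 \<le> 2 * (G1 t z)\<^sup>2 + 2 * \<alpha>\<^sup>2 * (G t z)\<^sup>2" for z by simp
    qed
    also have "\<dots> = 2 * J (G1 t) + 2 * \<alpha>\<^sup>2 * J (G t)"
      unfolding J_def using i by (subst set_integral_add(2)) auto
    also have "\<dots> \<le> 2 * (2 + 2 * J (G1 0)) + 2 * \<alpha>\<^sup>2 * (2 + 2 * J (G 0))"
      using dif[of t] t d(1) by (intro add_mono mult_left_mono) auto
    finally show ?thesis .
  qed
  then show ?thesis using d(1) by (intro exI[of _ "d / 2"]) auto
qed

end

text \<open>Order 2 in z with a time derivative is the common ground of the two flows: i = 1 leaves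
  the order 4 - 2 for the velocity, and i = 2 leaves 6 - 4 for the magnetic field.\<close>

lemma parabolic_curveI:
  assumes "heat_solution u" "C_time i \<alpha> 2 (\<lambda>t z. u t z - uE)" "1 \<le> i"
  shows "\<exists>D. parabolic_curve \<alpha> u uE D"
proof -
  obtain D where D: "D 0 = (\<lambda>t z. u t z - uE) \<and>
     (\<forall>j\<le>i. \<forall>t\<ge>0. D j t \<in> X_space \<alpha> 2 \<and>
        ((\<lambda>s. X_norm \<alpha> 2 (\<lambda>z. D j s z - D j t z)) \<longlongrightarrow> 0) (at t within {0..})) \<and>
     (\<forall>j<i. \<forall>t\<ge>0.
        ((\<lambda>s. X_norm \<alpha> 2 (\<lambda>z. (D j s z - D j t z) / (s - t) - D (Suc j) t z)) \<longlongrightarrow> 0)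
          (at t within {0..}))"
    using assms(2) unfolding C_time_def by (rule exE)
  have "parabolic_curve \<alpha> u uE D"
  proof
    show "D j t \<in> X_space \<alpha> 2" "((\<lambda>s. X_norm \<alpha> 2 (\<lambda>z. D j s z - D j t z)) \<longlongrightarrow> 0) (at t within {0..})"
      if "j \<le> 1" "0 \<le> t" for j t
      using D that assms(3) by simp_all
    show "((\<lambda>s. X_norm \<alpha> 2 (\<lambda>z. (D 0 s z - D 0 t z) / (s - t) - D 1 t z)) \<longlongrightarrow> 0) (at t within {0..})"
      if "0 \<le> t" for t
      using conjunct2[OF conjunct2[OF D], rule_format, of 0 t] that assms(3) by simp
  qed (use assms(1) D in simp_all)
  then show ?thesis by blast
qed

definition shear_component :: "real \<Rightarrow> (real \<Rightarrow> real \<Rightarrow> real) \<Rightarrow> bool" where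
  "shear_component \<alpha> u \<longleftrightarrow> regular u \<and> (\<forall>t\<ge>0. dz u t \<in> L2_space \<alpha>) \<and>
    (\<exists>t2>0. \<exists>M. \<forall>t. 0 \<le> t \<and> t \<le> t2 \<longrightarrow> (LINT z:{0..}|lborel. (exp (\<alpha> * z) * dz u t z)\<^sup>2) \<le> M)"

lemma parabolic_curve_shear_component: "parabolic_curve \<alpha> u uE D \<Longrightarrow> shear_component \<alpha> u"
proof -
  assume "parabolic_curve \<alpha> u uE D"
  then interpret parabolic_curve \<alpha> u uE D .
  show ?thesis
    unfolding shear_component_def using regular L2_u1 L2_u1_bounded by (simp add: u1_def)
qed

lemma velocity_shear_component: "velocity_shear \<alpha> u uE U \<Longrightarrow> shear_component \<alpha> u"
  unfolding velocity_shear_def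
proof -
  assume a: "heat_solution u \<and> (\<forall>t\<ge>0. u t 0 = 0) \<and> (\<forall>t\<ge>0. (u t \<longlongrightarrow> uE) at_top) \<and> (\<forall>z\<ge>0. u 0 z = U z) \<and>
     (\<forall>i\<le>1. C_time i \<alpha> (4 - 2 * i) (\<lambda>t z. u t z - uE))"
  then have "C_time 1 \<alpha> (4 - 2 * 1) (\<lambda>t z. u t z - uE)" by blast
  then have "\<exists>D. parabolic_curve \<alpha> u uE D" using a by (intro parabolic_curveI[of _ 1]) auto
  then show ?thesis using parabolic_curve_shear_component by blast
qed

lemma magnetic_shear_component: "magnetic_shear \<alpha> b bE B \<Longrightarrow> shear_component \<alpha> b"
  unfolding magnetic_shear_def
proof -
  assume a: "heat_solution b \<and> (\<forall>t\<ge>0. dz b t 0 = 0) \<and> (\<forall>t\<ge>0. (b t \<longlongrightarrow> bE) at_top) \<and> (\<forall>z\<ge>0. b 0 z = B z) \<and>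
     (\<forall>i\<le>2. C_time i \<alpha> (6 - 2 * i) (\<lambda>t z. b t z - bE))"
  then have "C_time 2 \<alpha> (6 - 2 * 2) (\<lambda>t z. b t z - bE)" by blast
  then have "\<exists>D. parabolic_curve \<alpha> b bE D" using a by (intro parabolic_curveI[of _ 2]) auto
  then show ?thesis using parabolic_curve_shear_component by blast
qed

section \<open>Functions glued along a moving interface\<close>

lemma vector_derivative_lipschitz:
  fixes g :: "real \<Rightarrow> 'a::real_normed_vector"
  assumes S: "convex S" and d: "\<And>x. x \<in> S \<Longrightarrow> (g has_vector_derivative g' x) (at x within S)"
    and B: "\<And>x. x \<in> S \<Longrightarrow> norm (g' x) \<le> B" and xy: "x \<in> S" "y \<in> S"
  shows "norm (g x - g y) \<le> B * \<bar>x - y\<bar>"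
proof -
  have "norm (g x - g y) \<le> B * norm (x - y)"
  proof (rule differentiable_bound[OF S _ _ xy(1) xy(2)])
    show "(g has_derivative (\<lambda>h. h *\<^sub>R g' x)) (at x within S)" if "x \<in> S" for x
      using d[OF that] by (simp add: has_vector_derivative_def)
    show "onorm (\<lambda>h. h *\<^sub>R g' x) \<le> B" if "x \<in> S" for x
      using B[OF that] by (intro onorm_le) (auto simp: mult.commute[of B] intro!: mult_left_mono)
  qed
  then show ?thesis by simp
qed

lemma has_vector_derivative_iff_quotient:
  "(g has_vector_derivative d) (at x within S) \<longleftrightarrow>
    ((\<lambda>y. (g y - g x) /\<^sub>R (y - x)) \<longlongrightarrow> d) (at x within S)"
proof -
  have eq: "norm ((g y - g x) /\<^sub>R (y - x) - d) = norm (g y - g x - (y - x) *\<^sub>R d) / norm (y - x)"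
    if "y \<noteq> x" for y
  proof -
    have "(g y - g x) /\<^sub>R (y - x) - d = inverse (y - x) *\<^sub>R (g y - g x - (y - x) *\<^sub>R d)"
      using that by (simp add: scaleR_right_diff_distrib)
    then show ?thesis by (simp add: divide_inverse mult.commute)
  qed
  have "((\<lambda>y. (g y - g x) /\<^sub>R (y - x)) \<longlongrightarrow> d) (at x within S) \<longleftrightarrow>
    ((\<lambda>y. norm ((g y - g x) /\<^sub>R (y - x) - d)) \<longlongrightarrow> 0) (at x within S)"
    by (simp add: LIM_zero_iff tendsto_norm_zero_iff)
  also have "\<dots> \<longleftrightarrow> ((\<lambda>y. norm (g y - g x - (y - x) *\<^sub>R d) / norm (y - x)) \<longlongrightarrow> 0) (at x within S)"
    by (rule Lim_cong_within) (auto simp: eq)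
  finally show ?thesis
    by (simp add: has_vector_derivative_def has_derivative_iff_norm bounded_linear_scaleR_left)
qed

text \<open>The value of Y at the interface is arbitrary; it enters the sum as an integrable
  function supported on one point.\<close>

lemma loc_integrable_glued:
  fixes Y :: "real \<Rightarrow> 'a::{banach, second_countable_topology}"
  assumes g: "continuous_on {0<..} g0" "continuous_on {0<..} g1"
    and Y: "\<And>z. 0 < z \<Longrightarrow> z \<noteq> c \<Longrightarrow> Y z = (if z < c then g0 z else g1 z)"
  shows "loc_integrable Y"
  unfolding loc_integrable_def set_integrable_def
proof (intro allI impI)
  fix r R :: real assume r: "0 < r"
  have i: "integrable lborel (\<lambda>z. indicator {r..R} z *\<^sub>R g0 z)" "integrable lborel (\<lambda>z. indicator {r..R} z *\<^sub>R g1 z)"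
    using loc_integrable_continuous[OF g(1)] loc_integrable_continuous[OF g(2)] r
    by (auto simp: loc_integrable_def set_integrable_def)
  have p: "integrable lborel (\<lambda>z. indicator ({r..R} \<inter> {c}) z *\<^sub>R Y c)"
    by (rule integrable_scaleR_left) (auto intro!: integrable_real_indicator emeasure_bounded_finite)
  have "integrable lborel (\<lambda>z. indicator {..<c} z *\<^sub>R (indicator {r..R} z *\<^sub>R g0 z) +
      indicator {c<..} z *\<^sub>R (indicator {r..R} z *\<^sub>R g1 z) + indicator ({r..R} \<inter> {c}) z *\<^sub>R Y c)"
    by (intro Bochner_Integration.integrable_add integrable_mult_indicator i p) auto
  also have "(\<lambda>z. indicator {..<c} z *\<^sub>R (indicator {r..R} z *\<^sub>R g0 z) +
      indicator {c<..} z *\<^sub>R (indicator {r..R} z *\<^sub>R g1 z) + indicator ({r..R} \<inter> {c}) z *\<^sub>R Y c)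
      = (\<lambda>z. indicator {r..R} z *\<^sub>R Y z)"
    using r Y by (auto simp: fun_eq_iff indicator_def)
  finally show "integrable lborel (\<lambda>z. indicator {r..R} z *\<^sub>R Y z)" .
qed

lemma continuous_on_glued:
  fixes g0 g1 :: "real \<Rightarrow> 'a::topological_space"
  assumes "continuous_on S g0" "continuous_on S g1" "g0 c = g1 c"
  shows "continuous_on S (\<lambda>z. if z < c then g0 z else g1 z)"
proof -
  have "continuous_on S (\<lambda>z. if z \<le> c then g0 z else g1 z)"
    by (rule continuous_on_cases_le[where h="\<lambda>z. z" and a=c])
       (use assms in \<open>auto intro: continuous_on_subset\<close>)
  moreover have "(\<lambda>z. if z \<le> c then g0 z else g1 z) = (\<lambda>z. if z < c then g0 z else g1 z)"
    using assms(3) by (auto simp: fun_eq_iff)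
  ultimately show ?thesis by (simp only:)
qed

text \<open>Residuals refer to the long interval [0, T), while bounds are available on shorter
  compact ones. A derivative at t sees only times near t, so the two may be exchanged.\<close>

lemma at_within_cut:
  assumes "t < t2" "t2 \<le> T"
  shows "at t within {0..<T} = at t within {0..t2::real}"
  by (rule at_within_nhd[of t "{..<t2}"]) (use assms in auto)

lemma test_fun_support:
  assumes "test_fun \<psi>"
  obtains r R where "0 < r" "\<And>z. z \<notin> {r..R} \<Longrightarrow> \<psi> z = 0"
  using assms unfolding test_fun_def by blast

text \<open>Both branches are given for all z > 0, so a branch can be differentiated in time at a
  fixed z even while the interface crosses it. The two equations \<open>agree\<close> remove the
  singular terms at z = f(t): the first acts on both the time derivative and the second
  z-derivative, the second on the latter.\<close>

locale glued =
  fixes X Xz Xzz Xt :: "bool \<Rightarrow> real \<Rightarrow> real \<Rightarrow> complex" and f :: "real \<Rightarrow> real" and t1 Lf :: real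
  assumes Xz: "\<And>h s z. 0 \<le> s \<Longrightarrow> s < t1 \<Longrightarrow> 0 < z \<Longrightarrow> (X h s has_vector_derivative Xz h s z) (at z)"
    and Xzz: "\<And>h s z. 0 \<le> s \<Longrightarrow> s < t1 \<Longrightarrow> 0 < z \<Longrightarrow> (Xz h s has_vector_derivative Xzz h s z) (at z)"
    and Xt: "\<And>h s z. 0 \<le> s \<Longrightarrow> s < t1 \<Longrightarrow> 0 < z \<Longrightarrow>
        ((\<lambda>s. X h s z) has_vector_derivative Xt h s z) (at s within {0..<t1})"
    and cont: "\<And>h. continuous_on ({0..<t1} \<times> {0<..}) (\<lambda>x. Xz h (fst x) (snd x))"
      "\<And>h. continuous_on ({0..<t1} \<times> {0<..}) (\<lambda>x. Xzz h (fst x) (snd x))"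
      "\<And>h. continuous_on ({0..<t1} \<times> {0<..}) (\<lambda>x. Xt h (fst x) (snd x))"
    and f_pos: "\<And>s. 0 \<le> s \<Longrightarrow> s < t1 \<Longrightarrow> 0 < f s"
    and f_lip: "\<And>s t. 0 \<le> s \<Longrightarrow> s < t1 \<Longrightarrow> 0 \<le> t \<Longrightarrow> t < t1 \<Longrightarrow> \<bar>f s - f t\<bar> \<le> Lf * \<bar>s - t\<bar>"
    and agree: "\<And>s. 0 \<le> s \<Longrightarrow> s < t1 \<Longrightarrow> X False s (f s) = X True s (f s)"
      "\<And>s. 0 \<le> s \<Longrightarrow> s < t1 \<Longrightarrow> Xz False s (f s) = Xz True s (f s)"
begin

lemma cont_z:
  assumes "0 \<le> s" "s < t1"
  shows "continuous_on {0<..} (X h s)" "continuous_on {0<..} (Xz h s)"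
    "continuous_on {0<..} (Xzz h s)" "continuous_on {0<..} (Xt h s)"
proof -
  have c: "continuous_on {0<..} (g s)" if "continuous_on ({0..<t1} \<times> {0<..}) (\<lambda>x. g (fst x) (snd x))"
    for g :: "real \<Rightarrow> real \<Rightarrow> complex"
  proof -
    have "continuous_on {0<..} (\<lambda>z. (s, z))" by (intro continuous_intros)
    from continuous_on_compose2[OF that this] show ?thesis using assms by force
  qed
  show "continuous_on {0<..} (X h s)"
    by (rule continuous_on_vector_derivative) (use Xz assms in \<open>auto intro: has_vector_derivative_at_within\<close>)
  show "continuous_on {0<..} (Xz h s)" "continuous_on {0<..} (Xzz h s)" "continuous_on {0<..} (Xt h s)"
    by (intro c cont)+
qed

context
  fixes Y :: "real \<Rightarrow> real \<Rightarrow> complex" and t T :: real and \<psi> :: "real \<Rightarrow> real"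
  assumes Y: "\<And>s z. 0 \<le> s \<Longrightarrow> s < t1 \<Longrightarrow> 0 < z \<Longrightarrow> z \<noteq> f s \<Longrightarrow> Y s z = X (f s < z) s z"
    and t: "0 \<le> t" "t < t1" "t1 \<le> T"
    and \<psi>: "test_fun \<psi>"
begin

lemma loc_integrable_Y: "0 \<le> s \<Longrightarrow> s < t1 \<Longrightarrow> loc_integrable (Y s)"
  by (rule loc_integrable_glued[of "X False s" "X True s" "f s"]) (use cont_z Y in auto)

lemma loc_integrable_Yd: "loc_integrable (\<lambda>z. Xzz (f t < z) t z)" "loc_integrable (\<lambda>z. Xt (f t < z) t z)"
  by (rule loc_integrable_glued[of "Xzz False t" "Xzz True t" "f t"]; use cont_z t in auto)
     (rule loc_integrable_glued[of "Xt False t" "Xt True t" "f t"]; use cont_z t in auto)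

text \<open>The primitive Q combines values and slopes of the branches. Since both agree at the
  interface, Q is continuous there, and the fundamental theorem with one exceptional point
  applies.\<close>

lemma glued_second_derivative:
  "(\<integral>z. (vderiv ^^ 2) \<psi> z *\<^sub>R Y t z \<partial>lborel) = (\<integral>z. \<psi> z *\<^sub>R Xzz (f t < z) t z \<partial>lborel)"
proof -
  obtain r R where r: "0 < r" "\<And>z. z \<notin> {r..R} \<Longrightarrow> \<psi> z = 0" using test_fun_support[OF \<psi>] by blast
  obtain r' R' where r': "0 < r'" "\<And>z. z \<notin> {r'..R'} \<Longrightarrow> vderiv \<psi> z = 0"
    using test_fun_support[OF test_fun_vderiv[OF \<psi>]] by blast
  obtain r'' R'' where r'': "0 < r''" "\<And>z. z \<notin> {r''..R''} \<Longrightarrow> (vderiv ^^ 2) \<psi> z = 0"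
    using test_fun_support[OF test_fun_funpow_vderiv[OF \<psi>]] by blast
  \<comment> \<open>The interval contains the supports of the test function and of its first two
    derivatives in its interior, so Q vanishes at the ends and P vanishes outside.\<close>
  define a where "a = min r (min r' r'') / 2"
  define b where "b = max a (max R (max R' R'')) + 1"
  have ab: "0 < a" "a < b" "a < r" "a < r'" "a < r''" "R < b" "R' < b" "R'' < b"
    using r r' r'' by (auto simp: a_def b_def)
  define y where "y = (\<lambda>z. if z < f t then X False t z else X True t z)"
  define yz where "yz = (\<lambda>z. if z < f t then Xz False t z else Xz True t z)"
  define P where "P z = (vderiv ^^ 2) \<psi> z *\<^sub>R Y t z - \<psi> z *\<^sub>R Xzz (f t < z) t z" for z
  define Q where "Q z = vderiv \<psi> z *\<^sub>R y z - \<psi> z *\<^sub>R yz z" for z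
  note c = cont_z[OF t(1) t(2)]
  have s: "smooth \<psi>" by (rule test_fun_smooth[OF \<psi>])
  have "(P has_integral (Q b - Q a)) {a..b}"
  proof (rule fundamental_theorem_of_calculus_interior_strong[where S="{f t}"])
    have "{a..b} \<subseteq> {0<..}" using ab by auto
    note sub = continuous_on_subset[OF _ this]
    have "continuous_on {a..b} y" "continuous_on {a..b} yz" unfolding y_def yz_def
      by (intro continuous_on_glued agree t sub[OF c(1)] sub[OF c(2)])+
    then show "continuous_on {a..b} Q" unfolding Q_def
      by (intro continuous_on_diff continuous_on_scaleR smooth_continuous_on[OF s]
          smooth_continuous_on[OF smooth_vderiv[OF s]])
    fix z assume z: "z \<in> {a<..<b} - {f t}"
    then have z0: "0 < z" "z \<noteq> f t" using ab by auto
    let ?h = "f t < z"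
    have "((\<lambda>z. vderiv \<psi> z *\<^sub>R X ?h t z - \<psi> z *\<^sub>R Xz ?h t z) has_vector_derivative
       (vderiv \<psi> z *\<^sub>R Xz ?h t z + vderiv (vderiv \<psi>) z *\<^sub>R X ?h t z) - (\<psi> z *\<^sub>R Xzz ?h t z + vderiv \<psi> z *\<^sub>R Xz ?h t z)) (at z)"
      using z0 t smooth_has_vderiv[OF s] smooth_has_vderiv[OF smooth_vderiv[OF s]]
      by (intro has_vector_derivative_diff has_vector_derivative_scaleR Xz Xzz)
         (auto simp: has_real_derivative_iff_has_vector_derivative)
    moreover have "(vderiv \<psi> z *\<^sub>R Xz ?h t z + vderiv (vderiv \<psi>) z *\<^sub>R X ?h t z) - (\<psi> z *\<^sub>R Xzz ?h t z + vderiv \<psi> z *\<^sub>R Xz ?h t z) = P z"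
      using Y[OF t(1,2) z0] by (simp add: P_def numeral_2_eq_2)
    ultimately have d: "((\<lambda>z. vderiv \<psi> z *\<^sub>R X ?h t z - \<psi> z *\<^sub>R Xz ?h t z) has_vector_derivative P z) (at z)" by simp
    show "(Q has_vector_derivative P z) (at z)"
    proof (cases ?h)
      case True
      show ?thesis
        by (rule has_vector_derivative_transform_within_open[OF d, of "{f t<..}"])
           (use True in \<open>auto simp: Q_def y_def yz_def\<close>)
    next
      case False
      show ?thesis
        by (rule has_vector_derivative_transform_within_open[OF d, of "{..<f t}"])
           (use False z0 in \<open>auto simp: Q_def y_def yz_def\<close>)
    qed
  qed (use ab in auto)
  moreover have "Q a = 0" "Q b = 0" using ab r(2)[of a] r(2)[of b] r'(2)[of a] r'(2)[of b] by (auto simp: Q_def)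
  ultimately have P0: "integral {a..b} P = 0" by (simp add: integral_unique)
  have i: "integrable lborel (\<lambda>z. (vderiv ^^ 2) \<psi> z *\<^sub>R Y t z)" "integrable lborel (\<lambda>z. \<psi> z *\<^sub>R Xzz (f t < z) t z)"
    by (intro integrable_test_scaleR \<psi> test_fun_funpow_vderiv loc_integrable_Y loc_integrable_Yd t)+
  have Ps: "P z = indicator {a..b} z *\<^sub>R P z" for z
    using r(2)[of z] r''(2)[of z] ab by (cases "z \<in> {a..b}") (auto simp: P_def)
  have "integrable lborel P" unfolding P_def by (intro Bochner_Integration.integrable_diff i)
  then have Psi: "set_integrable lborel {a..b} P" unfolding set_integrable_def by (simp flip: Ps)
  have "(\<integral>z. P z \<partial>lborel) = (LINT z:{a..b}|lborel. P z)"
    unfolding set_lebesgue_integral_def by (simp flip: Ps)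
  also have "\<dots> = 0" using set_borel_integral_eq_integral(2)[OF Psi] P0 by simp
  finally show ?thesis unfolding P_def using i by simp
qed

text \<open>Dominated convergence for the difference quotients. The delicate points z are those
  passed by the interface between the times s and t, where Y changes branch. There the branches
  differ by O(|z - f s|), since they agree at the interface, and this is O(|s - t|) because f is
  Lipschitz.\<close>

lemma glued_time_derivative:
  "((\<lambda>s. \<integral>z. \<psi> z *\<^sub>R Y s z \<partial>lborel) has_vector_derivative (\<integral>z. \<psi> z *\<^sub>R Xt (f t < z) t z \<partial>lborel))
     (at t within {0..<T})"
proof -
  \<comment> \<open>Stopping short of t1 puts the times, the support of the test function and the
    path f into a compact box, where the derivatives of the branches are bounded.\<close>
  define t2 where "t2 = (t + t1) / 2"
  have t2: "0 \<le> t" "t < t2" "t2 < t1" "t2 \<le> T" "0 \<le> t2" using t by (auto simp: t2_def)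
  obtain r R where r: "0 < r" "\<And>z. z \<notin> {r..R} \<Longrightarrow> \<psi> z = 0" using test_fun_support[OF \<psi>] by blast
  have "continuous_on {0..t2} f"
  proof (rule continuous_onI)
    fix x e :: real assume x: "x \<in> {0..t2}" and e: "0 < e"
    have "dist (f x') (f x) \<le> e" if "x' \<in> {0..t2}" "dist x' x < e / (\<bar>Lf\<bar> + 1)" for x'
    proof -
      have "\<bar>f x' - f x\<bar> \<le> Lf * \<bar>x' - x\<bar>" using f_lip x that t2 by auto
      also have "\<dots> \<le> (\<bar>Lf\<bar> + 1) * (e / (\<bar>Lf\<bar> + 1))" using that by (intro mult_mono) (auto simp: dist_real_def)
      finally show ?thesis by (simp add: dist_real_def)
    qed
    then show "\<exists>d>0. \<forall>x'\<in>{0..t2}. dist x' x < d \<longrightarrow> dist (f x') (f x) \<le> e"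
      using e by (intro exI[of _ "e / (\<bar>Lf\<bar> + 1)"]) auto
  qed
  then have cf: "compact (f ` {0..t2})" "f ` {0..t2} \<noteq> {}"
    using t2 by (auto intro: compact_continuous_image)
  obtain m where m: "m \<in> f ` {0..t2}" "\<And>y. y \<in> f ` {0..t2} \<Longrightarrow> m \<le> y" using compact_attains_inf[OF cf] by blast
  obtain M where M: "\<And>y. y \<in> f ` {0..t2} \<Longrightarrow> y \<le> M" using compact_attains_sup[OF cf] by blast
  define a where "a = min r m"
  define b where "b = max R M"
  have a: "0 < a" "a \<le> r" using r m(1) f_pos t2 by (auto simp: a_def min_def)
  have b: "R \<le> b" by (simp add: b_def)
  have fab: "f s \<in> {a..b}" if "s \<in> {0..t2}" for s
    using m(2)[of "f s"] M[of "f s"] that by (auto simp: a_def b_def)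
  define K where "K = {0..t2} \<times> {a..b}"
  have K: "compact K" "K \<subseteq> {0..<t1} \<times> {0<..}" unfolding K_def using a t2 by (auto intro: compact_Times)
  have bd: "\<exists>B. \<forall>x\<in>K. norm (g (fst x) (snd x)) \<le> B"
    if "continuous_on ({0..<t1} \<times> {0<..}) (\<lambda>x. g (fst x) (snd x))" for g :: "real \<Rightarrow> real \<Rightarrow> complex"
  proof -
    have "compact ((\<lambda>x. g (fst x) (snd x)) ` K)"
      by (intro compact_continuous_image continuous_on_subset[OF that] K)
    then have "bounded ((\<lambda>x. g (fst x) (snd x)) ` K)" by (rule compact_imp_bounded)
    then show ?thesis unfolding bounded_iff by auto
  qed
  obtain B1 B2 B3 B4 where B0: "\<forall>x\<in>K. norm (Xz True (fst x) (snd x)) \<le> B1" "\<forall>x\<in>K. norm (Xz False (fst x) (snd x)) \<le> B2"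
    "\<forall>x\<in>K. norm (Xt True (fst x) (snd x)) \<le> B3" "\<forall>x\<in>K. norm (Xt False (fst x) (snd x)) \<le> B4"
    using bd[OF cont(1)[of True]] bd[OF cont(1)[of False]] bd[OF cont(3)[of True]] bd[OF cont(3)[of False]] by blast
  define B where "B = max (max B1 B2) (max B3 B4)"
  have B: "norm (Xz h s z) \<le> B" "norm (Xt h s z) \<le> B" if "s \<in> {0..t2}" "z \<in> {a..b}" for h s z
    using B0[THEN bspec, of "(s, z)"] that by (cases h; force simp: K_def B_def)+
  have B_nn: "0 \<le> B" using B(1)[of t "f t"] fab[of t] t2 norm_ge_zero order.trans by (metis atLeastAtMost_iff less_imp_le)
  have lipt: "norm (X h s z - X h s' z) \<le> B * \<bar>s - s'\<bar>" if "s \<in> {0..t2}" "s' \<in> {0..t2}" "z \<in> {a..b}" for h s s' z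
    by (rule vector_derivative_lipschitz[where S="{0..t2}" and g'="\<lambda>s. Xt h s z"])
       (use that B t2 a in \<open>auto intro: has_vector_derivative_within_subset[OF Xt]\<close>)
  have lipz: "norm (X h s z - X h s z') \<le> B * \<bar>z - z'\<bar>" if "s \<in> {0..t2}" "z \<in> {a..b}" "z' \<in> {a..b}" for h s z z'
    by (rule vector_derivative_lipschitz[where S="{a..b}" and g'="\<lambda>z. Xz h s z"])
       (use that B t2 a in \<open>auto intro: has_vector_derivative_at_within[OF Xz]\<close>)
  have jump: "norm (X True s z - X False s z) \<le> 2 * B * \<bar>z - f s\<bar>" if "s \<in> {0..t2}" "z \<in> {a..b}" for s z
  proof -
    have ag: "X False s (f s) = X True s (f s)" using that t2 by (intro agree) auto
    have "norm (X True s z - X False s z) = norm ((X True s z - X True s (f s)) - (X False s z - X False s (f s)))"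
      using ag by simp
    also have "\<dots> \<le> B * \<bar>z - f s\<bar> + B * \<bar>z - f s\<bar>"
      by (rule norm_triangle_le_diff, rule add_mono) (rule lipz[OF that(1) that(2) fab[OF that(1)]])+
    finally show ?thesis by simp
  qed
  \<comment> \<open>The first term pays for a change of branch, the second for the variation in time
    along one branch.\<close>
  define C where "C = 2 * B * \<bar>Lf\<bar> + B"
  have lip: "norm (Y s z - Y t z) \<le> C * \<bar>s - t\<bar>" if s: "s \<in> {0..t2}" and z: "z \<in> {a..b}" and ne: "z \<noteq> f s" "z \<noteq> f t" for s z
  proof -
    have z0: "0 < z" using z a by auto
    have ft: "\<bar>f s - f t\<bar> \<le> \<bar>Lf\<bar> * \<bar>s - t\<bar>"
      using f_lip[of s t] s t2 by (intro order.trans[OF f_lip] mult_right_mono) auto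
    have e: "Y s z = X (f s < z) s z" "Y t z = X (f t < z) t z" using Y s t2 z0 ne by auto
    have l: "norm (X (f t < z) s z - X (f t < z) t z) \<le> B * \<bar>s - t\<bar>" using lipt[of s t z] s z t2 by auto
    show ?thesis
    proof (cases "(f s < z) = (f t < z)")
      case True
      then show ?thesis using l e B_nn unfolding C_def by (simp add: distrib_right add_increasing)
    next
      case False
      \<comment> \<open>Being on different sides at the two times means that z lies between f s and
        f t.\<close>
      then have "\<bar>z - f s\<bar> \<le> \<bar>f s - f t\<bar>" by auto
      then have "2 * B * \<bar>z - f s\<bar> \<le> 2 * B * (\<bar>Lf\<bar> * \<bar>s - t\<bar>)" using ft B_nn by (intro mult_left_mono) auto
      moreover have "norm (X (f s < z) s z - X (f t < z) s z) \<le> 2 * B * \<bar>z - f s\<bar>"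
        using jump[OF s z] False by (cases "f s < z") (auto simp: norm_minus_commute)
      moreover have "norm (Y s z - Y t z) \<le> norm (X (f s < z) s z - X (f t < z) s z) + norm (X (f t < z) s z - X (f t < z) t z)"
        unfolding e by (rule order.trans[OF _ norm_triangle_ineq]) simp
      ultimately show ?thesis using l unfolding C_def by (simp add: distrib_right)
    qed
  qed
  have liY: "loc_integrable (Y s)" if "s \<in> {0..t2}" for s using that t2 by (intro loc_integrable_Y) auto
  have iY: "integrable lborel (\<lambda>z. \<psi> z *\<^sub>R Y s z)" if "s \<in> {0..t2}" for s
    by (intro integrable_test_scaleR \<psi> liY that)
  have iXt: "integrable lborel (\<lambda>z. \<psi> z *\<^sub>R Xt (f t < z) t z)"
    by (intro integrable_test_scaleR \<psi> loc_integrable_Yd)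
  have li1: "loc_integrable (\<lambda>z. C :: real)" by (intro loc_integrable_continuous continuous_intros)
  define I where "I s = (\<integral>z. \<psi> z *\<^sub>R Y s z \<partial>lborel)" for s
  have tt: "t \<in> {0..t2}" using t2 by auto
  have key: "((\<lambda>s. (I s - I t) /\<^sub>R (s - t)) \<longlongrightarrow> (\<integral>z. \<psi> z *\<^sub>R Xt (f t < z) t z \<partial>lborel)) (at t within {0..t2})"
    unfolding tendsto_at_iff_sequentially
  proof (intro allI impI)
    fix \<sigma> :: "nat \<Rightarrow> real" assume \<sigma>: "\<forall>i. \<sigma> i \<in> {0..t2} - {t}" and lim: "\<sigma> \<longlonglongrightarrow> t"
    have \<sigma>i: "\<sigma> i \<in> {0..t2}" "\<sigma> i \<noteq> t" for i using \<sigma> by auto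
    have "(\<lambda>i. \<integral>z. (\<psi> z *\<^sub>R Y (\<sigma> i) z - \<psi> z *\<^sub>R Y t z) /\<^sub>R (\<sigma> i - t) \<partial>lborel)
        \<longlonglongrightarrow> (\<integral>z. \<psi> z *\<^sub>R Xt (f t < z) t z \<partial>lborel)"
    proof (rule integral_dominated_convergence[where w="\<lambda>z. \<bar>C * \<psi> z\<bar>"])
      show "(\<lambda>z. \<psi> z *\<^sub>R Xt (f t < z) t z) \<in> borel_measurable lborel" using iXt by simp
      show "(\<lambda>z. (\<psi> z *\<^sub>R Y (\<sigma> i) z - \<psi> z *\<^sub>R Y t z) /\<^sub>R (\<sigma> i - t)) \<in> borel_measurable lborel" for i
        by (rule borel_measurable_scaleR[OF borel_measurable_const borel_measurable_diff[OF
            borel_measurable_integrable[OF iY[OF \<sigma>i(1)]] borel_measurable_integrable[OF iY[OF tt]]]])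
      show "integrable lborel (\<lambda>z. \<bar>C * \<psi> z\<bar>)"
        by (intro integrable_abs integrable_test_mult \<psi> li1)
      show "AE z in lborel. norm ((\<psi> z *\<^sub>R Y (\<sigma> i) z - \<psi> z *\<^sub>R Y t z) /\<^sub>R (\<sigma> i - t)) \<le> \<bar>C * \<psi> z\<bar>" for i
        using AE_lborel_singleton[of "f t"] AE_lborel_singleton[of "f (\<sigma> i)"]
      proof eventually_elim
        case (elim z)
        show ?case
        proof (cases "z \<in> {r..R}")
          case True
          then have "z \<in> {a..b}" using a b by auto
          from lip[OF \<sigma>i(1) this elim(2,1)]
          have le: "norm (Y (\<sigma> i) z - Y t z) \<le> \<bar>C\<bar> * \<bar>\<sigma> i - t\<bar>"
            by (rule order.trans) (intro mult_right_mono, auto)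
          have "norm ((\<psi> z *\<^sub>R Y (\<sigma> i) z - \<psi> z *\<^sub>R Y t z) /\<^sub>R (\<sigma> i - t))
              = (\<bar>\<psi> z\<bar> * norm (Y (\<sigma> i) z - Y t z)) / \<bar>\<sigma> i - t\<bar>"
            by (simp add: divide_inverse abs_mult mult.commute flip: scaleR_right_diff_distrib)
          also have "\<dots> \<le> (\<bar>\<psi> z\<bar> * (\<bar>C\<bar> * \<bar>\<sigma> i - t\<bar>)) / \<bar>\<sigma> i - t\<bar>"
            by (intro divide_right_mono mult_left_mono le) auto
          also have "\<dots> = \<bar>C * \<psi> z\<bar>" using \<sigma>i(2)[of i] by (simp add: abs_mult)
          finally show ?thesis .
        next
          case False
          then show ?thesis using r(2)[of z] by simp
        qed
      qed
      show "AE z in lborel. (\<lambda>i. (\<psi> z *\<^sub>R Y (\<sigma> i) z - \<psi> z *\<^sub>R Y t z) /\<^sub>R (\<sigma> i - t)) \<longlonglongrightarrow> \<psi> z *\<^sub>R Xt (f t < z) t z"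
        using AE_lborel_singleton[of "f t"]
      proof eventually_elim
        case (elim z)
        show ?case
        proof (cases "z \<in> {r..R}")
          case True
          then have z0: "0 < z" using r by auto
          let ?h = "f t < z"
          have "((\<lambda>s. X ?h s z) has_vector_derivative Xt ?h t z) (at t within {0..t2})"
            by (rule has_vector_derivative_within_subset[OF Xt]) (use t2 z0 in auto)
          then have "((\<lambda>s. (X ?h s z - X ?h t z) /\<^sub>R (s - t)) \<longlongrightarrow> Xt ?h t z) (at t within {0..t2})"
            unfolding has_vector_derivative_iff_quotient .
          then have "(\<lambda>i. (X ?h (\<sigma> i) z - X ?h t z) /\<^sub>R (\<sigma> i - t)) \<longlonglongrightarrow> Xt ?h t z"
            using \<sigma> lim unfolding tendsto_at_iff_sequentially o_def by blast
          then have L: "(\<lambda>i. \<psi> z *\<^sub>R ((X ?h (\<sigma> i) z - X ?h t z) /\<^sub>R (\<sigma> i - t))) \<longlonglongrightarrow> \<psi> z *\<^sub>R Xt ?h t z"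
            by (intro tendsto_intros)
          \<comment> \<open>For a fixed z off the interface the sequence of times eventually sees z
            on one side only, so the pointwise limit involves a single branch.\<close>
          have "(\<lambda>i. f (\<sigma> i)) \<longlonglongrightarrow> f t"
            by (rule continuous_on_tendsto_compose[OF \<open>continuous_on {0..t2} f\<close> lim tt]) (use \<sigma>i(1) in simp)
          then have "\<forall>\<^sub>F i in sequentially. dist (f (\<sigma> i)) (f t) < dist z (f t)"
            by (rule tendstoD) (use elim in simp)
          then have "\<forall>\<^sub>F i in sequentially. \<psi> z *\<^sub>R ((X ?h (\<sigma> i) z - X ?h t z) /\<^sub>R (\<sigma> i - t))
             = (\<psi> z *\<^sub>R Y (\<sigma> i) z - \<psi> z *\<^sub>R Y t z) /\<^sub>R (\<sigma> i - t)"
          proof eventually_elim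
            case (elim i)
            then have ne: "z \<noteq> f (\<sigma> i)" "z \<noteq> f t" and same: "(f (\<sigma> i) < z) = (f t < z)" by (auto simp: dist_real_def)
            have "Y (\<sigma> i) z = X (f (\<sigma> i) < z) (\<sigma> i) z" using \<sigma>i(1)[of i] t2 z0 ne by (intro Y) auto
            moreover have "Y t z = X ?h t z" using t2 z0 ne by (intro Y) auto
            ultimately show ?case using same by (simp add: scaleR_right_diff_distrib mult.commute)
          qed
          with L show ?thesis by (rule Lim_transform_eventually)
        next
          case False
          then show ?thesis using r(2)[of z] by simp
        qed
      qed
    qed
    moreover have "(\<integral>z. (\<psi> z *\<^sub>R Y (\<sigma> i) z - \<psi> z *\<^sub>R Y t z) /\<^sub>R (\<sigma> i - t) \<partial>lborel) = (I (\<sigma> i) - I t) /\<^sub>R (\<sigma> i - t)" for i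
      unfolding I_def using iY[OF \<sigma>i(1)[of i]] iY[OF tt] by simp
    ultimately show "((\<lambda>s. (I s - I t) /\<^sub>R (s - t)) \<circ> \<sigma>) \<longlonglongrightarrow> (\<integral>z. \<psi> z *\<^sub>R Xt (f t < z) t z \<partial>lborel)"
      by (simp only: o_def)
  qed
  show ?thesis
    unfolding at_within_cut[OF t2(2,4)] I_def[symmetric] has_vector_derivative_iff_quotient by (rule key)
qed

end

lemma heat_residual_glued:
  assumes Y: "\<And>s z. 0 \<le> s \<Longrightarrow> s < t1 \<Longrightarrow> 0 < z \<Longrightarrow> z \<noteq> f s \<Longrightarrow> Y s z = X (f s < z) s z"
    and t: "0 \<le> t" "t < t1" "t1 \<le> T" and F: "loc_integrable F"
  shows "heat_residual T Y F t (\<lambda>z. Xt (f t < z) t z - Xzz (f t < z) t z + F z)"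
  unfolding heat_residual_def
proof (intro conjI allI impI)

  \<comment> \<open>The facts on local integrability were proved in a context with a fixed test
    function; the zero function fills that place.\<close>
  have t0: "test_fun (\<lambda>x. 0)" unfolding test_fun_def using smooth_const by (auto intro!: exI[of _ 1])
  have YI: "loc_integrable (Y s)" if "0 \<le> s" "s < t1" for s
    by (rule loc_integrable_Y[of Y t T "\<lambda>x. 0"]) (use Y t t0 that in auto)
  have Yd: "loc_integrable (\<lambda>z. Xzz (f t < z) t z)" "loc_integrable (\<lambda>z. Xt (f t < z) t z)"
    by (rule loc_integrable_Yd[of Y t T "\<lambda>x. 0"]; use Y t t0 in auto)+
  show "loc_integrable (Y t)" using YI t by auto
  show "loc_integrable F" by (rule F)
  have diff: "loc_integrable (\<lambda>z. Xt (f t < z) t z - Xzz (f t < z) t z)"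
    using Yd unfolding loc_integrable_def by auto
  show "loc_integrable (\<lambda>z. Xt (f t < z) t z - Xzz (f t < z) t z + F z)"
    using diff F unfolding loc_integrable_def by auto
  fix \<psi> assume \<psi>: "test_fun \<psi>"
  have "(\<integral>z. \<psi> z *\<^sub>R (Xt (f t < z) t z - Xzz (f t < z) t z + F z) \<partial>lborel) =
    (\<integral>z. \<psi> z *\<^sub>R Xt (f t < z) t z - \<psi> z *\<^sub>R Xzz (f t < z) t z + \<psi> z *\<^sub>R F z \<partial>lborel)"
    by (simp add: algebra_simps)
  also have "\<dots> = (\<integral>z. \<psi> z *\<^sub>R Xt (f t < z) t z \<partial>lborel) - (\<integral>z. \<psi> z *\<^sub>R Xzz (f t < z) t z \<partial>lborel) + (\<integral>z. \<psi> z *\<^sub>R F z \<partial>lborel)"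
    using integrable_test_scaleR[OF \<psi> Yd(1)] integrable_test_scaleR[OF \<psi> Yd(2)] integrable_test_scaleR[OF \<psi> F] by simp
  finally have "(\<integral>z. (vderiv ^^ 2) \<psi> z *\<^sub>R Y t z \<partial>lborel) - (\<integral>z. \<psi> z *\<^sub>R F z \<partial>lborel)
      + (\<integral>z. \<psi> z *\<^sub>R (Xt (f t < z) t z - Xzz (f t < z) t z + F z) \<partial>lborel) = (\<integral>z. \<psi> z *\<^sub>R Xt (f t < z) t z \<partial>lborel)"
    using glued_second_derivative[of Y t T \<psi>, OF Y t \<psi>] by simp
  then show "((\<lambda>s. \<integral>z. \<psi> z *\<^sub>R Y s z \<partial>lborel) has_vector_derivative
     ((\<integral>z. (vderiv ^^ 2) \<psi> z *\<^sub>R Y t z \<partial>lborel) - (\<integral>z. \<psi> z *\<^sub>R F z \<partial>lborel)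
      + (\<integral>z. \<psi> z *\<^sub>R (Xt (f t < z) t z - Xzz (f t < z) t z + F z) \<partial>lborel))) (at t within {0..<T})"
    using glued_time_derivative[of Y t T \<psi>, OF Y t \<psi>] by simp
qed

end

section \<open>Jets in the layer\<close>

text \<open>
  A jet stands for the values of a function and of its derivatives \<open>\<partial>\<^sub>z\<close>, \<open>\<partial>\<^sub>z\<^sup>2\<close>, \<open>\<partial>\<^sub>t\<close>, so that products and
  inverses are computed with their derivatives. The arguments of a family are the side of the
  interface (\<open>True\<close> above it), \<open>\<epsilon>\<close>, \<open>t\<close> and \<open>z\<close>.
\<close>

datatype jet = Jet (jv: complex) (jz: complex) (jzz: complex) (jt: complex)

type_synonym family = "bool \<Rightarrow> real \<Rightarrow> real \<Rightarrow> real \<Rightarrow> jet"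

definition jadd :: "family \<Rightarrow> family \<Rightarrow> family" where
  "jadd F G h \<epsilon> t z = (let a = F h \<epsilon> t z; b = G h \<epsilon> t z in
     Jet (jv a + jv b) (jz a + jz b) (jzz a + jzz b) (jt a + jt b))"

definition jmul :: "family \<Rightarrow> family \<Rightarrow> family" where
  "jmul F G h \<epsilon> t z = (let a = F h \<epsilon> t z; b = G h \<epsilon> t z in
     Jet (jv a * jv b) (jz a * jv b + jv a * jz b) (jzz a * jv b + 2 * (jz a * jz b) + jv a * jzz b)
       (jt a * jv b + jv a * jt b))"

definition jneg :: "family \<Rightarrow> family" where
  "jneg F h \<epsilon> t z = (let a = F h \<epsilon> t z in Jet (- jv a) (- jz a) (- jzz a) (- jt a))"

definition jinv :: "family \<Rightarrow> family" where
  "jinv F h \<epsilon> t z = (let a = F h \<epsilon> t z; i = inverse (jv a) in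
     Jet i (- (jz a * (i * i))) (2 * (jz a * jz a * (i * i * i)) - jzz a * (i * i)) (- (jt a * (i * i))))"

text \<open>Applied to \<epsilon> it is the width of the layer. Applied to \<open>kap L t\<close> it
  is the factor \<kappa>^(1/4) of the layer variable.\<close>

definition rt4 :: "real \<Rightarrow> real" where
  "rt4 \<epsilon> = \<epsilon> powr (1 / 4)"

lemma rt4_pos: "0 < \<epsilon> \<Longrightarrow> 0 < rt4 \<epsilon>"
  by (simp add: rt4_def)

lemma rt4_less_1: "0 < \<epsilon> \<Longrightarrow> \<epsilon> < 1 \<Longrightarrow> rt4 \<epsilon> < 1"
  unfolding rt4_def using powr_less_mono2[of "1 / 4" \<epsilon> 1] by simp

lemma rt4_square: "0 < \<epsilon> \<Longrightarrow> (rt4 \<epsilon>)\<^sup>2 = sqrt \<epsilon>"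
  by (simp add: rt4_def powr_power powr_half_sqrt)

lemma L_log_ge_1: "1 \<le> L_log \<epsilon>"
  by (simp add: L_log_def)

locale jet_setting =
  fixes f f' :: "real \<Rightarrow> real" and t1 \<delta> K0 Mf :: real
  assumes t1: "0 < t1" and \<delta>: "0 < \<delta>" and K0: "0 < K0"
    and f_gt: "\<And>t. 0 \<le> t \<Longrightarrow> t < t1 \<Longrightarrow> \<delta> < f t"
    and f_deriv: "\<And>t. 0 \<le> t \<Longrightarrow> t < t1 \<Longrightarrow> (f has_real_derivative f' t) (at t within {0..<t1})"
    and f'_cont: "continuous_on {0..<t1} f'"
    and f'_bound: "\<And>t. 0 \<le> t \<Longrightarrow> t < t1 \<Longrightarrow> \<bar>f' t\<bar> \<le> Mf"
begin

text \<open>The restriction on t lets a factor t count as \<epsilon>^(1/2) up to one logarithm. The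
  side h is tied to z because decay is true of each branch only on its own side.\<close>

definition dom :: "bool \<Rightarrow> real \<Rightarrow> real \<Rightarrow> real \<Rightarrow> bool" where
  "dom h \<epsilon> t z \<longleftrightarrow> 0 < \<epsilon> \<and> \<epsilon> < 1 \<and> 0 \<le> t \<and> t < t1 \<and> t \<le> K0 * sqrt \<epsilon> * L_log \<epsilon> \<and>
    \<bar>z - f t\<bar> \<le> \<delta> \<and> z \<noteq> f t \<and> (h \<longleftrightarrow> f t < z)"

definition zeta :: "real \<Rightarrow> real \<Rightarrow> real \<Rightarrow> real" where
  "zeta \<epsilon> t z = \<bar>z - f t\<bar> / rt4 \<epsilon>"

text \<open>The logarithm and the growth in the layer variable share one exponent, so weights are
  multiplied by adding exponents.\<close>

definition wt :: "nat \<Rightarrow> real \<Rightarrow> real \<Rightarrow> real \<Rightarrow> real" where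
  "wt N \<epsilon> t z = L_log \<epsilon> ^ N * (1 + zeta \<epsilon> t z) ^ N"

text \<open>
  \<open>layer_O decay n g\<close> means \<open>g = O(\<epsilon>\<^bsup>n/4\<^esup>)\<close> up to powers of \<open>L\<^sub>\<epsilon>\<close> and of \<open>1 + \<bar>Z\<bar>\<close>, with an exponential
  gain in \<open>\<bar>Z\<bar>\<close> if \<open>decay\<close>.
\<close>

definition layer_O :: "bool \<Rightarrow> real \<Rightarrow> (bool \<Rightarrow> real \<Rightarrow> real \<Rightarrow> real \<Rightarrow> complex) \<Rightarrow> bool" where
  "layer_O decay n g \<longleftrightarrow> (\<exists>C N \<eta>. 0 \<le> C \<and> 0 \<le> \<eta> \<and> (decay \<longrightarrow> 0 < \<eta>) \<and> (\<forall>h \<epsilon> t z. dom h \<epsilon> t z \<longrightarrow>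
     norm (g h \<epsilon> t z) \<le> C * wt N \<epsilon> t z * rt4 \<epsilon> powr n * exp (- \<eta> * zeta \<epsilon> t z)))"

lemma zeta_nonneg: "0 \<le> zeta \<epsilon> t z"
  by (simp add: zeta_def rt4_def)

lemma wt_ge_1: "1 \<le> wt N \<epsilon> t z"
  unfolding wt_def using L_log_ge_1 zeta_nonneg
  by (metis add.commute add_increasing2 le_add_same_cancel2 mult_ge1_I one_le_power order.refl)

lemma wt_mult: "wt N \<epsilon> t z * wt M \<epsilon> t z = wt (N + M) \<epsilon> t z"
  by (simp add: wt_def power_add algebra_simps)

lemma wt_mono: "N \<le> M \<Longrightarrow> wt N \<epsilon> t z \<le> wt M \<epsilon> t z"
  using wt_mult[of N \<epsilon> t z "M - N"] wt_ge_1[of "M - N" \<epsilon> t z] wt_ge_1[of N \<epsilon> t z]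
  by (metis le_add_diff_inverse mult.right_neutral mult_left_mono order.trans zero_le_one)

lemma layer_O_I:
  assumes "0 \<le> C" "\<And>h \<epsilon> t z. dom h \<epsilon> t z \<Longrightarrow> norm (g h \<epsilon> t z) \<le> C * wt N \<epsilon> t z * rt4 \<epsilon> powr n"
  shows "layer_O False n g"
  unfolding layer_O_def using assms by (intro exI[of _ C] exI[of _ N] exI[of _ 0]) auto

lemma layer_O_bounded:
  assumes "\<And>h \<epsilon> t z. dom h \<epsilon> t z \<Longrightarrow> norm (g h \<epsilon> t z) \<le> C"
  shows "layer_O False 0 g"
proof (rule layer_O_I[where C="\<bar>C\<bar>" and N=0])
  fix h \<epsilon> t z assume d: "dom h \<epsilon> t z"
  show "norm (g h \<epsilon> t z) \<le> \<bar>C\<bar> * wt 0 \<epsilon> t z * rt4 \<epsilon> powr 0"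
    using assms[OF d] d rt4_pos[of \<epsilon>] by (auto simp: wt_def dom_def)
qed simp

text \<open>Decay of one factor is enough for the product: the rates add, and the other rate may be
  0.\<close>

lemma layer_O_mult:
  assumes "layer_O d n g" "layer_O d' m g'"
  shows "layer_O (d \<or> d') (n + m) (\<lambda>h \<epsilon> t z. g h \<epsilon> t z * g' h \<epsilon> t z)"
proof -
  obtain C N \<eta> where 1: "0 \<le> C" "0 \<le> \<eta>" "d \<longrightarrow> 0 < \<eta>"
    "\<And>h \<epsilon> t z. dom h \<epsilon> t z \<Longrightarrow> norm (g h \<epsilon> t z) \<le> C * wt N \<epsilon> t z * rt4 \<epsilon> powr n * exp (- \<eta> * zeta \<epsilon> t z)"
    using assms(1) unfolding layer_O_def by auto
  obtain C' N' \<eta>' where 2: "0 \<le> C'" "0 \<le> \<eta>'" "d' \<longrightarrow> 0 < \<eta>'"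
    "\<And>h \<epsilon> t z. dom h \<epsilon> t z \<Longrightarrow> norm (g' h \<epsilon> t z) \<le> C' * wt N' \<epsilon> t z * rt4 \<epsilon> powr m * exp (- \<eta>' * zeta \<epsilon> t z)"
    using assms(2) unfolding layer_O_def by auto
  have "norm (g h \<epsilon> t z * g' h \<epsilon> t z) \<le> (C * C') * wt (N + N') \<epsilon> t z * rt4 \<epsilon> powr (n + m) * exp (- (\<eta> + \<eta>') * zeta \<epsilon> t z)"
    if "dom h \<epsilon> t z" for h \<epsilon> t z
  proof -
    have "norm (g h \<epsilon> t z * g' h \<epsilon> t z) \<le> (C * wt N \<epsilon> t z * rt4 \<epsilon> powr n * exp (- \<eta> * zeta \<epsilon> t z)) *
       (C' * wt N' \<epsilon> t z * rt4 \<epsilon> powr m * exp (- \<eta>' * zeta \<epsilon> t z))"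
      unfolding norm_mult by (rule mult_mono'[OF 1(4)[OF that] 2(4)[OF that]]) auto
    also have "\<dots> = (C * C') * (wt N \<epsilon> t z * wt N' \<epsilon> t z) * (rt4 \<epsilon> powr n * rt4 \<epsilon> powr m) *
        (exp (- \<eta> * zeta \<epsilon> t z) * exp (- \<eta>' * zeta \<epsilon> t z))" by (simp only: mult_ac)
    also have "\<dots> = (C * C') * wt (N + N') \<epsilon> t z * rt4 \<epsilon> powr (n + m) * exp (- (\<eta> + \<eta>') * zeta \<epsilon> t z)"
      unfolding wt_mult powr_add exp_add[symmetric] by (simp add: algebra_simps)
    finally show ?thesis .
  qed
  moreover have "0 \<le> C * C'" "0 \<le> \<eta> + \<eta>'" "d \<or> d' \<longrightarrow> 0 < \<eta> + \<eta>'" using 1(1-3) 2(1-3) by auto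
  ultimately show ?thesis unfolding layer_O_def by blast
qed

lemma layer_O_add:
  assumes "layer_O d n g" "layer_O d n g'"
  shows "layer_O d n (\<lambda>h \<epsilon> t z. g h \<epsilon> t z + g' h \<epsilon> t z)"
proof -
  obtain C N \<eta> where 1: "0 \<le> C" "0 \<le> \<eta>" "d \<longrightarrow> 0 < \<eta>"
    "\<And>h \<epsilon> t z. dom h \<epsilon> t z \<Longrightarrow> norm (g h \<epsilon> t z) \<le> C * wt N \<epsilon> t z * rt4 \<epsilon> powr n * exp (- \<eta> * zeta \<epsilon> t z)"
    using assms(1) unfolding layer_O_def by auto
  obtain C' N' \<eta>' where 2: "0 \<le> C'" "0 \<le> \<eta>'" "d \<longrightarrow> 0 < \<eta>'"
    "\<And>h \<epsilon> t z. dom h \<epsilon> t z \<Longrightarrow> norm (g' h \<epsilon> t z) \<le> C' * wt N' \<epsilon> t z * rt4 \<epsilon> powr n * exp (- \<eta>' * zeta \<epsilon> t z)"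
    using assms(2) unfolding layer_O_def by auto
  have "norm (g h \<epsilon> t z + g' h \<epsilon> t z) \<le> (C + C') * wt (max N N') \<epsilon> t z * rt4 \<epsilon> powr n * exp (- min \<eta> \<eta>' * zeta \<epsilon> t z)"
    if "dom h \<epsilon> t z" for h \<epsilon> t z
  proof -
    have w: "C * wt N \<epsilon> t z * rt4 \<epsilon> powr n * exp (- \<eta> * zeta \<epsilon> t z) \<le> C * wt (max N N') \<epsilon> t z * rt4 \<epsilon> powr n * exp (- min \<eta> \<eta>' * zeta \<epsilon> t z)"
      using 1 2 wt_ge_1[of N \<epsilon> t z] wt_ge_1[of "max N N'" \<epsilon> t z] zeta_nonneg
      by (intro mult_mono wt_mono) (auto intro!: mult_right_mono mult_nonneg_nonneg)
    have w': "C' * wt N' \<epsilon> t z * rt4 \<epsilon> powr n * exp (- \<eta>' * zeta \<epsilon> t z) \<le> C' * wt (max N N') \<epsilon> t z * rt4 \<epsilon> powr n * exp (- min \<eta> \<eta>' * zeta \<epsilon> t z)"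
      using 1 2 wt_ge_1[of N' \<epsilon> t z] wt_ge_1[of "max N N'" \<epsilon> t z] zeta_nonneg
      by (intro mult_mono wt_mono) (auto intro!: mult_right_mono mult_nonneg_nonneg)
    have "norm (g h \<epsilon> t z + g' h \<epsilon> t z) \<le> norm (g h \<epsilon> t z) + norm (g' h \<epsilon> t z)" by (rule norm_triangle_ineq)
    also have "\<dots> \<le> C * wt (max N N') \<epsilon> t z * rt4 \<epsilon> powr n * exp (- min \<eta> \<eta>' * zeta \<epsilon> t z)
       + C' * wt (max N N') \<epsilon> t z * rt4 \<epsilon> powr n * exp (- min \<eta> \<eta>' * zeta \<epsilon> t z)"
      by (intro add_mono order.trans[OF 1(4)[OF that] w] order.trans[OF 2(4)[OF that] w'])
    finally show ?thesis by (simp add: distrib_right)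
  qed
  then show ?thesis unfolding layer_O_def using 1 2
    by (intro exI[of _ "C + C'"] exI[of _ "max N N'"] exI[of _ "min \<eta> \<eta>'"]) auto
qed

lemma layer_O_minus: "layer_O d n g \<Longrightarrow> layer_O d n (\<lambda>h \<epsilon> t z. - g h \<epsilon> t z)"
  unfolding layer_O_def by simp

lemma layer_O_diff: "layer_O d n g \<Longrightarrow> layer_O d n g' \<Longrightarrow> layer_O d n (\<lambda>h \<epsilon> t z. g h \<epsilon> t z - g' h \<epsilon> t z)"
  using layer_O_add[OF _ layer_O_minus, of d n g g'] by simp

lemma layer_O_mono:
  assumes "layer_O d n g" "m \<le> n" "d' \<longrightarrow> d"
  shows "layer_O d' m g"
proof -
  obtain C N \<eta> where 1: "0 \<le> C" "0 \<le> \<eta>" "d \<longrightarrow> 0 < \<eta>"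
    "\<And>h \<epsilon> t z. dom h \<epsilon> t z \<Longrightarrow> norm (g h \<epsilon> t z) \<le> C * wt N \<epsilon> t z * rt4 \<epsilon> powr n * exp (- \<eta> * zeta \<epsilon> t z)"
    using assms(1) unfolding layer_O_def by auto
  have "norm (g h \<epsilon> t z) \<le> C * wt N \<epsilon> t z * rt4 \<epsilon> powr m * exp (- \<eta> * zeta \<epsilon> t z)" if "dom h \<epsilon> t z" for h \<epsilon> t z
  proof -
    have "rt4 \<epsilon> powr n \<le> rt4 \<epsilon> powr m"
      using that assms(2) rt4_pos[of \<epsilon>] rt4_less_1[of \<epsilon>] by (intro powr_mono') (auto simp: dom_def)
    then have "C * wt N \<epsilon> t z * rt4 \<epsilon> powr n * exp (- \<eta> * zeta \<epsilon> t z) \<le> C * wt N \<epsilon> t z * rt4 \<epsilon> powr m * exp (- \<eta> * zeta \<epsilon> t z)"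
      using 1(1) wt_ge_1[of N \<epsilon> t z] by (intro mult_right_mono mult_left_mono) auto
    with 1(4)[OF that] show ?thesis by linarith
  qed
  then show ?thesis unfolding layer_O_def using 1 assms(3) by blast
qed

definition jet_O :: "bool \<Rightarrow> real \<Rightarrow> family \<Rightarrow> bool" where
  "jet_O d n F \<longleftrightarrow> layer_O d n (\<lambda>h \<epsilon> t z. jv (F h \<epsilon> t z)) \<and> layer_O d (n - 1) (\<lambda>h \<epsilon> t z. jz (F h \<epsilon> t z)) \<and>
    layer_O d (n - 2) (\<lambda>h \<epsilon> t z. jzz (F h \<epsilon> t z)) \<and> layer_O d (n - 2) (\<lambda>h \<epsilon> t z. jt (F h \<epsilon> t z))"

lemma layer_O_mult':
  assumes "layer_O d n g" "layer_O d' m g'" "d'' = (d \<or> d')" "k = n + m"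
  shows "layer_O d'' k (\<lambda>h \<epsilon> t z. g h \<epsilon> t z * g' h \<epsilon> t z)"
  using layer_O_mult[OF assms(1,2)] assms(3,4) by simp

lemma layer_O_two: "layer_O d n g \<Longrightarrow> layer_O d n (\<lambda>h \<epsilon> t z. 2 * g h \<epsilon> t z)"
  using layer_O_add[of d n g g] by (simp flip: mult_2)

lemma jet_O_add: "jet_O d n F \<Longrightarrow> jet_O d n G \<Longrightarrow> jet_O d n (jadd F G)"
  by (auto simp: jet_O_def jadd_def Let_def intro!: layer_O_add)

lemma jet_O_neg: "jet_O d n F \<Longrightarrow> jet_O d n (jneg F)"
  by (auto simp: jet_O_def jneg_def Let_def intro!: layer_O_minus)

lemma jet_O_mul:
  assumes F: "jet_O d n F" and G: "jet_O d' m G"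
  shows "jet_O (d \<or> d') (n + m) (jmul F G)"
proof -
  from F have F0: "layer_O d n (\<lambda>h \<epsilon> t z. jv (F h \<epsilon> t z))" and F1: "layer_O d (n - 1) (\<lambda>h \<epsilon> t z. jz (F h \<epsilon> t z))"
    and F2: "layer_O d (n - 2) (\<lambda>h \<epsilon> t z. jzz (F h \<epsilon> t z))" and F3: "layer_O d (n - 2) (\<lambda>h \<epsilon> t z. jt (F h \<epsilon> t z))"
    by (simp_all add: jet_O_def)
  from G have G0: "layer_O d' m (\<lambda>h \<epsilon> t z. jv (G h \<epsilon> t z))" and G1: "layer_O d' (m - 1) (\<lambda>h \<epsilon> t z. jz (G h \<epsilon> t z))"
    and G2: "layer_O d' (m - 2) (\<lambda>h \<epsilon> t z. jzz (G h \<epsilon> t z))" and G3: "layer_O d' (m - 2) (\<lambda>h \<epsilon> t z. jt (G h \<epsilon> t z))"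
    by (simp_all add: jet_O_def)
  show ?thesis unfolding jet_O_def jmul_def Let_def jet.sel
    by (intro conjI layer_O_add layer_O_two layer_O_mult'[OF F0 G0] layer_O_mult'[OF F1 G0] layer_O_mult'[OF F0 G1]
        layer_O_mult'[OF F2 G0] layer_O_mult'[OF F1 G1] layer_O_mult'[OF F0 G2] layer_O_mult'[OF F3 G0] layer_O_mult'[OF F0 G3]) auto
qed

text \<open>Orders are upper bounds, so the size of the inverse has to come in as a separate
  assumption. The derivatives of the inverse are then products of known orders.\<close>

lemma jet_O_inv:
  assumes F: "jet_O False n F" and i: "layer_O False (- n) (\<lambda>h \<epsilon> t z. inverse (jv (F h \<epsilon> t z)))"
  shows "jet_O False (- n) (jinv F)"
proof -
  note F = F[unfolded jet_O_def]
  have ii: "layer_O False (- (2 * n)) (\<lambda>h \<epsilon> t z. inverse (jv (F h \<epsilon> t z)) * inverse (jv (F h \<epsilon> t z)))"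
    by (rule layer_O_mult'[OF i i]) auto
  have iii: "layer_O False (- (3 * n)) (\<lambda>h \<epsilon> t z. inverse (jv (F h \<epsilon> t z)) * inverse (jv (F h \<epsilon> t z)) * inverse (jv (F h \<epsilon> t z)))"
    by (rule layer_O_mult'[OF ii i]) auto
  have zz: "layer_O False (2 * n - 2) (\<lambda>h \<epsilon> t z. jz (F h \<epsilon> t z) * jz (F h \<epsilon> t z))"
    by (rule layer_O_mult'[OF F[THEN conjunct2, THEN conjunct1] F[THEN conjunct2, THEN conjunct1]]) auto
  show ?thesis unfolding jet_O_def jinv_def Let_def jet.sel
  proof (intro conjI layer_O_minus layer_O_diff layer_O_two)
    show "layer_O False (- n) (\<lambda>h \<epsilon> t z. inverse (jv (F h \<epsilon> t z)))" by (rule i)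
    show "layer_O False (- n - 1) (\<lambda>h \<epsilon> t z. jz (F h \<epsilon> t z) * (inverse (jv (F h \<epsilon> t z)) * inverse (jv (F h \<epsilon> t z))))"
      by (rule layer_O_mult'[OF F[THEN conjunct2, THEN conjunct1] ii]) auto
    show "layer_O False (- n - 2) (\<lambda>h \<epsilon> t z. jzz (F h \<epsilon> t z) * (inverse (jv (F h \<epsilon> t z)) * inverse (jv (F h \<epsilon> t z))))"
      by (rule layer_O_mult'[OF F[THEN conjunct2, THEN conjunct2, THEN conjunct1] ii]) auto
    show "layer_O False (- n - 2) (\<lambda>h \<epsilon> t z. jt (F h \<epsilon> t z) * (inverse (jv (F h \<epsilon> t z)) * inverse (jv (F h \<epsilon> t z))))"
      by (rule layer_O_mult'[OF F[THEN conjunct2, THEN conjunct2, THEN conjunct2] ii]) auto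
    show "layer_O False (- n - 2) (\<lambda>h \<epsilon> t z. jz (F h \<epsilon> t z) * jz (F h \<epsilon> t z) *
       (inverse (jv (F h \<epsilon> t z)) * inverse (jv (F h \<epsilon> t z)) * inverse (jv (F h \<epsilon> t z))))"
      by (rule layer_O_mult'[OF zz iii]) auto
  qed
qed

lemma jet_O_mono: "jet_O d n F \<Longrightarrow> m \<le> n \<Longrightarrow> (d' \<longrightarrow> d) \<Longrightarrow> jet_O d' m F"
  unfolding jet_O_def
  by (elim conjE, intro conjI)
     (rule layer_O_mono, assumption, simp, assumption)+

section \<open>Differentiability, localization and matching of families\<close>

definition jet_deriv :: "(real \<Rightarrow> real \<Rightarrow> jet) \<Rightarrow> real \<Rightarrow> real \<Rightarrow> bool" where
  "jet_deriv J t z \<longleftrightarrow> ((\<lambda>z. jv (J t z)) has_vector_derivative jz (J t z)) (at z) \<and>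
      ((\<lambda>z. jz (J t z)) has_vector_derivative jzz (J t z)) (at z) \<and>
      ((\<lambda>s. jv (J s z)) has_vector_derivative jt (J t z)) (at t within {0..<t1})"

definition jet_cont :: "(real \<Rightarrow> real \<Rightarrow> jet) \<Rightarrow> bool" where
  "jet_cont J \<longleftrightarrow> continuous_on ({0..<t1} \<times> {0<..}) (\<lambda>x. jv (J (fst x) (snd x))) \<and>
    continuous_on ({0..<t1} \<times> {0<..}) (\<lambda>x. jz (J (fst x) (snd x))) \<and>
    continuous_on ({0..<t1} \<times> {0<..}) (\<lambda>x. jzz (J (fst x) (snd x))) \<and>
    continuous_on ({0..<t1} \<times> {0<..}) (\<lambda>x. jt (J (fst x) (snd x)))"

definition is_jet :: "family \<Rightarrow> bool" where
  "is_jet F \<longleftrightarrow> (\<forall>h \<epsilon>. 0 < \<epsilon> \<longrightarrow> \<epsilon> < 1 \<longrightarrow>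
    (\<forall>t z. 0 \<le> t \<longrightarrow> t < t1 \<longrightarrow> 0 < z \<longrightarrow> jet_deriv (F h \<epsilon>) t z) \<and> jet_cont (F h \<epsilon>))"

lemma is_jet_jet_deriv:
  "is_jet F \<Longrightarrow> 0 < \<epsilon> \<Longrightarrow> \<epsilon> < 1 \<Longrightarrow> 0 \<le> t \<Longrightarrow> t < t1 \<Longrightarrow> 0 < z \<Longrightarrow> jet_deriv (F h \<epsilon>) t z"
  by (simp add: is_jet_def)

lemma is_jet_jet_cont: "is_jet F \<Longrightarrow> 0 < \<epsilon> \<Longrightarrow> \<epsilon> < 1 \<Longrightarrow> jet_cont (F h \<epsilon>)"
  by (simp add: is_jet_def)

lemma is_jetD:
  assumes "is_jet F" "0 < \<epsilon>" "\<epsilon> < 1"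
  shows "\<And>t z. 0 \<le> t \<Longrightarrow> t < t1 \<Longrightarrow> 0 < z \<Longrightarrow> ((\<lambda>z. jv (F h \<epsilon> t z)) has_vector_derivative jz (F h \<epsilon> t z)) (at z)"
    "\<And>t z. 0 \<le> t \<Longrightarrow> t < t1 \<Longrightarrow> 0 < z \<Longrightarrow> ((\<lambda>z. jz (F h \<epsilon> t z)) has_vector_derivative jzz (F h \<epsilon> t z)) (at z)"
    "\<And>t z. 0 \<le> t \<Longrightarrow> t < t1 \<Longrightarrow> 0 < z \<Longrightarrow> ((\<lambda>s. jv (F h \<epsilon> s z)) has_vector_derivative jt (F h \<epsilon> t z)) (at t within {0..<t1})"
    "continuous_on ({0..<t1} \<times> {0<..}) (\<lambda>x. jv (F h \<epsilon> (fst x) (snd x)))"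
    "continuous_on ({0..<t1} \<times> {0<..}) (\<lambda>x. jz (F h \<epsilon> (fst x) (snd x)))"
    "continuous_on ({0..<t1} \<times> {0<..}) (\<lambda>x. jzz (F h \<epsilon> (fst x) (snd x)))"
    "continuous_on ({0..<t1} \<times> {0<..}) (\<lambda>x. jt (F h \<epsilon> (fst x) (snd x)))"
proof -
  note D = is_jet_jet_deriv[OF assms, where h=h, unfolded jet_deriv_def]
  show "\<And>t z. 0 \<le> t \<Longrightarrow> t < t1 \<Longrightarrow> 0 < z \<Longrightarrow> ((\<lambda>z. jv (F h \<epsilon> t z)) has_vector_derivative jz (F h \<epsilon> t z)) (at z)"
    by (rule D[THEN conjunct1]) assumption+
  show "\<And>t z. 0 \<le> t \<Longrightarrow> t < t1 \<Longrightarrow> 0 < z \<Longrightarrow> ((\<lambda>z. jz (F h \<epsilon> t z)) has_vector_derivative jzz (F h \<epsilon> t z)) (at z)"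
    by (rule D[THEN conjunct2, THEN conjunct1]) assumption+
  show "\<And>t z. 0 \<le> t \<Longrightarrow> t < t1 \<Longrightarrow> 0 < z \<Longrightarrow> ((\<lambda>s. jv (F h \<epsilon> s z)) has_vector_derivative jt (F h \<epsilon> t z)) (at t within {0..<t1})"
    by (rule D[THEN conjunct2, THEN conjunct2]) assumption+
qed (use is_jet_jet_cont[OF assms, where h=h, unfolded jet_cont_def] in simp_all)

lemma is_jetI:
  assumes "\<And>h \<epsilon> t z. 0 < \<epsilon> \<Longrightarrow> \<epsilon> < 1 \<Longrightarrow> 0 \<le> t \<Longrightarrow> t < t1 \<Longrightarrow> 0 < z \<Longrightarrow> ((\<lambda>z. jv (F h \<epsilon> t z)) has_vector_derivative jz (F h \<epsilon> t z)) (at z)"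
    "\<And>h \<epsilon> t z. 0 < \<epsilon> \<Longrightarrow> \<epsilon> < 1 \<Longrightarrow> 0 \<le> t \<Longrightarrow> t < t1 \<Longrightarrow> 0 < z \<Longrightarrow> ((\<lambda>z. jz (F h \<epsilon> t z)) has_vector_derivative jzz (F h \<epsilon> t z)) (at z)"
    "\<And>h \<epsilon> t z. 0 < \<epsilon> \<Longrightarrow> \<epsilon> < 1 \<Longrightarrow> 0 \<le> t \<Longrightarrow> t < t1 \<Longrightarrow> 0 < z \<Longrightarrow> ((\<lambda>s. jv (F h \<epsilon> s z)) has_vector_derivative jt (F h \<epsilon> t z)) (at t within {0..<t1})"
    "\<And>h \<epsilon>. 0 < \<epsilon> \<Longrightarrow> \<epsilon> < 1 \<Longrightarrow> continuous_on ({0..<t1} \<times> {0<..}) (\<lambda>x. jv (F h \<epsilon> (fst x) (snd x)))"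
    "\<And>h \<epsilon>. 0 < \<epsilon> \<Longrightarrow> \<epsilon> < 1 \<Longrightarrow> continuous_on ({0..<t1} \<times> {0<..}) (\<lambda>x. jz (F h \<epsilon> (fst x) (snd x)))"
    "\<And>h \<epsilon>. 0 < \<epsilon> \<Longrightarrow> \<epsilon> < 1 \<Longrightarrow> continuous_on ({0..<t1} \<times> {0<..}) (\<lambda>x. jzz (F h \<epsilon> (fst x) (snd x)))"
    "\<And>h \<epsilon>. 0 < \<epsilon> \<Longrightarrow> \<epsilon> < 1 \<Longrightarrow> continuous_on ({0..<t1} \<times> {0<..}) (\<lambda>x. jt (F h \<epsilon> (fst x) (snd x)))"
  shows "is_jet F"
  unfolding is_jet_def jet_deriv_def jet_cont_def by (intro allI impI conjI assms)

lemma is_jet_add: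
  assumes F: "is_jet F" and G: "is_jet G"
  shows "is_jet (jadd F G)"
proof (rule is_jetI)
  fix h :: bool and \<epsilon> :: real assume e: "0 < \<epsilon>" "\<epsilon> < 1"
  note F' = is_jetD[OF F e, where h=h] and G' = is_jetD[OF G e, where h=h]
  { fix t z :: real assume tz: "0 \<le> t" "t < t1" "0 < z"
    show "((\<lambda>z. jv (jadd F G h \<epsilon> t z)) has_vector_derivative jz (jadd F G h \<epsilon> t z)) (at z)"
      "((\<lambda>z. jz (jadd F G h \<epsilon> t z)) has_vector_derivative jzz (jadd F G h \<epsilon> t z)) (at z)"
      "((\<lambda>s. jv (jadd F G h \<epsilon> s z)) has_vector_derivative jt (jadd F G h \<epsilon> t z)) (at t within {0..<t1})"
      unfolding jadd_def Let_def jet.sel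
      by (intro has_vector_derivative_add F'(1-3) G'(1-3) tz)+ }
  show "continuous_on ({0..<t1} \<times> {0<..}) (\<lambda>x. jv (jadd F G h \<epsilon> (fst x) (snd x)))"
    "continuous_on ({0..<t1} \<times> {0<..}) (\<lambda>x. jz (jadd F G h \<epsilon> (fst x) (snd x)))"
    "continuous_on ({0..<t1} \<times> {0<..}) (\<lambda>x. jzz (jadd F G h \<epsilon> (fst x) (snd x)))"
    "continuous_on ({0..<t1} \<times> {0<..}) (\<lambda>x. jt (jadd F G h \<epsilon> (fst x) (snd x)))"
    unfolding jadd_def Let_def jet.sel by (intro continuous_on_add F'(4-7) G'(4-7))+
qed

lemma is_jet_neg:
  assumes F: "is_jet F"
  shows "is_jet (jneg F)"
proof (rule is_jetI)
  fix h :: bool and \<epsilon> :: real assume e: "0 < \<epsilon>" "\<epsilon> < 1"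
  note F' = is_jetD[OF F e, where h=h]
  { fix t z :: real assume tz: "0 \<le> t" "t < t1" "0 < z"
    show "((\<lambda>z. jv (jneg F h \<epsilon> t z)) has_vector_derivative jz (jneg F h \<epsilon> t z)) (at z)"
      "((\<lambda>z. jz (jneg F h \<epsilon> t z)) has_vector_derivative jzz (jneg F h \<epsilon> t z)) (at z)"
      "((\<lambda>s. jv (jneg F h \<epsilon> s z)) has_vector_derivative jt (jneg F h \<epsilon> t z)) (at t within {0..<t1})"
      unfolding jneg_def Let_def jet.sel
      by (intro has_vector_derivative_minus F'(1-3) tz)+ }
  show "continuous_on ({0..<t1} \<times> {0<..}) (\<lambda>x. jv (jneg F h \<epsilon> (fst x) (snd x)))"
    "continuous_on ({0..<t1} \<times> {0<..}) (\<lambda>x. jz (jneg F h \<epsilon> (fst x) (snd x)))"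
    "continuous_on ({0..<t1} \<times> {0<..}) (\<lambda>x. jzz (jneg F h \<epsilon> (fst x) (snd x)))"
    "continuous_on ({0..<t1} \<times> {0<..}) (\<lambda>x. jt (jneg F h \<epsilon> (fst x) (snd x)))"
    unfolding jneg_def Let_def jet.sel by (intro continuous_on_minus F'(4-7))+
qed

lemma has_vector_derivative_mult':
  fixes g h :: "real \<Rightarrow> complex"
  assumes "(g has_vector_derivative g') (at x within S)" "(h has_vector_derivative h') (at x within S)"
  shows "((\<lambda>x. g x * h x) has_vector_derivative (g' * h x + g x * h')) (at x within S)"
  using has_vector_derivative_mult[OF assms] by (simp add: add.commute)

lemma is_jet_mul:
  assumes F: "is_jet F" and G: "is_jet G"
  shows "is_jet (jmul F G)"
proof (rule is_jetI)
  fix h :: bool and \<epsilon> :: real assume e: "0 < \<epsilon>" "\<epsilon> < 1"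
  note F' = is_jetD[OF F e, where h=h] and G' = is_jetD[OF G e, where h=h]
  { fix t z :: real assume tz: "0 \<le> t" "t < t1" "0 < z"
    show "((\<lambda>z. jv (jmul F G h \<epsilon> t z)) has_vector_derivative jz (jmul F G h \<epsilon> t z)) (at z)"
      "((\<lambda>s. jv (jmul F G h \<epsilon> s z)) has_vector_derivative jt (jmul F G h \<epsilon> t z)) (at t within {0..<t1})"
      unfolding jmul_def Let_def jet.sel
      by (intro has_vector_derivative_mult' F'(1-3) G'(1-3) tz)+
    have "((\<lambda>z. jz (F h \<epsilon> t z) * jv (G h \<epsilon> t z) + jv (F h \<epsilon> t z) * jz (G h \<epsilon> t z)) has_vector_derivative
      (jzz (F h \<epsilon> t z) * jv (G h \<epsilon> t z) + jz (F h \<epsilon> t z) * jz (G h \<epsilon> t z)) +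
      (jz (F h \<epsilon> t z) * jz (G h \<epsilon> t z) + jv (F h \<epsilon> t z) * jzz (G h \<epsilon> t z))) (at z)"
      by (intro has_vector_derivative_add has_vector_derivative_mult' F'(1-3) G'(1-3) tz)
    then show "((\<lambda>z. jz (jmul F G h \<epsilon> t z)) has_vector_derivative jzz (jmul F G h \<epsilon> t z)) (at z)"
      unfolding jmul_def Let_def jet.sel by (simp add: algebra_simps) }
  show "continuous_on ({0..<t1} \<times> {0<..}) (\<lambda>x. jv (jmul F G h \<epsilon> (fst x) (snd x)))"
    "continuous_on ({0..<t1} \<times> {0<..}) (\<lambda>x. jz (jmul F G h \<epsilon> (fst x) (snd x)))"
    "continuous_on ({0..<t1} \<times> {0<..}) (\<lambda>x. jzz (jmul F G h \<epsilon> (fst x) (snd x)))"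
    "continuous_on ({0..<t1} \<times> {0<..}) (\<lambda>x. jt (jmul F G h \<epsilon> (fst x) (snd x)))"
    unfolding jmul_def Let_def jet.sel
    by (intro continuous_on_add continuous_on_mult continuous_on_const F'(4-7) G'(4-7))+
qed

lemma has_vector_derivative_inverse':
  fixes g :: "real \<Rightarrow> complex"
  assumes "(g has_vector_derivative g') (at x within S)" "g x \<noteq> 0"
  shows "((\<lambda>x. inverse (g x)) has_vector_derivative (- (g' * (inverse (g x) * inverse (g x))))) (at x within S)"
proof -
  have "((\<lambda>x. inverse (g x)) has_derivative (\<lambda>h. - (inverse (g x) * (h *\<^sub>R g') * inverse (g x)))) (at x within S)"
    by (rule Deriv.has_derivative_inverse[where f=g and x=x,
          OF assms(2) assms(1)[unfolded has_vector_derivative_def]])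
  then show ?thesis by (simp add: has_vector_derivative_def algebra_simps)
qed

lemma is_jet_inv:
  assumes F: "is_jet F" and nz: "\<And>h \<epsilon> t z. 0 < \<epsilon> \<Longrightarrow> \<epsilon> < 1 \<Longrightarrow> 0 \<le> t \<Longrightarrow> t < t1 \<Longrightarrow> 0 < z \<Longrightarrow> jv (F h \<epsilon> t z) \<noteq> 0"
  shows "is_jet (jinv F)"
proof (rule is_jetI)
  fix h :: bool and \<epsilon> :: real assume e: "0 < \<epsilon>" "\<epsilon> < 1"
  note F' = is_jetD[OF F e, where h=h]
  { fix t z :: real assume tz: "0 \<le> t" "t < t1" "0 < z"
    note n = nz[OF e tz, of h]
    let ?i = "\<lambda>z. inverse (jv (F h \<epsilon> t z))"
    show "((\<lambda>z. jv (jinv F h \<epsilon> t z)) has_vector_derivative jz (jinv F h \<epsilon> t z)) (at z)"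
      "((\<lambda>s. jv (jinv F h \<epsilon> s z)) has_vector_derivative jt (jinv F h \<epsilon> t z)) (at t within {0..<t1})"
      unfolding jinv_def Let_def jet.sel
      by (intro has_vector_derivative_inverse' F'(1-3) tz n)+
    have i: "(?i has_vector_derivative (- (jz (F h \<epsilon> t z) * (?i z * ?i z)))) (at z)"
      by (intro has_vector_derivative_inverse' F'(1-3) tz n)
    have "((\<lambda>z. - (jz (F h \<epsilon> t z) * (?i z * ?i z))) has_vector_derivative
      - (jzz (F h \<epsilon> t z) * (?i z * ?i z) + jz (F h \<epsilon> t z) *
        (- (jz (F h \<epsilon> t z) * (?i z * ?i z)) * ?i z + ?i z * (- (jz (F h \<epsilon> t z) * (?i z * ?i z)))))) (at z)"
      by (intro has_vector_derivative_minus has_vector_derivative_mult' F'(1-3) tz i)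
    then show "((\<lambda>z. jz (jinv F h \<epsilon> t z)) has_vector_derivative jzz (jinv F h \<epsilon> t z)) (at z)"
      unfolding jinv_def Let_def jet.sel by (simp add: algebra_simps) }
  have ci: "continuous_on ({0..<t1} \<times> {0<..}) (\<lambda>x. inverse (jv (F h \<epsilon> (fst x) (snd x))))"
    by (intro continuous_on_inverse F'(4)) (use nz e in auto)
  show "continuous_on ({0..<t1} \<times> {0<..}) (\<lambda>x. jv (jinv F h \<epsilon> (fst x) (snd x)))"
    "continuous_on ({0..<t1} \<times> {0<..}) (\<lambda>x. jz (jinv F h \<epsilon> (fst x) (snd x)))"
    "continuous_on ({0..<t1} \<times> {0<..}) (\<lambda>x. jzz (jinv F h \<epsilon> (fst x) (snd x)))"
    "continuous_on ({0..<t1} \<times> {0<..}) (\<lambda>x. jt (jinv F h \<epsilon> (fst x) (snd x)))"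
    unfolding jinv_def Let_def jet.sel
    by (intro continuous_on_diff continuous_on_minus continuous_on_mult continuous_on_const F'(4-7) ci)+
qed

text \<open>\<open>layer_O\<close> makes no claim outside the window |z - f| \<le> \<delta>. This
  notion supplies the complement: there all four components vanish, including those on the boundary
  of the window.\<close>

definition localized :: "family \<Rightarrow> bool" where
  "localized F \<longleftrightarrow> (\<forall>h \<epsilon> t z. \<delta> \<le> \<bar>z - f t\<bar> \<longrightarrow> F h \<epsilon> t z = Jet 0 0 0 0)"

lemma localized_add: "localized F \<Longrightarrow> localized G \<Longrightarrow> localized (jadd F G)"
  by (auto simp: localized_def jadd_def)

lemma localized_neg: "localized F \<Longrightarrow> localized (jneg F)"
  by (auto simp: localized_def jneg_def)

lemma localized_mul: "localized F \<or> localized G \<Longrightarrow> localized (jmul F G)"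
  by (auto simp: localized_def jmul_def)

definition matched :: "family \<Rightarrow> bool" where
  "matched F \<longleftrightarrow> (\<forall>\<epsilon> t. 0 < \<epsilon> \<and> \<epsilon> < 1 \<and> 0 \<le> t \<and> t < t1 \<longrightarrow>
     jv (F False \<epsilon> t (f t)) = jv (F True \<epsilon> t (f t)) \<and> jz (F False \<epsilon> t (f t)) = jz (F True \<epsilon> t (f t)))"

lemma matched_add: "matched F \<Longrightarrow> matched G \<Longrightarrow> matched (jadd F G)"
  by (simp add: matched_def jadd_def Let_def)

lemma matched_neg: "matched F \<Longrightarrow> matched (jneg F)"
  by (simp add: matched_def jneg_def Let_def)

lemma matched_mul: "matched F \<Longrightarrow> matched G \<Longrightarrow> matched (jmul F G)"
  by (simp add: matched_def jmul_def Let_def)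

lemma matched_indep: "(\<And>\<epsilon> t z. F False \<epsilon> t z = F True \<epsilon> t z) \<Longrightarrow> matched F"
  by (auto simp: matched_def)

lemma f_lipschitz:
  assumes "0 \<le> s" "s < t1" "0 \<le> t" "t < t1"
  shows "\<bar>f s - f t\<bar> \<le> Mf * \<bar>s - t\<bar>"
  using vector_derivative_lipschitz[of "{0..<t1}" f f' Mf s t] assms f_deriv f'_bound
  by (auto simp flip: has_real_derivative_iff_has_vector_derivative)

lemma glued_jets:
  assumes F: "is_jet F" and a: "matched F" and e: "0 < \<epsilon>" "\<epsilon> < 1"
  shows "glued (\<lambda>h t z. jv (F h \<epsilon> t z)) (\<lambda>h t z. jz (F h \<epsilon> t z)) (\<lambda>h t z. jzz (F h \<epsilon> t z))
    (\<lambda>h t z. jt (F h \<epsilon> t z)) f t1 Mf"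
proof
  show "0 < f s" if "0 \<le> s" "s < t1" for s using f_gt[OF that] \<delta> by simp
qed (use is_jetD[OF F e] f_lipschitz a e in \<open>auto simp: matched_def\<close>)

end

section \<open>Elementary families: constants, powers of the width, shear flows and their
  traces\<close>

context jet_setting
begin

definition const_jet :: "complex \<Rightarrow> family" where
  "const_jet c h \<epsilon> t z = Jet c 0 0 0"

definition eps_jet :: "nat \<Rightarrow> family" where
  "eps_jet n h \<epsilon> t z = Jet (of_real (rt4 \<epsilon> ^ n)) 0 0 0"

definition side_jet :: family where
  "side_jet h \<epsilon> t z = Jet (if h then 1 else 0) 0 0 0"

definition time_jet :: "(real \<Rightarrow> real) \<Rightarrow> (real \<Rightarrow> real) \<Rightarrow> family" where
  "time_jet g g' h \<epsilon> t z = Jet (of_real (g t)) 0 0 (of_real (g' t))"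

lemma is_jet_const_jet: "is_jet (const_jet c)" and is_jet_eps_jet: "is_jet (eps_jet n)" and is_jet_side_jet: "is_jet side_jet"
  by (rule is_jetI; simp add: const_jet_def eps_jet_def side_jet_def)+

lemma of_real_has_vector_derivative:
  "(g has_real_derivative d) F \<Longrightarrow> ((\<lambda>x. of_real (g x) :: complex) has_vector_derivative of_real d) F"
  unfolding has_real_derivative_iff_has_vector_derivative
  by (rule bounded_linear.has_vector_derivative[OF bounded_linear_of_real])

lemma is_jet_time_jet:
  assumes "\<And>t. 0 \<le> t \<Longrightarrow> t < t1 \<Longrightarrow> (g has_real_derivative g' t) (at t within {0..<t1})"
    and c': "continuous_on {0..<t1} g'"
  shows "is_jet (time_jet g g')"
proof -
  have c: "continuous_on {0..<t1} g" by (rule DERIV_continuous_on) (use assms in auto)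
  have "continuous_on ({0..<t1} \<times> {0<..}) (\<lambda>x. of_real (k (fst x)) :: complex)"
    if "continuous_on {0..<t1} k" for k :: "real \<Rightarrow> real"
    by (intro continuous_on_of_real continuous_on_compose2[OF that] continuous_intros) auto
  from this[OF c] this[OF c'] show ?thesis
    by (intro is_jetI) (auto simp: time_jet_def intro!: of_real_has_vector_derivative assms(1))
qed

lemma layer_O_zero: "layer_O d n (\<lambda>h \<epsilon> t z. 0)"
  unfolding layer_O_def by (intro exI[of _ 0] exI[of _ 1]) auto

lemma layer_O_rt4: "layer_O False (real n) (\<lambda>h \<epsilon> t z. of_real (rt4 \<epsilon> ^ n))"
proof (rule layer_O_I[where C=1 and N=0])
  fix h \<epsilon> t z assume "dom h \<epsilon> t z"
  then have "0 < rt4 \<epsilon>" by (auto simp: dom_def rt4_pos)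
  then show "norm (of_real (rt4 \<epsilon> ^ n) :: complex) \<le> 1 * wt 0 \<epsilon> t z * rt4 \<epsilon> powr real n"
    by (simp add: wt_def powr_realpow norm_power)
qed simp

lemma jet_O_const_jet: "jet_O False 0 (const_jet c)"
  unfolding jet_O_def const_jet_def jet.sel by (intro conjI layer_O_zero layer_O_bounded[of _ "norm c"]) simp

lemma jet_O_eps_jet: "jet_O False (real n) (eps_jet n)"
  unfolding jet_O_def eps_jet_def jet.sel by (intro conjI layer_O_zero layer_O_rt4)

lemma layer_O_bounded': 
  assumes "\<And>h \<epsilon> t z. dom h \<epsilon> t z \<Longrightarrow> norm (g h \<epsilon> t z) \<le> C" "n \<le> 0"
  shows "layer_O False n g"
  by (rule layer_O_mono[OF layer_O_bounded[OF assms(1)] assms(2)]) auto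

lemma jet_O_bounded:
  assumes "\<And>h \<epsilon> t z. dom h \<epsilon> t z \<Longrightarrow> norm (jv (F h \<epsilon> t z)) \<le> C"
    "\<And>h \<epsilon> t z. dom h \<epsilon> t z \<Longrightarrow> norm (jz (F h \<epsilon> t z)) \<le> C"
    "\<And>h \<epsilon> t z. dom h \<epsilon> t z \<Longrightarrow> norm (jzz (F h \<epsilon> t z)) \<le> C"
    "\<And>h \<epsilon> t z. dom h \<epsilon> t z \<Longrightarrow> norm (jt (F h \<epsilon> t z)) \<le> C"
  shows "jet_O False 0 F"
  unfolding jet_O_def by (intro conjI layer_O_bounded'[of _ C] assms) auto

lemma jet_O_time_jet:
  assumes "\<And>t. 0 \<le> t \<Longrightarrow> t < t1 \<Longrightarrow> \<bar>g t\<bar> \<le> C" "\<And>t. 0 \<le> t \<Longrightarrow> t < t1 \<Longrightarrow> \<bar>g' t\<bar> \<le> C"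
  shows "jet_O False 0 (time_jet g g')"
proof -
  have "0 \<le> C" using assms(1)[of 0] t1 by auto
  then show ?thesis by (intro jet_O_bounded[of _ C]) (auto simp: time_jet_def dom_def assms)
qed

text \<open>The last two entries coincide because the time derivative equals the second
  z-derivative, for a shear flow as well as for its first z-derivative.\<close>

definition flow_jet :: "(real \<Rightarrow> real \<Rightarrow> real) \<Rightarrow> family" where
  "flow_jet u h \<epsilon> t z = Jet (of_real (u t z)) (of_real (dz u t z)) (of_real (dz (dz u) t z)) (of_real (dz (dz u) t z))"

lemma is_jet_flow_jet: 
  assumes "regular u"
  shows "is_jet (flow_jet u)"
proof (rule is_jetI)
  fix h :: bool and \<epsilon> t z :: real assume tz: "0 \<le> t" "t < t1" "0 < z"
  note R = assms[unfolded regular_def, THEN conjunct1, rule_format, OF tz(1,3)]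
  show "((\<lambda>z. jv (flow_jet u h \<epsilon> t z)) has_vector_derivative jz (flow_jet u h \<epsilon> t z)) (at z)"
    "((\<lambda>z. jz (flow_jet u h \<epsilon> t z)) has_vector_derivative jzz (flow_jet u h \<epsilon> t z)) (at z)"
    unfolding flow_jet_def jet.sel using R by (auto intro!: of_real_has_vector_derivative)
  show "((\<lambda>s. jv (flow_jet u h \<epsilon> s z)) has_vector_derivative jt (flow_jet u h \<epsilon> t z)) (at t within {0..<t1})"
    unfolding flow_jet_def jet.sel using R
    by (intro of_real_has_vector_derivative) (auto intro: has_field_derivative_subset)
next
  have c: "continuous_on ({0..<t1} \<times> {0<..}) (\<lambda>x. of_real (k (fst x) (snd x)) :: complex)"
    if "jointly_continuous k" for k :: "real \<Rightarrow> real \<Rightarrow> real"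
    by (intro continuous_on_of_real continuous_on_subset[OF that]) auto
  fix h :: bool and \<epsilon> :: real
  have jc: "jointly_continuous u" "jointly_continuous (dz u)" "jointly_continuous (dz (dz u))"
    using assms by (simp_all add: regular_def)
  show "continuous_on ({0..<t1} \<times> {0<..}) (\<lambda>x. jv (flow_jet u h \<epsilon> (fst x) (snd x)))"
    "continuous_on ({0..<t1} \<times> {0<..}) (\<lambda>x. jz (flow_jet u h \<epsilon> (fst x) (snd x)))"
    "continuous_on ({0..<t1} \<times> {0<..}) (\<lambda>x. jzz (flow_jet u h \<epsilon> (fst x) (snd x)))"
    "continuous_on ({0..<t1} \<times> {0<..}) (\<lambda>x. jt (flow_jet u h \<epsilon> (fst x) (snd x)))"
    unfolding flow_jet_def jet.sel by (rule c[OF jc(1)] c[OF jc(2)] c[OF jc(3)])+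
qed

lemma is_jet_flow_jet_dz:
  assumes "regular u"
  shows "is_jet (flow_jet (dz u))"
proof (rule is_jetI)
  fix h :: bool and \<epsilon> t z :: real assume tz: "0 \<le> t" "t < t1" "0 < z"
  note R = assms[unfolded regular_def, THEN conjunct1, rule_format, OF tz(1,3)]
  show "((\<lambda>z. jv (flow_jet (dz u) h \<epsilon> t z)) has_vector_derivative jz (flow_jet (dz u) h \<epsilon> t z)) (at z)"
    "((\<lambda>z. jz (flow_jet (dz u) h \<epsilon> t z)) has_vector_derivative jzz (flow_jet (dz u) h \<epsilon> t z)) (at z)"
    unfolding flow_jet_def jet.sel using R by (auto intro!: of_real_has_vector_derivative)
  show "((\<lambda>s. jv (flow_jet (dz u) h \<epsilon> s z)) has_vector_derivative jt (flow_jet (dz u) h \<epsilon> t z)) (at t within {0..<t1})"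
    unfolding flow_jet_def jet.sel using R
    by (intro of_real_has_vector_derivative) (auto intro: has_field_derivative_subset)
next
  have c: "continuous_on ({0..<t1} \<times> {0<..}) (\<lambda>x. of_real (k (fst x) (snd x)) :: complex)"
    if "jointly_continuous k" for k :: "real \<Rightarrow> real \<Rightarrow> real"
    by (intro continuous_on_of_real continuous_on_subset[OF that]) auto
  fix h :: bool and \<epsilon> :: real
  have jc: "jointly_continuous (dz u)" "jointly_continuous (dz (dz u))" "jointly_continuous (dz (dz (dz u)))"
    using assms by (simp_all add: regular_def)
  show "continuous_on ({0..<t1} \<times> {0<..}) (\<lambda>x. jv (flow_jet (dz u) h \<epsilon> (fst x) (snd x)))"
    "continuous_on ({0..<t1} \<times> {0<..}) (\<lambda>x. jz (flow_jet (dz u) h \<epsilon> (fst x) (snd x)))"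
    "continuous_on ({0..<t1} \<times> {0<..}) (\<lambda>x. jzz (flow_jet (dz u) h \<epsilon> (fst x) (snd x)))"
    "continuous_on ({0..<t1} \<times> {0<..}) (\<lambda>x. jt (flow_jet (dz u) h \<epsilon> (fst x) (snd x)))"
    unfolding flow_jet_def jet.sel by (rule c[OF jc(1)] c[OF jc(2)] c[OF jc(3)])+
qed

lemma f_cont: "continuous_on {0..<t1} f"
  by (rule DERIV_continuous_on) (use f_deriv in auto)

text \<open>These four derivatives are the ones that occur in the jets of \<open>dz u\<close> and of
  the traces of \<open>dz u\<close> and \<open>dz (dz u)\<close> along the interface.\<close>

definition layer_bounded :: "(real \<Rightarrow> real \<Rightarrow> real) \<Rightarrow> real \<Rightarrow> bool" where
  "layer_bounded u M \<longleftrightarrow> (\<forall>t z. 0 \<le> t \<longrightarrow> t < t1 \<longrightarrow> \<bar>z - f t\<bar> \<le> \<delta> \<longrightarrow>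
     \<bar>dz u t z\<bar> \<le> M \<and> \<bar>dz (dz u) t z\<bar> \<le> M \<and> \<bar>dz (dz (dz u)) t z\<bar> \<le> M \<and> \<bar>dt (dz (dz u)) t z\<bar> \<le> M)"

lemma jet_O_flow_jet_dz: "layer_bounded u M \<Longrightarrow> jet_O False 0 (flow_jet (dz u))"
  by (rule jet_O_bounded[of _ M]) (auto simp: flow_jet_def layer_bounded_def dom_def)

text \<open>Chain rule along the path s -> (s, f s). The path starts on the boundary t = 0, where
  the time derivative is one-sided; continuity of the z-derivative in both variables makes g
  differentiable within the quarter plane.\<close>

lemma trace_deriv:
  assumes gt: "\<And>t z. 0 \<le> t \<Longrightarrow> 0 < z \<Longrightarrow> ((\<lambda>s. g s z) has_real_derivative gt t z) (at t within {0..})"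
    and gz: "\<And>t z. 0 \<le> t \<Longrightarrow> 0 < z \<Longrightarrow> (g t has_real_derivative gz t z) (at z)"
    and c: "jointly_continuous gz"
    and t: "0 \<le> t" "t < t1"
  shows "((\<lambda>t. g t (f t)) has_real_derivative gt t (f t) + gz t (f t) * f' t) (at t within {0..<t1})"
proof -
  have ft: "0 < f t" using f_gt[OF t] \<delta> by simp
  have "((\<lambda>(s, z). g s z) has_derivative (\<lambda>(ts, tz). gt t (f t) * ts + blinfun_scaleR_left (gz t (f t)) tz)) (at (t, f t) within {0..} \<times> {0<..})"
  proof (rule has_derivative_partialsI[where fy="\<lambda>s z. blinfun_scaleR_left (gz s z)"])
    show "((\<lambda>s. g s (f t)) has_derivative (*) (gt t (f t))) (at t within {0..})"
      using gt[OF t(1) ft] by (simp add: has_field_derivative_def)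
    show "(g x has_derivative blinfun_apply (blinfun_scaleR_left (gz x y))) (at y within {0<..})"
      if "x \<in> {0..}" "y \<in> {0<..}" for x y
      using gz[of x y] that by (auto simp: has_field_derivative_def mult_commute_abs intro: has_derivative_at_withinI)
    have "continuous (at (t, f t) within {0..} \<times> {0<..}) (\<lambda>x. gz (fst x) (snd x))"
      using c ft t by (auto simp: continuous_on_eq_continuous_within)
    then show "continuous (at (t, f t) within {0..} \<times> {0<..}) (\<lambda>(x, y). blinfun_scaleR_left (gz x y))"
      unfolding case_prod_beta
      by (intro bounded_linear.continuous[OF bounded_linear_blinfun_scaleR_left])
  qed (use ft in auto)
  then have 1: "((\<lambda>(s, z). g s z) has_derivative (\<lambda>(ts, tz). gt t (f t) * ts + blinfun_scaleR_left (gz t (f t)) tz))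
      (at (t, f t) within (\<lambda>s. (s, f s)) ` {0..<t1})"
    by (rule has_derivative_subset) (use f_gt \<delta> in \<open>force intro: less_trans\<close>)
  have "((\<lambda>s. (s, f s)) has_derivative (\<lambda>h. (h, f' t * h))) (at t within {0..<t1})"
    using f_deriv[OF t] by (auto intro!: has_derivative_Pair has_derivative_ident simp: has_field_derivative_def)
  from has_derivative_in_compose[OF this 1]
  have "((\<lambda>s. g s (f s)) has_derivative (\<lambda>h. gt t (f t) * h + f' t * h * gz t (f t))) (at t within {0..<t1})"
    by simp
  also have "(\<lambda>h. gt t (f t) * h + f' t * h * gz t (f t)) = (*) (gt t (f t) + gz t (f t) * f' t)"
    by (simp add: fun_eq_iff algebra_simps)
  finally show ?thesis by (simp add: has_field_derivative_def)
qed

lemma trace_cont: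
  assumes "jointly_continuous g"
  shows "continuous_on {0..<t1} (\<lambda>t. g t (f t))"
proof -
  have "continuous_on {0..<t1} (\<lambda>t. (t, f t))" by (intro continuous_intros f_cont)
  from continuous_on_compose2[OF assms this] show ?thesis
    using f_gt \<delta> by (force intro: less_trans)
qed

definition trace_jet1 :: "(real \<Rightarrow> real \<Rightarrow> real) \<Rightarrow> family" where
  "trace_jet1 u = time_jet (\<lambda>t. dz u t (f t)) (\<lambda>t. dz (dz (dz u)) t (f t) + dz (dz u) t (f t) * f' t)"

definition trace_jet2 :: "(real \<Rightarrow> real \<Rightarrow> real) \<Rightarrow> family" where
  "trace_jet2 u = time_jet (\<lambda>t. dz (dz u) t (f t)) (\<lambda>t. dt (dz (dz u)) t (f t) + dz (dz (dz u)) t (f t) * f' t)"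

lemma is_jet_trace_jet:
  assumes "regular u"
  shows "is_jet (trace_jet1 u)" "is_jet (trace_jet2 u)"
proof -
  have c: "jointly_continuous (dz u)" "jointly_continuous (dz (dz u))"
    "jointly_continuous (dz (dz (dz u)))" "jointly_continuous (dt (dz (dz u)))"
    using assms by (simp_all add: regular_def)
  note R = assms[unfolded regular_def, THEN conjunct1, rule_format]
  show "is_jet (trace_jet1 u)" unfolding trace_jet1_def
  proof (rule is_jet_time_jet)
    fix t assume t: "0 \<le> t" "t < t1"
    show "((\<lambda>t. dz u t (f t)) has_real_derivative dz (dz (dz u)) t (f t) + dz (dz u) t (f t) * f' t) (at t within {0..<t1})"
      by (rule trace_deriv[OF _ _ c(2) t]) (use R in blast)+
  qed (intro continuous_on_add continuous_on_mult trace_cont f'_cont c)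
  show "is_jet (trace_jet2 u)" unfolding trace_jet2_def
  proof (rule is_jet_time_jet)
    fix t assume t: "0 \<le> t" "t < t1"
    show "((\<lambda>t. dz (dz u) t (f t)) has_real_derivative dt (dz (dz u)) t (f t) + dz (dz (dz u)) t (f t) * f' t) (at t within {0..<t1})"
      by (rule trace_deriv[OF _ _ c(3) t]) (use R in blast)+
  qed (intro continuous_on_add continuous_on_mult trace_cont f'_cont c)
qed

lemma jet_O_trace_jet:
  assumes "layer_bounded u M"
  shows "jet_O False 0 (trace_jet1 u)" "jet_O False 0 (trace_jet2 u)"
proof -
  have b: "\<bar>dz u t (f t)\<bar> \<le> M" "\<bar>dz (dz u) t (f t)\<bar> \<le> M" "\<bar>dz (dz (dz u)) t (f t)\<bar> \<le> M"
     "\<bar>dt (dz (dz u)) t (f t)\<bar> \<le> M" if "0 \<le> t" "t < t1" for t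
    using assms that \<delta> by (auto simp: layer_bounded_def)
  have M: "0 \<le> M" using b(1)[of 0] t1 by auto
  have Mf: "0 \<le> Mf" using f'_bound[of 0] t1 by auto
  have m: "\<bar>a + c * f' t\<bar> \<le> M + M * Mf" if "\<bar>a\<bar> \<le> M" "\<bar>c\<bar> \<le> M" "0 \<le> t" "t < t1" for a c t
  proof -
    have "\<bar>a + c * f' t\<bar> \<le> \<bar>a\<bar> + \<bar>c\<bar> * \<bar>f' t\<bar>" by (rule order.trans[OF abs_triangle_ineq]) (simp add: abs_mult)
    also have "\<dots> \<le> M + M * Mf" using that f'_bound M by (intro add_mono mult_mono) auto
    finally show ?thesis .
  qed
  have M': "x \<le> M \<Longrightarrow> x \<le> M + M * Mf" for x using M Mf by (simp add: add_increasing2)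
  show "jet_O False 0 (trace_jet1 u)" "jet_O False 0 (trace_jet2 u)"
    unfolding trace_jet1_def trace_jet2_def by (intro jet_O_time_jet[of _ "M + M * Mf"] m M' b; assumption)+
qed

end

section \<open>Smooth branches of the critical-layer profile\<close>

lemma vderiv_cong_open:
  assumes "open S" "\<And>x. x \<in> S \<Longrightarrow> g x = h x" "x \<in> S"
  shows "(vderiv ^^ n) g x = (vderiv ^^ n) h x"
  using assms(3)
proof (induction n arbitrary: x)
  case (Suc n)
  have "((vderiv ^^ n) g has_vector_derivative d) (at x) \<longleftrightarrow> ((vderiv ^^ n) h has_vector_derivative d) (at x)" for d
    using has_vector_derivative_transform_within_open[OF _ assms(1) Suc.prems, of _ d] Suc.IH by metis
  then show ?case
    unfolding funpow.simps o_def vderiv_def[of "(vderiv ^^ n) g" x] vderiv_def[of "(vderiv ^^ n) h" x]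
      vector_derivative_def by simp
qed (use assms in simp)

lemma vderiv_funpow_diff:
  assumes "smooth g" "smooth h"
  shows "(vderiv ^^ n) (\<lambda>x. g x - h x) = (\<lambda>x. (vderiv ^^ n) g x - (vderiv ^^ n) h x)"
proof (induction n)
  case (Suc n)
  show ?case
    unfolding funpow.simps(2) o_def Suc
    by (rule vderiv_eqI) (intro has_vector_derivative_diff smooth_has_vderiv smooth_funpow_vderiv assms)
qed simp

definition parabola :: "complex \<Rightarrow> real \<Rightarrow> complex" where
  "parabola \<tau> Z = \<tau> - of_real (Z\<^sup>2)"

lemma vderiv_parabola:
  "vderiv (parabola \<tau>) = (\<lambda>Z. - (2 * of_real Z))" "vderiv (\<lambda>Z. - (2 * of_real Z :: complex)) = (\<lambda>Z. - 2)"
  "vderiv (\<lambda>Z. c :: complex) = (\<lambda>Z. 0)"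
  unfolding parabola_def[abs_def]
  by ((rule vderiv_eqI)+;
      auto intro!: derivative_eq_intros simp: has_vector_derivative_def scaleR_conv_of_real fun_eq_iff)+

lemma smooth_parabola: "smooth (parabola \<tau>)"
proof (rule smooth_of_all)
  show "(parabola \<tau> has_vector_derivative - (2 * of_real x)) (at x)" for x
    unfolding parabola_def[abs_def]
    by (auto intro!: derivative_eq_intros simp: has_vector_derivative_def scaleR_conv_of_real fun_eq_iff)
  show "smooth (\<lambda>x. - (2 * of_real x :: complex))"
  proof (rule smooth_of_all)
    show "((\<lambda>x. - (2 * of_real x :: complex)) has_vector_derivative -2) (at x)" for x
      by (auto intro!: derivative_eq_intros simp: has_vector_derivative_def scaleR_conv_of_real fun_eq_iff)
  qed (rule smooth_const)
qed

text \<open>The jump of \<open>W_sl\<close> at 0 stems from its indicator. Freezing the indicator at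
  0 or at 1 gives two functions that are smooth on the whole line and differ by \<tau> -
  Z^2.\<close>

definition branch :: "complex \<Rightarrow> (real \<Rightarrow> complex) \<Rightarrow> bool \<Rightarrow> real \<Rightarrow> complex" where
  "branch \<tau> W h Z = parabola \<tau> Z * W Z - (if h then parabola \<tau> Z else 0)"

lemma smooth_branch: "smooth W \<Longrightarrow> smooth (branch \<tau> W h)"
proof -
  assume W: "smooth W"
  have "smooth (\<lambda>Z. parabola \<tau> Z * W Z + (if h then -1 else 0) * parabola \<tau> Z)"
    by (intro smooth_add smooth_mult smooth_const smooth_parabola W)
  moreover have "(\<lambda>Z. parabola \<tau> Z * W Z + (if h then -1 else 0) * parabola \<tau> Z) = branch \<tau> W h"
    by (auto simp: branch_def fun_eq_iff)
  ultimately show ?thesis by simp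
qed

lemma vderiv_branch:
  "smooth W \<Longrightarrow> (vderiv ^^ n) (branch \<tau> W True) Z = (vderiv ^^ n) (branch \<tau> W False) Z - (vderiv ^^ n) (parabola \<tau>) Z"
proof -
  assume W: "smooth W"
  have "branch \<tau> W True = (\<lambda>Z. branch \<tau> W False Z - parabola \<tau> Z)" by (simp add: branch_def fun_eq_iff)
  then show ?thesis using vderiv_funpow_diff[OF smooth_branch[OF W, of \<tau> False] smooth_parabola] by simp
qed

lemma vderiv_branch_W_sl:
  assumes "Z \<noteq> 0" "h \<longleftrightarrow> 0 < Z"
  shows "(vderiv ^^ n) (branch \<tau> W h) Z = (vderiv ^^ n) (W_sl \<tau> W) Z"
proof (rule vderiv_cong_open[of "if h then {0<..} else {..<0}"])
  show "branch \<tau> W h x = W_sl \<tau> W x" if "x \<in> (if h then {0<..} else {..<0})" for x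
    using that by (auto simp: branch_def parabola_def W_sl_def heaviside_def split: if_splits)
qed (use assms in auto)

section \<open>The critical layer\<close>

text \<open>\<open>w_crit\<close> says that f(t) is a critical point of w with w_zz = -2 \<kappa>,
  written through \<kappa>^(1/4). \<open>c_bound\<close> is the double zero of c at the initial
  point, as seen from the moving point f(t): its loss is linear in t. The constants
  \<open>q0\<close> and \<open>M\<close> make all bounds uniform in time.\<close>

locale critical_layer = jet_setting "crit L" f' t1 \<delta> K0 Mf
  for L :: layer and f' t1 \<delta> K0 Mf +
  fixes \<phi> q' :: "real \<Rightarrow> real" and q0 M \<rho> :: real
  assumes reg: "regular (wa L)" "regular (cs L)"
    and \<phi>: "smooth \<phi>" "0 < \<rho>" "\<And>x. \<bar>x\<bar> < \<rho> \<Longrightarrow> \<phi> x = 1" "\<And>x. \<delta> \<le> \<bar>x\<bar> \<Longrightarrow> \<phi> x = 0"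
      "\<And>n x. \<delta> \<le> \<bar>x\<bar> \<Longrightarrow> (vderiv ^^ n) \<phi> x = 0"
    and prof: "critical_layer_profile (tau L) (prof L)"
    and kap_pos: "\<And>t. 0 \<le> t \<Longrightarrow> t < t1 \<Longrightarrow> 0 < kap L t"
    and q0: "0 < q0" "\<And>t. 0 \<le> t \<Longrightarrow> t < t1 \<Longrightarrow> q0 \<le> rt4 (kap L t)" "\<And>t. 0 \<le> t \<Longrightarrow> t < t1 \<Longrightarrow> rt4 (kap L t) \<le> M"
    and q': "\<And>t. 0 \<le> t \<Longrightarrow> t < t1 \<Longrightarrow> ((\<lambda>t. rt4 (kap L t)) has_real_derivative q' t) (at t within {0..<t1})"
      "continuous_on {0..<t1} q'" "\<And>t. 0 \<le> t \<Longrightarrow> t < t1 \<Longrightarrow> \<bar>q' t\<bar> \<le> M"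
    and w_crit: "\<And>t. 0 \<le> t \<Longrightarrow> t < t1 \<Longrightarrow> dz (wa L) t (crit L t) = 0"
      "\<And>t. 0 \<le> t \<Longrightarrow> t < t1 \<Longrightarrow> dz (dz (wa L)) t (crit L t) = - 2 * rt4 (kap L t) ^ 4"
    and lb: "layer_bounded (wa L) M" "layer_bounded (cs L) M"
    and w_bound: "\<And>t z. 0 \<le> t \<Longrightarrow> t < t1 \<Longrightarrow> \<bar>z - crit L t\<bar> \<le> \<delta> \<Longrightarrow>
        \<bar>wa L t z - wa L t (crit L t)\<bar> \<le> M * \<bar>z - crit L t\<bar>\<^sup>2"
      "\<And>t z. 0 \<le> t \<Longrightarrow> t < t1 \<Longrightarrow> \<bar>z - crit L t\<bar> \<le> \<delta> \<Longrightarrow> \<bar>dz (wa L) t z\<bar> \<le> M * \<bar>z - crit L t\<bar>"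
    and c_bound: "\<And>t z. 0 \<le> t \<Longrightarrow> t < t1 \<Longrightarrow> \<bar>z - crit L t\<bar> \<le> \<delta> \<Longrightarrow> \<bar>cs L t z\<bar> \<le> M * (t + \<bar>z - crit L t\<bar>\<^sup>2)"
      "\<And>t z. 0 \<le> t \<Longrightarrow> t < t1 \<Longrightarrow> \<bar>z - crit L t\<bar> \<le> \<delta> \<Longrightarrow> \<bar>dz (cs L) t z\<bar> \<le> M * (t + \<bar>z - crit L t\<bar>)"
begin

abbreviation "f \<equiv> crit L"
abbreviation "\<tau> \<equiv> tau L"

definition q :: "real \<Rightarrow> real" where "q t = rt4 (kap L t)"

lemma q_pos: "0 \<le> t \<Longrightarrow> t < t1 \<Longrightarrow> 0 < q t"
  unfolding q_def using q0(1) q0(2)[of t] by simp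

lemma q_le: "0 \<le> t \<Longrightarrow> t < t1 \<Longrightarrow> q t \<le> M" "0 \<le> t \<Longrightarrow> t < t1 \<Longrightarrow> q0 \<le> q t"
  unfolding q_def using q0 by auto

lemma M_nonneg: "0 \<le> M"
  using q_pos[of 0] q_le[of 0] t1 by simp

lemma sqrt_kap: "0 \<le> t \<Longrightarrow> t < t1 \<Longrightarrow> sqrt (kap L t) = q t ^ 2"
  unfolding q_def by (simp add: rt4_square kap_pos)

lemma Im_tau: "Im \<tau> < 0" and smooth_prof: "smooth (prof L)"
  using prof by (simp_all add: critical_layer_profile_def)

lemma W_sl_decay: "\<exists>C \<eta>. 0 < \<eta> \<and> (\<forall>Z. Z \<noteq> 0 \<longrightarrow> norm ((vderiv ^^ n) (W_sl \<tau> (prof L)) Z) \<le> C * exp (- \<eta> * \<bar>Z\<bar>))"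
  using prof unfolding critical_layer_profile_def by blast

definition qj :: family where "qj = time_jet q q'"

primrec qp :: "nat \<Rightarrow> family" where
  "qp 0 = const_jet 1"
| "qp (Suc n) = jmul qj (qp n)"

lemma jv_qp: "jv (qp n h \<epsilon> t z) = of_real (q t ^ n)"
  by (induction n) (simp_all add: const_jet_def jmul_def qj_def time_jet_def Let_def)

lemma jz_qp: "jz (qp n h \<epsilon> t z) = 0" "jzz (qp n h \<epsilon> t z) = 0"
  by (induction n) (simp_all add: const_jet_def jmul_def qj_def time_jet_def Let_def)

lemma is_jet_qp: "is_jet (qp n)" and jet_O_qp: "jet_O False 0 (qp n)" and matched_qp: "matched (qp n)"
proof -
  have q: "is_jet qj" unfolding qj_def q_def[abs_def] by (intro is_jet_time_jet q')
  have o: "jet_O False 0 qj" unfolding qj_def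
    using q_pos q_le q'(3) by (intro jet_O_time_jet[of _ M]) (auto simp: less_imp_le)
  show "is_jet (qp n)" by (induction n) (auto intro: is_jet_const_jet is_jet_mul q)
  show "jet_O False 0 (qp n)" by (induction n) (use jet_O_const_jet jet_O_mul[OF o] in auto)
  have "matched qj" by (rule matched_indep) (simp add: qj_def time_jet_def)
  moreover have "matched (const_jet 1)" by (rule matched_indep) (simp add: const_jet_def)
  ultimately show "matched (qp n)" by (induction n) (auto intro: matched_mul)
qed

definition phj :: "nat \<Rightarrow> family" where
  "phj n h \<epsilon> t z = (let x = z - f t in Jet (of_real ((vderiv ^^ n) \<phi> x)) (of_real ((vderiv ^^ Suc n) \<phi> x))
     (of_real ((vderiv ^^ Suc (Suc n)) \<phi> x)) (of_real (- f' t * (vderiv ^^ Suc n) \<phi> x)))"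

lemma phi_deriv: "((vderiv ^^ n) \<phi> has_real_derivative (vderiv ^^ Suc n) \<phi> x) (at x within S)"
  using smooth_has_vderiv_funpow[OF \<phi>(1)]
  by (simp add: has_real_derivative_iff_has_vector_derivative has_vector_derivative_at_within del: funpow.simps)

lemma continuous_shift: "continuous_on ({0..<t1} \<times> {0<..}) (\<lambda>x. snd x - f (fst x))"
  by (intro continuous_intros continuous_on_compose2[OF f_cont]) auto

lemma is_jet_phj: "is_jet (phj n)"
proof (rule is_jetI)
  fix h :: bool and \<epsilon> t z :: real assume tz: "0 \<le> t" "t < t1" "0 < z"
  have d: "((\<lambda>z. (vderiv ^^ k) \<phi> (z - f t)) has_real_derivative (vderiv ^^ Suc k) \<phi> (z - f t)) (at z)" for k
  proof -
    have "((\<lambda>z. z - f t) has_real_derivative 1) (at z)" by (auto intro!: derivative_eq_intros)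
    from DERIV_chain'[OF this phi_deriv, of k] show ?thesis by simp
  qed
  show "((\<lambda>z. jv (phj n h \<epsilon> t z)) has_vector_derivative jz (phj n h \<epsilon> t z)) (at z)"
    "((\<lambda>z. jz (phj n h \<epsilon> t z)) has_vector_derivative jzz (phj n h \<epsilon> t z)) (at z)"
    unfolding phj_def Let_def jet.sel by (intro of_real_has_vector_derivative d)+
  have "((\<lambda>s. z - f s) has_real_derivative - f' t) (at t within {0..<t1})"
    using f_deriv[OF tz(1,2)] by (auto intro!: derivative_eq_intros)
  from DERIV_chain'[OF this phi_deriv, of n]
  show "((\<lambda>s. jv (phj n h \<epsilon> s z)) has_vector_derivative jt (phj n h \<epsilon> t z)) (at t within {0..<t1})"
    unfolding phj_def Let_def jet.sel by (intro of_real_has_vector_derivative) (simp add: mult.commute)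
next
  fix h :: bool and \<epsilon> :: real
  have c: "continuous_on ({0..<t1} \<times> {0<..}) (\<lambda>x. (vderiv ^^ k) \<phi> (snd x - f (fst x)))" for k
    by (rule continuous_on_compose2[OF smooth_funpow_continuous_on[OF \<phi>(1), of UNIV] continuous_shift]) auto
  have c': "continuous_on ({0..<t1} \<times> {0<..}) (\<lambda>x. f' (fst x))"
    by (rule continuous_on_compose2[OF f'_cont]) (auto intro!: continuous_intros)
  show "continuous_on ({0..<t1} \<times> {0<..}) (\<lambda>x. jv (phj n h \<epsilon> (fst x) (snd x)))"
    "continuous_on ({0..<t1} \<times> {0<..}) (\<lambda>x. jz (phj n h \<epsilon> (fst x) (snd x)))"
    "continuous_on ({0..<t1} \<times> {0<..}) (\<lambda>x. jzz (phj n h \<epsilon> (fst x) (snd x)))"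
    "continuous_on ({0..<t1} \<times> {0<..}) (\<lambda>x. jt (phj n h \<epsilon> (fst x) (snd x)))"
    unfolding phj_def Let_def jet.sel
    by (intro continuous_on_of_real continuous_on_mult continuous_on_minus c c')+
qed

lemma phi_bounded: "\<exists>C. \<forall>x. \<bar>(vderiv ^^ n) \<phi> x\<bar> \<le> C"
proof -
  have "compact ((vderiv ^^ n) \<phi> ` {-\<delta>..\<delta>})"
    by (intro compact_continuous_image smooth_funpow_continuous_on \<phi>) simp
  then have "bounded ((vderiv ^^ n) \<phi> ` {-\<delta>..\<delta>})" by (rule compact_imp_bounded)
  then obtain C where "\<And>y. y \<in> (vderiv ^^ n) \<phi> ` {-\<delta>..\<delta>} \<Longrightarrow> norm y \<le> C"
    unfolding bounded_iff by blast
  then have C: "\<bar>(vderiv ^^ n) \<phi> x\<bar> \<le> C" if "x \<in> {-\<delta>..\<delta>}" for x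
    using that by (metis image_eqI real_norm_def)
  have "\<bar>(vderiv ^^ n) \<phi> x\<bar> \<le> max C 0" for x
  proof (cases "x \<in> {-\<delta>..\<delta>}")
    case True
    from C[OF this] show ?thesis by simp
  next
    case False
    then have "\<delta> \<le> \<bar>x\<bar>" by auto
    then show ?thesis using \<phi>(5) by simp
  qed
  then show ?thesis by blast
qed

lemma jet_O_phj: "jet_O False 0 (phj n)"
proof -
  obtain C0 C1 C2 where C: "\<And>x. \<bar>(vderiv ^^ n) \<phi> x\<bar> \<le> C0" "\<And>x. \<bar>(vderiv ^^ Suc n) \<phi> x\<bar> \<le> C1"
    "\<And>x. \<bar>(vderiv ^^ Suc (Suc n)) \<phi> x\<bar> \<le> C2"
    using phi_bounded[of n] phi_bounded[of "Suc n"] phi_bounded[of "Suc (Suc n)"] by metis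
  have Mf: "0 \<le> Mf" using f'_bound[of 0] t1 by auto
  have C1: "0 \<le> C1" using C(2)[of 0] by auto
  have C0: "0 \<le> C0" using C(1)[of 0] by auto
  have C2: "0 \<le> C2" using C(3)[of 0] by auto
  have nn: "0 \<le> Mf * C1" using C1 Mf by simp
  have t: "\<bar>- f' t * (vderiv ^^ Suc n) \<phi> x\<bar> \<le> C0 + C1 + C2 + Mf * C1" if "0 \<le> t" "t < t1" for t x
  proof -
    have "\<bar>- f' t * (vderiv ^^ Suc n) \<phi> x\<bar> \<le> Mf * C1"
      unfolding abs_mult using f'_bound[OF that] C(2)[of x] Mf by (intro mult_mono) auto
    then show ?thesis using C0 C1 C2 by linarith
  qed
  show ?thesis unfolding phj_def Let_def
  proof (rule jet_O_bounded[of _ "C0 + C1 + C2 + Mf * C1"]; unfold jet.sel norm_of_real)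
    fix h \<epsilon> t z assume "dom h \<epsilon> t z"
    then have tt: "0 \<le> t" "t < t1" by (auto simp: dom_def)
    show "\<bar>- f' t * (vderiv ^^ Suc n) \<phi> (z - f t)\<bar> \<le> C0 + C1 + C2 + Mf * C1" by (rule t[OF tt])
    show "\<bar>(vderiv ^^ n) \<phi> (z - f t)\<bar> \<le> C0 + C1 + C2 + Mf * C1" using C(1)[of "z - f t"] C1 C2 nn by linarith
    show "\<bar>(vderiv ^^ Suc n) \<phi> (z - f t)\<bar> \<le> C0 + C1 + C2 + Mf * C1" using C(2)[of "z - f t"] C0 C2 nn by linarith
    show "\<bar>(vderiv ^^ Suc (Suc n)) \<phi> (z - f t)\<bar> \<le> C0 + C1 + C2 + Mf * C1" using C(3)[of "z - f t"] C0 C1 nn by linarith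
  qed
qed

lemma localized_phj: "localized (phj n)"
  unfolding localized_def phj_def Let_def using \<phi>(5) by (simp del: funpow.simps)

definition branch_deriv :: "bool \<Rightarrow> nat \<Rightarrow> real \<Rightarrow> complex" where
  "branch_deriv h n = (vderiv ^^ n) (branch \<tau> (prof L) h)"

lemma branch_deriv_deriv: "(branch_deriv h n has_vector_derivative branch_deriv h (Suc n) Z) (at Z within S)"
  unfolding branch_deriv_def
  by (rule has_vector_derivative_at_within[OF smooth_has_vderiv_funpow[OF smooth_branch[OF smooth_prof]]])

lemma branch_deriv_cont: "continuous_on S (branch_deriv h n)"
  unfolding branch_deriv_def by (rule smooth_funpow_continuous_on[OF smooth_branch[OF smooth_prof]])

text \<open>The layer variable is \<open>stretch \<epsilon> t * (z - f t)\<close>.\<close>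

definition stretch :: "real \<Rightarrow> real \<Rightarrow> real" where "stretch \<epsilon> t = q t / rt4 \<epsilon>"

text \<open>The orders n = 0, 1, 2 all occur: \<open>S1j\<close> and \<open>S2j\<close> contain
  derivatives of the profile, and the residual differentiates them again, once in t and twice in z.
  The time entry contains the velocity of the layer variable.\<close>

definition Vj :: "nat \<Rightarrow> family" where
  "Vj n h \<epsilon> t z = (let x = z - f t; m = stretch \<epsilon> t; Z = m * x in Jet (branch_deriv h n Z) (m *\<^sub>R branch_deriv h (Suc n) Z)
     (m\<^sup>2 *\<^sub>R branch_deriv h (Suc (Suc n)) Z) ((q' t / rt4 \<epsilon> * x - m * f' t) *\<^sub>R branch_deriv h (Suc n) Z))"

lemma branch_deriv_chain:
  "(g has_real_derivative g') (at x within S) \<Longrightarrow>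
    ((\<lambda>x. branch_deriv h n (g x)) has_vector_derivative g' *\<^sub>R branch_deriv h (Suc n) (g x)) (at x within S)"
  using vector_diff_chain_within[OF _ branch_deriv_deriv, of g g' x S h n]
  by (simp add: has_real_derivative_iff_has_vector_derivative o_def)

lemma q_cont: "continuous_on {0..<t1} q"
  by (rule DERIV_continuous_on) (use q'(1) in \<open>auto simp: q_def[abs_def]\<close>)

lemma is_jet_Vj: "is_jet (Vj n)"
proof (rule is_jetI)
  fix h :: bool and \<epsilon> t z :: real assume tz: "0 < \<epsilon>" "\<epsilon> < 1" "0 \<le> t" "t < t1" "0 < z"
  have l: "((\<lambda>z. stretch \<epsilon> t * (z - f t)) has_real_derivative stretch \<epsilon> t) (at z)"
    by (auto intro!: derivative_eq_intros)
  show "((\<lambda>z. jv (Vj n h \<epsilon> t z)) has_vector_derivative jz (Vj n h \<epsilon> t z)) (at z)"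
    unfolding Vj_def Let_def jet.sel by (rule branch_deriv_chain[OF l])
  show "((\<lambda>z. jz (Vj n h \<epsilon> t z)) has_vector_derivative jzz (Vj n h \<epsilon> t z)) (at z)"
    unfolding Vj_def Let_def jet.sel power2_eq_square scaleR_scaleR[symmetric]
    by (rule bounded_linear.has_vector_derivative[OF bounded_linear_scaleR_right branch_deriv_chain[OF l]])
  have "((\<lambda>s. stretch \<epsilon> s * (z - f s)) has_real_derivative q' t / rt4 \<epsilon> * (z - f t) - stretch \<epsilon> t * f' t) (at t within {0..<t1})"
    unfolding stretch_def q_def using f_deriv[OF tz(3,4)] q'(1)[OF tz(3,4)] rt4_pos[OF tz(1)]
    by (auto intro!: derivative_eq_intros simp: field_simps)
  then show "((\<lambda>s. jv (Vj n h \<epsilon> s z)) has_vector_derivative jt (Vj n h \<epsilon> t z)) (at t within {0..<t1})"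
    unfolding Vj_def Let_def jet.sel by (rule branch_deriv_chain)
next
  fix h :: bool and \<epsilon> :: real assume e: "0 < \<epsilon>" "\<epsilon> < 1"
  have cm: "continuous_on ({0..<t1} \<times> {0<..}) (\<lambda>x :: real \<times> real. stretch \<epsilon> (fst x))"
    unfolding stretch_def using rt4_pos[OF e(1)]
    by (intro continuous_on_divide continuous_on_compose2[OF q_cont] continuous_intros) auto
  have cb: "continuous_on ({0..<t1} \<times> {0<..}) (\<lambda>x. branch_deriv h k (stretch \<epsilon> (fst x) * (snd x - f (fst x))))" for k
    by (rule continuous_on_compose2[OF branch_deriv_cont[of UNIV]])
       (auto intro!: continuous_on_mult cm continuous_shift)
  have cq: "continuous_on ({0..<t1} \<times> {0<..}) (\<lambda>x :: real \<times> real. q' (fst x) / rt4 \<epsilon>)"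
    using rt4_pos[OF e(1)] by (intro continuous_on_divide continuous_on_compose2[OF q'(2)] continuous_intros) auto
  have cf: "continuous_on ({0..<t1} \<times> {0<..}) (\<lambda>x :: real \<times> real. f' (fst x))"
    by (rule continuous_on_compose2[OF f'_cont]) (auto intro!: continuous_intros)
  show "continuous_on ({0..<t1} \<times> {0<..}) (\<lambda>x. jv (Vj n h \<epsilon> (fst x) (snd x)))"
    "continuous_on ({0..<t1} \<times> {0<..}) (\<lambda>x. jz (Vj n h \<epsilon> (fst x) (snd x)))"
    "continuous_on ({0..<t1} \<times> {0<..}) (\<lambda>x. jzz (Vj n h \<epsilon> (fst x) (snd x)))"
    "continuous_on ({0..<t1} \<times> {0<..}) (\<lambda>x. jt (Vj n h \<epsilon> (fst x) (snd x)))"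
    unfolding Vj_def Let_def jet.sel
    by (intro continuous_on_scaleR continuous_on_power continuous_on_diff[of _ "\<lambda>x. q' (fst x) / rt4 \<epsilon> * (snd x - f (fst x))"]
      continuous_on_mult cm cb cq cf continuous_shift)+
qed

text \<open>Decay is assumed in the layer variable, whose modulus is
  \<open>q t * zeta \<epsilon> t z\<close>. The lower bound \<open>q0\<close> on q turns it into
  decay in \<open>zeta\<close> at a rate independent of time, and the side condition in
  \<open>dom\<close> selects the branch that equals \<open>W_sl\<close> there.\<close>

lemma layer_O_branch_deriv: "layer_O True 0 (\<lambda>h \<epsilon> t z. branch_deriv h n (stretch \<epsilon> t * (z - f t)))"
proof -
  obtain C \<eta> where C: "0 < \<eta>" "\<And>Z. Z \<noteq> 0 \<Longrightarrow> norm ((vderiv ^^ n) (W_sl \<tau> (prof L)) Z) \<le> C * exp (- \<eta> * \<bar>Z\<bar>)"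
    using W_sl_decay[of n] by blast
  have C0: "0 \<le> C"
    using order.trans[OF norm_ge_zero C(2)[of 1]] by (simp add: zero_le_mult_iff)
  have "norm (branch_deriv h n (stretch \<epsilon> t * (z - f t))) \<le> C * wt 0 \<epsilon> t z * rt4 \<epsilon> powr 0 * exp (- (\<eta> * q0) * zeta \<epsilon> t z)"
    if d: "dom h \<epsilon> t z" for h \<epsilon> t z
  proof -
    have t: "0 \<le> t" "t < t1" "0 < rt4 \<epsilon>" "z \<noteq> f t" "h \<longleftrightarrow> f t < z" using d rt4_pos by (auto simp: dom_def)
    have m: "0 < stretch \<epsilon> t" using t q_pos by (simp add: stretch_def)
    have "stretch \<epsilon> t * (z - f t) \<noteq> 0" "h \<longleftrightarrow> 0 < stretch \<epsilon> t * (z - f t)" using m t by (auto simp: zero_less_mult_iff)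
    then have "branch_deriv h n (stretch \<epsilon> t * (z - f t)) = (vderiv ^^ n) (W_sl \<tau> (prof L)) (stretch \<epsilon> t * (z - f t))"
      unfolding branch_deriv_def by (rule vderiv_branch_W_sl)
    then have "norm (branch_deriv h n (stretch \<epsilon> t * (z - f t))) \<le> C * exp (- \<eta> * \<bar>stretch \<epsilon> t * (z - f t)\<bar>)"
      using C(2) \<open>stretch \<epsilon> t * (z - f t) \<noteq> 0\<close> by simp
    also have "\<bar>stretch \<epsilon> t * (z - f t)\<bar> = q t * zeta \<epsilon> t z" using q_pos[OF t(1,2)] t by (simp add: stretch_def zeta_def abs_mult)
    also have "C * exp (- \<eta> * (q t * zeta \<epsilon> t z)) \<le> C * exp (- (\<eta> * q0) * zeta \<epsilon> t z)"
      using q_le(2)[OF t(1,2)] C(1) C0 zeta_nonneg by (intro mult_left_mono) (auto simp: mult.assoc mult_left_mono mult_right_mono)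
    finally show ?thesis using t by (simp add: wt_def)
  qed
  then show ?thesis unfolding layer_O_def using C0 C(1) q0(1)
    by (intro exI[of _ C] exI[of _ 0] exI[of _ "\<eta> * q0"]) auto
qed

lemma layer_O_stretch: "layer_O False (-1) (\<lambda>h \<epsilon> t z. of_real (stretch \<epsilon> t))"
proof (rule layer_O_I[where C=M and N=0])
  fix h \<epsilon> t z assume "dom h \<epsilon> t z"
  then have t: "0 \<le> t" "t < t1" "0 < rt4 \<epsilon>" using rt4_pos by (auto simp: dom_def)
  then show "norm (of_real (stretch \<epsilon> t) :: complex) \<le> M * wt 0 \<epsilon> t z * rt4 \<epsilon> powr - 1"
    using q_pos[OF t(1,2)] q_le(1)[OF t(1,2)] by (simp add: stretch_def wt_def powr_minus_divide divide_right_mono norm_divide)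
qed (rule M_nonneg)

lemma jet_O_Vj: "jet_O True 0 (Vj n)"
proof -
  have m2: "layer_O False (-2) (\<lambda>h \<epsilon> t z. of_real ((stretch \<epsilon> t)\<^sup>2))"
    using layer_O_mult[OF layer_O_stretch layer_O_stretch] by (simp add: power2_eq_square)
  \<comment> \<open>The layer variable has time derivative O(\<epsilon>^(-1/4)) only, since f' and
    q' are bounded and z stays within \<delta> of f. This is better than the order -2 that a jet
    allows.\<close>
  have t: "layer_O False (-2) (\<lambda>h \<epsilon> t z. of_real (q' t / rt4 \<epsilon> * (z - f t) - stretch \<epsilon> t * f' t))"
  proof (rule layer_O_mono[where n="-1" and d=False])
    have Mf: "0 \<le> Mf" using f'_bound[of 0] t1 by auto
    show "layer_O False (-1) (\<lambda>h \<epsilon> t z. of_real (q' t / rt4 \<epsilon> * (z - f t) - stretch \<epsilon> t * f' t))"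
    proof (rule layer_O_I[where C="M * \<delta> + M * Mf" and N=0])
      fix h \<epsilon> t z assume "dom h \<epsilon> t z"
      then have t: "0 \<le> t" "t < t1" "0 < rt4 \<epsilon>" "\<bar>z - f t\<bar> \<le> \<delta>" using rt4_pos by (auto simp: dom_def)
      have e: "q' t / rt4 \<epsilon> * (z - f t) - stretch \<epsilon> t * f' t = (q' t * (z - f t) - q t * f' t) / rt4 \<epsilon>"
        by (simp add: stretch_def diff_divide_distrib)
      have "\<bar>q' t * (z - f t) - q t * f' t\<bar> \<le> \<bar>q' t\<bar> * \<bar>z - f t\<bar> + \<bar>q t\<bar> * \<bar>f' t\<bar>"
        by (rule order.trans[OF abs_triangle_ineq4]) (simp add: abs_mult)
      also have "\<dots> \<le> M * \<delta> + M * Mf"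
        using q'(3)[OF t(1,2)] f'_bound[OF t(1,2)] q_pos[OF t(1,2)] q_le(1)[OF t(1,2)] t M_nonneg
        by (intro add_mono mult_mono) auto
      finally have le: "\<bar>q' t * (z - f t) - q t * f' t\<bar> \<le> M * \<delta> + M * Mf" .
      show "norm (of_real (q' t / rt4 \<epsilon> * (z - f t) - stretch \<epsilon> t * f' t) :: complex)
         \<le> (M * \<delta> + M * Mf) * wt 0 \<epsilon> t z * rt4 \<epsilon> powr - 1"
        unfolding norm_of_real e using le t by (simp add: wt_def powr_minus_divide divide_right_mono)
    qed (use M_nonneg \<delta> Mf in auto)
  qed auto
  show ?thesis unfolding jet_O_def Vj_def Let_def jet.sel scaleR_conv_of_real
    by (intro conjI layer_O_branch_deriv layer_O_mult'[OF layer_O_stretch layer_O_branch_deriv] layer_O_mult'[OF m2 layer_O_branch_deriv]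
       layer_O_mult'[OF t layer_O_branch_deriv]) auto
qed

section \<open>The orders of A, 1/A and c in the layer\<close>

definition cjet :: family where "cjet = flow_jet (cs L)"

text \<open>The sum \<lambda> + w, arranged as w - w(f) plus the small complex shift. The trace w(t,
  f(t)) has time derivative w_zz(t, f(t)): the term with f' drops because w_z vanishes there, and
  w_t = w_zz.\<close>

definition Aj :: family where
  "Aj = jadd (flow_jet (wa L)) (jadd (time_jet (\<lambda>t. - wa L t (f t)) (\<lambda>t. - dz (dz (wa L)) t (f t)))
     (jmul (eps_jet 2) (jmul (const_jet \<tau>) (qp 2))))"

lemma jv_Aj: "jv (Aj h \<epsilon> t z) = of_real (wa L t z - wa L t (f t)) + of_real (rt4 \<epsilon> ^ 2 * q t ^ 2) * \<tau>"
  by (simp add: Aj_def jadd_def flow_jet_def time_jet_def jmul_def eps_jet_def const_jet_def Let_def jv_qp algebra_simps)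

lemma is_jet_Aj: "is_jet Aj"
proof -
  have "is_jet (time_jet (\<lambda>t. - wa L t (f t)) (\<lambda>t. - dz (dz (wa L)) t (f t)))"
  proof (rule is_jet_time_jet)
    have c: "jointly_continuous (dz (wa L))" "jointly_continuous (dz (dz (wa L)))" using reg by (simp_all add: regular_def)
    note R = reg(1)[unfolded regular_def, THEN conjunct1, rule_format]
    show "continuous_on {0..<t1} (\<lambda>t. - dz (dz (wa L)) t (f t))" by (intro continuous_on_minus trace_cont c)
    fix t assume t: "0 \<le> t" "t < t1"
    have "((\<lambda>t. wa L t (f t)) has_real_derivative dz (dz (wa L)) t (f t) + dz (wa L) t (f t) * f' t) (at t within {0..<t1})"
      by (rule trace_deriv[OF _ _ c(1) t]) (use R in auto)
    then show "((\<lambda>t. - wa L t (f t)) has_real_derivative - dz (dz (wa L)) t (f t)) (at t within {0..<t1})"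
      using w_crit(1)[OF t] by (auto intro!: derivative_eq_intros)
  qed
  then show ?thesis unfolding Aj_def by (intro is_jet_add is_jet_mul is_jet_flow_jet reg is_jet_const_jet is_jet_eps_jet is_jet_qp)
qed

text \<open>As w is real, the imaginary part of A is \<epsilon>^(1/2) \<kappa>^(1/2) Im \<tau> at
  every z, far from the critical point too.\<close>

lemma Aj_bound_below: "0 < \<epsilon> \<Longrightarrow> 0 \<le> t \<Longrightarrow> t < t1 \<Longrightarrow> rt4 \<epsilon> ^ 2 * (q0\<^sup>2 * \<bar>Im \<tau>\<bar>) \<le> norm (jv (Aj h \<epsilon> t z))"
proof -
  assume a: "0 < \<epsilon>" "0 \<le> t" "t < t1"
  have "rt4 \<epsilon> ^ 2 * (q0\<^sup>2 * \<bar>Im \<tau>\<bar>) \<le> rt4 \<epsilon> ^ 2 * (q t ^ 2 * \<bar>Im \<tau>\<bar>)"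
    using q_le(2)[OF a(2,3)] q0(1) by (intro mult_left_mono mult_right_mono power_mono) auto
  also have "\<dots> = \<bar>Im (jv (Aj h \<epsilon> t z))\<bar>" unfolding jv_Aj by (simp add: abs_mult)
  also have "\<dots> \<le> norm (jv (Aj h \<epsilon> t z))" by (rule abs_Im_le_cmod)
  finally show ?thesis .
qed

lemma Aj_nonzero: "0 < \<epsilon> \<Longrightarrow> 0 \<le> t \<Longrightarrow> t < t1 \<Longrightarrow> jv (Aj h \<epsilon> t z) \<noteq> 0"
proof -
  assume a: "0 < \<epsilon>" "0 \<le> t" "t < t1"
  have "0 < rt4 \<epsilon> ^ 2 * (q0\<^sup>2 * \<bar>Im \<tau>\<bar>)"
    using rt4_pos[OF a(1)] q0(1) Im_tau by (intro mult_pos_pos zero_less_power) auto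
  with Aj_bound_below[OF a, of h z] show ?thesis by auto
qed

text \<open>The order 2 of A rests on w - w(f) being quadratic at the critical point, and the order
  1 of its z-derivative on the zero of w_z there; boundedness alone would give order 0 for both. The
  lower bound on |A| then settles the inverse.\<close>

lemma jet_O_Ainv: "jet_O False (-2) (jinv Aj)" and jet_O_Aj: "jet_O False 2 Aj"
proof -
  have sA: "layer_O False 2 (\<lambda>h \<epsilon> t z. jv (Aj h \<epsilon> t z))" unfolding jv_Aj
  proof (rule layer_O_I[where C="M + M\<^sup>2 * norm \<tau>" and N=2])
    fix h \<epsilon> t z assume "dom h \<epsilon> t z"
    then have t: "0 \<le> t" "t < t1" "0 < rt4 \<epsilon>" "\<bar>z - f t\<bar> \<le> \<delta>" using rt4_pos by (auto simp: dom_def)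
    have x: "\<bar>z - f t\<bar> = zeta \<epsilon> t z * rt4 \<epsilon>" using t by (simp add: zeta_def)
    have "\<bar>wa L t z - wa L t (f t)\<bar> \<le> M * (zeta \<epsilon> t z ^ 2 * rt4 \<epsilon> ^ 2)"
      using w_bound(1)[OF t(1,2,4)] unfolding x by (simp add: power_mult_distrib)
    also have "\<dots> \<le> M * (wt 2 \<epsilon> t z * rt4 \<epsilon> ^ 2)"
    proof (intro mult_left_mono mult_right_mono M_nonneg)
      have "zeta \<epsilon> t z ^ 2 \<le> 1 * (1 + zeta \<epsilon> t z) ^ 2" using zeta_nonneg by (simp add: power_mono)
      also have "\<dots> \<le> L_log \<epsilon> ^ 2 * (1 + zeta \<epsilon> t z) ^ 2" using L_log_ge_1 by (intro mult_right_mono) auto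
      finally show "zeta \<epsilon> t z ^ 2 \<le> wt 2 \<epsilon> t z" by (simp add: wt_def)
    qed auto
    finally have 1: "norm (of_real (wa L t z - wa L t (f t)) :: complex) \<le> M * (wt 2 \<epsilon> t z * rt4 \<epsilon> ^ 2)"
      unfolding norm_of_real .
    have "norm (of_real (rt4 \<epsilon> ^ 2 * q t ^ 2) * \<tau>) = rt4 \<epsilon> ^ 2 * q t ^ 2 * norm \<tau>" by (simp add: norm_mult norm_power)
    also have "\<dots> \<le> rt4 \<epsilon> ^ 2 * M\<^sup>2 * norm \<tau>"
      using q_pos[OF t(1,2)] q_le(1)[OF t(1,2)] by (intro mult_right_mono mult_left_mono power_mono) auto
    also have "\<dots> \<le> wt 2 \<epsilon> t z * (rt4 \<epsilon> ^ 2 * M\<^sup>2 * norm \<tau>)"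
      using mult_right_mono[OF wt_ge_1[of 2 \<epsilon> t z], of "rt4 \<epsilon> ^ 2 * M\<^sup>2 * norm \<tau>"] by simp
    finally have 2: "norm (of_real (rt4 \<epsilon> ^ 2 * q t ^ 2) * \<tau>) \<le> wt 2 \<epsilon> t z * (rt4 \<epsilon> ^ 2 * M\<^sup>2 * norm \<tau>)" .
    have "norm (of_real (wa L t z - wa L t (f t)) + of_real (rt4 \<epsilon> ^ 2 * q t ^ 2) * \<tau>) \<le>
      M * (wt 2 \<epsilon> t z * rt4 \<epsilon> ^ 2) + wt 2 \<epsilon> t z * (rt4 \<epsilon> ^ 2 * M\<^sup>2 * norm \<tau>)"
      by (rule norm_triangle_mono[OF 1 2])
    also have "\<dots> = (M + M\<^sup>2 * norm \<tau>) * wt 2 \<epsilon> t z * rt4 \<epsilon> powr 2"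
      using t powr_realpow[of "rt4 \<epsilon>" 2] by (simp add: algebra_simps)
    finally show "norm (of_real (wa L t z - wa L t (f t)) + of_real (rt4 \<epsilon> ^ 2 * q t ^ 2) * \<tau>) \<le> (M + M\<^sup>2 * norm \<tau>) * wt 2 \<epsilon> t z * rt4 \<epsilon> powr 2" .
  qed (use M_nonneg in simp)
  have sz: "layer_O False 1 (\<lambda>h \<epsilon> t z. of_real (dz (wa L) t z))"
  proof (rule layer_O_I[where C=M and N=1])
    fix h \<epsilon> t z assume "dom h \<epsilon> t z"
    then have t: "0 \<le> t" "t < t1" "0 < rt4 \<epsilon>" "\<bar>z - f t\<bar> \<le> \<delta>" using rt4_pos by (auto simp: dom_def)
    have x: "\<bar>z - f t\<bar> = zeta \<epsilon> t z * rt4 \<epsilon>" using t by (simp add: zeta_def)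
    have "1 * (1 + zeta \<epsilon> t z) \<le> L_log \<epsilon> * (1 + zeta \<epsilon> t z)"
      using L_log_ge_1 zeta_nonneg by (intro mult_right_mono) auto
    then have "zeta \<epsilon> t z \<le> wt 1 \<epsilon> t z" by (simp add: wt_def)
    then have "M * (zeta \<epsilon> t z * rt4 \<epsilon>) \<le> M * (wt 1 \<epsilon> t z * rt4 \<epsilon>)" using M_nonneg t by (intro mult_left_mono mult_right_mono) auto
    then show "norm (of_real (dz (wa L) t z) :: complex) \<le> M * wt 1 \<epsilon> t z * rt4 \<epsilon> powr 1"
      using w_bound(2)[OF t(1,2,4)] t unfolding x by (simp add: mult.assoc)
  qed (rule M_nonneg)
  have o3: "jet_O False (real 2 + (0 + 0)) (jmul (eps_jet 2) (jmul (const_jet \<tau>) (qp 2)))"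
    using jet_O_mul[OF jet_O_eps_jet[of 2] jet_O_mul[OF jet_O_const_jet[of \<tau>] jet_O_qp[of 2]]] by simp
  have b: "\<bar>dz (dz (wa L)) t z\<bar> \<le> M" "\<bar>dz (dz (wa L)) t (f t)\<bar> \<le> M" if "dom h \<epsilon> t z" for h \<epsilon> t z
    using lb(1) that \<delta> by (auto simp: layer_bounded_def dom_def)
  show A: "jet_O False 2 Aj"
    unfolding jet_O_def
  proof (intro conjI)
    show "layer_O False 2 (\<lambda>h \<epsilon> t z. jv (Aj h \<epsilon> t z))" by (rule sA)
    have "jz (Aj h \<epsilon> t z) = of_real (dz (wa L) t z)" for h \<epsilon> t z
      by (simp add: Aj_def jadd_def jmul_def flow_jet_def time_jet_def eps_jet_def const_jet_def jz_qp Let_def)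
    then show "layer_O False (2 - 1) (\<lambda>h \<epsilon> t z. jz (Aj h \<epsilon> t z))" using sz by simp
    have "jzz (Aj h \<epsilon> t z) = of_real (dz (dz (wa L)) t z)" for h \<epsilon> t z
      by (simp add: Aj_def jadd_def jmul_def flow_jet_def time_jet_def eps_jet_def const_jet_def jz_qp Let_def)
    then show "layer_O False (2 - 2) (\<lambda>h \<epsilon> t z. jzz (Aj h \<epsilon> t z))" using b(1) by (intro layer_O_bounded'[of _ M]) auto
    have "layer_O False 0 (\<lambda>h \<epsilon> t z. of_real (dz (dz (wa L)) t z) + (of_real (- dz (dz (wa L)) t (f t)) + jt (jmul (eps_jet 2) (jmul (const_jet \<tau>) (qp 2)) h \<epsilon> t z)))"
      using o3 b by (intro layer_O_add) (auto intro!: layer_O_bounded'[of _ M] simp: jet_O_def)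
    then show "layer_O False (2 - 2) (\<lambda>h \<epsilon> t z. jt (Aj h \<epsilon> t z))"
      by (simp add: Aj_def jadd_def flow_jet_def time_jet_def Let_def)
  qed
  have "layer_O False (-2) (\<lambda>h \<epsilon> t z. inverse (jv (Aj h \<epsilon> t z)))"
  proof (rule layer_O_I[where C="1 / (q0\<^sup>2 * \<bar>Im \<tau>\<bar>)" and N=0])
    fix h \<epsilon> t z assume "dom h \<epsilon> t z"
    then have t: "0 < \<epsilon>" "0 \<le> t" "t < t1" "0 < rt4 \<epsilon>" using rt4_pos by (auto simp: dom_def)
    have p: "0 < rt4 \<epsilon> ^ 2 * (q0\<^sup>2 * \<bar>Im \<tau>\<bar>)"
      using t q0(1) Im_tau by (intro mult_pos_pos zero_less_power) auto
    have "norm (inverse (jv (Aj h \<epsilon> t z))) \<le> inverse (rt4 \<epsilon> ^ 2 * (q0\<^sup>2 * \<bar>Im \<tau>\<bar>))"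
      unfolding norm_inverse by (rule le_imp_inverse_le[OF Aj_bound_below[OF t(1-3)] p])
    then show "norm (inverse (jv (Aj h \<epsilon> t z))) \<le> 1 / (q0\<^sup>2 * \<bar>Im \<tau>\<bar>) * wt 0 \<epsilon> t z * rt4 \<epsilon> powr - 2"
      using t powr_realpow[of "rt4 \<epsilon>" 2] by (simp add: wt_def powr_minus field_simps)
  qed simp
  then show "jet_O False (-2) (jinv Aj)" using jet_O_inv[OF A] by simp
qed

lemma is_jet_Ainv: "is_jet (jinv Aj)"
  by (rule is_jet_inv[OF is_jet_Aj]) (rule Aj_nonzero)

text \<open>In the allowed window t is at most \<open>K0 * L_log \<epsilon>\<close> times
  \<epsilon>^(1/2), so t + |z - f|^2 has order 2. For the z-derivative the bound is t + |z - f|, and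
  t is weakened to order 1.\<close>

lemma jet_O_cjet: "jet_O False 2 cjet"
proof -
  have key: "t \<le> K0 * (L_log \<epsilon> * rt4 \<epsilon> ^ 2)" if "dom h \<epsilon> t z" for h \<epsilon> t z
    using that by (auto simp: dom_def rt4_square mult_ac)
  have s0: "layer_O False 2 (\<lambda>h \<epsilon> t z. of_real (cs L t z))"
  proof (rule layer_O_I[where C="M * (K0 + 1)" and N=2])
    fix h \<epsilon> t z assume d: "dom h \<epsilon> t z"
    then have t: "0 \<le> t" "t < t1" "0 < rt4 \<epsilon>" "\<bar>z - f t\<bar> \<le> \<delta>" using rt4_pos by (auto simp: dom_def)
    have x: "\<bar>z - f t\<bar> = zeta \<epsilon> t z * rt4 \<epsilon>" using t by (simp add: zeta_def)
    have L1: "L_log \<epsilon> * 1 \<le> L_log \<epsilon> ^ 2 * (1 + zeta \<epsilon> t z) ^ 2"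
      using L_log_ge_1[of \<epsilon>] zeta_nonneg[of \<epsilon> t z] by (intro mult_mono) (auto simp: self_le_power)
    have L2: "1 * zeta \<epsilon> t z ^ 2 \<le> L_log \<epsilon> ^ 2 * (1 + zeta \<epsilon> t z) ^ 2"
      using L_log_ge_1[of \<epsilon>] zeta_nonneg[of \<epsilon> t z] by (intro mult_mono power_mono) (auto simp: one_le_power)
    have "\<bar>cs L t z\<bar> \<le> M * (t + zeta \<epsilon> t z ^ 2 * rt4 \<epsilon> ^ 2)"
      using c_bound(1)[OF t(1,2,4)] unfolding x by (simp add: power_mult_distrib)
    also have "\<dots> \<le> M * (K0 * (L_log \<epsilon> * rt4 \<epsilon> ^ 2) + zeta \<epsilon> t z ^ 2 * rt4 \<epsilon> ^ 2)"
      using key[OF d] M_nonneg by (intro mult_left_mono) auto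
    also have "\<dots> \<le> M * (K0 * (wt 2 \<epsilon> t z * rt4 \<epsilon> ^ 2) + wt 2 \<epsilon> t z * rt4 \<epsilon> ^ 2)"
      using L1 L2 K0 M_nonneg by (intro mult_left_mono add_mono mult_right_mono) (auto simp: wt_def)
    also have "\<dots> = M * (K0 + 1) * wt 2 \<epsilon> t z * rt4 \<epsilon> powr 2"
      using t powr_realpow[of "rt4 \<epsilon>" 2] by (simp add: algebra_simps)
    finally show "norm (of_real (cs L t z) :: complex) \<le> M * (K0 + 1) * wt 2 \<epsilon> t z * rt4 \<epsilon> powr 2" by simp
  qed (use M_nonneg K0 in simp)
  have s1: "layer_O False 1 (\<lambda>h \<epsilon> t z. of_real (dz (cs L) t z))"
  proof (rule layer_O_I[where C="M * (K0 + 1)" and N=1])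
    fix h \<epsilon> t z assume d: "dom h \<epsilon> t z"
    then have t: "0 \<le> t" "t < t1" "0 < rt4 \<epsilon>" "\<bar>z - f t\<bar> \<le> \<delta>" "rt4 \<epsilon> < 1" using rt4_pos rt4_less_1 by (auto simp: dom_def)
    have x: "\<bar>z - f t\<bar> = zeta \<epsilon> t z * rt4 \<epsilon>" using t by (simp add: zeta_def)
    have L1: "L_log \<epsilon> * 1 \<le> L_log \<epsilon> * (1 + zeta \<epsilon> t z)"
      using L_log_ge_1[of \<epsilon>] zeta_nonneg[of \<epsilon> t z] by (intro mult_mono) auto
    have L2: "1 * zeta \<epsilon> t z \<le> L_log \<epsilon> * (1 + zeta \<epsilon> t z)"
      using L_log_ge_1[of \<epsilon>] zeta_nonneg[of \<epsilon> t z] by (intro mult_mono) auto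
    have "rt4 \<epsilon> ^ 2 \<le> rt4 \<epsilon>" using t by (simp add: power2_eq_square mult_left_le)
    then have "K0 * (L_log \<epsilon> * rt4 \<epsilon> ^ 2) \<le> K0 * (L_log \<epsilon> * rt4 \<epsilon>)"
      using K0 L_log_ge_1[of \<epsilon>] by (intro mult_left_mono) auto
    with key[OF d] have key': "t \<le> K0 * (L_log \<epsilon> * rt4 \<epsilon>)" by linarith
    have "\<bar>dz (cs L) t z\<bar> \<le> M * (t + zeta \<epsilon> t z * rt4 \<epsilon>)"
      using c_bound(2)[OF t(1,2,4)] unfolding x .
    also have "\<dots> \<le> M * (K0 * (L_log \<epsilon> * rt4 \<epsilon>) + zeta \<epsilon> t z * rt4 \<epsilon>)"
      using key' M_nonneg by (intro mult_left_mono) auto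
    also have "\<dots> \<le> M * (K0 * (wt 1 \<epsilon> t z * rt4 \<epsilon>) + wt 1 \<epsilon> t z * rt4 \<epsilon>)"
      using L1 L2 K0 M_nonneg t by (intro mult_left_mono add_mono mult_right_mono) (auto simp: wt_def)
    also have "\<dots> = M * (K0 + 1) * wt 1 \<epsilon> t z * rt4 \<epsilon> powr 1"
      using t by (simp add: algebra_simps)
    finally show "norm (of_real (dz (cs L) t z) :: complex) \<le> M * (K0 + 1) * wt 1 \<epsilon> t z * rt4 \<epsilon> powr 1" by simp
  qed (use M_nonneg K0 in simp)
  have s2: "layer_O False 0 (\<lambda>h \<epsilon> t z. of_real (dz (dz (cs L)) t z))"
    using lb(2) by (intro layer_O_bounded'[of _ M]) (auto simp: layer_bounded_def dom_def)
  show ?thesis unfolding jet_O_def cjet_def flow_jet_def jet.sel using s0 s1 s2 by simp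
qed

end

lemma (in jet_setting) jet_O_mul':
  "jet_O d n F \<Longrightarrow> jet_O d' m G \<Longrightarrow> d'' = (d \<or> d') \<Longrightarrow> k = n + m \<Longrightarrow> jet_O d'' k (jmul F G)"
  using jet_O_mul by simp

section \<open>The approximate solution as families of jets\<close>

context critical_layer
begin

text \<open>
  \<open>Sj\<close>, \<open>S1j\<close>, \<open>S2j\<close> are \<open>W\<^bsup>sl\<^esup>\<close> and its first two derivatives in \<open>z\<close>, \<open>pj\<close> is \<open>1 / \<partial>\<^sub>z\<^sup>2 w(f)\<close>, and \<open>Dj\<close> is
  \<open>U - \<rho> \<partial>\<^sub>z U\<^sup>s\<close>. In \<open>ULj\<close>, \<open>rhoLj\<close>, \<open>BLj\<close> the regular parts \<open>H \<partial>\<^sub>z U\<^sup>s\<close>, \<open>H\<close>, \<open>H \<partial>\<^sub>z B\<^sup>s\<close> are removed.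
\<close>

definition Sj :: family where
  "Sj = jmul (eps_jet 2) (jmul (qp 2) (jmul (phj 0) (Vj 0)))"

definition S1j :: family where
  "S1j = jadd (jmul (eps_jet 1) (jmul (qp 3) (jmul (phj 0) (Vj 1)))) (jmul (eps_jet 2) (jmul (qp 2) (jmul (phj 1) (Vj 0))))"

definition S2j :: family where
  "S2j = jadd (jmul (eps_jet 0) (jmul (qp 4) (jmul (phj 0) (Vj 2))))
     (jadd (jmul (const_jet 2) (jmul (eps_jet 1) (jmul (qp 3) (jmul (phj 1) (Vj 1)))))
       (jmul (eps_jet 2) (jmul (qp 2) (jmul (phj 2) (Vj 0)))))"

definition pj :: family where
  "pj = jmul (const_jet (- 1 / 2)) (jinv (qp 4))"

definition ULj :: "(real \<Rightarrow> real \<Rightarrow> real) \<Rightarrow> family" where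
  "ULj u = jadd (jmul (jmul S2j (trace_jet1 u)) pj) (jmul (jmul S1j (trace_jet2 u)) pj)"

definition rhoLj :: family where
  "rhoLj = jmul Sj (jinv Aj)"

definition Dj :: "(real \<Rightarrow> real \<Rightarrow> real) \<Rightarrow> family" where
  "Dj u = jadd (ULj u) (jneg (jmul rhoLj (flow_jet (dz u))))"

definition cAj :: family where
  "cAj = jmul cjet (jinv Aj)"

definition BLj :: "(real \<Rightarrow> real \<Rightarrow> real) \<Rightarrow> (real \<Rightarrow> real \<Rightarrow> real) \<Rightarrow> family" where
  "BLj u b = jadd (jmul rhoLj (flow_jet (dz b))) (jmul cAj (Dj u))"

definition Uj :: "(real \<Rightarrow> real \<Rightarrow> real) \<Rightarrow> family" where
  "Uj u = jadd (jmul side_jet (flow_jet (dz u))) (ULj u)"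

definition Bj :: "(real \<Rightarrow> real \<Rightarrow> real) \<Rightarrow> (real \<Rightarrow> real \<Rightarrow> real) \<Rightarrow> family" where
  "Bj u b = jadd (jmul side_jet (flow_jet (dz b))) (BLj u b)"

lemma jet_O_layer: "jet_O True (real n) (jmul (eps_jet n) (jmul (qp i) (jmul (phj j) (Vj k))))"
  using jet_O_mul[OF jet_O_eps_jet jet_O_mul[OF jet_O_qp jet_O_mul[OF jet_O_phj jet_O_Vj]]] by simp

lemma jet_O_Sj: "jet_O True 2 Sj"
  unfolding Sj_def using jet_O_layer[of 2] by simp

lemma jet_O_S1j: "jet_O True 1 S1j"
proof -
  show ?thesis unfolding S1j_def
    by (intro jet_O_add jet_O_mono[OF jet_O_layer[of 1]] jet_O_mono[OF jet_O_layer[of 2]]) auto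
qed

lemma jet_O_S2j: "jet_O True 0 S2j"
proof -
  have "jet_O True (real 1) (jmul (const_jet 2) (jmul (eps_jet 1) (jmul (qp 3) (jmul (phj 1) (Vj 1)))))"
    using jet_O_mul[OF jet_O_const_jet jet_O_layer[of 1]] by simp
  from jet_O_mono[OF this, of 0 True] show ?thesis unfolding S2j_def
    by (intro jet_O_add jet_O_mono[OF jet_O_layer[of 0]] jet_O_mono[OF jet_O_layer[of 2]]) auto
qed

lemma jet_O_pj: "jet_O False 0 pj"
proof -
  have "layer_O False (- 0) (\<lambda>h \<epsilon> t z. inverse (jv (qp 4 h \<epsilon> t z)))"
  proof (rule layer_O_bounded'[where C="inverse (q0 ^ 4)"])
    fix h \<epsilon> t z assume "dom h \<epsilon> t z"
    then have t: "0 \<le> t" "t < t1" by (auto simp: dom_def)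
    have "inverse (q t ^ 4) \<le> inverse (q0 ^ 4)"
      using q_le(2)[OF t] q0(1) by (intro le_imp_inverse_le power_mono) auto
    then show "norm (inverse (jv (qp 4 h \<epsilon> t z))) \<le> inverse (q0 ^ 4)"
      using q_pos[OF t] by (simp add: jv_qp norm_inverse norm_power)
  qed simp
  from jet_O_mul[OF jet_O_const_jet[of "- 1 / 2"] jet_O_inv[OF jet_O_qp this]] show ?thesis unfolding pj_def by simp
qed

lemma jet_O_ULj: "layer_bounded u m \<Longrightarrow> jet_O True 0 (ULj u)"
  unfolding ULj_def
  by (intro jet_O_add jet_O_mul'[OF _ jet_O_pj] jet_O_mul'[OF jet_O_S2j jet_O_trace_jet(1)] jet_O_mul'[OF jet_O_mono[OF jet_O_S1j] jet_O_trace_jet(2)])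
     (auto split: if_splits)

lemma jet_O_rhoLj: "jet_O True 0 rhoLj"
  unfolding rhoLj_def by (rule jet_O_mul'[OF jet_O_Sj jet_O_Ainv]) auto

lemma jet_O_cAj: "jet_O False 0 cAj"
  unfolding cAj_def by (rule jet_O_mul'[OF jet_O_cjet jet_O_Ainv]) auto

lemma jet_O_Dj: "layer_bounded u m \<Longrightarrow> jet_O True 0 (Dj u)"
  unfolding Dj_def by (intro jet_O_add jet_O_neg jet_O_ULj jet_O_mul'[OF jet_O_rhoLj jet_O_flow_jet_dz]) auto

lemma jet_O_BLj: "layer_bounded u m \<Longrightarrow> layer_bounded b m' \<Longrightarrow> jet_O True 0 (BLj u b)"
  unfolding BLj_def by (intro jet_O_add jet_O_mul'[OF jet_O_rhoLj jet_O_flow_jet_dz] jet_O_mul'[OF jet_O_cAj jet_O_Dj]) auto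

lemma is_jet_pj: "is_jet pj"
  unfolding pj_def by (intro is_jet_mul is_jet_const_jet is_jet_inv is_jet_qp) (use q_pos in \<open>fastforce simp: jv_qp\<close>)

lemmas is_jet_atoms = is_jet_add is_jet_mul is_jet_neg is_jet_const_jet is_jet_eps_jet is_jet_side_jet is_jet_qp is_jet_phj is_jet_Vj is_jet_trace_jet is_jet_flow_jet_dz
  is_jet_Ainv is_jet_Aj is_jet_pj

lemma is_jet_S: "is_jet Sj" "is_jet S1j" "is_jet S2j"
  unfolding Sj_def S1j_def S2j_def by (intro is_jet_atoms)+

lemma is_jet_rhoLj: "is_jet rhoLj"
  unfolding rhoLj_def by (intro is_jet_atoms is_jet_S)

lemma is_jet_ULj: "regular u \<Longrightarrow> is_jet (ULj u)"
  unfolding ULj_def by (intro is_jet_atoms is_jet_S)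

lemma is_jet_Dj: "regular u \<Longrightarrow> is_jet (Dj u)"
  unfolding Dj_def by (intro is_jet_atoms is_jet_ULj is_jet_rhoLj)

lemma is_jet_cjet: "is_jet cjet"
  unfolding cjet_def by (rule is_jet_flow_jet[OF reg(2)])

lemma is_jet_cAj: "is_jet cAj"
  unfolding cAj_def by (intro is_jet_mul is_jet_cjet is_jet_Ainv)

lemma is_jet_Uj: "regular u \<Longrightarrow> is_jet (Uj u)"
  unfolding Uj_def by (intro is_jet_atoms is_jet_ULj)

lemma is_jet_BLj: "regular u \<Longrightarrow> regular b \<Longrightarrow> is_jet (BLj u b)"
  unfolding BLj_def by (intro is_jet_atoms is_jet_rhoLj is_jet_cAj is_jet_Dj)

lemma is_jet_Bj: "regular u \<Longrightarrow> regular b \<Longrightarrow> is_jet (Bj u b)"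
  unfolding Bj_def by (intro is_jet_atoms is_jet_BLj)

lemma localized_S: "localized Sj" "localized S1j" "localized S2j"
  unfolding Sj_def S1j_def S2j_def by (auto intro!: localized_add localized_mul localized_phj)

lemma localized_rhoLj: "localized rhoLj"
  unfolding rhoLj_def by (auto intro!: localized_mul localized_S)

lemma localized_ULj: "localized (ULj u)"
  unfolding ULj_def by (auto intro!: localized_add localized_mul localized_S)

lemma localized_Dj: "localized (Dj u)"
  unfolding Dj_def by (auto intro!: localized_add localized_mul localized_neg localized_rhoLj localized_ULj)

lemma localized_BLj: "localized (BLj u b)"
  unfolding BLj_def by (auto intro!: localized_add localized_mul localized_rhoLj localized_Dj)

lemma stretch_rt4: "0 < \<epsilon> \<Longrightarrow> rt4 \<epsilon> * stretch \<epsilon> t = q t"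
  using rt4_pos[of \<epsilon>] by (simp add: stretch_def)

text \<open>Q, E and m stand for q, \<epsilon>^(1/4) and \<open>stretch\<close>. Each derivative of
  the profile brings a factor m, and Q = E m trades a power of E for one of Q; the two mixed terms
  of the product rule then merge into one with the factor 2.\<close>

lemma S1_algebra:
  fixes Q E m :: complex
  assumes "Q = E * m"
  shows "E * (Q ^ 3 * (P1 * V1 + P0 * (m * V2))) + E\<^sup>2 * (Q\<^sup>2 * (P2 * V0 + P1 * (m * V1)))
    = Q ^ 4 * (P0 * V2) + (2 * (E * (Q ^ 3 * (P1 * V1))) + E\<^sup>2 * (Q\<^sup>2 * (P2 * V0)))"
  using assms by algebra

lemma jz_Sj:
  assumes "0 < \<epsilon>"
  shows "jz (Sj h \<epsilon> t z) = jv (S1j h \<epsilon> t z)"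
proof -
  have q: "q t = rt4 \<epsilon> * stretch \<epsilon> t" using stretch_rt4[OF assms] by simp
  show ?thesis
    by (simp add: Sj_def S1j_def jmul_def jadd_def Let_def eps_jet_def jv_qp jz_qp phj_def Vj_def scaleR_conv_of_real)
       (simp add: q power_mult_distrib power2_eq_square power3_eq_cube algebra_simps)
qed

lemma jz_S1j:
  assumes "0 < \<epsilon>"
  shows "jz (S1j h \<epsilon> t z) = jv (S2j h \<epsilon> t z)"
proof -
  have q: "complex_of_real (q t) = of_real (rt4 \<epsilon>) * of_real (stretch \<epsilon> t)"
    using stretch_rt4[OF assms, of t] by (simp flip: of_real_mult)
  let ?P = "\<lambda>n. complex_of_real ((vderiv ^^ n) \<phi> (z - f t))" and ?V = "\<lambda>n. branch_deriv h n (stretch \<epsilon> t * (z - f t))"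
  have "jz (S1j h \<epsilon> t z) = of_real (rt4 \<epsilon>) * (of_real (q t) ^ 3 * (?P 1 * ?V 1 + ?P 0 * (of_real (stretch \<epsilon> t) * ?V 2)))
      + (of_real (rt4 \<epsilon>))\<^sup>2 * ((of_real (q t))\<^sup>2 * (?P 2 * ?V 0 + ?P 1 * (of_real (stretch \<epsilon> t) * ?V 1)))"
    by (simp add: S1j_def jmul_def jadd_def Let_def eps_jet_def jv_qp jz_qp phj_def Vj_def
        scaleR_conv_of_real numeral_2_eq_2[symmetric] del: funpow.simps qp.simps)
  also have "\<dots> = jv (S2j h \<epsilon> t z)" unfolding S1_algebra[OF q]
    by (simp add: S2j_def jmul_def jadd_def Let_def eps_jet_def const_jet_def jv_qp jz_qp phj_def Vj_def
        scaleR_conv_of_real numeral_2_eq_2[symmetric] del: funpow.simps qp.simps)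
  finally show ?thesis .
qed

lemma W_sl_eps_eq:
  assumes e: "0 < \<epsilon>" and t: "0 \<le> t" "t < t1" and z: "z \<noteq> f t" "h \<longleftrightarrow> f t < z"
  shows "W_sl_eps L \<phi> \<epsilon> t z = jv (Sj h \<epsilon> t z)"
proof -
  have m: "0 < stretch \<epsilon> t" using q_pos[OF t] rt4_pos[OF e] by (simp add: stretch_def)
  have Z: "kap L t powr (1 / 4) * ((z - f t) / \<epsilon> powr (1 / 4)) = stretch \<epsilon> t * (z - f t)"
    by (simp add: stretch_def q_def rt4_def)
  have "stretch \<epsilon> t * (z - f t) \<noteq> 0" "h \<longleftrightarrow> 0 < stretch \<epsilon> t * (z - f t)" using m z by (auto simp: zero_less_mult_iff)
  from vderiv_branch_W_sl[OF this, of 0 \<tau> "prof L"]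
  have "W_sl \<tau> (prof L) (stretch \<epsilon> t * (z - f t)) = branch_deriv h 0 (stretch \<epsilon> t * (z - f t))" by (simp add: branch_deriv_def)
  then show ?thesis
    unfolding W_sl_eps_def Z sqrt_kap[OF t] rt4_square[OF e, symmetric]
    by (simp add: Sj_def jmul_def Let_def eps_jet_def jv_qp phj_def Vj_def)
qed

lemma vderiv_W_sl_eps:
  assumes e: "0 < \<epsilon>" "\<epsilon> < 1" and t: "0 \<le> t" "t < t1" and z: "0 < z" "z \<noteq> f t"
  shows "vderiv (W_sl_eps L \<phi> \<epsilon> t) z = jv (S1j (f t < z) \<epsilon> t z)"
    "(vderiv ^^ 2) (W_sl_eps L \<phi> \<epsilon> t) z = jv (S2j (f t < z) \<epsilon> t z)"
proof -
  have v1: "vderiv (W_sl_eps L \<phi> \<epsilon> t) y = jv (S1j (f t < y) \<epsilon> t y)" if y: "0 < y" "y \<noteq> f t" for y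
  proof -
    have "((\<lambda>y'. jv (Sj (f t < y) \<epsilon> t y')) has_vector_derivative jv (S1j (f t < y) \<epsilon> t y)) (at y)"
      using is_jetD(1)[OF is_jet_S(1) e t y(1)] by (simp add: jz_Sj[OF e(1)])
    then have "(W_sl_eps L \<phi> \<epsilon> t has_vector_derivative jv (S1j (f t < y) \<epsilon> t y)) (at y)"
      by (rule has_vector_derivative_transform_within_open[of _ _ _ "if f t < y then {f t<..} else {..<f t}"])
         (use y in \<open>auto simp: W_sl_eps_eq[OF e(1) t] split: if_splits\<close>)
    then show ?thesis by (simp add: vderiv_def vector_derivative_at)
  qed
  show "vderiv (W_sl_eps L \<phi> \<epsilon> t) z = jv (S1j (f t < z) \<epsilon> t z)" by (rule v1[OF z])
  have "((\<lambda>y'. jv (S1j (f t < z) \<epsilon> t y')) has_vector_derivative jv (S2j (f t < z) \<epsilon> t z)) (at z)"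
    using is_jetD(1)[OF is_jet_S(2) e t z(1)] by (simp add: jz_S1j[OF e(1)])
  moreover have "0 < f t" using f_gt[OF t] \<delta> by simp
  \<comment> \<open>The first derivative has been identified at positive points only, so the
    neighbourhood on the lower side is cut off at 0.\<close>
  ultimately have "(vderiv (W_sl_eps L \<phi> \<epsilon> t) has_vector_derivative jv (S2j (f t < z) \<epsilon> t z)) (at z)"
    by (elim has_vector_derivative_transform_within_open[of _ _ _ "if f t < z then {f t<..} else {0<..<f t}"])
       (use z in \<open>auto simp: v1 split: if_splits\<close>)
  then show "(vderiv ^^ 2) (W_sl_eps L \<phi> \<epsilon> t) z = jv (S2j (f t < z) \<epsilon> t z)"
    by (simp add: numeral_2_eq_2 vderiv_def[of "vderiv _"] vector_derivative_at)
qed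

lemma A_eps_eq: "0 < \<epsilon> \<Longrightarrow> 0 \<le> t \<Longrightarrow> t < t1 \<Longrightarrow> A_eps L \<epsilon> t z = jv (Aj h \<epsilon> t z)"
  unfolding A_eps_def lam_def jv_Aj by (simp add: sqrt_kap rt4_square[symmetric] algebra_simps)

lemma heaviside_eq: "z \<noteq> f t \<Longrightarrow> heaviside (z - f t) = (if f t < z then 1 else 0)"
  by (auto simp: heaviside_def)

text \<open>The regular part of Q is the Heaviside function times A itself. Division by A leaves the
  Heaviside function plus a layer term.\<close>

lemma rho_eps_eq:
  assumes e: "0 < \<epsilon>" and t: "0 \<le> t" "t < t1" and z: "z \<noteq> f t"
  shows "rho_eps L \<phi> \<epsilon> t z = jv (side_jet (f t < z) \<epsilon> t z) + jv (rhoLj (f t < z) \<epsilon> t z)"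
    "Q_eps L \<phi> \<epsilon> t z = jv (Aj (f t < z) \<epsilon> t z) * rho_eps L \<phi> \<epsilon> t z"
proof -
  note nz = Aj_nonzero[OF e t, of "f t < z" z]
  have A: "A_eps L \<epsilon> t z = jv (Aj (f t < z) \<epsilon> t z)" by (rule A_eps_eq[OF e t])
  have W: "W_reg_eps L \<epsilon> t z = jv (side_jet (f t < z) \<epsilon> t z) * jv (Aj (f t < z) \<epsilon> t z)"
    unfolding W_reg_eps_def jv_Aj heaviside_eq[OF z] by (simp add: side_jet_def sqrt_kap[OF t] rt4_square[OF e, symmetric])
  show "rho_eps L \<phi> \<epsilon> t z = jv (side_jet (f t < z) \<epsilon> t z) + jv (rhoLj (f t < z) \<epsilon> t z)"
    unfolding rho_eps_def Q_eps_def A W_sl_eps_eq[OF e t z refl] W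
    using nz by (simp add: rhoLj_def jmul_def jinv_def Let_def field_simps)
  show "Q_eps L \<phi> \<epsilon> t z = jv (Aj (f t < z) \<epsilon> t z) * rho_eps L \<phi> \<epsilon> t z"
    unfolding rho_eps_def A using nz by simp
qed

lemma jv_pj: "jv (pj h \<epsilon> t z) = - 1 / 2 * inverse (of_real (q t ^ 4))" and jz_pj: "jz (pj h \<epsilon> t z) = 0"
  by (simp_all add: pj_def jmul_def const_jet_def jinv_def jv_qp jz_qp Let_def)

lemma U_prof_eq:
  assumes e: "0 < \<epsilon>" "\<epsilon> < 1" and t: "0 \<le> t" "t < t1" and z: "0 < z" "z \<noteq> f t"
  shows "U_prof L \<phi> \<epsilon> u t z = jv (Uj u (f t < z) \<epsilon> t z)"
proof -
  have w: "dz (dz (wa L)) t (f t) = - 2 * q t ^ 4" using w_crit(2)[OF t] by (simp add: q_def)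
  show ?thesis
    unfolding U_prof_def vderiv_W_sl_eps[OF e t z] heaviside_eq[OF z(2)] w
    using q_pos[OF t]
    by (simp add: Uj_def ULj_def jadd_def jmul_def side_jet_def flow_jet_def trace_jet1_def trace_jet2_def time_jet_def jv_pj Let_def)
       (simp add: field_simps)
qed

lemma B_prof_eq:
  assumes e: "0 < \<epsilon>" "\<epsilon> < 1" and t: "0 \<le> t" "t < t1" and z: "0 < z" "z \<noteq> f t"
  shows "B_prof L \<phi> \<epsilon> u b t z = jv (Bj u b (f t < z) \<epsilon> t z)"
proof -
  have A: "A_eps L \<epsilon> t z = jv (Aj (f t < z) \<epsilon> t z)" by (rule A_eps_eq[OF e(1) t])
  show ?thesis
    unfolding B_prof_def U_prof_eq[OF e t z] rho_eps_eq(1)[OF e(1) t z(2)] A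
    by (simp add: Bj_def BLj_def Dj_def Uj_def cAj_def cjet_def jadd_def jmul_def jneg_def jinv_def flow_jet_def Let_def)
       (simp add: divide_inverse algebra_simps)
qed

section \<open>Matching of the branches at the interface\<close>

lemma phi_at_0: "(vderiv ^^ n) \<phi> 0 = (if n = 0 then 1 else 0)"
proof -
  have "(vderiv ^^ n) \<phi> 0 = (vderiv ^^ n) (\<lambda>x. 1) (0 :: real)"
    by (rule vderiv_cong_open[of "{-\<rho><..<\<rho>}"]) (use \<phi>(2,3) in auto)
  also have "(vderiv ^^ n) (\<lambda>x. 1) = (\<lambda>x. if n = 0 then 1 else 0 :: real)"
  proof (induction n)
    case (Suc n)
    have "vderiv (\<lambda>x. c) = (\<lambda>x. 0 :: real)" for c :: real by (rule vderiv_eqI) auto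
    then show ?case by (simp add: Suc)
  qed simp
  finally show ?thesis .
qed

text \<open>The jumps are minus the derivatives of \<tau> - Z^2 at 0. The cutoff, being 1 near 0,
  does not alter them.\<close>

lemma branch_deriv_jump:
  "branch_deriv True 0 0 = branch_deriv False 0 0 - \<tau>" "branch_deriv True (Suc 0) 0 = branch_deriv False (Suc 0) 0"
  "branch_deriv True 2 0 = branch_deriv False 2 0 + 2" "branch_deriv True 3 0 = branch_deriv False 3 0"
proof -
  have j: "branch_deriv True n 0 = branch_deriv False n 0 - (vderiv ^^ n) (parabola \<tau>) 0" for n
    unfolding branch_deriv_def by (rule vderiv_branch[OF smooth_prof])
  show "branch_deriv True 0 0 = branch_deriv False 0 0 - \<tau>" using j[of 0] by (simp add: parabola_def)
  show "branch_deriv True (Suc 0) 0 = branch_deriv False (Suc 0) 0" using j[of "Suc 0"] by (simp add: vderiv_parabola)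
  show "branch_deriv True 2 0 = branch_deriv False 2 0 + 2" using j[of 2] by (simp add: vderiv_parabola numeral_2_eq_2)
  show "branch_deriv True 3 0 = branch_deriv False 3 0" using j[of 3] by (simp add: vderiv_parabola numeral_3_eq_3)
qed

lemma S_at_crit:
  assumes "0 < \<epsilon>"
  shows "jv (Sj h \<epsilon> t (f t)) = of_real (rt4 \<epsilon> ^ 2 * q t ^ 2) * branch_deriv h 0 0"
    "jv (S1j h \<epsilon> t (f t)) = of_real (rt4 \<epsilon> * q t ^ 3) * branch_deriv h (Suc 0) 0"
    "jv (S2j h \<epsilon> t (f t)) = of_real (q t ^ 4) * branch_deriv h 2 0"
    "jz (S2j h \<epsilon> t (f t)) = of_real (q t ^ 4 * stretch \<epsilon> t) * branch_deriv h 3 0"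
  by (simp_all add: Sj_def S1j_def S2j_def jmul_def jadd_def Let_def eps_jet_def const_jet_def jv_qp jz_qp phj_def Vj_def
      phi_at_0 \<phi>(2) \<phi>(3)[of 0] scaleR_conv_of_real numeral_2_eq_2[symmetric] del: funpow.simps qp.simps)

text \<open>This is what the two correction terms in the velocity profile are made for.
  \<open>S2j\<close> jumps by 2 q^4 and \<open>pj\<close> is -1/(2 q^4), so the first correction
  cancels the jump of the Heaviside term in value. The second does the same for the slope, because
  the slope of \<open>S1j\<close> is \<open>S2j\<close>; the value of \<open>S1j\<close> and the
  slope of \<open>S2j\<close> are continuous and disturb neither.\<close>

lemma matched_Uj: "matched (Uj u)"
  unfolding matched_def
proof (intro allI impI)
  fix \<epsilon> t :: real assume "0 < \<epsilon> \<and> \<epsilon> < 1 \<and> 0 \<le> t \<and> t < t1"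
  then have e: "0 < \<epsilon>" "\<epsilon> < 1" and t: "0 \<le> t" "t < t1" by auto
  have q: "q t \<noteq> 0" using q_pos[OF t] by simp
  show "jv (Uj u False \<epsilon> t (f t)) = jv (Uj u True \<epsilon> t (f t)) \<and> jz (Uj u False \<epsilon> t (f t)) = jz (Uj u True \<epsilon> t (f t))"
    using q
    by (simp add: Uj_def ULj_def jadd_def jmul_def side_jet_def flow_jet_def trace_jet1_def trace_jet2_def time_jet_def Let_def
        jv_pj jz_pj jz_S1j[OF e(1)] S_at_crit[OF e(1)] branch_deriv_jump field_simps)
qed

lemma jz_Aj: "jz (Aj h \<epsilon> t z) = of_real (dz (wa L) t z)"
  by (simp add: Aj_def jadd_def jmul_def flow_jet_def time_jet_def eps_jet_def const_jet_def jz_qp Let_def)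

text \<open>At the interface A equals \<epsilon>^(1/2) q^2 \<tau>, and S jumps by minus this amount,
  so S/A jumps by -1 and compensates the Heaviside function. For the slope, S_z is continuous and
  A_z vanishes at the critical point.\<close>

lemma matched_rho: "matched (jadd side_jet rhoLj)"
  unfolding matched_def
proof (intro allI impI)
  fix \<epsilon> t :: real assume "0 < \<epsilon> \<and> \<epsilon> < 1 \<and> 0 \<le> t \<and> t < t1"
  then have e: "0 < \<epsilon>" "\<epsilon> < 1" and t: "0 \<le> t" "t < t1" by auto
  have q: "q t \<noteq> 0" "rt4 \<epsilon> \<noteq> 0" "\<tau> \<noteq> 0" using q_pos[OF t] rt4_pos[OF e(1)] Im_tau by auto
  have z: "dz (wa L) t (f t) = 0" by (rule w_crit(1)[OF t])
  show "jv (jadd side_jet rhoLj False \<epsilon> t (f t)) = jv (jadd side_jet rhoLj True \<epsilon> t (f t)) \<and>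
    jz (jadd side_jet rhoLj False \<epsilon> t (f t)) = jz (jadd side_jet rhoLj True \<epsilon> t (f t))"
    using q
    by (simp add: rhoLj_def jadd_def jmul_def side_jet_def jinv_def Let_def jv_Aj jz_Aj z
        jz_Sj[OF e(1)] S_at_crit[OF e(1)] branch_deriv_jump field_simps)
qed

text \<open>Adding and subtracting the Heaviside part of \<open>dz u\<close> expresses B through U,
  c/A and the full \<rho>, each of which is matched; in the original form the single terms are
  not.\<close>

lemma Bj_alt: "Bj u b = jadd (jmul (jadd side_jet rhoLj) (flow_jet (dz b)))
    (jmul cAj (jadd (Uj u) (jneg (jmul (jadd side_jet rhoLj) (flow_jet (dz u))))))"
proof -
  have "Bj u b h \<epsilon> t z = jadd (jmul (jadd side_jet rhoLj) (flow_jet (dz b)))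
    (jmul cAj (jadd (Uj u) (jneg (jmul (jadd side_jet rhoLj) (flow_jet (dz u)))))) h \<epsilon> t z" for h \<epsilon> t z
    by (rule jet.expand) (simp add: Bj_def BLj_def Dj_def Uj_def jadd_def jmul_def jneg_def side_jet_def Let_def algebra_simps)
  then show ?thesis by (simp add: fun_eq_iff)
qed

lemma qp_indep: "qp n False \<epsilon> t z = qp n True \<epsilon> t z"
  by (induction n) (simp_all add: const_jet_def jmul_def qj_def time_jet_def)

lemma matched_Bj: "matched (Bj u b)"
proof -
  have A: "Aj False \<epsilon> t z = Aj True \<epsilon> t z" for \<epsilon> t z
    unfolding Aj_def jadd_def jmul_def flow_jet_def time_jet_def eps_jet_def const_jet_def qp_indep ..
  have cA: "matched cAj" by (rule matched_indep) (simp add: cAj_def cjet_def jmul_def jinv_def flow_jet_def A)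
  have u: "matched (flow_jet k)" for k by (rule matched_indep) (simp add: flow_jet_def)
  show ?thesis unfolding Bj_alt
    by (rule matched_add[OF matched_mul[OF matched_rho u]
          matched_mul[OF cA matched_add[OF matched_Uj matched_neg[OF matched_mul[OF matched_rho u]]]]])
qed

section \<open>The growth factor and the residual off the interface\<close>

definition Ej :: family where
  "Ej h \<epsilon> t z = Jet (\<i> * E_amp L \<epsilon> t) 0 0 (\<i> * (\<i> / of_real \<epsilon> * lam L \<epsilon> t * E_amp L \<epsilon> t))"

lemma lam_cont: "continuous_on {0..<t1} (lam L \<epsilon>)"
proof -
  have c: "jointly_continuous (wa L)" using reg by (simp add: regular_def)
  have "continuous_on {0..<t1} (\<lambda>t. of_real (- wa L t (f t)) + of_real (sqrt \<epsilon> * q t ^ 2) * \<tau>)"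
    by (intro continuous_intros trace_cont c q_cont)
  then show ?thesis
    by (rule continuous_on_eq) (simp add: lam_def sqrt_kap)
qed

lemma E_amp_deriv:
  assumes "0 \<le> t" "t < t1"
  shows "(E_amp L \<epsilon> has_vector_derivative \<i> / of_real \<epsilon> * lam L \<epsilon> t * E_amp L \<epsilon> t) (at t within {0..<t1})"
proof -
  \<comment> \<open>Continuity of \<lambda> is known on [0, t1), so the fundamental theorem is used
    on a closed interval that ends between t and t1.\<close>
  define t2 where "t2 = (t + t1) / 2"
  have t2: "t < t2" "t2 \<le> t1" "t2 < t1" "t \<in> {0..t2}" using assms by (auto simp: t2_def)
  have "continuous_on {0..t2} (lam L \<epsilon>)" by (rule continuous_on_subset[OF lam_cont]) (use t2 in auto)
  from integral_has_vector_derivative[OF this t2(4)]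
  have "((\<lambda>t. \<i> / of_real \<epsilon> * integral {0..t} (lam L \<epsilon>)) has_vector_derivative \<i> / of_real \<epsilon> * lam L \<epsilon> t) (at t within {0..t2})"
    by (rule has_vector_derivative_mult_right)
  from field_vector_diff_chain_within[OF this DERIV_subset[OF DERIV_exp subset_UNIV]]
  show ?thesis unfolding at_within_cut[OF t2(1,2)]
    by (simp add: E_amp_def[abs_def] o_def)
qed

lemma is_jet_Ej: "is_jet Ej"
proof -
  have E: "continuous_on {0..<t1} (E_amp L \<epsilon>)" for \<epsilon>
    by (rule continuous_on_vector_derivative) (use E_amp_deriv in auto)
  have c: "continuous_on ({0..<t1} \<times> {0<..}) (\<lambda>x. k (fst x))" if "continuous_on {0..<t1} k" for k :: "real \<Rightarrow> complex"
    by (intro continuous_on_compose2[OF that] continuous_intros) auto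
  show ?thesis
    by (rule is_jetI; unfold Ej_def jet.sel; intro has_vector_derivative_const has_vector_derivative_mult_right E_amp_deriv
        c E lam_cont continuous_on_mult continuous_on_const; assumption)
qed

lemma matched_Ej: "matched Ej"
  by (rule matched_indep) (simp add: Ej_def)

text \<open>After multiplication by \<open>\<i> E\<close> the transport terms of the residual collapse, because
  \<open>\<lambda> + w = A\<close> and \<open>Q = A \<rho>\<close>.\<close>

lemma velocity_algebra:
  fixes E l w c U B :: complex
  assumes "U = h * u1 + UL" "B = h * b1 + (rL * b1 + cA * D)" "r = h + rL" "D = UL - rL * u1" "A = l + w"
  shows "(\<i> * (\<i> * k * l * E)) * U + \<i> * E * (h * u3 + Ut) - \<i> * E * (h * u3 + Uzz) +
     (\<i> * k * w * (\<i> * E * U) - \<i> * k * c * (\<i> * E * B) + k * E * (A * r) * u1 - k * E * c * r * b1)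
    = \<i> * E * (\<i> * k * (A - c * cA) * D + Ut - Uzz)"
proof -
  have i: "\<i> * (\<i> * x) = - x" for x by (simp flip: mult.assoc)
  show ?thesis unfolding assms by (simp add: algebra_simps i)
qed

text \<open>B is defined as the exact solution of the transport part, A B - c U = A \<rho> b1 - c
  \<rho> u1. So the transport terms cancel completely, and only the heat operator on the layer part
  remains.\<close>

lemma magnetic_algebra:
  fixes E l w c U B :: complex
  assumes "U = h * u1 + UL" "B = h * b1 + (rL * b1 + cA * D)" "r = h + rL" "D = UL - rL * u1" "A = l + w" "A * cA = c"
  shows "(\<i> * (\<i> * k * l * E)) * B + \<i> * E * (h * b3 + Bt) - \<i> * E * (h * b3 + Bzz) +
     (\<i> * k * w * (\<i> * E * B) - \<i> * k * c * (\<i> * E * U) + k * E * (A * r) * b1 - k * E * c * r * u1)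
    = \<i> * E * (Bt - Bzz)"
proof -
  have i: "\<i> * (\<i> * x) = - x" for x by (simp flip: mult.assoc)
  show ?thesis unfolding assms(1-5) assms(6)[symmetric, unfolded assms(5)] by (simp add: algebra_simps i)
qed

definition RUj :: "(real \<Rightarrow> real \<Rightarrow> real) \<Rightarrow> bool \<Rightarrow> real \<Rightarrow> real \<Rightarrow> real \<Rightarrow> complex" where
  "RUj u h \<epsilon> t z = \<i> * of_real (1 / \<epsilon>) * (jv (Aj h \<epsilon> t z) - of_real (cs L t z) * jv (cAj h \<epsilon> t z)) * jv (Dj u h \<epsilon> t z)
     + jt (ULj u h \<epsilon> t z) - jzz (ULj u h \<epsilon> t z)"

definition RBj :: "(real \<Rightarrow> real \<Rightarrow> real) \<Rightarrow> (real \<Rightarrow> real \<Rightarrow> real) \<Rightarrow> bool \<Rightarrow> real \<Rightarrow> real \<Rightarrow> real \<Rightarrow> complex" where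
  "RBj u b h \<epsilon> t z = jt (BLj u b h \<epsilon> t z) - jzz (BLj u b h \<epsilon> t z)"

lemma transport_terms:
  assumes e: "0 < \<epsilon>" "\<epsilon> < 1" and t: "0 \<le> t" "t < t1" and z: "0 < z" "z \<noteq> f t" and h: "h = (f t < z)"
  shows "U_amp L \<phi> \<epsilon> u t z = \<i> * E_amp L \<epsilon> t * jv (Uj u h \<epsilon> t z)"
    "B_amp L \<phi> \<epsilon> u b t z = \<i> * E_amp L \<epsilon> t * jv (Bj u b h \<epsilon> t z)"
    "W_amp L \<phi> \<epsilon> t z = of_real (1 / \<epsilon>) * E_amp L \<epsilon> t * (jv (Aj h \<epsilon> t z) * (jv (side_jet h \<epsilon> t z) + jv (rhoLj h \<epsilon> t z)))"
    "H_amp L \<phi> \<epsilon> t z = of_real (1 / \<epsilon>) * E_amp L \<epsilon> t * of_real (cs L t z) * (jv (side_jet h \<epsilon> t z) + jv (rhoLj h \<epsilon> t z))"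
  unfolding h U_amp_def B_amp_def W_amp_def H_amp_def U_prof_eq[OF e t z] B_prof_eq[OF e t z]
    rho_eps_eq[OF e(1) t z(2)] by simp_all

lemma cont_in_z:
  assumes F: "is_jet F" and e: "0 < \<epsilon>" "\<epsilon> < 1" and t: "0 \<le> t" "t < t1"
  shows "continuous_on {0<..} (\<lambda>z. jv (F h \<epsilon> t z))"
  by (rule continuous_on_vector_derivative) (use is_jetD(1)[OF F e t] in \<open>auto intro: has_vector_derivative_at_within\<close>)

text \<open>The growth factor depends on time only, so its product with the velocity profile is
  again a matched family, and \<open>heat_residual_glued\<close> yields the distributional identity.
  The explicit form of R is then pure algebra on either side of the interface.\<close>

lemma velocity_residual_glued:
  assumes e: "0 < \<epsilon>" "\<epsilon> < 1" and t: "0 \<le> t" "t < t1" "t1 \<le> T" and u: "regular u" and b: "regular b"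
  shows "\<exists>R. velocity_residual L \<phi> \<epsilon> T u b t R \<and>
    (\<forall>z>0. z \<noteq> f t \<longrightarrow> R z = \<i> * E_amp L \<epsilon> t * RUj u (f t < z) \<epsilon> t z)"
proof -
  define XF where "XF = jmul Ej (Uj u)"
  have XF: "is_jet XF" "matched XF" unfolding XF_def by (intro is_jet_mul is_jet_Ej is_jet_Uj u matched_mul matched_Ej matched_Uj)+
  interpret glued "\<lambda>h t z. jv (XF h \<epsilon> t z)" "\<lambda>h t z. jz (XF h \<epsilon> t z)" "\<lambda>h t z. jzz (XF h \<epsilon> t z)"
    "\<lambda>h t z. jt (XF h \<epsilon> t z)" f t1 Mf
    by (rule glued_jets[OF XF e])
  define F where "F = (\<lambda>z. \<i> / of_real \<epsilon> * of_real (wa L t z) * U_amp L \<phi> \<epsilon> u t z - \<i> / of_real \<epsilon> * of_real (cs L t z) * B_amp L \<phi> \<epsilon> u b t z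
          + W_amp L \<phi> \<epsilon> t z * of_real (dz u t z) - H_amp L \<phi> \<epsilon> t z * of_real (dz b t z))"
  define g where "g h z = \<i> / of_real \<epsilon> * of_real (wa L t z) * (\<i> * E_amp L \<epsilon> t * jv (Uj u h \<epsilon> t z))
     - \<i> / of_real \<epsilon> * of_real (cs L t z) * (\<i> * E_amp L \<epsilon> t * jv (Bj u b h \<epsilon> t z))
     + of_real (1 / \<epsilon>) * E_amp L \<epsilon> t * (jv (Aj h \<epsilon> t z) * (jv (side_jet h \<epsilon> t z) + jv (rhoLj h \<epsilon> t z))) * of_real (dz u t z)
     - of_real (1 / \<epsilon>) * E_amp L \<epsilon> t * of_real (cs L t z) * (jv (side_jet h \<epsilon> t z) + jv (rhoLj h \<epsilon> t z)) * of_real (dz b t z)" for h z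
  have Fg: "F z = g (f t < z) z" if "0 < z" "z \<noteq> f t" for z
    unfolding F_def g_def transport_terms[OF e t(1,2) that refl] ..
  note cz = cont_in_z[OF _ e t(1,2)]
  have cu: "continuous_on {0<..} (\<lambda>z. of_real (k t z) :: complex)" if "regular k" for k
    using cz[OF is_jet_flow_jet[OF that]] by (simp add: flow_jet_def)
  have cu': "continuous_on {0<..} (\<lambda>z. of_real (dz k t z) :: complex)" if "regular k" for k
    using cz[OF is_jet_flow_jet_dz[OF that]] by (simp add: flow_jet_def)
  \<comment> \<open>Written for one side at a time, the transport terms are continuous on the open
    half-line; gluing the two sides gives local integrability.\<close>
  have cg: "continuous_on {0<..} (g h)" for h unfolding g_def
    by (intro continuous_on_add continuous_on_diff continuous_on_mult continuous_on_const cu[OF reg(1)] cu[OF reg(2)]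
        cu'[OF u] cu'[OF b] cz[OF is_jet_Uj[OF u]] cz[OF is_jet_Bj[OF u b]] cz[OF is_jet_Aj] cz[OF is_jet_side_jet] cz[OF is_jet_rhoLj])
  have Fl: "loc_integrable F"
    by (rule loc_integrable_glued[OF cg[of False] cg[of True], of "f t"]) (use Fg in auto)
  have "heat_residual T (U_amp L \<phi> \<epsilon> u) F t
     (\<lambda>z. jt (XF (f t < z) \<epsilon> t z) - jzz (XF (f t < z) \<epsilon> t z) + F z)"
    by (rule heat_residual_glued[OF _ t Fl])
       (simp add: XF_def jmul_def Let_def Ej_def transport_terms(1)[OF e])
  then have "velocity_residual L \<phi> \<epsilon> T u b t (\<lambda>z. jt (XF (f t < z) \<epsilon> t z) - jzz (XF (f t < z) \<epsilon> t z) + F z)"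
    unfolding velocity_residual_def F_def .
  moreover have "jt (XF (f t < z) \<epsilon> t z) - jzz (XF (f t < z) \<epsilon> t z) + F z = \<i> * E_amp L \<epsilon> t * RUj u (f t < z) \<epsilon> t z"
    if z: "0 < z" "z \<noteq> f t" for z
  proof -
    define h where "h = (f t < z)"
    have X: "jt (XF h \<epsilon> t z) = (\<i> * (\<i> * of_real (1 / \<epsilon>) * lam L \<epsilon> t * E_amp L \<epsilon> t)) * jv (Uj u h \<epsilon> t z)
          + \<i> * E_amp L \<epsilon> t * (jv (side_jet h \<epsilon> t z) * of_real (dz (dz (dz u)) t z) + jt (ULj u h \<epsilon> t z))"
      "jzz (XF h \<epsilon> t z) = \<i> * E_amp L \<epsilon> t * (jv (side_jet h \<epsilon> t z) * of_real (dz (dz (dz u)) t z) + jzz (ULj u h \<epsilon> t z))"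
      by (simp_all add: XF_def Uj_def jmul_def jadd_def Ej_def side_jet_def flow_jet_def Let_def)
    have g: "F z = \<i> * of_real (1 / \<epsilon>) * of_real (wa L t z) * (\<i> * E_amp L \<epsilon> t * jv (Uj u h \<epsilon> t z))
     - \<i> * of_real (1 / \<epsilon>) * of_real (cs L t z) * (\<i> * E_amp L \<epsilon> t * jv (Bj u b h \<epsilon> t z))
     + of_real (1 / \<epsilon>) * E_amp L \<epsilon> t * (jv (Aj h \<epsilon> t z) * (jv (side_jet h \<epsilon> t z) + jv (rhoLj h \<epsilon> t z))) * of_real (dz u t z)
     - of_real (1 / \<epsilon>) * E_amp L \<epsilon> t * of_real (cs L t z) * (jv (side_jet h \<epsilon> t z) + jv (rhoLj h \<epsilon> t z)) * of_real (dz b t z)"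
      unfolding Fg[OF z] g_def h_def by simp
    show ?thesis unfolding h_def[symmetric] X g RUj_def
    proof (rule velocity_algebra[where cA="jv (cAj h \<epsilon> t z)" and rL="jv (rhoLj h \<epsilon> t z)" and UL="jv (ULj u h \<epsilon> t z)"
          and l="lam L \<epsilon> t" and w="of_real (wa L t z)"])
      show "jv (Aj h \<epsilon> t z) = lam L \<epsilon> t + of_real (wa L t z)"
        using A_eps_eq[OF e(1) t(1,2), of z h] by (simp add: A_eps_def)
    qed (simp_all add: Uj_def Bj_def BLj_def Dj_def jadd_def jmul_def jneg_def flow_jet_def Let_def)
  qed
  ultimately show ?thesis by blast
qed

lemma magnetic_residual_glued:
  assumes e: "0 < \<epsilon>" "\<epsilon> < 1" and t: "0 \<le> t" "t < t1" "t1 \<le> T" and u: "regular u" and b: "regular b"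
  shows "\<exists>R. magnetic_residual L \<phi> \<epsilon> T u b t R \<and>
    (\<forall>z>0. z \<noteq> f t \<longrightarrow> R z = \<i> * E_amp L \<epsilon> t * RBj u b (f t < z) \<epsilon> t z)"
proof -
  define XF where "XF = jmul Ej (Bj u b)"
  have XF: "is_jet XF" "matched XF" unfolding XF_def by (intro is_jet_mul is_jet_Ej is_jet_Bj u b matched_mul matched_Ej matched_Bj)+
  interpret glued "\<lambda>h t z. jv (XF h \<epsilon> t z)" "\<lambda>h t z. jz (XF h \<epsilon> t z)" "\<lambda>h t z. jzz (XF h \<epsilon> t z)"
    "\<lambda>h t z. jt (XF h \<epsilon> t z)" f t1 Mf
    by (rule glued_jets[OF XF e])
  define F where "F = (\<lambda>z. \<i> / of_real \<epsilon> * of_real (wa L t z) * B_amp L \<phi> \<epsilon> u b t z - \<i> / of_real \<epsilon> * of_real (cs L t z) * U_amp L \<phi> \<epsilon> u t z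
          + W_amp L \<phi> \<epsilon> t z * of_real (dz b t z) - H_amp L \<phi> \<epsilon> t z * of_real (dz u t z))"
  define g where "g h z = \<i> / of_real \<epsilon> * of_real (wa L t z) * (\<i> * E_amp L \<epsilon> t * jv (Bj u b h \<epsilon> t z))
     - \<i> / of_real \<epsilon> * of_real (cs L t z) * (\<i> * E_amp L \<epsilon> t * jv (Uj u h \<epsilon> t z))
     + of_real (1 / \<epsilon>) * E_amp L \<epsilon> t * (jv (Aj h \<epsilon> t z) * (jv (side_jet h \<epsilon> t z) + jv (rhoLj h \<epsilon> t z))) * of_real (dz b t z)
     - of_real (1 / \<epsilon>) * E_amp L \<epsilon> t * of_real (cs L t z) * (jv (side_jet h \<epsilon> t z) + jv (rhoLj h \<epsilon> t z)) * of_real (dz u t z)" for h z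
  have Fg: "F z = g (f t < z) z" if "0 < z" "z \<noteq> f t" for z
    unfolding F_def g_def transport_terms[OF e t(1,2) that refl] ..
  note cz = cont_in_z[OF _ e t(1,2)]
  have cu: "continuous_on {0<..} (\<lambda>z. of_real (k t z) :: complex)" if "regular k" for k
    using cz[OF is_jet_flow_jet[OF that]] by (simp add: flow_jet_def)
  have cu': "continuous_on {0<..} (\<lambda>z. of_real (dz k t z) :: complex)" if "regular k" for k
    using cz[OF is_jet_flow_jet_dz[OF that]] by (simp add: flow_jet_def)
  have cg: "continuous_on {0<..} (g h)" for h unfolding g_def
    by (intro continuous_on_add continuous_on_diff continuous_on_mult continuous_on_const cu[OF reg(1)] cu[OF reg(2)]
        cu'[OF u] cu'[OF b] cz[OF is_jet_Uj[OF u]] cz[OF is_jet_Bj[OF u b]] cz[OF is_jet_Aj] cz[OF is_jet_side_jet] cz[OF is_jet_rhoLj])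
  have Fl: "loc_integrable F"
    by (rule loc_integrable_glued[OF cg[of False] cg[of True], of "f t"]) (use Fg in auto)
  have "heat_residual T (B_amp L \<phi> \<epsilon> u b) F t
     (\<lambda>z. jt (XF (f t < z) \<epsilon> t z) - jzz (XF (f t < z) \<epsilon> t z) + F z)"
    by (rule heat_residual_glued[OF _ t Fl])
       (simp add: XF_def jmul_def Let_def Ej_def transport_terms(2)[OF e])
  then have "magnetic_residual L \<phi> \<epsilon> T u b t (\<lambda>z. jt (XF (f t < z) \<epsilon> t z) - jzz (XF (f t < z) \<epsilon> t z) + F z)"
    unfolding magnetic_residual_def F_def .
  moreover have "jt (XF (f t < z) \<epsilon> t z) - jzz (XF (f t < z) \<epsilon> t z) + F z = \<i> * E_amp L \<epsilon> t * RBj u b (f t < z) \<epsilon> t z"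
    if z: "0 < z" "z \<noteq> f t" for z
  proof -
    define h where "h = (f t < z)"
    have X: "jt (XF h \<epsilon> t z) = (\<i> * (\<i> * of_real (1 / \<epsilon>) * lam L \<epsilon> t * E_amp L \<epsilon> t)) * jv (Bj u b h \<epsilon> t z)
          + \<i> * E_amp L \<epsilon> t * (jv (side_jet h \<epsilon> t z) * of_real (dz (dz (dz b)) t z) + jt (BLj u b h \<epsilon> t z))"
      "jzz (XF h \<epsilon> t z) = \<i> * E_amp L \<epsilon> t * (jv (side_jet h \<epsilon> t z) * of_real (dz (dz (dz b)) t z) + jzz (BLj u b h \<epsilon> t z))"
      by (simp_all add: XF_def Bj_def jmul_def jadd_def Ej_def side_jet_def flow_jet_def Let_def)
    have g: "F z = \<i> * of_real (1 / \<epsilon>) * of_real (wa L t z) * (\<i> * E_amp L \<epsilon> t * jv (Bj u b h \<epsilon> t z))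
     - \<i> * of_real (1 / \<epsilon>) * of_real (cs L t z) * (\<i> * E_amp L \<epsilon> t * jv (Uj u h \<epsilon> t z))
     + of_real (1 / \<epsilon>) * E_amp L \<epsilon> t * (jv (Aj h \<epsilon> t z) * (jv (side_jet h \<epsilon> t z) + jv (rhoLj h \<epsilon> t z))) * of_real (dz b t z)
     - of_real (1 / \<epsilon>) * E_amp L \<epsilon> t * of_real (cs L t z) * (jv (side_jet h \<epsilon> t z) + jv (rhoLj h \<epsilon> t z)) * of_real (dz u t z)"
      unfolding Fg[OF z] g_def h_def by simp
    show ?thesis unfolding h_def[symmetric] X g RBj_def
    proof (rule magnetic_algebra[where cA="jv (cAj h \<epsilon> t z)" and rL="jv (rhoLj h \<epsilon> t z)" and UL="jv (ULj u h \<epsilon> t z)"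
          and l="lam L \<epsilon> t" and w="of_real (wa L t z)" and D="jv (Dj u h \<epsilon> t z)"])
      show "jv (Aj h \<epsilon> t z) = lam L \<epsilon> t + of_real (wa L t z)"
        using A_eps_eq[OF e(1) t(1,2), of z h] by (simp add: A_eps_def)
      show "jv (Aj h \<epsilon> t z) * jv (cAj h \<epsilon> t z) = of_real (cs L t z)"
        using Aj_nonzero[OF e(1) t(1,2), of h z] by (simp add: cAj_def jmul_def jinv_def cjet_def flow_jet_def Let_def)
    qed (simp_all add: Uj_def Bj_def BLj_def Dj_def jadd_def jmul_def jneg_def flow_jet_def Let_def)
  qed
  ultimately show ?thesis by blast
qed

text \<open>Order count: -4 from 1/\<epsilon>, 2 from A and from c^2/A, 0 from \<open>Dj\<close>,
  which carries the decay. The heat operator applied to a family of order 0 also gives -2, so the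
  two parts balance.\<close>

lemma layer_O_RUj:
  assumes "layer_bounded u m"
  shows "layer_O True (-2) (RUj u)"
proof -
  note D = jet_O_Dj[OF assms, unfolded jet_O_def, THEN conjunct1]
  have c: "layer_O False 2 (\<lambda>h \<epsilon> t z. of_real (cs L t z))" using jet_O_cjet by (simp add: jet_O_def cjet_def flow_jet_def)
  have cc: "layer_O False 2 (\<lambda>h \<epsilon> t z. of_real (cs L t z) * jv (cAj h \<epsilon> t z))"
    using layer_O_mult[OF c jet_O_cAj[unfolded jet_O_def, THEN conjunct1]] by simp
  have A: "layer_O False 2 (\<lambda>h \<epsilon> t z. jv (Aj h \<epsilon> t z))" using jet_O_Aj by (simp add: jet_O_def)
  have k: "layer_O False (-4) (\<lambda>h \<epsilon> t z. \<i> * of_real (1 / \<epsilon>))"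
  proof (rule layer_O_I[where C=1 and N=0])
    fix h \<epsilon> t z assume "dom h \<epsilon> t z"
    then have e: "0 < \<epsilon>" by (simp add: dom_def)
    have "rt4 \<epsilon> powr - 4 = 1 / \<epsilon>" using e by (simp add: rt4_def powr_powr powr_minus_divide)
    then show "norm (\<i> * of_real (1 / \<epsilon>)) \<le> 1 * wt 0 \<epsilon> t z * rt4 \<epsilon> powr - 4"
      using e by (simp add: wt_def norm_mult norm_divide)
  qed simp
  have "layer_O True (-2) (\<lambda>h \<epsilon> t z. \<i> * of_real (1 / \<epsilon>) * (jv (Aj h \<epsilon> t z) - of_real (cs L t z) * jv (cAj h \<epsilon> t z)) * jv (Dj u h \<epsilon> t z))"
    using layer_O_mult[OF layer_O_mult[OF k layer_O_diff[OF A cc]] D] by simp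
  then show ?thesis unfolding RUj_def using jet_O_ULj[OF assms] by (intro layer_O_add layer_O_diff) (simp_all add: jet_O_def)
qed

lemma layer_O_RBj: "layer_bounded u m \<Longrightarrow> layer_bounded b m' \<Longrightarrow> layer_O True (-2) (RBj u b)"
  unfolding RBj_def using jet_O_BLj[of u m b m'] by (intro layer_O_diff) (simp_all add: jet_O_def)

lemma RUj_outside: "\<delta> \<le> \<bar>z - f t\<bar> \<Longrightarrow> RUj u h \<epsilon> t z = 0"
  using localized_ULj[of u] localized_Dj[of u] by (simp add: RUj_def localized_def)

lemma RBj_outside: "\<delta> \<le> \<bar>z - f t\<bar> \<Longrightarrow> RBj u b h \<epsilon> t z = 0"
  using localized_BLj[of u b] by (simp add: RBj_def localized_def)

end

section \<open>Weighted norms of decaying families\<close>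

lemma power_le_exp:
  assumes "0 < c"
  shows "\<exists>K>0. \<forall>x\<ge>0. (1 + x) ^ N \<le> K * exp (c * x :: real)"
proof -
  \<comment> \<open>This gives N d \<le> c, and N + 1 covers the case N = 0. The estimate is 1 + x
    \<le> K (1 + d x) \<le> K exp(d x), raised to the power N.\<close>
  define d where "d = c / (real N + 1)"
  have d: "0 < d" "real N * d \<le> c" using assms by (auto simp: d_def field_simps)
  define K where "K = max 1 (1 / d)"
  have K: "1 \<le> K" "1 \<le> K * d" using d by (auto simp: K_def max_def field_simps)
  have "(1 + x) ^ N \<le> K ^ N * exp (c * x)" if x: "0 \<le> x" for x
  proof -
    have "1 + x \<le> K * (1 + d * x)" using K x mult_right_mono[OF K(2) x] by (simp add: algebra_simps)
    also have "\<dots> \<le> K * exp (d * x)" using K by (intro mult_left_mono) auto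
    finally have "(1 + x) ^ N \<le> (K * exp (d * x)) ^ N" using x by (intro power_mono) auto
    also have "\<dots> = K ^ N * exp (real N * d * x)" by (simp add: power_mult_distrib exp_of_nat_mult[symmetric] mult.assoc)
    also have "\<dots> \<le> K ^ N * exp (c * x)" using d x K by (intro mult_left_mono) (auto simp: mult_right_mono)
    finally show ?thesis .
  qed
  then show ?thesis using K by (intro exI[of _ "K ^ N"]) auto
qed

lemma integral_exp_abs:
  fixes k c d :: real
  assumes k: "0 < k" and d: "0 \<le> d"
  shows "integrable lborel (\<lambda>z. indicator {c - d..c + d} z * exp (- k * \<bar>z - c\<bar>))"
    "(\<integral>z. indicator {c - d..c + d} z * exp (- k * \<bar>z - c\<bar>) \<partial>lborel) \<le> 2 / k"
proof -
  define A where "A z = indicator {c - d..c} z * exp (k * (z - c))" for z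
  define B where "B z = indicator {c..c + d} z * exp (- k * (z - c))" for z
  have "has_bochner_integral lborel (\<lambda>z. exp (k * (z - c)) * indicator {c - d..c} z)
      (exp (k * (c - c)) / k - exp (k * (c - d - c)) / k)"
    by (rule has_bochner_integral_FTC_Icc_real)
       (use d k in \<open>auto intro!: derivative_eq_intros continuous_intros\<close>)
  then have A: "has_bochner_integral lborel A ((1 - exp (- (k * d))) / k)"
    by (simp add: A_def[abs_def] mult.commute diff_divide_distrib)
  have "has_bochner_integral lborel (\<lambda>z. exp (- k * (z - c)) * indicator {c..c + d} z)
      (- exp (- k * (c + d - c)) / k - (- exp (- k * (c - c)) / k))"
    by (rule has_bochner_integral_FTC_Icc_real)
       (use d k in \<open>auto intro!: derivative_eq_intros continuous_intros\<close>)
  then have B: "has_bochner_integral lborel B ((1 - exp (- (k * d))) / k)"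
    by (simp add: B_def[abs_def] mult.commute diff_divide_distrib)
  have i: "integrable lborel (\<lambda>z. A z + B z)"
    by (intro Bochner_Integration.integrable_add) (use A B in \<open>auto simp: has_bochner_integral_iff\<close>)
  have "(\<integral>z. A z + B z \<partial>lborel) = (1 - exp (- (k * d))) / k + (1 - exp (- (k * d))) / k"
    by (rule has_bochner_integral_integral_eq[OF has_bochner_integral_add[OF A B]])
  moreover have "(1 - exp (- (k * d))) / k \<le> 1 / k" using k by (intro divide_right_mono) auto
  moreover have "2 / k = 1 / k + 1 / k" by simp
  ultimately have AB: "(\<integral>z. A z + B z \<partial>lborel) \<le> 2 / k" by linarith
  have le: "indicator {c - d..c + d} z * exp (- k * \<bar>z - c\<bar>) \<le> A z + B z" for z
    by (auto simp: A_def B_def indicator_def abs_if algebra_simps)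
  show I: "integrable lborel (\<lambda>z. indicator {c - d..c + d} z * exp (- k * \<bar>z - c\<bar>))"
    by (rule Bochner_Integration.integrable_bound[OF i])
       (use le in \<open>auto intro!: AE_I2 order.trans[OF _ abs_ge_self]\<close>)
  show "(\<integral>z. indicator {c - d..c + d} z * exp (- k * \<bar>z - c\<bar>) \<partial>lborel) \<le> 2 / k"
    by (rule order.trans[OF integral_mono[OF I i] AB]) (use le in auto)
qed

text \<open>The amplitudes are identified for z > 0 off the interface only; the two exceptional
  points form a null set.\<close>

lemma L2_majorant:
  fixes G :: "real \<Rightarrow> 'a::{real_normed_vector, second_countable_topology}"
  assumes m: "set_borel_measurable lborel {0..} G"
    and D: "integrable lborel D" "(\<integral>z. D z \<partial>lborel) \<le> B" "\<And>z. 0 \<le> D z"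
    and le: "\<And>z. 0 < z \<Longrightarrow> z \<noteq> c \<Longrightarrow> (norm (exp (\<alpha> * z) *\<^sub>R G z))\<^sup>2 \<le> D z"
  shows "G \<in> L2_space \<alpha>" "L2_norm \<alpha> G \<le> sqrt B"
proof -
  let ?g = "\<lambda>z. indicator {0..} z *\<^sub>R (norm (exp (\<alpha> * z) *\<^sub>R G z))\<^sup>2"
  have "(\<lambda>z. (norm (exp (\<alpha> * z) *\<^sub>R (indicator {0..} z *\<^sub>R G z)))\<^sup>2) \<in> borel_measurable lborel"
    using m unfolding set_borel_measurable_def by measurable
  also have "(\<lambda>z. (norm (exp (\<alpha> * z) *\<^sub>R (indicator {0..} z *\<^sub>R G z)))\<^sup>2) = ?g"
    by (auto simp: indicator_def)
  finally have gm: "?g \<in> borel_measurable lborel" .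
  have ae: "AE z in lborel. ?g z \<le> D z"
    using AE_lborel_singleton[of c] AE_lborel_singleton[of 0]
    by eventually_elim (use le D(3) in \<open>auto simp: indicator_def\<close>)
  have gi: "integrable lborel ?g"
    by (rule Bochner_Integration.integrable_bound[OF D(1) gm])
       (use ae in eventually_elim, use D(3) in auto)
  then show "G \<in> L2_space \<alpha>" using m by (simp add: L2_space_def set_integrable_def)
  have "(\<integral>z. ?g z \<partial>lborel) \<le> (\<integral>z. D z \<partial>lborel)" by (rule integral_mono_AE[OF gi D(1) ae])
  then show "L2_norm \<alpha> G \<le> sqrt B"
    unfolding L2_norm_def set_lebesgue_integral_def using D(2) by (intro real_sqrt_le_mono) simp
qed

text \<open>For times up to K0 \<epsilon>^(1/2) L the quantity t^2 / \<epsilon>^(1/2) is at most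
  K0^2 \<epsilon>^(1/2) L^2. Its boundedness is what permits freezing the growth rate at time
  0.\<close>

lemma sqrt_L_log_bounded: "\<exists>K>0. \<forall>\<epsilon>. 0 < \<epsilon> \<and> \<epsilon> < 1 \<longrightarrow> sqrt \<epsilon> * L_log \<epsilon> ^ 2 \<le> K"
proof -
  obtain K :: real where K: "0 < K" "\<And>x. 0 \<le> x \<Longrightarrow> (1 + x) ^ 2 \<le> K * exp (1 / 2 * x)"
    using power_le_exp[of "1 / 2" 2] by auto
  have "sqrt \<epsilon> * L_log \<epsilon> ^ 2 \<le> K" if e: "0 < \<epsilon>" "\<epsilon> < 1" for \<epsilon>
  proof -
    have "L_log \<epsilon> ^ 2 \<le> K * exp (1 / 2 * (- ln \<epsilon>))" using K(2)[of "- ln \<epsilon>"] e by (simp add: L_log_def)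
    also have "exp (1 / 2 * (- ln \<epsilon>)) = 1 / sqrt \<epsilon>"
      using e by (simp add: powr_half_sqrt[symmetric] powr_def exp_minus inverse_eq_divide)
    finally have "sqrt \<epsilon> * L_log \<epsilon> ^ 2 \<le> sqrt \<epsilon> * (K * (1 / sqrt \<epsilon>))" using e by (intro mult_left_mono) auto
    then show ?thesis using e by simp
  qed
  with K show ?thesis by blast
qed

text \<open>It makes the whole time window fit into [0, t1) once \<epsilon> is small.\<close>

lemma sqrt_L_log_tendsto: "((\<lambda>\<epsilon>. sqrt \<epsilon> * L_log \<epsilon>) \<longlongrightarrow> 0) (at_right 0)"
proof -
  have "((\<lambda>\<epsilon>. sqrt \<epsilon> * (1 - ln \<epsilon>)) \<longlongrightarrow> 0) (at_right 0)" by real_asymp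
  moreover have "\<forall>\<^sub>F \<epsilon> in at_right 0. sqrt \<epsilon> * (1 - ln \<epsilon>) = sqrt \<epsilon> * L_log \<epsilon>"
    unfolding eventually_at_right_field by (intro exI[of _ 1]) (auto simp: L_log_def)
  ultimately show ?thesis by (rule Lim_transform_eventually)
qed

context jet_setting
begin

lemma f_upper: "0 \<le> t \<Longrightarrow> t < t1 \<Longrightarrow> f t \<le> f 0 + Mf * t1"
proof -
  assume t: "0 \<le> t" "t < t1"
  have "0 \<le> Mf" using f'_bound[OF t] by simp
  then have "Mf * \<bar>t - 0\<bar> \<le> Mf * t1" using t by (intro mult_left_mono) auto
  with f_lipschitz[of t 0] t t1 show ?thesis by auto
qed

lemma layer_O_norm: "layer_O d n g \<Longrightarrow> layer_O d n (\<lambda>h \<epsilon> t z. of_real (norm (g h \<epsilon> t z)))"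
  by (simp add: layer_O_def)

text \<open>An exponentially decaying family has width \<open>\<epsilon>\<^bsup>1/4\<^esup>\<close>, which gains a factor \<open>\<epsilon>\<^bsup>1/8\<^esup>\<close> in \<open>L\<^sup>2\<close>.\<close>

lemma layer_O_square_integral:
  assumes g: "layer_O True n g" and \<alpha>: "0 \<le> \<alpha>"
  obtains C N where "0 \<le> C" "\<And>\<epsilon> t. 0 < \<epsilon> \<Longrightarrow> \<epsilon> < 1 \<Longrightarrow> 0 \<le> t \<Longrightarrow> t < t1 \<Longrightarrow> t \<le> K0 * sqrt \<epsilon> * L_log \<epsilon> \<Longrightarrow>
     \<exists>D. integrable lborel D \<and> (\<forall>z. 0 \<le> D z) \<and> (\<integral>z. D z \<partial>lborel) \<le> C * L_log \<epsilon> ^ (2 * N) * rt4 \<epsilon> powr (2 * n + 1) \<and>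
       (\<forall>z>0. z \<noteq> f t \<longrightarrow> \<bar>z - f t\<bar> \<le> \<delta> \<longrightarrow> (exp (\<alpha> * z) * norm (g (f t < z) \<epsilon> t z))\<^sup>2 \<le> D z)"
proof -
  obtain C N \<eta> where C: "0 \<le> C" "0 < \<eta>"
    "\<And>h \<epsilon> t z. dom h \<epsilon> t z \<Longrightarrow> norm (g h \<epsilon> t z) \<le> C * wt N \<epsilon> t z * rt4 \<epsilon> powr n * exp (- \<eta> * zeta \<epsilon> t z)"
    using g unfolding layer_O_def by auto
  \<comment> \<open>Half of the decay rate absorbs the polynomial weight; the other half is left for
    the integration.\<close>
  obtain K where K: "0 < K" "\<And>x. 0 \<le> x \<Longrightarrow> (1 + x) ^ N \<le> K * exp (\<eta> / 2 * x)"
    using power_le_exp[of "\<eta> / 2" N] C(2) by auto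
  \<comment> \<open>Within the window z is at most f 0 + Mf t1 + \<delta>, so the weight
    exp(\<alpha> z) is bounded by a constant there.\<close>
  define Z where "Z = exp (\<alpha> * (f 0 + Mf * t1 + \<delta>))"
  define C' where "C' = (Z * C * K)\<^sup>2"
  show ?thesis
  proof (rule that[of "C' * (2 / \<eta>)" N])
    show "0 \<le> C' * (2 / \<eta>)" using C(2) by (simp add: C'_def)
    fix \<epsilon> t :: real assume e: "0 < \<epsilon>" "\<epsilon> < 1" and t: "0 \<le> t" "t < t1" "t \<le> K0 * sqrt \<epsilon> * L_log \<epsilon>"
    note r = rt4_pos[OF e(1)]
    let ?k = "\<eta> / rt4 \<epsilon>"
    define P where "P = C' * L_log \<epsilon> ^ (2 * N) * rt4 \<epsilon> powr (2 * n)"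
    have P0: "0 \<le> P" using L_log_ge_1[of \<epsilon>] by (simp add: P_def C'_def)
    define D where "D z = P * (indicator {f t - \<delta>..f t + \<delta>} z * exp (- ?k * \<bar>z - f t\<bar>))" for z
    have k: "0 < ?k" using C(2) r by simp
    have "(\<integral>z. D z \<partial>lborel) = P * (\<integral>z. indicator {f t - \<delta>..f t + \<delta>} z * exp (- ?k * \<bar>z - f t\<bar>) \<partial>lborel)"
      unfolding D_def by (rule integral_mult_right_zero)
    also have "\<dots> \<le> P * (2 / ?k)"
      by (rule mult_left_mono[OF integral_exp_abs(2)[OF k less_imp_le[OF \<delta>]] P0])
    \<comment> \<open>2/k is 2/\<eta> times the width of the layer: this is the additional 1 in the
      exponent.\<close>
    also have "P * (2 / ?k) = C' * (2 / \<eta>) * L_log \<epsilon> ^ (2 * N) * rt4 \<epsilon> powr (2 * n + 1)"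
      using r by (simp add: P_def powr_add)
    finally have D: "(\<integral>z. D z \<partial>lborel) \<le> C' * (2 / \<eta>) * L_log \<epsilon> ^ (2 * N) * rt4 \<epsilon> powr (2 * n + 1)" .
    have "(exp (\<alpha> * z) * norm (g (f t < z) \<epsilon> t z))\<^sup>2 \<le> D z" if z: "0 < z" "z \<noteq> f t" "\<bar>z - f t\<bar> \<le> \<delta>" for z
    proof -
      have d: "dom (f t < z) \<epsilon> t z" using e t z by (simp add: dom_def)
      let ?\<zeta> = "zeta \<epsilon> t z"
      have "wt N \<epsilon> t z * exp (- \<eta> * ?\<zeta>) \<le> L_log \<epsilon> ^ N * (K * exp (\<eta> / 2 * ?\<zeta>)) * exp (- \<eta> * ?\<zeta>)"
        unfolding wt_def using K(2)[OF zeta_nonneg] L_log_ge_1[of \<epsilon>]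
        by (intro mult_right_mono mult_left_mono) auto
      also have "\<dots> = L_log \<epsilon> ^ N * K * (exp (\<eta> / 2 * ?\<zeta>) * exp (- \<eta> * ?\<zeta>))" by simp
      also have "exp (\<eta> / 2 * ?\<zeta>) * exp (- \<eta> * ?\<zeta>) = exp (- (\<eta> / 2) * ?\<zeta>)"
        unfolding exp_add[symmetric] by (simp add: algebra_simps)
      finally have w: "wt N \<epsilon> t z * exp (- \<eta> * ?\<zeta>) \<le> L_log \<epsilon> ^ N * K * exp (- (\<eta> / 2) * ?\<zeta>)" .
      have "norm (g (f t < z) \<epsilon> t z) \<le> (C * rt4 \<epsilon> powr n) * (wt N \<epsilon> t z * exp (- \<eta> * ?\<zeta>))"
        using C(3)[OF d] by (simp add: mult_ac)
      also have "\<dots> \<le> (C * rt4 \<epsilon> powr n) * (L_log \<epsilon> ^ N * K * exp (- (\<eta> / 2) * ?\<zeta>))"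
        using C(1) by (intro mult_left_mono w) auto
      finally have gb: "norm (g (f t < z) \<epsilon> t z) \<le> (C * rt4 \<epsilon> powr n) * (L_log \<epsilon> ^ N * K * exp (- (\<eta> / 2) * ?\<zeta>))" .
      have "exp (\<alpha> * z) \<le> Z"
        unfolding Z_def using \<alpha> f_upper[OF t(1,2)] z by (auto intro!: mult_left_mono)
      then have "exp (\<alpha> * z) * norm (g (f t < z) \<epsilon> t z) \<le> Z * ((C * rt4 \<epsilon> powr n) * (L_log \<epsilon> ^ N * K * exp (- (\<eta> / 2) * ?\<zeta>)))"
        by (intro mult_mono gb) (auto simp: Z_def)
      then have "(exp (\<alpha> * z) * norm (g (f t < z) \<epsilon> t z))\<^sup>2 \<le> (Z * ((C * rt4 \<epsilon> powr n) * (L_log \<epsilon> ^ N * K * exp (- (\<eta> / 2) * ?\<zeta>))))\<^sup>2"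
        by (intro power_mono) auto
      also have "\<dots> = P * (exp (- (\<eta> / 2) * ?\<zeta>))\<^sup>2"
        using r by (simp add: P_def C'_def power_mult_distrib power_mult[symmetric] powr_power mult_ac)
      also have "(exp (- (\<eta> / 2) * ?\<zeta>))\<^sup>2 = exp (- ?k * \<bar>z - f t\<bar>)"
        by (simp add: exp_of_nat_mult[symmetric] zeta_def flip: exp_double)
      finally show ?thesis using z by (auto simp: D_def abs_le_iff)
    qed
    moreover have "integrable lborel D" unfolding D_def
      using integral_exp_abs(1)[OF k less_imp_le[OF \<delta>], of "f t"] by simp
    moreover have "0 \<le> D z" for z using P0 by (simp add: D_def)
    ultimately show "\<exists>D. integrable lborel D \<and> (\<forall>z. 0 \<le> D z) \<and> (\<integral>z. D z \<partial>lborel) \<le> C' * (2 / \<eta>) * L_log \<epsilon> ^ (2 * N) * rt4 \<epsilon> powr (2 * n + 1) \<and>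
       (\<forall>z>0. z \<noteq> f t \<longrightarrow> \<bar>z - f t\<bar> \<le> \<delta> \<longrightarrow> (exp (\<alpha> * z) * norm (g (f t < z) \<epsilon> t z))\<^sup>2 \<le> D z)"
      using D by blast
  qed
qed

end

section \<open>Growth of the amplitude and the weighted estimates\<close>

locale critical_shear = critical_layer +
  fixes \<alpha> m MU cu :: real
  assumes \<alpha>: "0 \<le> \<alpha>" and cu: "0 < cu"
    and regs: "regular (us L)" "regular (vs L)" "regular (bs L)" "regular (gs L)"
    and lbs: "layer_bounded (us L) m" "layer_bounded (vs L) m" "layer_bounded (bs L) m" "layer_bounded (gs L) m"
    and L2: "\<And>t u. 0 \<le> t \<Longrightarrow> t < t1 \<Longrightarrow> u \<in> {us L, vs L, bs L, gs L} \<Longrightarrow>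
        dz u t \<in> L2_space \<alpha> \<and> (LINT z:{0..}|lborel. (exp (\<alpha> * z) * dz u t z)\<^sup>2) \<le> MU"
    and lower: "\<And>t z. 0 \<le> t \<Longrightarrow> t < t1 \<Longrightarrow> crit L t + \<delta> \<le> z \<Longrightarrow> z \<le> crit L t + 2 * \<delta> \<Longrightarrow> cu \<le> \<bar>dz (us L) t z\<bar>"
begin

definition \<sigma>0 :: real where "\<sigma>0 = - Im \<tau> * (q 0)\<^sup>2"

lemma \<sigma>0_pos: "0 < \<sigma>0"
  using Im_tau q_pos[of 0] t1 by (simp add: \<sigma>0_def mult_neg_pos)

lemma q_square_lipschitz: "0 \<le> t \<Longrightarrow> t < t1 \<Longrightarrow> \<bar>(q t)\<^sup>2 - (q 0)\<^sup>2\<bar> \<le> 2 * M\<^sup>2 * t"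
proof -
  assume t: "0 \<le> t" "t < t1"
  have d: "(q has_vector_derivative q' s) (at s within {0..<t1})" if "s \<in> {0..<t1}" for s
    using q'(1)[of s] that unfolding q_def[abs_def] by (simp flip: has_real_derivative_iff_has_vector_derivative)
  have "norm (q t - q 0) \<le> M * \<bar>t - 0\<bar>"
    by (rule vector_derivative_lipschitz[OF _ d]) (use q'(3) t t1 in auto)
  then have "\<bar>q t - q 0\<bar> \<le> M * t" using t by simp
  moreover have "\<bar>q t + q 0\<bar> \<le> 2 * M" using q_pos[OF t] q_le(1)[OF t] q_pos[of 0] q_le(1)[of 0] t1 by simp
  ultimately have "\<bar>q t - q 0\<bar> * \<bar>q t + q 0\<bar> \<le> (M * t) * (2 * M)" using M_nonneg t by (intro mult_mono) auto
  moreover have "(q t)\<^sup>2 - (q 0)\<^sup>2 = (q t - q 0) * (q t + q 0)" by (simp add: power2_eq_square algebra_simps)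
  ultimately show ?thesis by (simp add: abs_mult power2_eq_square mult_ac)
qed

text \<open>The real term -w(t, f(t)) of \<lambda> only turns the phase; the modulus sees
  \<epsilon>^(1/2) \<kappa>^(1/2) Im \<tau>, divided by \<epsilon>.\<close>

lemma norm_E_amp:
  assumes e: "0 < \<epsilon>" and t: "0 \<le> t" "t < t1"
  shows "norm (E_amp L \<epsilon> t) = exp (- Im \<tau> / sqrt \<epsilon> * integral {0..t} (\<lambda>s. (q s)\<^sup>2))"
proof -
  have sub: "{0..t} \<subseteq> {0..<t1}" using t by auto
  have li: "lam L \<epsilon> integrable_on {0..t}"
    by (rule integrable_continuous_real[OF continuous_on_subset[OF lam_cont sub]])
  have "Im (integral {0..t} (lam L \<epsilon>)) = integral {0..t} (Im \<circ> lam L \<epsilon>)"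
    by (rule integral_linear[OF li bounded_linear_Im, symmetric])
  also have "\<dots> = integral {0..t} (\<lambda>s. (sqrt \<epsilon> * Im \<tau>) * (q s)\<^sup>2)"
    by (rule Henstock_Kurzweil_Integration.integral_cong) (use t in \<open>auto simp: lam_def sqrt_kap\<close>)
  also have "\<dots> = (sqrt \<epsilon> * Im \<tau>) * integral {0..t} (\<lambda>s. (q s)\<^sup>2)" by simp
  finally have I: "Im (integral {0..t} (lam L \<epsilon>)) = (sqrt \<epsilon> * Im \<tau>) * integral {0..t} (\<lambda>s. (q s)\<^sup>2)" .
  have "norm (E_amp L \<epsilon> t) = exp (Re (\<i> / of_real \<epsilon> * integral {0..t} (lam L \<epsilon>)))"
    unfolding E_amp_def by (rule norm_exp_eq_Re)
  also have "Re (\<i> / of_real \<epsilon> * integral {0..t} (lam L \<epsilon>)) = - Im (integral {0..t} (lam L \<epsilon>)) / \<epsilon>"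
    by simp
  also have "\<dots> = - Im \<tau> * (sqrt \<epsilon> / \<epsilon>) * integral {0..t} (\<lambda>s. (q s)\<^sup>2)"
    unfolding I by simp
  also have "sqrt \<epsilon> / \<epsilon> = 1 / sqrt \<epsilon>" using e by (simp add: field_simps)
  finally show ?thesis by simp
qed

lemma q_integral:
  assumes t: "0 \<le> t" "t < t1"
  shows "\<bar>integral {0..t} (\<lambda>s. (q s)\<^sup>2) - (q 0)\<^sup>2 * t\<bar> \<le> 2 * M\<^sup>2 * t\<^sup>2"
proof -
  have sub: "{0..t} \<subseteq> {0..<t1}" using t by auto
  have qi: "(\<lambda>s. (q s)\<^sup>2) integrable_on {0..t}"
    by (intro integrable_continuous_real continuous_intros continuous_on_subset[OF q_cont sub])
  have "integral {0..t} (\<lambda>s. (q s)\<^sup>2) - (q 0)\<^sup>2 * t = integral {0..t} (\<lambda>s. (q s)\<^sup>2) - integral {0..t} (\<lambda>s. (q 0)\<^sup>2)"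
    using t by simp
  also have "\<dots> = integral {0..t} (\<lambda>s. (q s)\<^sup>2 - (q 0)\<^sup>2)"
    by (rule Henstock_Kurzweil_Integration.integral_diff[symmetric]) (use qi in auto)
  also have "norm \<dots> \<le> (2 * M\<^sup>2 * t) * (t - 0)"
  proof (rule integral_bound)
    show "continuous_on {0..t} (\<lambda>s. (q s)\<^sup>2 - (q 0)\<^sup>2)" by (intro continuous_intros continuous_on_subset[OF q_cont sub])
    show "norm ((q s)\<^sup>2 - (q 0)\<^sup>2) \<le> 2 * M\<^sup>2 * t" if "s \<in> {0..t}" for s
      using q_square_lipschitz[of s] that t mult_left_mono[of s t "2 * M\<^sup>2"] by auto
  qed (use t in auto)
  finally show ?thesis by (simp add: power2_eq_square)
qed

lemma E_amp_bounds:
  obtains K where "0 < K" "\<And>\<epsilon> t. 0 < \<epsilon> \<Longrightarrow> \<epsilon> < 1 \<Longrightarrow> 0 \<le> t \<Longrightarrow> t < t1 \<Longrightarrow> t \<le> K0 * sqrt \<epsilon> * L_log \<epsilon> \<Longrightarrow>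
     exp (\<sigma>0 * t / sqrt \<epsilon>) / K \<le> norm (E_amp L \<epsilon> t) \<and> norm (E_amp L \<epsilon> t) \<le> K * exp (\<sigma>0 * t / sqrt \<epsilon>)"
proof -
  obtain B where B: "0 < B" "\<And>\<epsilon>. 0 < \<epsilon> \<Longrightarrow> \<epsilon> < 1 \<Longrightarrow> sqrt \<epsilon> * L_log \<epsilon> ^ 2 \<le> B"
    using sqrt_L_log_bounded by blast
  define k where "k = - Im \<tau> * (2 * M\<^sup>2 * (K0\<^sup>2 * B))"
  show ?thesis
  proof (rule that[of "exp k"])
    fix \<epsilon> t :: real assume e: "0 < \<epsilon>" "\<epsilon> < 1" and t: "0 \<le> t" "t < t1" "t \<le> K0 * sqrt \<epsilon> * L_log \<epsilon>"
    have "t\<^sup>2 \<le> (K0 * sqrt \<epsilon> * L_log \<epsilon>)\<^sup>2" using t by (intro power_mono) auto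
    also have "\<dots> = sqrt \<epsilon> * (K0\<^sup>2 * (sqrt \<epsilon> * L_log \<epsilon> ^ 2))" using e by (simp add: power2_eq_square)
    also have "\<dots> \<le> sqrt \<epsilon> * (K0\<^sup>2 * B)" using B(2)[OF e] e by (intro mult_left_mono) auto
    finally have t2: "t\<^sup>2 \<le> sqrt \<epsilon> * (K0\<^sup>2 * B)" .
    define I where "I = integral {0..t} (\<lambda>s. (q s)\<^sup>2)"
    have s: "0 < sqrt \<epsilon>" using e by simp
    have "\<bar>I - (q 0)\<^sup>2 * t\<bar> \<le> 2 * M\<^sup>2 * (sqrt \<epsilon> * (K0\<^sup>2 * B))"
      using q_integral[OF t(1,2)] mult_left_mono[OF t2, of "2 * M\<^sup>2"] unfolding I_def by simp
    then have "\<bar>I - (q 0)\<^sup>2 * t\<bar> / sqrt \<epsilon> \<le> 2 * M\<^sup>2 * (K0\<^sup>2 * B)" using s by (simp add: field_simps)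
    then have "- Im \<tau> * (\<bar>I - (q 0)\<^sup>2 * t\<bar> / sqrt \<epsilon>) \<le> k"
      unfolding k_def using Im_tau by (intro mult_left_mono) auto
    moreover have "\<bar>- Im \<tau> / sqrt \<epsilon> * I - \<sigma>0 * t / sqrt \<epsilon>\<bar> = - Im \<tau> * (\<bar>I - (q 0)\<^sup>2 * t\<bar> / sqrt \<epsilon>)"
    proof -
      have "- Im \<tau> / sqrt \<epsilon> * I - \<sigma>0 * t / sqrt \<epsilon> = - Im \<tau> * ((I - (q 0)\<^sup>2 * t) / sqrt \<epsilon>)"
        by (simp add: \<sigma>0_def diff_divide_distrib algebra_simps)
      then show ?thesis using Im_tau s by (simp add: abs_mult)
    qed
    ultimately have le: "\<bar>- Im \<tau> / sqrt \<epsilon> * I - \<sigma>0 * t / sqrt \<epsilon>\<bar> \<le> k" by simp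
    have le': "\<sigma>0 * t / sqrt \<epsilon> - k \<le> - Im \<tau> / sqrt \<epsilon> * I" "- Im \<tau> / sqrt \<epsilon> * I \<le> k + \<sigma>0 * t / sqrt \<epsilon>"
    proof -
      have "y - x \<le> a \<and> a \<le> x + y" if "\<bar>a - y\<bar> \<le> x" for a x y :: real using that by linarith
      from this[OF le] show "\<sigma>0 * t / sqrt \<epsilon> - k \<le> - Im \<tau> / sqrt \<epsilon> * I" "- Im \<tau> / sqrt \<epsilon> * I \<le> k + \<sigma>0 * t / sqrt \<epsilon>"
        by blast+
    qed
    have "exp (\<sigma>0 * t / sqrt \<epsilon>) / exp k \<le> exp (- Im \<tau> / sqrt \<epsilon> * I)"
      unfolding exp_diff[symmetric] exp_le_cancel_iff by (rule le')
    moreover have "exp (- Im \<tau> / sqrt \<epsilon> * I) \<le> exp k * exp (\<sigma>0 * t / sqrt \<epsilon>)"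
      unfolding exp_add[symmetric] exp_le_cancel_iff by (rule le')
    ultimately show "exp (\<sigma>0 * t / sqrt \<epsilon>) / exp k \<le> norm (E_amp L \<epsilon> t) \<and> norm (E_amp L \<epsilon> t) \<le> exp k * exp (\<sigma>0 * t / sqrt \<epsilon>)"
      unfolding norm_E_amp[OF e(1) t(1,2)] I_def by simp
  qed simp
qed

lemma norm_quadruple_le: "norm (a, b, c, d) \<le> norm a + norm b + norm c + norm d"
  using norm_Pair_le[of a "(b, c, d)"] norm_Pair_le[of b "(c, d)"] norm_Pair_le[of c d] by linarith

lemma set_borel_measurable_quadruple:
  fixes g1 g2 g3 g4 :: "real \<Rightarrow> complex"
  assumes "set_borel_measurable M' S g1" "set_borel_measurable M' S g2"
    "set_borel_measurable M' S g3" "set_borel_measurable M' S g4"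
  shows "set_borel_measurable M' S (\<lambda>z. (g1 z, g2 z, g3 z, g4 z))"
proof -
  have "(\<lambda>z. (indicator S z *\<^sub>R g1 z, indicator S z *\<^sub>R g2 z, indicator S z *\<^sub>R g3 z, indicator S z *\<^sub>R g4 z)) \<in> borel_measurable M'"
    using assms unfolding set_borel_measurable_def by (intro borel_measurable_Pair)
  then show ?thesis unfolding set_borel_measurable_def by (simp add: scaleR_Pair)
qed

lemma residual_estimate:
  assumes T: "t1 \<le> T"
  obtains C N where "0 \<le> C" "\<And>\<epsilon> t. 0 < \<epsilon> \<Longrightarrow> \<epsilon> < 1 \<Longrightarrow> 0 \<le> t \<Longrightarrow> t < t1 \<Longrightarrow> t \<le> K0 * sqrt \<epsilon> * L_log \<epsilon> \<Longrightarrow>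
     (\<exists>R. residual L \<phi> \<epsilon> T t R \<and> R \<in> L2_space \<alpha> \<and>
        L2_norm \<alpha> R \<le> norm (E_amp L \<epsilon> t) * (C * L_log \<epsilon> ^ N * \<epsilon> powr (- 3 / 8)))"
proof -
  \<comment> \<open>A single scalar family dominates the quadruple, so one application of the square
    integral bound serves all components.\<close>
  define S where "S h \<epsilon> t z = complex_of_real (norm (RUj (us L) h \<epsilon> t z)) + of_real (norm (RUj (vs L) h \<epsilon> t z))
    + of_real (norm (RBj (us L) (bs L) h \<epsilon> t z)) + of_real (norm (RBj (vs L) (gs L) h \<epsilon> t z))" for h \<epsilon> t z
  have S: "layer_O True (-2) S" unfolding S_def
    by (intro layer_O_add layer_O_norm layer_O_RUj[OF lbs(1)] layer_O_RUj[OF lbs(2)] layer_O_RBj[OF lbs(1,3)] layer_O_RBj[OF lbs(2,4)])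
  have nS: "norm (S h \<epsilon> t z) = norm (RUj (us L) h \<epsilon> t z) + norm (RUj (vs L) h \<epsilon> t z)
    + norm (RBj (us L) (bs L) h \<epsilon> t z) + norm (RBj (vs L) (gs L) h \<epsilon> t z)" for h \<epsilon> t z
    unfolding S_def of_real_add[symmetric] norm_of_real by simp
  obtain C N where C: "0 \<le> C" "\<And>\<epsilon> t. 0 < \<epsilon> \<Longrightarrow> \<epsilon> < 1 \<Longrightarrow> 0 \<le> t \<Longrightarrow> t < t1 \<Longrightarrow> t \<le> K0 * sqrt \<epsilon> * L_log \<epsilon> \<Longrightarrow>
     \<exists>D. integrable lborel D \<and> (\<forall>z. 0 \<le> D z) \<and> (\<integral>z. D z \<partial>lborel) \<le> C * L_log \<epsilon> ^ (2 * N) * rt4 \<epsilon> powr (2 * (-2) + 1) \<and>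
       (\<forall>z>0. z \<noteq> f t \<longrightarrow> \<bar>z - f t\<bar> \<le> \<delta> \<longrightarrow> (exp (\<alpha> * z) * norm (S (f t < z) \<epsilon> t z))\<^sup>2 \<le> D z)"
    using layer_O_square_integral[OF S \<alpha>] by blast
  show ?thesis
  proof (rule that[of "sqrt C" N])
    show "0 \<le> sqrt C" using C(1) by simp
    fix \<epsilon> t :: real assume e: "0 < \<epsilon>" "\<epsilon> < 1" and t: "0 \<le> t" "t < t1" "t \<le> K0 * sqrt \<epsilon> * L_log \<epsilon>"
    obtain D where D: "integrable lborel D" "\<And>z. 0 \<le> D z" "(\<integral>z. D z \<partial>lborel) \<le> C * L_log \<epsilon> ^ (2 * N) * rt4 \<epsilon> powr - 3"
      "\<And>z. 0 < z \<Longrightarrow> z \<noteq> f t \<Longrightarrow> \<bar>z - f t\<bar> \<le> \<delta> \<Longrightarrow> (exp (\<alpha> * z) * norm (S (f t < z) \<epsilon> t z))\<^sup>2 \<le> D z"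
      using C(2)[OF e t] by auto
    let ?E = "E_amp L \<epsilon> t"
    obtain R1 where R1: "velocity_residual L \<phi> \<epsilon> T (us L) (bs L) t R1"
      "\<And>z. 0 < z \<Longrightarrow> z \<noteq> f t \<Longrightarrow> R1 z = \<i> * ?E * RUj (us L) (f t < z) \<epsilon> t z"
      using velocity_residual_glued[OF e t(1,2) T regs(1,3)] by blast
    obtain R2 where R2: "velocity_residual L \<phi> \<epsilon> T (vs L) (gs L) t R2"
      "\<And>z. 0 < z \<Longrightarrow> z \<noteq> f t \<Longrightarrow> R2 z = \<i> * ?E * RUj (vs L) (f t < z) \<epsilon> t z"
      using velocity_residual_glued[OF e t(1,2) T regs(2,4)] by blast
    obtain R3 where R3: "magnetic_residual L \<phi> \<epsilon> T (us L) (bs L) t R3"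
      "\<And>z. 0 < z \<Longrightarrow> z \<noteq> f t \<Longrightarrow> R3 z = \<i> * ?E * RBj (us L) (bs L) (f t < z) \<epsilon> t z"
      using magnetic_residual_glued[OF e t(1,2) T regs(1,3)] by blast
    obtain R4 where R4: "magnetic_residual L \<phi> \<epsilon> T (vs L) (gs L) t R4"
      "\<And>z. 0 < z \<Longrightarrow> z \<noteq> f t \<Longrightarrow> R4 z = \<i> * ?E * RBj (vs L) (gs L) (f t < z) \<epsilon> t z"
      using magnetic_residual_glued[OF e t(1,2) T regs(2,4)] by blast
    define R where "R z = (R1 z, R2 z, R3 z, R4 z)" for z
    have res: "residual L \<phi> \<epsilon> T t R" unfolding residual_def R_def using R1(1) R2(1) R3(1) R4(1) by simp
    have m: "set_borel_measurable lborel {0..} R" unfolding R_def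
      using R1(1) R2(1) R3(1) R4(1)
      by (intro set_borel_measurable_quadruple loc_integrable_measurable)
         (auto simp: velocity_residual_def magnetic_residual_def heat_residual_def)
    have nR: "norm (R z) \<le> norm ?E * norm (S (f t < z) \<epsilon> t z)" if "0 < z" "z \<noteq> f t" for z
      unfolding R_def R1(2)[OF that] R2(2)[OF that] R3(2)[OF that] R4(2)[OF that] nS
      by (rule order.trans[OF norm_quadruple_le]) (simp add: norm_mult algebra_simps)
    have le: "(norm (exp (\<alpha> * z) *\<^sub>R R z))\<^sup>2 \<le> (norm ?E)\<^sup>2 * D z" if z: "0 < z" "z \<noteq> f t" for z
    proof (cases "\<bar>z - f t\<bar> \<le> \<delta>")
      case True
      have "norm (exp (\<alpha> * z) *\<^sub>R R z) \<le> norm ?E * (exp (\<alpha> * z) * norm (S (f t < z) \<epsilon> t z))"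
        using mult_left_mono[OF nR[OF z], of "exp (\<alpha> * z)"] by (simp add: mult_ac)
      then have "(norm (exp (\<alpha> * z) *\<^sub>R R z))\<^sup>2 \<le> (norm ?E * (exp (\<alpha> * z) * norm (S (f t < z) \<epsilon> t z)))\<^sup>2"
        by (intro power_mono) auto
      also have "\<dots> \<le> (norm ?E)\<^sup>2 * D z"
        unfolding power_mult_distrib[of "norm ?E"] using D(4)[OF z True] by (intro mult_left_mono) auto
      finally show ?thesis .
    next
      case False
      then have "norm (S (f t < z) \<epsilon> t z) = 0" unfolding nS by (simp add: RUj_outside RBj_outside)
      with nR[OF z] have "R z = 0" by simp
      then show ?thesis using D(2) by simp
    qed
    let ?B = "(norm ?E)\<^sup>2 * (C * L_log \<epsilon> ^ (2 * N) * rt4 \<epsilon> powr - 3)"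
    have "integrable lborel (\<lambda>z. (norm ?E)\<^sup>2 * D z)" "(\<integral>z. (norm ?E)\<^sup>2 * D z \<partial>lborel) \<le> ?B"
      using D(1,3) by (auto intro: mult_left_mono)
    note L = L2_majorant[OF m this _ le]
    \<comment> \<open>The squared norm has order 2 (-2) + 1 = -3 in \<open>rt4 \<epsilon>\<close>,
      that is \<epsilon>^(-3/4).\<close>
    have "sqrt ?B = norm ?E * (sqrt C * L_log \<epsilon> ^ N * \<epsilon> powr (- 3 / 8))"
    proof -
      have "sqrt (rt4 \<epsilon> powr - 3) = \<epsilon> powr (- 3 / 8)"
        using e by (simp add: rt4_def powr_powr powr_half_sqrt[symmetric])
      moreover have "sqrt (L_log \<epsilon> ^ (2 * N)) = L_log \<epsilon> ^ N"
        using L_log_ge_1[of \<epsilon>] by (simp add: power_mult power_even_abs real_sqrt_power)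
      ultimately show ?thesis by (simp add: real_sqrt_mult)
    qed
    then show "\<exists>R. residual L \<phi> \<epsilon> T t R \<and> R \<in> L2_space \<alpha> \<and>
        L2_norm \<alpha> R \<le> norm ?E * (sqrt C * L_log \<epsilon> ^ N * \<epsilon> powr (- 3 / 8))"
      using res L D(2) by (intro exI[of _ R]) auto
  qed
qed

lemma Z_measurable:
  assumes e: "0 < \<epsilon>" "\<epsilon> < 1" and t: "0 \<le> t" "t < t1"
  shows "set_borel_measurable lborel {0..} (Z_amp L \<phi> \<epsilon> t)"
proof -
  \<comment> \<open>Local integrability of the amplitude is part of a residual identity, so
    measurability is read off from the identities already established.\<close>
  have "loc_integrable (U_amp L \<phi> \<epsilon> u t)" "loc_integrable (B_amp L \<phi> \<epsilon> u b t)" if "regular u" "regular b" for u b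
    using velocity_residual_glued[OF e t order.refl that] magnetic_residual_glued[OF e t order.refl that]
    by (auto simp: velocity_residual_def magnetic_residual_def heat_residual_def)
  then show ?thesis unfolding Z_amp_def[abs_def] using regs
    by (intro set_borel_measurable_quadruple loc_integrable_measurable)
qed

lemma Z_estimate:
  obtains C N where "0 \<le> C" "\<And>\<epsilon> t. 0 < \<epsilon> \<Longrightarrow> \<epsilon> < 1 \<Longrightarrow> 0 \<le> t \<Longrightarrow> t < t1 \<Longrightarrow> t \<le> K0 * sqrt \<epsilon> * L_log \<epsilon> \<Longrightarrow>
     Z_amp L \<phi> \<epsilon> t \<in> L2_space \<alpha> \<and> L2_norm \<alpha> (Z_amp L \<phi> \<epsilon> t) \<le> norm (E_amp L \<epsilon> t) * (C * L_log \<epsilon> ^ N)"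
proof -
  define S where "S h \<epsilon> t z = complex_of_real (norm (jv (ULj (us L) h \<epsilon> t z))) + of_real (norm (jv (ULj (vs L) h \<epsilon> t z)))
    + of_real (norm (jv (BLj (us L) (bs L) h \<epsilon> t z))) + of_real (norm (jv (BLj (vs L) (gs L) h \<epsilon> t z)))" for h \<epsilon> t z
  have o: "layer_O True 0 (\<lambda>h \<epsilon> t z. jv (ULj u h \<epsilon> t z))" if "layer_bounded u m" for u
    using jet_O_ULj[OF that] by (simp add: jet_O_def)
  have o': "layer_O True 0 (\<lambda>h \<epsilon> t z. jv (BLj u b h \<epsilon> t z))" if "layer_bounded u m" "layer_bounded b m" for u b
    using jet_O_BLj[OF that] by (simp add: jet_O_def)
  have S: "layer_O True 0 S" unfolding S_def
    by (intro layer_O_add layer_O_norm o[OF lbs(1)] o[OF lbs(2)] o'[OF lbs(1,3)] o'[OF lbs(2,4)])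
  have nS: "norm (S h \<epsilon> t z) = norm (jv (ULj (us L) h \<epsilon> t z)) + norm (jv (ULj (vs L) h \<epsilon> t z))
    + norm (jv (BLj (us L) (bs L) h \<epsilon> t z)) + norm (jv (BLj (vs L) (gs L) h \<epsilon> t z))" for h \<epsilon> t z
    unfolding S_def of_real_add[symmetric] norm_of_real by simp
  obtain C N where C: "0 \<le> C" "\<And>\<epsilon> t. 0 < \<epsilon> \<Longrightarrow> \<epsilon> < 1 \<Longrightarrow> 0 \<le> t \<Longrightarrow> t < t1 \<Longrightarrow> t \<le> K0 * sqrt \<epsilon> * L_log \<epsilon> \<Longrightarrow>
     \<exists>D. integrable lborel D \<and> (\<forall>z. 0 \<le> D z) \<and> (\<integral>z. D z \<partial>lborel) \<le> C * L_log \<epsilon> ^ (2 * N) * rt4 \<epsilon> powr (2 * 0 + 1) \<and>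
       (\<forall>z>0. z \<noteq> f t \<longrightarrow> \<bar>z - f t\<bar> \<le> \<delta> \<longrightarrow> (exp (\<alpha> * z) * norm (S (f t < z) \<epsilon> t z))\<^sup>2 \<le> D z)"
    using layer_O_square_integral[OF S \<alpha>] by blast
  have "0 \<le> (LINT z:{0..}|lborel. (exp (\<alpha> * z) * dz (us L) 0 z)\<^sup>2)"
    unfolding set_lebesgue_integral_def by (rule integral_nonneg_AE) auto
  then have MU: "0 \<le> MU" using L2[of 0 "us L"] t1 by auto
  show ?thesis
  \<comment> \<open>32 is 8 times 4: the shear parts contribute 8 W, where the integral of W is at
    most 4 \<open>MU\<close>, and the layer parts contribute 2 D.\<close>
  proof (rule that[of "sqrt (32 * MU + 2 * C)" N])
    show "0 \<le> sqrt (32 * MU + 2 * C)" using C(1) MU by simp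
    fix \<epsilon> t :: real assume e: "0 < \<epsilon>" "\<epsilon> < 1" and t: "0 \<le> t" "t < t1" "t \<le> K0 * sqrt \<epsilon> * L_log \<epsilon>"
    obtain D where D: "integrable lborel D" "\<And>z. 0 \<le> D z" "(\<integral>z. D z \<partial>lborel) \<le> C * L_log \<epsilon> ^ (2 * N) * rt4 \<epsilon>"
      "\<And>z. 0 < z \<Longrightarrow> z \<noteq> f t \<Longrightarrow> \<bar>z - f t\<bar> \<le> \<delta> \<Longrightarrow> (exp (\<alpha> * z) * norm (S (f t < z) \<epsilon> t z))\<^sup>2 \<le> D z"
      using C(2)[OF e t] rt4_pos[OF e(1)] by auto
    let ?E = "E_amp L \<epsilon> t"
    define w where "w u z = indicator {0..} z * (exp (\<alpha> * z) * dz u t z)\<^sup>2" for u and z :: real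
    have wi: "integrable lborel (w u)" "(\<integral>z. w u z \<partial>lborel) \<le> MU" if "u \<in> {us L, vs L, bs L, gs L}" for u
      using L2[OF t(1,2) that] unfolding w_def L2_space_def set_integrable_def set_lebesgue_integral_def
      by (simp_all add: power_mult_distrib)
    define W where "W z = w (us L) z + w (vs L) z + w (bs L) z + w (gs L) z" for z
    have Wi: "integrable lborel W" "(\<integral>z. W z \<partial>lborel) \<le> 4 * MU"
      unfolding W_def using wi[of "us L"] wi[of "vs L"] wi[of "bs L"] wi[of "gs L"] by simp_all
    have W0: "0 \<le> W z" for z by (simp add: W_def w_def)
    have le: "(norm (exp (\<alpha> * z) *\<^sub>R Z_amp L \<phi> \<epsilon> t z))\<^sup>2 \<le> (norm ?E)\<^sup>2 * (8 * W z + 2 * D z)" if z: "0 < z" "z \<noteq> f t" for z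
    proof -
      define h where "h = (f t < z)"
      define s where "s = norm (S h \<epsilon> t z)"
      let ?k = "\<bar>dz (us L) t z\<bar> + \<bar>dz (vs L) t z\<bar> + \<bar>dz (bs L) t z\<bar> + \<bar>dz (gs L) t z\<bar>"
      have nU: "norm (U_amp L \<phi> \<epsilon> u t z) \<le> norm ?E * (\<bar>dz u t z\<bar> + norm (jv (ULj u h \<epsilon> t z)))" for u
        unfolding transport_terms(1)[OF e t(1,2) z h_def] norm_mult norm_ii mult_1
        by (intro mult_left_mono)
           (auto simp: Uj_def jadd_def jmul_def side_jet_def flow_jet_def Let_def intro: order.trans[OF norm_triangle_ineq])
      have nB: "norm (B_amp L \<phi> \<epsilon> u b t z) \<le> norm ?E * (\<bar>dz b t z\<bar> + norm (jv (BLj u b h \<epsilon> t z)))" for u b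
        unfolding transport_terms(2)[OF e t(1,2) z h_def] norm_mult norm_ii mult_1
        by (intro mult_left_mono)
           (auto simp: Bj_def jadd_def jmul_def side_jet_def flow_jet_def Let_def intro: order.trans[OF norm_triangle_ineq])
      have "norm (Z_amp L \<phi> \<epsilon> t z) \<le> norm (U_amp L \<phi> \<epsilon> (us L) t z) + norm (U_amp L \<phi> \<epsilon> (vs L) t z)
         + norm (B_amp L \<phi> \<epsilon> (us L) (bs L) t z) + norm (B_amp L \<phi> \<epsilon> (vs L) (gs L) t z)"
        unfolding Z_amp_def by (rule norm_quadruple_le)
      also have "\<dots> \<le> norm ?E * (?k + s)"
        using nU[of "us L"] nU[of "vs L"] nB[of "us L" "bs L"] nB[of "vs L" "gs L"]
        unfolding s_def nS by (simp add: algebra_simps)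
      finally have "exp (\<alpha> * z) * norm (Z_amp L \<phi> \<epsilon> t z) \<le> exp (\<alpha> * z) * (norm ?E * (?k + s))"
        by (rule mult_left_mono) simp
      also have "\<dots> = norm ?E * (exp (\<alpha> * z) * (?k + s))" by (rule mult.left_commute)
      finally have "norm (exp (\<alpha> * z) *\<^sub>R Z_amp L \<phi> \<epsilon> t z) \<le> norm ?E * (exp (\<alpha> * z) * (?k + s))"
        by simp
      then have "(norm (exp (\<alpha> * z) *\<^sub>R Z_amp L \<phi> \<epsilon> t z))\<^sup>2 \<le> (norm ?E * (exp (\<alpha> * z) * (?k + s)))\<^sup>2"
        by (intro power_mono) auto
      also have "\<dots> = (norm ?E)\<^sup>2 * (exp (\<alpha> * z) * ?k + exp (\<alpha> * z) * s)\<^sup>2"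
        unfolding power_mult_distrib[of "norm ?E"] by (simp only: distrib_left)
      also have "\<dots> \<le> (norm ?E)\<^sup>2 * (8 * W z + 2 * D z)"
      proof (rule mult_left_mono)
        have sq: "(x + y)\<^sup>2 \<le> 2 * x\<^sup>2 + 2 * y\<^sup>2" for x y :: real
          using zero_le_power2[of "x - y"] by (simp add: power2_eq_square algebra_simps)
        have sq4: "(a + b + c + d)\<^sup>2 \<le> 4 * (a\<^sup>2 + b\<^sup>2 + c\<^sup>2 + d\<^sup>2)" for a b c d :: real
          using sq[of "a + b" "c + d"] sq[of a b] sq[of c d] by (simp add: algebra_simps)
        have "(exp (\<alpha> * z) * ?k)\<^sup>2 \<le> 4 * W z"
          using sq4[of "exp (\<alpha> * z) * \<bar>dz (us L) t z\<bar>" "exp (\<alpha> * z) * \<bar>dz (vs L) t z\<bar>" "exp (\<alpha> * z) * \<bar>dz (bs L) t z\<bar>" "exp (\<alpha> * z) * \<bar>dz (gs L) t z\<bar>"] z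
          by (simp add: W_def w_def distrib_left power_mult_distrib)
        moreover have "(exp (\<alpha> * z) * s)\<^sup>2 \<le> D z"
        proof (cases "\<bar>z - f t\<bar> \<le> \<delta>")
          case True
          then show ?thesis using D(4)[OF z] by (simp add: s_def h_def)
        next
          case False
          then have "s = 0" unfolding s_def nS using localized_ULj[unfolded localized_def] localized_BLj[unfolded localized_def] by simp
          then show ?thesis using D(2) by simp
        qed
        ultimately show "(exp (\<alpha> * z) * ?k + exp (\<alpha> * z) * s)\<^sup>2 \<le> 8 * W z + 2 * D z"
          using sq[of "exp (\<alpha> * z) * ?k" "exp (\<alpha> * z) * s"] by linarith
      qed simp
      finally show ?thesis .
    qed
    let ?B = "(norm ?E)\<^sup>2 * ((32 * MU + 2 * C) * L_log \<epsilon> ^ (2 * N))"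
    have L1: "1 \<le> L_log \<epsilon> ^ (2 * N)" using L_log_ge_1 by (rule one_le_power)
    have i: "integrable lborel (\<lambda>z. (norm ?E)\<^sup>2 * (8 * W z + 2 * D z))" using Wi(1) D(1) by simp
    have "(\<integral>z. (norm ?E)\<^sup>2 * (8 * W z + 2 * D z) \<partial>lborel) = (norm ?E)\<^sup>2 * (8 * (\<integral>z. W z \<partial>lborel) + 2 * (\<integral>z. D z \<partial>lborel))"
      using Wi(1) D(1) by simp
    also have "\<dots> \<le> ?B"
    proof (rule mult_left_mono)
      \<comment> \<open>The gain from the small width is dropped here, as the Heaviside parts are of
        size 1 anyway.\<close>
      have "C * L_log \<epsilon> ^ (2 * N) * rt4 \<epsilon> \<le> C * L_log \<epsilon> ^ (2 * N)"
        using rt4_less_1[OF e] rt4_pos[OF e(1)] C(1) L1 by (intro mult_left_le) auto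
      moreover have "MU \<le> MU * L_log \<epsilon> ^ (2 * N)" using L1 MU mult_left_mono by fastforce
      ultimately show "8 * (\<integral>z. W z \<partial>lborel) + 2 * (\<integral>z. D z \<partial>lborel) \<le> (32 * MU + 2 * C) * L_log \<epsilon> ^ (2 * N)"
        using Wi(2) D(3) by (simp add: distrib_right)
    qed simp
    finally have ib: "(\<integral>z. (norm ?E)\<^sup>2 * (8 * W z + 2 * D z) \<partial>lborel) \<le> ?B" .
    have nn: "0 \<le> (norm ?E)\<^sup>2 * (8 * W z + 2 * D z)" for z using W0 D(2) by simp
    have "sqrt ?B = norm ?E * (sqrt (32 * MU + 2 * C) * L_log \<epsilon> ^ N)"
      using L_log_ge_1[of \<epsilon>] by (simp add: real_sqrt_mult power_mult power_even_abs real_sqrt_power)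
    then show "Z_amp L \<phi> \<epsilon> t \<in> L2_space \<alpha> \<and> L2_norm \<alpha> (Z_amp L \<phi> \<epsilon> t) \<le> norm ?E * (sqrt (32 * MU + 2 * C) * L_log \<epsilon> ^ N)"
      using L2_majorant[OF Z_measurable[OF e t(1,2)] i ib nn le] by auto
  qed
qed

lemma Z_lower:
  assumes e: "0 < \<epsilon>" "\<epsilon> < 1" and t: "0 \<le> t" "t < t1" and Z: "Z_amp L \<phi> \<epsilon> t \<in> L2_space \<alpha>"
  shows "norm (E_amp L \<epsilon> t) * (sqrt \<delta> * cu) \<le> L2_norm \<alpha> (Z_amp L \<phi> \<epsilon> t)"
proof -
  let ?E = "E_amp L \<epsilon> t"
  let ?I = "{f t + \<delta>..f t + 2 * \<delta>}"
  have ft: "0 < f t" using f_gt[OF t] \<delta> by simp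
  have le: "indicator ?I z * (norm ?E * cu)\<^sup>2 \<le> indicator {0..} z *\<^sub>R (norm (exp (\<alpha> * z) *\<^sub>R Z_amp L \<phi> \<epsilon> t z))\<^sup>2" for z
  proof (cases "z \<in> ?I")
    case True
    \<comment> \<open>Here the layer terms vanish and the Heaviside function is 1; as \<alpha> \<ge>
      0, the weight can only increase the norm.\<close>
    then have z: "0 < z" "z \<noteq> f t" "f t < z" "\<delta> \<le> \<bar>z - f t\<bar>" using ft \<delta> by auto
    have "U_amp L \<phi> \<epsilon> (us L) t z = \<i> * ?E * of_real (dz (us L) t z)"
      unfolding transport_terms(1)[OF e t z(1,2) refl] using localized_ULj[of "us L"] z
      by (simp add: localized_def Uj_def jadd_def jmul_def side_jet_def flow_jet_def Let_def)
    then have "norm ?E * \<bar>dz (us L) t z\<bar> = norm (U_amp L \<phi> \<epsilon> (us L) t z)" by (simp add: norm_mult)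
    also have "\<dots> \<le> norm (Z_amp L \<phi> \<epsilon> t z)" unfolding Z_amp_def by (rule norm_fst_le)
    also have "\<dots> \<le> norm (exp (\<alpha> * z) *\<^sub>R Z_amp L \<phi> \<epsilon> t z)"
      using \<alpha> z by (simp add: mult_right_mono[of 1 "exp (\<alpha> * z)", simplified])
    finally have "norm ?E * \<bar>dz (us L) t z\<bar> \<le> norm (exp (\<alpha> * z) *\<^sub>R Z_amp L \<phi> \<epsilon> t z)" .
    moreover have "norm ?E * cu \<le> norm ?E * \<bar>dz (us L) t z\<bar>"
      using lower[OF t, of z] True by (intro mult_left_mono) auto
    ultimately have "norm ?E * cu \<le> norm (exp (\<alpha> * z) *\<^sub>R Z_amp L \<phi> \<epsilon> t z)" by linarith
    then have "(norm ?E * cu)\<^sup>2 \<le> (norm (exp (\<alpha> * z) *\<^sub>R Z_amp L \<phi> \<epsilon> t z))\<^sup>2" using cu by (intro power_mono) auto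
    then show ?thesis using True z by simp
  qed simp
  have i: "integrable lborel (\<lambda>z. indicator ?I z * (norm ?E * cu)\<^sup>2)"
    by (intro integrable_mult_left integrable_real_indicator emeasure_bounded_finite) auto
  have "measure lborel ?I = \<delta>" using \<delta> by (simp add: algebra_simps)
  moreover have "(\<integral>z. indicator ?I z * (norm ?E * cu)\<^sup>2 \<partial>lborel) = measure lborel ?I * (norm ?E * cu)\<^sup>2"
    by simp
  ultimately have eq: "\<delta> * (norm ?E * cu)\<^sup>2 = (\<integral>z. indicator ?I z * (norm ?E * cu)\<^sup>2 \<partial>lborel)"
    by (simp only:)
  have Zi: "integrable lborel (\<lambda>z. indicator {0..} z *\<^sub>R (norm (exp (\<alpha> * z) *\<^sub>R Z_amp L \<phi> \<epsilon> t z))\<^sup>2)"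
    using Z unfolding L2_space_def set_integrable_def by blast
  have "\<delta> * (norm ?E * cu)\<^sup>2 \<le> (LINT z:{0..}|lborel. (norm (exp (\<alpha> * z) *\<^sub>R Z_amp L \<phi> \<epsilon> t z))\<^sup>2)"
    unfolding set_lebesgue_integral_def eq by (rule integral_mono[OF i Zi le])
  then have "sqrt (\<delta> * (norm ?E * cu)\<^sup>2) \<le> L2_norm \<alpha> (Z_amp L \<phi> \<epsilon> t)"
    unfolding L2_norm_def by (rule real_sqrt_le_mono)
  then show ?thesis using cu by (simp add: real_sqrt_mult mult_ac)
qed

lemma approximate_solution:
  assumes T: "t1 \<le> T"
  shows "\<exists>N\<ge>(1::nat). \<exists>\<epsilon>0>0. \<exists>c0>0. \<exists>C0>0. \<exists>\<sigma>0>0. \<forall>\<epsilon>. 0 < \<epsilon> \<and> \<epsilon> < \<epsilon>0 \<longrightarrow>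
        (\<forall>t. 0 \<le> t \<and> t \<le> K0 * sqrt \<epsilon> * L_log \<epsilon> \<longrightarrow>
           Z_amp L \<phi> \<epsilon> t \<in> L2_space \<alpha> \<and>
           c0 * exp (\<sigma>0 * t / sqrt \<epsilon>) \<le> L2_norm \<alpha> (Z_amp L \<phi> \<epsilon> t) \<and>
           L2_norm \<alpha> (Z_amp L \<phi> \<epsilon> t) \<le> C0 * L_log \<epsilon> ^ N * exp (\<sigma>0 * t / sqrt \<epsilon>) \<and>
           (\<exists>R. residual L \<phi> \<epsilon> T t R \<and> R \<in> L2_space \<alpha> \<and>
              L2_norm \<alpha> R \<le> C0 * \<epsilon> powr (- 3 / 8) * L_log \<epsilon> ^ N * exp (\<sigma>0 * t / sqrt \<epsilon>)))"
proof -
  obtain C1 N1 where R: "0 \<le> C1" "\<And>\<epsilon> t. 0 < \<epsilon> \<Longrightarrow> \<epsilon> < 1 \<Longrightarrow> 0 \<le> t \<Longrightarrow> t < t1 \<Longrightarrow> t \<le> K0 * sqrt \<epsilon> * L_log \<epsilon> \<Longrightarrow>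
     (\<exists>R. residual L \<phi> \<epsilon> T t R \<and> R \<in> L2_space \<alpha> \<and>
        L2_norm \<alpha> R \<le> norm (E_amp L \<epsilon> t) * (C1 * L_log \<epsilon> ^ N1 * \<epsilon> powr (- 3 / 8)))"
    using residual_estimate[OF T] by blast
  obtain C2 N2 where Z: "0 \<le> C2" "\<And>\<epsilon> t. 0 < \<epsilon> \<Longrightarrow> \<epsilon> < 1 \<Longrightarrow> 0 \<le> t \<Longrightarrow> t < t1 \<Longrightarrow> t \<le> K0 * sqrt \<epsilon> * L_log \<epsilon> \<Longrightarrow>
     Z_amp L \<phi> \<epsilon> t \<in> L2_space \<alpha> \<and> L2_norm \<alpha> (Z_amp L \<phi> \<epsilon> t) \<le> norm (E_amp L \<epsilon> t) * (C2 * L_log \<epsilon> ^ N2)"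
    using Z_estimate by blast
  obtain K where K: "0 < K" "\<And>\<epsilon> t. 0 < \<epsilon> \<Longrightarrow> \<epsilon> < 1 \<Longrightarrow> 0 \<le> t \<Longrightarrow> t < t1 \<Longrightarrow> t \<le> K0 * sqrt \<epsilon> * L_log \<epsilon> \<Longrightarrow>
     exp (\<sigma>0 * t / sqrt \<epsilon>) / K \<le> norm (E_amp L \<epsilon> t) \<and> norm (E_amp L \<epsilon> t) \<le> K * exp (\<sigma>0 * t / sqrt \<epsilon>)"
    using E_amp_bounds by blast
  have "((\<lambda>\<epsilon>. K0 * (sqrt \<epsilon> * L_log \<epsilon>)) \<longlongrightarrow> K0 * 0) (at_right 0)"
    by (intro tendsto_mult tendsto_const sqrt_L_log_tendsto)
  then have "\<forall>\<^sub>F \<epsilon> in at_right 0. K0 * (sqrt \<epsilon> * L_log \<epsilon>) < t1"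
    by (rule order_tendstoD) (use t1 in simp)
  then obtain b where b: "0 < b" "\<And>\<epsilon>. 0 < \<epsilon> \<Longrightarrow> \<epsilon> < b \<Longrightarrow> K0 * (sqrt \<epsilon> * L_log \<epsilon>) < t1"
    unfolding eventually_at_right_field by blast
  define N where "N = max 1 (max N1 N2)"
  \<comment> \<open>The summand 1 secures positivity when both constants are 0.\<close>
  define C0 where "C0 = K * (C1 + C2) + 1"
  have C0: "0 < C0" "K * C1 \<le> C0" "K * C2 \<le> C0" using K R(1) Z(1) by (auto simp: C0_def distrib_left intro: add_nonneg_pos)
  have main: "Z_amp L \<phi> \<epsilon> t \<in> L2_space \<alpha> \<and>
           (sqrt \<delta> * cu / K) * exp (\<sigma>0 * t / sqrt \<epsilon>) \<le> L2_norm \<alpha> (Z_amp L \<phi> \<epsilon> t) \<and>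
           L2_norm \<alpha> (Z_amp L \<phi> \<epsilon> t) \<le> C0 * L_log \<epsilon> ^ N * exp (\<sigma>0 * t / sqrt \<epsilon>) \<and>
           (\<exists>R. residual L \<phi> \<epsilon> T t R \<and> R \<in> L2_space \<alpha> \<and>
              L2_norm \<alpha> R \<le> C0 * \<epsilon> powr (- 3 / 8) * L_log \<epsilon> ^ N * exp (\<sigma>0 * t / sqrt \<epsilon>))"
    if e: "0 < \<epsilon>" "\<epsilon> < min 1 b" and t: "0 \<le> t" "t \<le> K0 * sqrt \<epsilon> * L_log \<epsilon>" for \<epsilon> t
  proof -
    have e1: "\<epsilon> < 1" and tt: "t < t1" using e t b(2)[of \<epsilon>] by (auto simp: mult.assoc)
    let ?X = "exp (\<sigma>0 * t / sqrt \<epsilon>)"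
    note E = K(2)[OF e(1) e1 t(1) tt t(2)]
    note Z' = Z(2)[OF e(1) e1 t(1) tt t(2)]
    have L: "L_log \<epsilon> ^ k \<le> L_log \<epsilon> ^ N" if "k \<le> N" for k using that L_log_ge_1 by (rule power_increasing)
    have up: "norm (E_amp L \<epsilon> t) * (C * L_log \<epsilon> ^ k) \<le> C0 * L_log \<epsilon> ^ N * ?X" if C: "0 \<le> C" "K * C \<le> C0" and k: "k \<le> N" for C k
    proof -
      have "norm (E_amp L \<epsilon> t) * (C * L_log \<epsilon> ^ k) \<le> (K * ?X) * (C * L_log \<epsilon> ^ N)"
        using E C L[OF k] L_log_ge_1[of \<epsilon>] K(1) by (intro mult_mono mult_left_mono) auto
      also have "\<dots> = (K * C) * (L_log \<epsilon> ^ N * ?X)" by simp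
      also have "\<dots> \<le> C0 * (L_log \<epsilon> ^ N * ?X)" using C L_log_ge_1[of \<epsilon>] by (intro mult_right_mono) auto
      finally show ?thesis by (simp add: mult.assoc)
    qed
    have "(sqrt \<delta> * cu / K) * ?X = ?X / K * (sqrt \<delta> * cu)" by simp
    also have "\<dots> \<le> norm (E_amp L \<epsilon> t) * (sqrt \<delta> * cu)" using E cu \<delta> by (intro mult_right_mono) auto
    also have "\<dots> \<le> L2_norm \<alpha> (Z_amp L \<phi> \<epsilon> t)" by (rule Z_lower[OF e(1) e1 t(1) tt]) (use Z' in blast)
    finally have low: "(sqrt \<delta> * cu / K) * ?X \<le> L2_norm \<alpha> (Z_amp L \<phi> \<epsilon> t)" .
    have "L2_norm \<alpha> (Z_amp L \<phi> \<epsilon> t) \<le> norm (E_amp L \<epsilon> t) * (C2 * L_log \<epsilon> ^ N2)" using Z' by blast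
    also have "\<dots> \<le> C0 * L_log \<epsilon> ^ N * ?X" by (rule up[OF Z(1) C0(3)]) (simp add: N_def)
    finally have upZ: "L2_norm \<alpha> (Z_amp L \<phi> \<epsilon> t) \<le> C0 * L_log \<epsilon> ^ N * ?X" .
    obtain R' where R': "residual L \<phi> \<epsilon> T t R'" "R' \<in> L2_space \<alpha>"
      "L2_norm \<alpha> R' \<le> norm (E_amp L \<epsilon> t) * (C1 * L_log \<epsilon> ^ N1 * \<epsilon> powr (- 3 / 8))"
      using R(2)[OF e(1) e1 t(1) tt t(2)] by blast
    have "norm (E_amp L \<epsilon> t) * (C1 * L_log \<epsilon> ^ N1) * \<epsilon> powr (- 3 / 8) \<le> C0 * L_log \<epsilon> ^ N * ?X * \<epsilon> powr (- 3 / 8)"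
      by (intro mult_right_mono up R(1) C0(2)) (auto simp: N_def)
    then have "L2_norm \<alpha> R' \<le> C0 * \<epsilon> powr (- 3 / 8) * L_log \<epsilon> ^ N * ?X"
      using R'(3) by (simp add: mult_ac)
    then show ?thesis using Z' low upZ R' by blast
  qed
  have pos: "1 \<le> N" "0 < min 1 b" "0 < sqrt \<delta> * cu / K"
    using b(1) \<delta> cu K(1) by (auto simp: N_def)
  show ?thesis
    by (rule exI[of _ N], rule conjI[OF pos(1)], rule exI[of _ "min 1 b"], rule conjI[OF pos(2)],
        rule exI[of _ "sqrt \<delta> * cu / K"], rule conjI[OF pos(3)], rule exI[of _ C0], rule conjI[OF C0(1)],
        rule exI[of _ "\<sigma>0"], rule conjI[OF \<sigma>0_pos], intro allI impI, elim conjE, rule main)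
qed

end

section \<open>Geometry of the critical point\<close>

lemma regularD:
  assumes "regular u" "0 \<le> t" "0 < z"
  shows "(u t has_real_derivative dz u t z) (at z)"
    "(dz u t has_real_derivative dz (dz u) t z) (at z)"
    "(dz (dz u) t has_real_derivative dz (dz (dz u)) t z) (at z)"
    "((\<lambda>s. u s z) has_real_derivative dz (dz u) t z) (at t within {0..})"
    "((\<lambda>s. dz u s z) has_real_derivative dz (dz (dz u)) t z) (at t within {0..})"
    "((\<lambda>s. dz (dz u) s z) has_real_derivative dt (dz (dz u)) t z) (at t within {0..})"
  using assms unfolding regular_def by blast+

lemma regular_continuous:
  assumes "regular u"
  shows "jointly_continuous u" "jointly_continuous (dz u)" "jointly_continuous (dz (dz u))"
    "jointly_continuous (dz (dz (dz u)))" "jointly_continuous (dt (dz (dz u)))"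
  using assms unfolding regular_def by blast+

text \<open>\<open>dz\<close> is total, so linearity at one order can be used only after the
  previous order has been identified on the open half-line. Hence the ladder from \<open>e1\<close>
  to \<open>e4\<close>.\<close>

lemma regular_lincomb:
  fixes u v :: "real \<Rightarrow> real \<Rightarrow> real" and a :: real
  assumes u: "regular u" and v: "regular v"
  defines "w \<equiv> (\<lambda>t z. v t z - a * u t z)"
  shows "regular w" "\<And>t z. 0 \<le> t \<Longrightarrow> 0 < z \<Longrightarrow> dz w t z = dz v t z - a * dz u t z"
proof -
  note U = regularD[OF u] and V = regularD[OF v]
  have w1: "(w t has_real_derivative dz v t z - a * dz u t z) (at z)" if "0 \<le> t" "0 < z" for t z
    unfolding w_def by (intro DERIV_diff DERIV_cmult U V that)
  have e1: "dz w t z = dz v t z - a * dz u t z" if "0 \<le> t" "0 < z" for t z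
    by (intro dz_eqI w1 that)
  have w2: "(dz w t has_real_derivative dz (dz v) t z - a * dz (dz u) t z) (at z)" if "0 \<le> t" "0 < z" for t z
    by (rule has_field_derivative_transform_within_open[of "\<lambda>z. dz v t z - a * dz u t z" _ _ "{0<..}"])
       (use that e1 in \<open>auto intro!: DERIV_diff DERIV_cmult U V\<close>)
  have e2: "dz (dz w) t z = dz (dz v) t z - a * dz (dz u) t z" if "0 \<le> t" "0 < z" for t z
    by (intro dz_eqI w2 that)
  have w3: "(dz (dz w) t has_real_derivative dz (dz (dz v)) t z - a * dz (dz (dz u)) t z) (at z)" if "0 \<le> t" "0 < z" for t z
    by (rule has_field_derivative_transform_within_open[of "\<lambda>z. dz (dz v) t z - a * dz (dz u) t z" _ _ "{0<..}"])
       (use that e2 in \<open>auto intro!: DERIV_diff DERIV_cmult U V\<close>)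
  have e3: "dz (dz (dz w)) t z = dz (dz (dz v)) t z - a * dz (dz (dz u)) t z" if "0 \<le> t" "0 < z" for t z
    by (intro dz_eqI w3 that)
  have t0: "((\<lambda>s. w s z) has_real_derivative dz (dz w) t z) (at t within {0..})" if "0 \<le> t" "0 < z" for t z
    unfolding e2[OF that] unfolding w_def by (intro DERIV_diff DERIV_cmult U V that)
  have t1: "((\<lambda>s. dz w s z) has_real_derivative dz (dz (dz w)) t z) (at t within {0..})" if "0 \<le> t" "0 < z" for t z
    by (rule has_field_derivative_transform_within[of "\<lambda>s. dz v s z - a * dz u s z" _ _ _ 1])
       (use that e1 e3 in \<open>auto intro!: DERIV_diff DERIV_cmult U V\<close>)
  have t2: "((\<lambda>s. dz (dz w) s z) has_real_derivative dt (dz (dz v)) t z - a * dt (dz (dz u)) t z) (at t within {0..})" if "0 \<le> t" "0 < z" for t z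
    by (rule has_field_derivative_transform_within[of "\<lambda>s. dz (dz v) s z - a * dz (dz u) s z" _ _ _ 1])
       (use that e2 in \<open>auto intro!: DERIV_diff DERIV_cmult U V\<close>)
  have e4: "dt (dz (dz w)) t z = dt (dz (dz v)) t z - a * dt (dz (dz u)) t z" if "0 \<le> t" "0 < z" for t z
    by (intro dt_eqI t2 that)
  note cu = regular_continuous[OF u] and cv = regular_continuous[OF v]
  have c: "jointly_continuous (\<lambda>t z. g t z - a * k t z)" if "jointly_continuous g" "jointly_continuous k" for g k
    by (intro continuous_on_diff continuous_on_mult continuous_on_const that)
  show "dz w t z = dz v t z - a * dz u t z" if "0 \<le> t" "0 < z" for t z by (rule e1[OF that])
  have jc: "jointly_continuous w" "jointly_continuous (dz w)" "jointly_continuous (dz (dz w))"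
    "jointly_continuous (dz (dz (dz w)))" "jointly_continuous (dt (dz (dz w)))"
    using c[OF cv(1) cu(1)] jointly_continuous_eq[OF c[OF cv(2) cu(2)], of "dz w"] jointly_continuous_eq[OF c[OF cv(3) cu(3)], of "dz (dz w)"]
      jointly_continuous_eq[OF c[OF cv(4) cu(4)], of "dz (dz (dz w))"] jointly_continuous_eq[OF c[OF cv(5) cu(5)], of "dt (dz (dz w))"] e1 e2 e3 e4
    unfolding w_def by auto
  show "regular w" unfolding regular_def
    using w1 w2 w3 t0 t1 t2 e1 e2 e3 e4 jc by auto
qed

lemma box_bound:
  assumes "jointly_continuous g" "0 < a"
  shows "\<exists>B. \<forall>t z. 0 \<le> t \<and> t \<le> T \<and> a \<le> z \<and> z \<le> b \<longrightarrow> \<bar>g t z\<bar> \<le> B"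
proof -
  let ?K = "{0..T} \<times> {a..b}"
  have "compact ?K" by (intro compact_Times) auto
  moreover have "continuous_on ?K (\<lambda>x. g (fst x) (snd x))"
    by (rule continuous_on_subset[OF assms(1)]) (use assms(2) in auto)
  ultimately have "compact ((\<lambda>x. g (fst x) (snd x)) ` ?K)" by (intro compact_continuous_image)
  then have "bounded ((\<lambda>x. g (fst x) (snd x)) ` ?K)" by (rule compact_imp_bounded)
  then obtain B where "\<And>y. y \<in> (\<lambda>x. g (fst x) (snd x)) ` ?K \<Longrightarrow> norm y \<le> B" unfolding bounded_iff by blast
  then have "\<bar>g t z\<bar> \<le> B" if "0 \<le> t" "t \<le> T" "a \<le> z" "z \<le> b" for t z
    using that by (force simp: image_iff)
  then show ?thesis by blast
qed

lemma regular_box_bound: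
  assumes u: "regular u" and a: "0 < a"
  shows "\<exists>B\<ge>0. \<forall>t z. 0 \<le> t \<and> t \<le> T \<and> a \<le> z \<and> z \<le> b \<longrightarrow>
    \<bar>dz u t z\<bar> \<le> B \<and> \<bar>dz (dz u) t z\<bar> \<le> B \<and> \<bar>dz (dz (dz u)) t z\<bar> \<le> B \<and> \<bar>dt (dz (dz u)) t z\<bar> \<le> B"
proof -
  note c = regular_continuous[OF u]
  obtain B1 where 1: "\<And>t z. 0 \<le> t \<and> t \<le> T \<and> a \<le> z \<and> z \<le> b \<Longrightarrow> \<bar>dz u t z\<bar> \<le> B1" using box_bound[OF c(2) a] by blast
  obtain B2 where 2: "\<And>t z. 0 \<le> t \<and> t \<le> T \<and> a \<le> z \<and> z \<le> b \<Longrightarrow> \<bar>dz (dz u) t z\<bar> \<le> B2" using box_bound[OF c(3) a] by blast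
  obtain B3 where 3: "\<And>t z. 0 \<le> t \<and> t \<le> T \<and> a \<le> z \<and> z \<le> b \<Longrightarrow> \<bar>dz (dz (dz u)) t z\<bar> \<le> B3" using box_bound[OF c(4) a] by blast
  obtain B4 where 4: "\<And>t z. 0 \<le> t \<and> t \<le> T \<and> a \<le> z \<and> z \<le> b \<Longrightarrow> \<bar>dt (dz (dz u)) t z\<bar> \<le> B4" using box_bound[OF c(5) a] by blast
  have "\<bar>dz u t z\<bar> \<le> \<bar>B1\<bar> + \<bar>B2\<bar> + \<bar>B3\<bar> + \<bar>B4\<bar> \<and> \<bar>dz (dz u) t z\<bar> \<le> \<bar>B1\<bar> + \<bar>B2\<bar> + \<bar>B3\<bar> + \<bar>B4\<bar> \<and>
    \<bar>dz (dz (dz u)) t z\<bar> \<le> \<bar>B1\<bar> + \<bar>B2\<bar> + \<bar>B3\<bar> + \<bar>B4\<bar> \<and> \<bar>dt (dz (dz u)) t z\<bar> \<le> \<bar>B1\<bar> + \<bar>B2\<bar> + \<bar>B3\<bar> + \<bar>B4\<bar>"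
    if "0 \<le> t \<and> t \<le> T \<and> a \<le> z \<and> z \<le> b" for t z
    using 1[OF that] 2[OF that] 3[OF that] 4[OF that] by linarith
  then show ?thesis by (intro exI[of _ "\<bar>B1\<bar> + \<bar>B2\<bar> + \<bar>B3\<bar> + \<bar>B4\<bar>"]) auto
qed

lemma jointly_continuous_near:
  assumes g: "jointly_continuous g" and z0: "0 < z0" and e: "0 < e"
  shows "\<exists>d>0. \<forall>t z. 0 \<le> t \<and> t < d \<and> \<bar>z - z0\<bar> < d \<longrightarrow> \<bar>g t z - g 0 z0\<bar> < e"
proof -
  obtain d where d: "0 < d" "\<And>y. y \<in> {0..} \<times> {0<..} \<Longrightarrow> dist y (0, z0) < d \<Longrightarrow> dist (g (fst y) (snd y)) (g 0 z0) < e"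
    using g z0 e unfolding continuous_on_iff by (metis (no_types, lifting) SigmaI atLeast_iff fst_conv greaterThan_iff order_refl snd_conv)
  show ?thesis
  proof (intro exI[of _ "min (d / 2) z0"] conjI allI impI)
    show "0 < min (d / 2) z0" using d z0 by simp
    fix t z assume a: "0 \<le> t \<and> t < min (d / 2) z0 \<and> \<bar>z - z0\<bar> < min (d / 2) z0"
    have "dist (t, z) (0, z0) \<le> \<bar>t\<bar> + \<bar>z - z0\<bar>"
      unfolding dist_Pair_Pair by (rule order.trans[OF sqrt_sum_squares_le_sum_abs]) (simp add: dist_real_def)
    also have "\<dots> < d" using a by auto
    finally show "\<bar>g t z - g 0 z0\<bar> < e" using d(2)[of "(t, z)"] a by (auto simp: dist_real_def)
  qed
qed

lemma real_lipschitz: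
  fixes g g' :: "real \<Rightarrow> real"
  assumes "\<And>x. x \<in> {a..b} \<Longrightarrow> (g has_real_derivative g' x) (at x within {a..b})" "\<And>x. x \<in> {a..b} \<Longrightarrow> \<bar>g' x\<bar> \<le> B"
    "x \<in> {a..b}" "y \<in> {a..b}"
  shows "\<bar>g x - g y\<bar> \<le> B * \<bar>x - y\<bar>"
  using vector_derivative_lipschitz[of "{a..b}" g g' B x y] assms
  by (simp add: has_real_derivative_iff_has_vector_derivative)

text \<open>Two Lipschitz estimates in succession: first for g1, from its zero at y; then for g on
  the segment between x and y, with the bound on g1 valid there.\<close>

lemma critical_point_bounds:
  fixes g g1 g2 :: "real \<Rightarrow> real"
  assumes d1: "\<And>x. x \<in> {a..b} \<Longrightarrow> (g has_real_derivative g1 x) (at x)"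
    and d2: "\<And>x. x \<in> {a..b} \<Longrightarrow> (g1 has_real_derivative g2 x) (at x)"
    and B: "\<And>x. x \<in> {a..b} \<Longrightarrow> \<bar>g2 x\<bar> \<le> B" and x: "x \<in> {a..b}" and y: "y \<in> {a..b}" and c: "g1 y = 0"
  shows "\<bar>g1 x\<bar> \<le> B * \<bar>x - y\<bar>" "\<bar>g x - g y\<bar> \<le> B * \<bar>x - y\<bar>\<^sup>2"
proof -
  have l: "\<bar>g1 v\<bar> \<le> B * \<bar>v - y\<bar>" if "v \<in> {a..b}" for v
    using real_lipschitz[of a b g1 g2 B v y] d2 B y c that by (auto intro: has_field_derivative_at_within)
  show "\<bar>g1 x\<bar> \<le> B * \<bar>x - y\<bar>" by (rule l[OF x])
  have B0: "0 \<le> B" using B[OF x] by simp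
  have "\<bar>g x - g y\<bar> \<le> (B * \<bar>x - y\<bar>) * \<bar>x - y\<bar>"
  proof (rule real_lipschitz[of "min x y" "max x y" g g1])
    fix v assume v: "v \<in> {min x y..max x y}"
    then have v': "v \<in> {a..b}" using x y by auto
    show "(g has_real_derivative g1 v) (at v within {min x y..max x y})"
      by (rule has_field_derivative_at_within[OF d1[OF v']])
    have "\<bar>v - y\<bar> \<le> \<bar>x - y\<bar>" using v by auto
    then show "\<bar>g1 v\<bar> \<le> B * \<bar>x - y\<bar>" using l[OF v'] mult_left_mono[OF _ B0] by fastforce
  qed auto
  then show "\<bar>g x - g y\<bar> \<le> B * \<bar>x - y\<bar>\<^sup>2" by (simp add: power2_eq_square mult.assoc)
qed

lemma cutoffD:
  assumes "cutoff \<delta> \<phi>"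
  shows "smooth \<phi>" "\<exists>\<rho>>0. \<forall>x. \<bar>x\<bar> < \<rho> \<longrightarrow> \<phi> x = 1" "\<delta> \<le> \<bar>x\<bar> \<Longrightarrow> (vderiv ^^ n) \<phi> x = 0"
proof -
  show "smooth \<phi>" "\<exists>\<rho>>0. \<forall>x. \<bar>x\<bar> < \<rho> \<longrightarrow> \<phi> x = 1" using assms by (auto simp: cutoff_def)
  obtain r where r: "r < \<delta>" "\<And>x. \<bar>x\<bar> > r \<Longrightarrow> \<phi> x = 0" using assms by (auto simp: cutoff_def)
  assume x: "\<delta> \<le> \<bar>x\<bar>"
  \<comment> \<open>Since r < \<delta>, the open set |x| > r contains every x with \<delta> \<le>
    |x|, the boundary points included.\<close>
  have "(vderiv ^^ n) \<phi> x = (vderiv ^^ n) (\<lambda>x. 0) x"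
    by (rule vderiv_cong_open[of "{x. r < \<bar>x\<bar>}"]) (use r x in \<open>auto intro!: open_Collect_less continuous_intros\<close>)
  also have "(vderiv ^^ n) (\<lambda>x. 0) = (\<lambda>x. 0 :: real)"
  proof (induction n)
    case (Suc n)
    have "vderiv (\<lambda>x. 0 :: real) = (\<lambda>x. 0)" by (rule vderiv_eqI) auto
    then show ?case by (simp add: Suc)
  qed simp
  finally show "(vderiv ^^ n) \<phi> x = 0" .
qed

lemma rt4_power4: "0 < x \<Longrightarrow> rt4 x ^ 4 = x"
  by (simp add: rt4_def powr_power)

lemma rt4_mono: "0 \<le> x \<Longrightarrow> x \<le> y \<Longrightarrow> rt4 x \<le> rt4 y"
  by (simp add: rt4_def powr_mono2)

text \<open>The order of choices matters: \<delta>, t1 and all bounds come from the flow and the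
  path alone, and only \<open>\<rho>\<close> is taken from the cutoff. So one \<delta> serves every
  cutoff and every \<open>K0\<close>.\<close>

lemma critical_shear_exists:
  fixes L :: layer
  assumes \<alpha>: "0 \<le> \<alpha>"
    and comp: "\<And>u. u \<in> {us L, vs L, bs L, gs L} \<Longrightarrow> shear_component \<alpha> u"
    and z0: "0 < z0"
    and at0: "dz (wa L) 0 z0 = 0" "dz (dz (wa L)) 0 z0 < 0" "dz (us L) 0 z0 \<noteq> 0"
      "cs L 0 z0 = 0" "dz (cs L) 0 z0 = 0"
    and t0: "0 < t0" and crit0: "crit L 0 = z0"
    and crit: "\<And>t. 0 \<le> t \<Longrightarrow> t < t0 \<Longrightarrow>
           (crit L has_real_derivative f' t) (at t within {0..<t0}) \<and>
           dt (dz (wa L)) t (crit L t) + dz (dz (wa L)) t (crit L t) * f' t = 0"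
    and prof: "critical_layer_profile (tau L) (prof L)"
  obtains \<delta> t1 Mf q' q0 M m MU cu where "0 < \<delta>" "t1 \<le> t0"
    "\<And>\<phi> K0. cutoff \<delta> \<phi> \<Longrightarrow> 0 < K0 \<Longrightarrow> \<exists>\<rho>. critical_shear L f' t1 \<delta> K0 Mf \<phi> q' q0 M \<rho> \<alpha> m MU cu"
proof -
  let ?f = "crit L"
  let ?w = "wa L" and ?c = "cs L"
  let ?w1 = "dz ?w" and ?w2 = "dz (dz ?w)" and ?w3 = "dz (dz (dz ?w))" and ?w4 = "dt (dz (dz ?w))"
  have regs: "regular u" if "u \<in> {us L, vs L, bs L, gs L}" for u
    using comp[OF that] by (simp add: shear_component_def)
  have rw: "regular ?w" unfolding wa_def[abs_def] by (intro regular_lincomb(1) regs) auto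
  have rc: "regular ?c" unfolding cs_def[abs_def] by (intro regular_lincomb(1) regs) auto
  note cw = regular_continuous[OF rw]
  \<comment> \<open>w_zz is -2 k at the initial point, hence at most -k nearby; in the same way
    |u_z| is 2 \<open>cu\<close> initially and at least \<open>cu\<close> nearby.\<close>
  define k where "k = - ?w2 0 z0 / 2"
  define cu where "cu = \<bar>dz (us L) 0 z0\<bar> / 2"
  have k: "0 < k" and cu: "0 < cu" using at0 by (auto simp: k_def cu_def)
  obtain d1 where d1: "0 < d1" "\<And>t z. 0 \<le> t \<and> t < d1 \<and> \<bar>z - z0\<bar> < d1 \<Longrightarrow> \<bar>?w2 t z - ?w2 0 z0\<bar> < k"
    using jointly_continuous_near[OF cw(3) z0 k] by blast
  obtain d2 where d2: "0 < d2" "\<And>t z. 0 \<le> t \<and> t < d2 \<and> \<bar>z - z0\<bar> < d2 \<Longrightarrow> \<bar>dz (us L) t z - dz (us L) 0 z0\<bar> < cu"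
    using jointly_continuous_near[OF regular_continuous(2)[OF regs] z0 cu, of "us L"] by blast
  \<comment> \<open>Room for three widths: |f - z0| < \<delta> and |z - f| \<le> 2 \<delta> keep z
    within 3 \<delta> of z0, where z > 0 and both nondegeneracy bounds hold. The 2 \<delta> is
    needed for the interval of the lower bound, just above the cutoff.\<close>
  define \<delta> where "\<delta> = min z0 (min d1 d2) / 4"
  have \<delta>: "0 < \<delta>" "3 * \<delta> < z0" "3 * \<delta> < d1" "3 * \<delta> < d2" using z0 d1(1) d2(1) by (auto simp: \<delta>_def min_def)
  have "(?f has_real_derivative f' 0) (at 0 within {0..<t0})" using crit[of 0] t0 by auto
  then have "(?f \<longlongrightarrow> ?f 0) (at 0 within {0..<t0})"
    by (meson DERIV_continuous continuous_within)
  then have "\<forall>\<^sub>F t in at 0 within {0..<t0}. dist (?f t) (?f 0) < \<delta>" by (rule tendstoD) (rule \<delta>)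
  then obtain d3 where d3: "0 < d3" "\<And>t. t \<in> {0..<t0} \<Longrightarrow> t \<noteq> 0 \<Longrightarrow> dist t 0 < d3 \<Longrightarrow> dist (?f t) (?f 0) < \<delta>"
    unfolding eventually_at by blast
  have ex: "\<exists>s M. 0 < s \<and> (\<forall>t. 0 \<le> t \<and> t \<le> s \<longrightarrow> (LINT z:{0..}|lborel. (exp (\<alpha> * z) * dz u t z)\<^sup>2) \<le> M)"
    if "u \<in> {us L, vs L, bs L, gs L}" for u
    using comp[OF that] unfolding shear_component_def by blast
  obtain s1 M1 where s1: "0 < s1" "\<And>t. 0 \<le> t \<and> t \<le> s1 \<Longrightarrow> (LINT z:{0..}|lborel. (exp (\<alpha> * z) * dz (us L) t z)\<^sup>2) \<le> M1"
    using ex[of "us L"] by auto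
  obtain s2 M2 where s2: "0 < s2" "\<And>t. 0 \<le> t \<and> t \<le> s2 \<Longrightarrow> (LINT z:{0..}|lborel. (exp (\<alpha> * z) * dz (vs L) t z)\<^sup>2) \<le> M2"
    using ex[of "vs L"] by auto
  obtain s3 M3 where s3: "0 < s3" "\<And>t. 0 \<le> t \<and> t \<le> s3 \<Longrightarrow> (LINT z:{0..}|lborel. (exp (\<alpha> * z) * dz (bs L) t z)\<^sup>2) \<le> M3"
    using ex[of "bs L"] by auto
  obtain s4 M4 where s4: "0 < s4" "\<And>t. 0 \<le> t \<and> t \<le> s4 \<Longrightarrow> (LINT z:{0..}|lborel. (exp (\<alpha> * z) * dz (gs L) t z)\<^sup>2) \<le> M4"
    using ex[of "gs L"] by auto
  define MU where "MU = max (max M1 M2) (max M3 M4)"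
  \<comment> \<open>Besides the ranges found so far, t1 \<le> 1 is imposed, so that t^2 \<le> t in
    the bound for c.\<close>
  define t1 where "t1 = min (min (min 1 t0) (min d1 d2)) (min d3 (min (min s1 s2) (min s3 s4)))"
  have t1: "0 < t1" "t1 \<le> 1" "t1 \<le> t0" "t1 \<le> d1" "t1 \<le> d2" "t1 \<le> d3" "t1 \<le> s1" "t1 \<le> s2" "t1 \<le> s3" "t1 \<le> s4"
    using t0 d1(1) d2(1) d3(1) s1(1) s2(1) s3(1) s4(1) by (simp_all add: t1_def min_le_iff_disj)
  have MU: "dz u t \<in> L2_space \<alpha> \<and> (LINT z:{0..}|lborel. (exp (\<alpha> * z) * dz u t z)\<^sup>2) \<le> MU"
    if u: "u \<in> {us L, vs L, bs L, gs L}" and t: "0 \<le> t" "t < t1" for u t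
  proof
    show "dz u t \<in> L2_space \<alpha>" using comp[OF u] t by (simp add: shear_component_def)
    have "M1 \<le> MU" "M2 \<le> MU" "M3 \<le> MU" "M4 \<le> MU" by (simp_all add: MU_def)
    moreover have ts: "0 \<le> t \<and> t \<le> s1" "0 \<le> t \<and> t \<le> s2" "0 \<le> t \<and> t \<le> s3" "0 \<le> t \<and> t \<le> s4" using t t1 by linarith+
    ultimately show "(LINT z:{0..}|lborel. (exp (\<alpha> * z) * dz u t z)\<^sup>2) \<le> MU"
      using u s1(2)[OF ts(1)] s2(2)[OF ts(2)] s3(2)[OF ts(3)] s4(2)[OF ts(4)] by (auto intro: order.trans)
  qed
  have fz: "\<bar>?f t - z0\<bar> < \<delta>" if "0 \<le> t" "t < t1" for t
    using d3(2)[of t] that t1 \<delta>(1) crit0 by (cases "t = 0") (auto simp: dist_real_def)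
  define a where "a = z0 - 3 * \<delta>"
  define b where "b = z0 + 3 * \<delta>"
  have a: "0 < a" using \<delta> by (simp add: a_def)
  have box: "a \<le> z \<and> z \<le> b \<and> \<bar>z - z0\<bar> < d1 \<and> \<bar>z - z0\<bar> < d2 \<and> 0 < z" if "0 \<le> t" "t < t1" "\<bar>z - ?f t\<bar> \<le> 2 * \<delta>" for t z
    using fz[OF that(1,2)] that(3) \<delta> by (auto simp: a_def b_def)
  have z0ab: "z0 \<in> {a..b}" using \<delta> by (simp add: a_def b_def)
  have bnd: "\<exists>B\<ge>0. \<forall>t z. 0 \<le> t \<and> t \<le> t1 \<and> a \<le> z \<and> z \<le> b \<longrightarrow>
    \<bar>dz u t z\<bar> \<le> B \<and> \<bar>dz (dz u) t z\<bar> \<le> B \<and> \<bar>dz (dz (dz u)) t z\<bar> \<le> B \<and> \<bar>dt (dz (dz u)) t z\<bar> \<le> B" if "regular u" for u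
    by (rule regular_box_bound[OF that a])
  define P where "P u B \<longleftrightarrow> (\<forall>t z. 0 \<le> t \<and> t \<le> t1 \<and> a \<le> z \<and> z \<le> b \<longrightarrow>
    \<bar>dz u t z\<bar> \<le> B \<and> \<bar>dz (dz u) t z\<bar> \<le> B \<and> \<bar>dz (dz (dz u)) t z\<bar> \<le> B \<and> \<bar>dt (dz (dz u)) t z\<bar> \<le> B)" for u B
  have Pmono: "P u B' \<Longrightarrow> B' \<le> B \<Longrightarrow> P u B" for u B B'
    unfolding P_def by (meson order.trans)
  have ex: "\<exists>B\<ge>0. P u B" if "regular u" for u using bnd[OF that] unfolding P_def .
  obtain B1 B2 B3 B4 B5 B6 where Bi: "0 \<le> B1" "P ?w B1" "0 \<le> B2" "P ?c B2" "0 \<le> B3" "P (us L) B3" "0 \<le> B4" "P (vs L) B4"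
    "0 \<le> B5" "P (bs L) B5" "0 \<le> B6" "P (gs L) B6"
    using ex[OF rw] ex[OF rc] ex[OF regs, of "us L"] ex[OF regs, of "vs L"] ex[OF regs, of "bs L"] ex[OF regs, of "gs L"] by auto
  define B where "B = B1 + B2 + B3 + B4 + B5 + B6"
  have B0: "0 \<le> B" using Bi by (simp add: B_def)
  have PB: "P ?w B" "P ?c B" "P (us L) B" "P (vs L) B" "P (bs L) B" "P (gs L) B"
    by (rule Pmono[OF Bi(2)] Pmono[OF Bi(4)] Pmono[OF Bi(6)] Pmono[OF Bi(8)] Pmono[OF Bi(10)] Pmono[OF Bi(12)];
        use Bi in \<open>simp add: B_def\<close>)+
  have PD: "\<bar>dz u t z\<bar> \<le> B" "\<bar>dz (dz u) t z\<bar> \<le> B" "\<bar>dz (dz (dz u)) t z\<bar> \<le> B" "\<bar>dt (dz (dz u)) t z\<bar> \<le> B"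
    if "P u B" "0 \<le> t" "t \<le> t1" "a \<le> z" "z \<le> b" for u t z
    using that unfolding P_def by blast+
  have fab: "a \<le> ?f t" "?f t \<le> b" "0 < ?f t" "\<bar>?f t - z0\<bar> < d1" if "0 \<le> t" "t < t1" for t
    using box[OF that, of "?f t"] \<delta> by auto
  have w2: "?w2 t z \<le> - k" if "0 \<le> t" "t < t1" "\<bar>z - z0\<bar> < d1" for t z
    using d1(2)[of t z] that t1 by (auto simp: k_def)
  \<comment> \<open>Solving the equation of the path for f' gives both continuity and a bound of f',
    neither of which is assumed.\<close>
  have f'_eq: "f' t = - ?w3 t (?f t) / ?w2 t (?f t)" if t: "0 \<le> t" "t < t1" for t
  proof -
    have "dt ?w1 t (?f t) = ?w3 t (?f t)" by (intro dt_eqI regularD(5)[OF rw] fab(3) t)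
    then have "?w3 t (?f t) + ?w2 t (?f t) * f' t = 0" using crit[of t] t t1 by auto
    moreover have "?w2 t (?f t) \<noteq> 0" using w2[OF t fab(4)[OF t]] k by auto
    ultimately show ?thesis by (simp add: field_simps)
  qed
  define Mf where "Mf = B / k"
  have Mf: "0 \<le> Mf" using B0 k by (simp add: Mf_def)
  have f'_b: "\<bar>f' t\<bar> \<le> Mf" if t: "0 \<le> t" "t < t1" for t
  proof -
    have "k \<le> \<bar>?w2 t (?f t)\<bar>" using w2[OF t fab(4)[OF t]] k by auto
    then have "\<bar>?w3 t (?f t)\<bar> / \<bar>?w2 t (?f t)\<bar> \<le> B / k"
      using PD(3)[OF PB(1) t(1) _ fab(1,2)[OF t]] t k by (intro frac_le) auto
    then show ?thesis unfolding f'_eq[OF t] Mf_def by (simp add: abs_divide)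
  qed
  have f_d: "(?f has_real_derivative f' t) (at t within {0..<t1})" if t: "0 \<le> t" "t < t1" for t
    by (rule has_field_derivative_subset[of _ _ _ "{0..<t0}"]) (use crit[of t] t t1 in auto)
  have fc: "continuous_on {0..<t1} ?f" by (rule DERIV_continuous_on) (use f_d in auto)
  have trc: "continuous_on {0..<t1} (\<lambda>t. g t (?f t))" if "jointly_continuous g" for g
  proof -
    have "continuous_on {0..<t1} (\<lambda>t. (t, ?f t))" by (intro continuous_intros fc)
    from continuous_on_compose2[OF that this] show ?thesis using fab by force
  qed
  have f'c: "continuous_on {0..<t1} f'"
  proof (rule continuous_on_eq)
    show "continuous_on {0..<t1} (\<lambda>t. - ?w3 t (?f t) / ?w2 t (?f t))"
      by (intro continuous_on_divide continuous_on_minus trc cw) (use w2 fab k in fastforce)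
  qed (use f'_eq in auto)
  have js: "jet_setting ?f f' t1 \<delta> K0 Mf" if "0 < K0" for K0
  proof
    show "\<delta> < ?f t" if "0 \<le> t" "t < t1" for t using fz[OF that] \<delta> by auto
  qed (use that t1 \<delta> f_d f'c f'_b in auto)
  interpret J: jet_setting ?f f' t1 \<delta> 1 Mf by (rule js) simp
  \<comment> \<open>The equation of the path says that w_z is constant along it, and w_z vanishes at
    the start. So f(t) is a critical point at all times.\<close>
  have w1f: "?w1 t (?f t) = 0" if t: "0 \<le> t" "t < t1" for t
  proof -
    have d: "((\<lambda>t. ?w1 t (?f t)) has_real_derivative 0) (at s within {0..<t1})" if s: "s \<in> {0..<t1}" for s
    proof -
      have s': "0 \<le> s" "s < t1" using s by auto
      have "((\<lambda>t. ?w1 t (?f t)) has_real_derivative ?w3 s (?f s) + ?w2 s (?f s) * f' s) (at s within {0..<t1})"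
        by (rule J.trace_deriv[OF _ _ cw(3) s']) (use regularD[OF rw] in auto)
      moreover have "?w2 s (?f s) \<noteq> 0" using w2[OF s' fab(4)[OF s']] k by auto
      ultimately show ?thesis unfolding f'_eq[OF s'] by simp
    qed
    have "norm (?w1 t (?f t) - ?w1 0 (?f 0)) \<le> 0 * \<bar>t - 0\<bar>"
      by (rule vector_derivative_lipschitz[of "{0..<t1}" _ "\<lambda>_. 0"])
         (use d t t1 in \<open>auto simp flip: has_real_derivative_iff_has_vector_derivative\<close>)
    then show ?thesis using at0(1) crit0 by simp
  qed
  have kap: "kap L t = - 1 / 2 * ?w2 t (?f t)" "k / 2 \<le> kap L t" "kap L t \<le> B" if t: "0 \<le> t" "t < t1" for t
  proof -
    note w = w2[OF t fab(4)[OF t]]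
    show e: "kap L t = - 1 / 2 * ?w2 t (?f t)" using w k by (simp add: kap_def)
    show "k / 2 \<le> kap L t" using w unfolding e by simp
    show "kap L t \<le> B" using PD(2)[OF PB(1) t(1) less_imp_le[OF t(2)] fab(1,2)[OF t]] B0 unfolding e by (auto simp: abs_le_iff)
  qed
  have kp: "0 < kap L t" if "0 \<le> t" "t < t1" for t using kap(2)[OF that] k by simp
  define kd where "kd t = - 1 / 2 * (?w4 t (?f t) + ?w3 t (?f t) * f' t)" for t
  \<comment> \<open>The derivative of \<kappa>^(1/4) by the chain rule; \<open>kd\<close> is that of
    \<kappa>.\<close>
  define q' where "q' t = 1 / 4 * kap L t powr (1 / 4 - 1) * kd t" for t
  have kap_d: "(kap L has_real_derivative kd t) (at t within {0..<t1})" if t: "0 \<le> t" "t < t1" for t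
  proof (rule has_field_derivative_transform_within[of "\<lambda>t. - 1 / 2 * ?w2 t (?f t)" _ _ _ 1])
    have "((\<lambda>t. ?w2 t (?f t)) has_real_derivative ?w4 t (?f t) + ?w3 t (?f t) * f' t) (at t within {0..<t1})"
      by (rule J.trace_deriv[OF _ _ cw(4) t]) (use regularD[OF rw] in auto)
    then show "((\<lambda>t. - 1 / 2 * ?w2 t (?f t)) has_real_derivative kd t) (at t within {0..<t1})"
      unfolding kd_def by (rule DERIV_cmult)
  qed (use t kap(1) in auto)
  have q'_d: "((\<lambda>t. rt4 (kap L t)) has_real_derivative q' t) (at t within {0..<t1})" if t: "0 \<le> t" "t < t1" for t
    unfolding rt4_def q'_def
    by (rule DERIV_chain'[OF kap_d[OF t] has_real_derivative_powr[OF kp[OF t]]])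
  have kap_c: "continuous_on {0..<t1} (kap L)" by (rule DERIV_continuous_on) (use kap_d in auto)
  have kd_c: "continuous_on {0..<t1} kd" unfolding kd_def[abs_def]
    by (intro continuous_on_mult continuous_on_add continuous_on_const trc cw f'c)
  have q'_c: "continuous_on {0..<t1} q'" unfolding q'_def[abs_def]
    by (intro continuous_on_mult continuous_on_powr continuous_on_const kap_c kd_c) (use kp in fastforce)
  define Mq where "Mq = (k / 2) powr (1 / 4 - 1) * (B + B * Mf)"
  have Mq: "0 \<le> Mq" using B0 Mf by (simp add: Mq_def)
  have q'_b: "\<bar>q' t\<bar> \<le> Mq" if t: "0 \<le> t" "t < t1" for t
  proof -
    note ft = fab(1,2)[OF t]
    have "\<bar>?w4 t (?f t) + ?w3 t (?f t) * f' t\<bar> \<le> \<bar>?w4 t (?f t)\<bar> + \<bar>?w3 t (?f t)\<bar> * \<bar>f' t\<bar>"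
      by (rule order.trans[OF abs_triangle_ineq]) (simp add: abs_mult)
    also have "\<dots> \<le> B + B * Mf"
      using PD[OF PB(1) t(1) less_imp_le[OF t(2)] ft] f'_b[OF t] B0 by (intro add_mono mult_mono) auto
    finally have kb: "\<bar>kd t\<bar> \<le> B + B * Mf" unfolding kd_def abs_mult by simp
    have "kap L t powr (1 / 4 - 1) \<le> (k / 2) powr (1 / 4 - 1)"
      using kap(2)[OF t] k by (intro powr_mono2') auto
    then have "kap L t powr (1 / 4 - 1) * \<bar>kd t\<bar> \<le> Mq" unfolding Mq_def by (intro mult_mono kb) auto
    then show ?thesis using Mq unfolding q'_def abs_mult by simp
  qed
  define q0 where "q0 = rt4 (k / 2)"
  \<comment> \<open>The last summand is large enough for the constants B + B Mf, B + 2 B Mf^2 and 2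
    B that arise in the bounds for c.\<close>
  define M where "M = B + rt4 B + Mq + 4 * B * (1 + Mf)\<^sup>2"
  have rB: "0 \<le> rt4 B" by (simp add: rt4_def)
  have M: "B \<le> M" "rt4 B \<le> M" "Mq \<le> M" "4 * B * (1 + Mf)\<^sup>2 \<le> M" "0 \<le> M"
    using B0 Mq rB by (auto simp: M_def)
  have sq: "4 * B * (1 + Mf)\<^sup>2 = 4 * B + 8 * (B * Mf) + 4 * (B * Mf\<^sup>2)" by (simp add: power2_eq_square algebra_simps)
  have BM: "0 \<le> B * Mf" "0 \<le> B * Mf\<^sup>2" using B0 Mf by auto
  have lb: "J.layer_bounded u C" if "P u B" "B \<le> C" for u C
    unfolding J.layer_bounded_def
  proof (intro allI impI)
    fix t z assume t: "0 \<le> t" "t < t1" and z: "\<bar>z - ?f t\<bar> \<le> \<delta>"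
    have "\<bar>z - ?f t\<bar> \<le> 2 * \<delta>" using z \<delta> by simp
    from box[OF t this] have "a \<le> z" "z \<le> b" by auto
    note p = PD[OF that(1) t(1) less_imp_le[OF t(2)] this]
    show "\<bar>dz u t z\<bar> \<le> C \<and> \<bar>dz (dz u) t z\<bar> \<le> C \<and> \<bar>dz (dz (dz u)) t z\<bar> \<le> C \<and> \<bar>dt (dz (dz u)) t z\<bar> \<le> C"
      using p that(2) by auto
  qed
  have wb: "\<bar>?w t z - ?w t (?f t)\<bar> \<le> B * \<bar>z - ?f t\<bar>\<^sup>2" "\<bar>?w1 t z\<bar> \<le> B * \<bar>z - ?f t\<bar>"
    if t: "0 \<le> t" "t < t1" and z: "\<bar>z - ?f t\<bar> \<le> \<delta>" for t z
  proof -
    have "\<bar>z - ?f t\<bar> \<le> 2 * \<delta>" using z \<delta> by simp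
    from box[OF t this] have z': "z \<in> {a..b}" by auto
    have f': "?f t \<in> {a..b}" using fab[OF t] by auto
    have d: "(?w t has_real_derivative ?w1 t x) (at x)" "(?w1 t has_real_derivative ?w2 t x) (at x)" "\<bar>?w2 t x\<bar> \<le> B" if "x \<in> {a..b}" for x
      using regularD[OF rw t(1), of x] PD(2)[OF PB(1) t(1), of x] that t a by auto
    show "\<bar>?w t z - ?w t (?f t)\<bar> \<le> B * \<bar>z - ?f t\<bar>\<^sup>2" "\<bar>?w1 t z\<bar> \<le> B * \<bar>z - ?f t\<bar>"
      using critical_point_bounds[of a b "?w t" "?w1 t" "?w2 t" B z "?f t", OF d(1) d(2) d(3) z' f' w1f[OF t]] by auto
  qed
  \<comment> \<open>Going back to time 0 costs B t; there c has a double zero at z0; and the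
    distance to z0 is replaced by that to f(t) through |z - z0| \<le> |z - f| + Mf t.\<close>
  have cb: "\<bar>?c t z\<bar> \<le> M * (t + \<bar>z - ?f t\<bar>\<^sup>2)" "\<bar>dz ?c t z\<bar> \<le> M * (t + \<bar>z - ?f t\<bar>)"
    if t: "0 \<le> t" "t < t1" and z: "\<bar>z - ?f t\<bar> \<le> \<delta>" for t z
  proof -
    have "\<bar>z - ?f t\<bar> \<le> 2 * \<delta>" using z \<delta> by simp
    from box[OF t this] have z': "z \<in> {a..b}" "0 < z" by auto
    have d: "(?c 0 has_real_derivative dz ?c 0 x) (at x)" "(dz ?c 0 has_real_derivative dz (dz ?c) 0 x) (at x)" "\<bar>dz (dz ?c) 0 x\<bar> \<le> B" if "x \<in> {a..b}" for x
      using regularD[OF rc order.refl, of x] PD(2)[OF PB(2) order.refl, of x] that t1 a by auto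
    note c0 = critical_point_bounds[of a b "?c 0" "dz ?c 0" "dz (dz ?c) 0" B z z0, OF d(1) d(2) d(3) z'(1) z0ab at0(5)]
    have T: "t \<in> {0..t}" "0 \<in> {0..t}" using t by auto
    have dc: "((\<lambda>t. ?c t z) has_real_derivative dz (dz ?c) x z) (at x within {0..t})" "\<bar>dz (dz ?c) x z\<bar> \<le> B"
      "((\<lambda>t. dz ?c t z) has_real_derivative dz (dz (dz ?c)) x z) (at x within {0..t})" "\<bar>dz (dz (dz ?c)) x z\<bar> \<le> B"
      if x: "x \<in> {0..t}" for x
    proof -
      have x': "0 \<le> x" "x \<le> t1" using x t by auto
      show "((\<lambda>t. ?c t z) has_real_derivative dz (dz ?c) x z) (at x within {0..t})"
        by (rule has_field_derivative_subset[OF regularD(4)[OF rc x'(1) z'(2)]]) auto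
      show "((\<lambda>t. dz ?c t z) has_real_derivative dz (dz (dz ?c)) x z) (at x within {0..t})"
        by (rule has_field_derivative_subset[OF regularD(5)[OF rc x'(1) z'(2)]]) auto
      show "\<bar>dz (dz ?c) x z\<bar> \<le> B" "\<bar>dz (dz (dz ?c)) x z\<bar> \<le> B"
        using PD(2,3)[OF PB(2) x', of z] z' by auto
    qed
    have ct: "\<bar>?c t z - ?c 0 z\<bar> \<le> B * \<bar>t - 0\<bar>"
      by (rule real_lipschitz[of 0 t "\<lambda>t. ?c t z" "\<lambda>t. dz (dz ?c) t z", OF dc(1,2) T])
    have ct1: "\<bar>dz ?c t z - dz ?c 0 z\<bar> \<le> B * \<bar>t - 0\<bar>"
      by (rule real_lipschitz[of 0 t "\<lambda>t. dz ?c t z" "\<lambda>t. dz (dz (dz ?c)) t z", OF dc(3,4) T])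
    have ff: "\<bar>?f t - z0\<bar> \<le> Mf * t" using J.f_lipschitz[OF t order.refl t1(1)] t crit0 by simp
    define x where "x = \<bar>z - ?f t\<bar>"
    have zz: "\<bar>z - z0\<bar> \<le> x + Mf * t" using ff unfolding x_def by linarith
    have x0: "0 \<le> x" by (simp add: x_def)
    have "\<bar>dz ?c t z\<bar> \<le> B * t + B * (x + Mf * t)"
      using ct1 c0(1) mult_left_mono[OF zz B0] t by auto
    also have "\<dots> = (B + B * Mf) * t + B * x" by (simp add: algebra_simps)
    also have "\<dots> \<le> M * t + M * x"
      using M sq BM B0 t x0 by (intro add_mono mult_right_mono; linarith)
    finally show "\<bar>dz ?c t z\<bar> \<le> M * (t + \<bar>z - ?f t\<bar>)" by (simp add: x_def distrib_left)
    have "\<bar>z - z0\<bar>\<^sup>2 \<le> (x + Mf * t)\<^sup>2" using zz by (intro power_mono) auto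
    also have "\<dots> \<le> 2 * x\<^sup>2 + 2 * (Mf * t)\<^sup>2"
      using zero_le_power2[of "x - Mf * t"] by (simp add: power2_eq_square algebra_simps)
    also have "(Mf * t)\<^sup>2 \<le> Mf\<^sup>2 * t"
      unfolding power_mult_distrib using t t1 by (intro mult_left_mono) (auto simp: power2_eq_square mult_left_le)
    finally have "\<bar>z - z0\<bar>\<^sup>2 \<le> 2 * x\<^sup>2 + 2 * (Mf\<^sup>2 * t)" by simp
    from mult_left_mono[OF this B0] have "\<bar>?c t z\<bar> \<le> B * t + B * (2 * x\<^sup>2 + 2 * (Mf\<^sup>2 * t))"
      using ct c0(2) at0(4) t by auto
    also have "\<dots> = (B + 2 * (B * Mf\<^sup>2)) * t + (2 * B) * x\<^sup>2" by (simp add: algebra_simps)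
    also have "\<dots> \<le> M * t + M * x\<^sup>2"
      using M sq BM B0 t zero_le_power2[of x] by (intro add_mono mult_right_mono; linarith)
    finally show "\<bar>?c t z\<bar> \<le> M * (t + \<bar>z - ?f t\<bar>\<^sup>2)" by (simp add: x_def distrib_left)
  qed
  have low: "cu \<le> \<bar>dz (us L) t z\<bar>" if t: "0 \<le> t" "t < t1" and z: "?f t + \<delta> \<le> z" "z \<le> ?f t + 2 * \<delta>" for t z
  proof -
    have "\<bar>z - ?f t\<bar> \<le> 2 * \<delta>" using z \<delta> by auto
    from box[OF t this] have "\<bar>dz (us L) t z - dz (us L) 0 z0\<bar> < cu" using t t1 by (intro d2(2)) auto
    moreover have "\<bar>dz (us L) 0 z0\<bar> = 2 * cu" by (simp add: cu_def)
    ultimately show ?thesis by linarith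
  qed
  have wBM: "B * y \<le> M * y" if "0 \<le> y" for y using M(1) that by (rule mult_right_mono)
  show ?thesis
  proof (rule that[of \<delta> t1 Mf q' q0 M B MU cu])
    show "0 < \<delta>" "t1 \<le> t0" by (rule \<delta> t1)+
    fix \<phi> K0 assume \<phi>: "cutoff \<delta> \<phi>" and K0: "0 < (K0 :: real)"
    obtain \<rho> where \<rho>: "0 < \<rho>" "\<And>x. \<bar>x\<bar> < \<rho> \<Longrightarrow> \<phi> x = 1" using cutoffD(2)[OF \<phi>] by blast
    interpret jet_setting ?f f' t1 \<delta> K0 Mf by (rule js[OF K0])
    have "critical_shear L f' t1 \<delta> K0 Mf \<phi> q' q0 M \<rho> \<alpha> B MU cu"
    proof
      show "regular ?w" "regular ?c" by (rule rw rc)+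
      show "smooth \<phi>" by (rule cutoffD(1)[OF \<phi>])
      show "0 < \<rho>" by (rule \<rho>)
      show "\<phi> x = 1" if "\<bar>x\<bar> < \<rho>" for x by (rule \<rho>(2)[OF that])
      show "\<phi> x = 0" if "\<delta> \<le> \<bar>x\<bar>" for x using cutoffD(3)[OF \<phi> that, of 0] by simp
      show "(vderiv ^^ n) \<phi> x = 0" if "\<delta> \<le> \<bar>x\<bar>" for n x by (rule cutoffD(3)[OF \<phi> that])
      show "critical_layer_profile (tau L) (prof L)" by (rule prof)
      show "0 < q0" using k by (simp add: q0_def rt4_pos)
      show "layer_bounded ?w M" "layer_bounded ?c M" by (rule lb[OF PB(1) M(1)] lb[OF PB(2) M(1)])+
      show "layer_bounded (us L) B" "layer_bounded (vs L) B" "layer_bounded (bs L) B" "layer_bounded (gs L) B"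
        by (rule lb[OF PB(3) order.refl] lb[OF PB(4) order.refl] lb[OF PB(5) order.refl] lb[OF PB(6) order.refl])+
      show "continuous_on {0..<t1} q'" by (rule q'_c)
      show "0 \<le> \<alpha>" "0 < cu" by (rule \<alpha> cu)+
      show "regular (us L)" "regular (vs L)" "regular (bs L)" "regular (gs L)" by (auto intro: regs)
      fix t assume t: "0 \<le> t" "t < t1"
      show "0 < kap L t" by (rule kp[OF t])
      show "q0 \<le> rt4 (kap L t)" unfolding q0_def using kap(2)[OF t] k by (intro rt4_mono) auto
      show "rt4 (kap L t) \<le> M" using rt4_mono[OF less_imp_le[OF kp[OF t]] kap(3)[OF t]] M(2) by simp
      show "((\<lambda>t. rt4 (kap L t)) has_real_derivative q' t) (at t within {0..<t1})" by (rule q'_d[OF t])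
      show "\<bar>q' t\<bar> \<le> M" using q'_b[OF t] M(3) by simp
      show "?w1 t (?f t) = 0" by (rule w1f[OF t])
      show "?w2 t (?f t) = - 2 * rt4 (kap L t) ^ 4" using kap(1)[OF t] rt4_power4[OF kp[OF t]] by simp
      show "dz u t \<in> L2_space \<alpha> \<and> (LINT z:{0..}|lborel. (exp (\<alpha> * z) * dz u t z)\<^sup>2) \<le> MU" if "u \<in> {us L, vs L, bs L, gs L}" for u
        using MU[OF that t] .
      show "cu \<le> \<bar>dz (us L) t z\<bar>" if "?f t + \<delta> \<le> z" "z \<le> ?f t + 2 * \<delta>" for z by (rule low[OF t that])
      fix z assume z: "\<bar>z - ?f t\<bar> \<le> \<delta>"
      show "\<bar>?w t z - ?w t (?f t)\<bar> \<le> M * \<bar>z - ?f t\<bar>\<^sup>2" by (rule order.trans[OF wb(1)[OF t z] wBM]) simp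
      show "\<bar>?w1 t z\<bar> \<le> M * \<bar>z - ?f t\<bar>" by (rule order.trans[OF wb(2)[OF t z] wBM]) simp
      show "\<bar>?c t z\<bar> \<le> M * (t + \<bar>z - ?f t\<bar>\<^sup>2)" "\<bar>dz ?c t z\<bar> \<le> M * (t + \<bar>z - ?f t\<bar>)"
        by (rule cb[OF t z])+
    qed
    then show "\<exists>\<rho>. critical_shear L f' t1 \<delta> K0 Mf \<phi> q' q0 M \<rho> \<alpha> B MU cu" by blast
  qed
qed

section \<open>The theorem, from the conditions on the initial data\<close>

lemma deriv_initial:
  assumes "regular u" "\<And>z. 0 \<le> z \<Longrightarrow> u 0 z = U z" "0 < z0"
  shows "deriv U z0 = dz u 0 z0"
proof (rule DERIV_imp_deriv)
  show "(U has_real_derivative dz u 0 z0) (at z0)"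
    by (rule has_field_derivative_transform_within_open[OF regularD(1)[OF assms(1) order.refl assms(3)], of "{0<..}"])
       (use assms in auto)
qed

theorem proposition2p1:
  fixes L :: layer
    and \<alpha> uE vE bE gE z0 t0 :: real
    and U0 V0 B0 G0 :: "real \<Rightarrow> real"
    and p q :: int
    and f' :: "real \<Rightarrow> real"
  assumes "\<alpha> \<ge> 0"
    and "velocity_shear \<alpha> (us L) uE U0" and "velocity_shear \<alpha> (vs L) vE V0"
    and "magnetic_shear \<alpha> (bs L) bE B0" and "magnetic_shear \<alpha> (gs L) gE G0"
    and "z0 > 0"
    and "deriv V0 z0 * deriv (deriv U0) z0 \<noteq> deriv U0 z0 * deriv (deriv V0) z0"
    and "B0 z0 = 0" and "G0 z0 = 0" and "deriv B0 z0 = 0" and "deriv G0 z0 = 0"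
    and "deriv U0 z0 \<noteq> 0"
    and "slope L = deriv V0 z0 / deriv U0 z0"
    and "q > 0" and "slope L = real_of_int p / real_of_int q"
    and "dz (dz (wa L)) 0 z0 < 0"
    and "t0 > 0" and "crit L 0 = z0"
    and "\<And>t. 0 \<le> t \<Longrightarrow> t < t0 \<Longrightarrow>
           crit L t > 0 \<and> (crit L has_real_derivative f' t) (at t within {0..<t0}) \<and>
           dt (dz (wa L)) t (crit L t) + dz (dz (wa L)) t (crit L t) * f' t = 0"
    and "critical_layer_profile (tau L) (prof L)"
  shows "\<exists>\<delta>>0. \<forall>\<phi>. cutoff \<delta> \<phi> \<longrightarrow>
    (\<forall>K0>0. \<exists>N\<ge>(1::nat). \<exists>\<epsilon>0>0. \<exists>c0>0. \<exists>C0>0. \<exists>\<sigma>0>0.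
      \<forall>\<epsilon>\<in>admissible q. 0 < \<epsilon> \<and> \<epsilon> < \<epsilon>0 \<longrightarrow>
        (\<forall>t. 0 \<le> t \<and> t \<le> K0 * sqrt \<epsilon> * L_log \<epsilon> \<longrightarrow>
           Z_amp L \<phi> \<epsilon> t \<in> L2_space \<alpha> \<and>
           c0 * exp (\<sigma>0 * t / sqrt \<epsilon>) \<le> L2_norm \<alpha> (Z_amp L \<phi> \<epsilon> t) \<and>
           L2_norm \<alpha> (Z_amp L \<phi> \<epsilon> t) \<le> C0 * L_log \<epsilon> ^ N * exp (\<sigma>0 * t / sqrt \<epsilon>) \<and>
           (\<exists>R. residual L \<phi> \<epsilon> t0 t R \<and> R \<in> L2_space \<alpha> \<and>
              L2_norm \<alpha> R \<le> C0 * \<epsilon> powr (- 3 / 8) * L_log \<epsilon> ^ N * exp (\<sigma>0 * t / sqrt \<epsilon>))) \<and>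
        L2_norm \<alpha> (Z_amp L \<phi> \<epsilon> 0) \<le> C0 * L_log \<epsilon> ^ N)"
proof -
  have comp: "shear_component \<alpha> u" if "u \<in> {us L, vs L, bs L, gs L}" for u
    using that assms(2-5) velocity_shear_component magnetic_shear_component by blast
  have reg: "regular (us L)" "regular (vs L)" "regular (bs L)" "regular (gs L)"
    using comp by (simp_all add: shear_component_def)
  have ini: "us L 0 z = U0 z" "vs L 0 z = V0 z" "bs L 0 z = B0 z" "gs L 0 z = G0 z" if "0 \<le> z" for z
    using that assms(2-5) by (simp_all add: velocity_shear_def magnetic_shear_def)
  note d = deriv_initial[OF reg(1) ini(1) \<open>z0 > 0\<close>] deriv_initial[OF reg(2) ini(2) \<open>z0 > 0\<close>]
    deriv_initial[OF reg(3) ini(3) \<open>z0 > 0\<close>] deriv_initial[OF reg(4) ini(4) \<open>z0 > 0\<close>]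
  \<comment> \<open>The slope is the quotient of the two initial derivatives at z0, which makes z0 a
    critical point of w.\<close>
  have w: "dz (wa L) 0 z0 = 0"
    unfolding wa_def[abs_def] regular_lincomb(2)[OF reg(1,2) order.refl \<open>z0 > 0\<close>]
    using d(1,2) assms(12,13) by simp
  have c: "dz (cs L) 0 z0 = 0"
    unfolding cs_def[abs_def] regular_lincomb(2)[OF reg(3,4) order.refl \<open>z0 > 0\<close>]
    using d(3,4) assms(10,11) by simp
  have c0: "cs L 0 z0 = 0" using ini(3,4)[of z0] assms(6,8,9) by (simp add: cs_def)
  have u: "dz (us L) 0 z0 \<noteq> 0" using d(1) assms(12) by simp
  obtain \<delta> t1 Mf q' q0 M m MU cu where d0: "0 < \<delta>" and t1t0: "t1 \<le> t0" and
    ex: "\<And>\<phi> K0. cutoff \<delta> \<phi> \<Longrightarrow> 0 < K0 \<Longrightarrow> \<exists>\<rho>. critical_shear L f' t1 \<delta> K0 Mf \<phi> q' q0 M \<rho> \<alpha> m MU cu"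
    using critical_shear_exists[OF assms(1) comp assms(6) w assms(16) u c0 c assms(17,18) conjunct2[OF assms(19)] assms(20)]
    by blast
  show ?thesis
  proof (intro exI[of _ \<delta>] conjI allI impI)
    show "0 < \<delta>" by (rule d0)
    fix \<phi> and K0 :: real assume "cutoff \<delta> \<phi>" "0 < K0"
    then obtain \<rho> where "critical_shear L f' t1 \<delta> K0 Mf \<phi> q' q0 M \<rho> \<alpha> m MU cu" using ex by blast
    then interpret critical_shear L f' t1 \<delta> K0 Mf \<phi> q' q0 M \<rho> \<alpha> m MU cu .
    define S where "S N \<epsilon>0 c0 C0 \<sigma> \<longleftrightarrow> (\<forall>\<epsilon>. 0 < \<epsilon> \<and> \<epsilon> < \<epsilon>0 \<longrightarrow>
        (\<forall>t. 0 \<le> t \<and> t \<le> K0 * sqrt \<epsilon> * L_log \<epsilon> \<longrightarrow>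
           Z_amp L \<phi> \<epsilon> t \<in> L2_space \<alpha> \<and>
           c0 * exp (\<sigma> * t / sqrt \<epsilon>) \<le> L2_norm \<alpha> (Z_amp L \<phi> \<epsilon> t) \<and>
           L2_norm \<alpha> (Z_amp L \<phi> \<epsilon> t) \<le> C0 * L_log \<epsilon> ^ N * exp (\<sigma> * t / sqrt \<epsilon>) \<and>
           (\<exists>R. residual L \<phi> \<epsilon> t0 t R \<and> R \<in> L2_space \<alpha> \<and>
              L2_norm \<alpha> R \<le> C0 * \<epsilon> powr (- 3 / 8) * L_log \<epsilon> ^ N * exp (\<sigma> * t / sqrt \<epsilon>))))"
      for N :: nat and \<epsilon>0 c0 C0 \<sigma> :: real
    have "\<exists>N\<ge>1. \<exists>\<epsilon>0>0. \<exists>c0>0. \<exists>C0>0. \<exists>\<sigma>0>0. S N \<epsilon>0 c0 C0 \<sigma>0"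
      unfolding S_def by (rule approximate_solution[OF t1t0])
    then obtain N \<epsilon>0 c0 C0 \<sigma> where *: "(1::nat) \<le> N" "0 < \<epsilon>0" "0 < c0" "0 < C0" "0 < \<sigma>" and
      S: "S N \<epsilon>0 c0 C0 \<sigma>"
      by blast
    have
      est: "Z_amp L \<phi> \<epsilon> t \<in> L2_space \<alpha> \<and>
           c0 * exp (\<sigma> * t / sqrt \<epsilon>) \<le> L2_norm \<alpha> (Z_amp L \<phi> \<epsilon> t) \<and>
           L2_norm \<alpha> (Z_amp L \<phi> \<epsilon> t) \<le> C0 * L_log \<epsilon> ^ N * exp (\<sigma> * t / sqrt \<epsilon>) \<and>
           (\<exists>R. residual L \<phi> \<epsilon> t0 t R \<and> R \<in> L2_space \<alpha> \<and>
              L2_norm \<alpha> R \<le> C0 * \<epsilon> powr (- 3 / 8) * L_log \<epsilon> ^ N * exp (\<sigma> * t / sqrt \<epsilon>))"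
      if "0 < \<epsilon>" "\<epsilon> < \<epsilon>0" "0 \<le> t \<and> t \<le> K0 * sqrt \<epsilon> * L_log \<epsilon>" for \<epsilon> t
      using S[unfolded S_def, rule_format, OF conjI[OF that(1,2)] that(3)] .
    \<comment> \<open>Time 0 belongs to every window, and the exponential is 1 there.\<close>
    have est0: "L2_norm \<alpha> (Z_amp L \<phi> \<epsilon> 0) \<le> C0 * L_log \<epsilon> ^ N" if e: "0 < \<epsilon>" "\<epsilon> < \<epsilon>0" for \<epsilon>
    proof -
      have "0 \<le> (0::real) \<and> 0 \<le> K0 * sqrt \<epsilon> * L_log \<epsilon>"
        using \<open>0 < K0\<close> e L_log_ge_1[of \<epsilon>] by simp
      from est[OF e this] show ?thesis by simp
    qed
    show "\<exists>N\<ge>(1::nat). \<exists>\<epsilon>0>0. \<exists>c0>0. \<exists>C0>0. \<exists>\<sigma>0>0.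
      \<forall>\<epsilon>\<in>admissible q. 0 < \<epsilon> \<and> \<epsilon> < \<epsilon>0 \<longrightarrow>
        (\<forall>t. 0 \<le> t \<and> t \<le> K0 * sqrt \<epsilon> * L_log \<epsilon> \<longrightarrow>
           Z_amp L \<phi> \<epsilon> t \<in> L2_space \<alpha> \<and>
           c0 * exp (\<sigma>0 * t / sqrt \<epsilon>) \<le> L2_norm \<alpha> (Z_amp L \<phi> \<epsilon> t) \<and>
           L2_norm \<alpha> (Z_amp L \<phi> \<epsilon> t) \<le> C0 * L_log \<epsilon> ^ N * exp (\<sigma>0 * t / sqrt \<epsilon>) \<and>
           (\<exists>R. residual L \<phi> \<epsilon> t0 t R \<and> R \<in> L2_space \<alpha> \<and>
              L2_norm \<alpha> R \<le> C0 * \<epsilon> powr (- 3 / 8) * L_log \<epsilon> ^ N * exp (\<sigma>0 * t / sqrt \<epsilon>))) \<and>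
        L2_norm \<alpha> (Z_amp L \<phi> \<epsilon> 0) \<le> C0 * L_log \<epsilon> ^ N"
      by (rule exI[of _ N], rule conjI[OF *(1)], rule exI[of _ \<epsilon>0], rule conjI[OF *(2)],
          rule exI[of _ c0], rule conjI[OF *(3)], rule exI[of _ C0], rule conjI[OF *(4)],
          rule exI[of _ \<sigma>], rule conjI[OF *(5)], intro ballI impI, elim conjE, rule conjI,
          intro allI impI, rule est, assumption, assumption, assumption, rule est0, assumption, assumption)
  qed
qed

end
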